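(* Let $\Omega\subseteq\mathbb{R}^n$ be open. (i) For all $w\in\mathcal{D}'(\Omega)$ the maps $\iota_d(w),\iota'(w)\in\mathcal{L}(\mathcal{G}_c(\Omega),\widetilde{\mathbb{C}})$ coincide on $\mathcal{G}_c^\infty(\Omega)$. (ii) For all $w\in\mathcal{E}'(\Omega)$ the maps $\iota_d(w),\iota'(w)\in\mathcal{L}(\mathcal{G}(\Omega),\widetilde{\mathbb{C}})$ coincide on $\mathcal{G}^\infty(\Omega)$. (iii) For all $w\in\mathscr{S}'(\mathbb{R}^n)$ the maps $\iota_d(w),\iota'(w)\in\mathcal{L}(\mathcal{G}_{\mathscr{S}}(\mathbb{R}^n),\widetilde{\mathbb{C}})$ coincide on $\mathcal{G}^\infty_{\mathscr{S}}(\mathbb{R}^n)$. (iv) For all $w\in\mathcal{D}'(\Omega)$ $$\mathrm{supp}\,w=\mathrm{supp}\,\iota(w)=\mathrm{supp}\,\iota'(w)=\mathrm{supp}\,\iota_d(w)$$ and $$\mathrm{sing\,supp}\,w=\mathrm{sing\,supp}_{\mathrm g}\,\iota(w)=\mathrm{sing\,supp}_{\mathrm g}\,\iota'(w)=\mathrm{sing\,supp}_{\mathrm g}\,\iota_d(w).$$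
   Context: All nets are indexed by $\varepsilon\in(0,1]$ and $O$-estimates are for $\varepsilon\to 0$. Generalized numbers: $\widetilde{\mathbb{C}}$ is the ring of nets $(z_\varepsilon)_\varepsilon\in\mathbb{C}^{(0,1]}$ with $|z_\varepsilon|=O(\varepsilon^{-N})$ for some $N\in\mathbb{N}$, modulo the nets with $|z_\varepsilon|=O(\varepsilon^q)$ for all $q\in\mathbb{N}$. For $z=[(z_\varepsilon)_\varepsilon]$, $|z|_{\mathrm e}=\exp(-\sup\{b\in\mathbb{R}: |z_\varepsilon|=O(\varepsilon^b)\})$; $\widetilde{\mathbb{C}}$ carries the topology of the ultrametric $|z-z'|_{\mathrm e}$. Algebras: $\mathcal{G}(\Omega)=\mathcal{E}_M(\Omega)/\mathcal{N}(\Omega)$, where $\mathcal{E}_M(\Omega)$ is the set of nets $(u_\varepsilon)_\varepsilon\in C^\infty(\Omega)^{(0,1]}$ such that for all compact $K\subset\Omega$ and $\alpha\in\mathbb{N}^n$ there is $N\in\mathbb{N}$ with $\sup_{x\in K}|\partial^\alpha u_\varepsilon(x)|=O(\varepsilon^{-N})$, and $\mathcal{N}(\Omega)$ is the set of nets such that for all $K,\alpha$ and $q\in\mathbb{N}$, $\sup_{x\in K}|\partial^\alpha u_\varepsilon(x)|=O(\varepsilon^{q})$. $\mathcal{G}^\infty(\Omega)=\mathcal{E}_M^\infty(\Omega)/\mathcal{N}(\Omega)$, where in $\mathcal{E}_M^\infty(\Omega)$ the number $N$ may depend on $K$ but not on $\alpha$. The support of $u\in\mathcal{G}(\Omega)$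 is the complement in $\Omega$ of the largest open set on which $u$ restricts to $0$. $\mathcal{G}_c(\Omega)$, $\mathcal{G}_c^\infty(\Omega)$ are the sets of compactly supported elements of $\mathcal{G}(\Omega)$, $\mathcal{G}^\infty(\Omega)$; $\mathcal{G}_K(\Omega)$ is the set of elements of $\mathcal{G}(\Omega)$ with support in the compact set $K\subset\Omega$. With $p_j(f)=\sup_{x\in\mathbb{R}^n,|\alpha|\le j}(1+|x|)^j|\partial^\alpha f(x)|$, $\mathcal{G}_{\mathscr{S}}(\mathbb{R}^n)=\mathcal{E}_{\mathscr{S}}(\mathbb{R}^n)/\mathcal{N}_{\mathscr{S}}(\mathbb{R}^n)$ where $\mathcal{E}_{\mathscr{S}}(\mathbb{R}^n)$ is the set of nets in $\mathscr{S}(\mathbb{R}^n)^{(0,1]}$ such that for all $j$ there is $N$ with $p_j(u_\varepsilon)=O(\varepsilon^{-N})$ and $\mathcal{N}_{\mathscr{S}}(\mathbb{R}^n)$ the set of nets with $p_j(u_\varepsilon)=O(\varepsilon^q)$ for all $j,q$; $\mathcal{G}^\infty_{\mathscr{S}}(\mathbb{R}^n)$ is the set of classes of nets for which $N$ can be chosen independent of $j$. $\mathcal{G}_\tau(\mathbb{R}^n)=\mathcal{E}_\tau(\mathbb{R}^n)/\mathcal{N}_\tau(\mathbb{R}^n)$, where $\mathcal{E}_\tau(\mathbb{R}^n)$ is the set of nets in $\mathcal{O}_M(\mathbb{R}^n)^{(0,1]}$ (smooth functions with all derivatives of at most polynomial growth) such that for all $\alpha$ there is $N$ with $\sup_x(1+|x|)^{-N}|\partial^\alpha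 u_\varepsilon(x)|=O(\varepsilon^{-N})$, and $\mathcal{N}_\tau(\mathbb{R}^n)$ the set of nets such that for all $\alpha$ there is $N$ such that for all $q$, $\sup_x(1+|x|)^{-N}|\partial^\alpha u_\varepsilon(x)|=O(\varepsilon^{q})$. Topologies (determined by ultra-pseudo-seminorms, i.e. maps $\mathcal{P}\ge0$ with $\mathcal{P}(0)=0$, $\mathcal{P}(\lambda u)\le|\lambda|_{\mathrm e}\mathcal{P}(u)$ with equality for $\lambda=[(c\varepsilon^a)_\varepsilon]$, $c\in\mathbb{C}\setminus\{0\}$, $a\in\mathbb{R}$, and $\mathcal{P}(u+v)\le\max\{\mathcal{P}(u),\mathcal{P}(v)\}$): $\mathcal{G}(\Omega)$ has $\mathcal{P}_{K,j}(u)=\exp(-\sup\{b:\sup_{x\in K,|\alpha|\le j}|\partial^\alpha u_\varepsilon(x)|=O(\varepsilon^b)\})$, $K\subset\Omega$ compact, $j\in\mathbb{N}$; $\mathcal{G}_{\mathscr{S}}(\mathbb{R}^n)$ has $\mathcal{P}_j(u)=\exp(-\sup\{b:p_j(u_\varepsilon)=O(\varepsilon^b)\})$, $j\in\mathbb{N}$; $\mathcal{G}_K(\Omega)$ has $\mathcal{P}_{K',j}$, $j\in\mathbb{N}$, for any compact $K'\subset\Omega$ with $K\subseteq\mathrm{int}(K')$; $\mathcal{G}_c(\Omega)=\bigcup_m\mathcal{G}_{K_m}(\Omega)$ ($(K_m)_m$ an exhausting sequence of compact subsets of $\Omega$) has the strict inductive limit topology, the finest such topology making all inclusions continuous. $\mathcal{L}(\mathcal{M},\widetilde{\mathbb{C}})$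 is the space of continuous $\widetilde{\mathbb{C}}$-linear functionals on $\mathcal{M}$. Embedding $\iota$: fix $\varphi\in\mathscr{S}(\mathbb{R}^n)$ with $\int\varphi=1$ and $\int y^\alpha\varphi(y)\,dy=0$ for all $\alpha\ne0$, and put $\varphi_\varepsilon(y)=\varepsilon^{-n}\varphi(y/\varepsilon)$. For $w\in\mathcal{E}'(\Omega)$, $\iota(w)=[((w*\varphi_\varepsilon)|_\Omega)_\varepsilon]\in\mathcal{G}_c(\Omega)$. For $w\in\mathcal{D}'(\Omega)$, $\iota(w)$ is the unique element of $\mathcal{G}(\Omega)$ whose restriction to every open $\Omega_1$ with $\overline{\Omega_1}$ compact in $\Omega$ equals $[(((\psi w)*\varphi_\varepsilon)|_{\Omega_1})_\varepsilon]$, for any $\psi\in C_c^\infty(\Omega)$ identically $1$ near $\overline{\Omega_1}$. For $w\in\mathscr{S}'(\mathbb{R}^n)$, $\iota(w)=(w*\varphi_\varepsilon)_\varepsilon+\mathcal{N}_\tau(\mathbb{R}^n)\in\mathcal{G}_\tau(\mathbb{R}^n)$. The functional $\iota'(w)$ is $v\mapsto\int\iota(w)(y)v(y)\,dy$, with $v\in\mathcal{G}_c(\Omega)$, $v\in\mathcal{G}(\Omega)$, $v\in\mathcal{G}_{\mathscr{S}}(\mathbb{R}^n)$ for $w\in\mathcal{D}'(\Omega)$, $\mathcal{E}'(\Omega)$, $\mathscr{S}'(\mathbb{R}^n)$ respectively; here integrals are computed on representatives, over $\mathbb{R}^n$ in the last case and, for $h\in\mathcal{G}_c(\Omega)$,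 as $\int_\Omega h:=[(\int_K h_\varepsilon)_\varepsilon]$ with $K\subset\Omega$ any compact set containing $\mathrm{supp}\,h$ in its interior. The functional $\iota_d(w)$ is $u\mapsto[(w(u_\varepsilon))_\varepsilon]$ on $\mathcal{G}_c(\Omega)$, $\mathcal{G}(\Omega)$, $\mathcal{G}_{\mathscr{S}}(\mathbb{R}^n)$ respectively, where for $u\in\mathcal{G}_c(\Omega)$ one takes a representative with $\mathrm{supp}\,u_\varepsilon$ in a fixed compact subset of $\Omega$ for all $\varepsilon$. Supports: for $V\subseteq\Omega$ open and $T\in\mathcal{L}(\mathcal{G}_c(\Omega),\widetilde{\mathbb{C}})$, $T|_V$ is the restriction of $T$ to $\mathcal{G}_c(V)$; $x\in\Omega\setminus\mathrm{supp}\,T$ iff $T|_V=0$ for some open neighbourhood $V\subseteq\Omega$ of $x$. $x\in\Omega\setminus\mathrm{sing\,supp}_{\mathrm g}\,T$ iff for some open neighbourhood $V\subseteq\Omega$ of $x$, $T|_V$ belongs to $\mathcal{G}^\infty(V)$, i.e. there is $v\in\mathcal{G}^\infty(V)$ with $T(u)=\int_V v(y)u(y)\,dy$ for all $u\in\mathcal{G}_c(V)$. For $u\in\mathcal{G}(\Omega)$, $x\in\Omega\setminus\mathrm{sing\,supp}_{\mathrm g}\,u$ iff $u|_V\in\mathcal{G}^\infty(V)$ for some open neighbourhood $V\subseteq\Omega$ of $x$. $\mathrm{supp}\,w$ and $\mathrm{sing\,supp}\,w$ are the usual distributional (singular) supports. *)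

theory Defs
  imports "HOL-Analysis.Analysis"
begin

section \<open>Asymptotics\<close>

text \<open>
  Nets are total functions on \<^typ>\<open>real\<close>; only the indices in \<open>(0,1]\<close> matter.  Growth is measured
  by nets of extended nonnegative reals, so that an infinite supremum is never \<open>O(\<epsilon>\<^sup>b)\<close> and the
  supremum over an empty set is \<open>0\<close>.
\<close>

definition bigO_eps :: "(real \<Rightarrow> ennreal) \<Rightarrow> real \<Rightarrow> bool" where
  "bigO_eps r b \<longleftrightarrow> (\<exists>C::real. \<forall>\<^sub>F \<epsilon> in at_right 0. r \<epsilon> \<le> ennreal (C * \<epsilon> powr b))"

text \<open>\<open>exp (- sup {b. r = O(\<epsilon>\<^sup>b)})\<close>, with \<open>exp (- \<infinity>) = 0\<close>.\<close>

definition sharp_value :: "(real \<Rightarrow> ennreal) \<Rightarrow> real" where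
  "sharp_value r =
     (if bdd_above {b. bigO_eps r b} then exp (- Sup {b. bigO_eps r b}) else 0)"

section \<open>The ring of generalized numbers\<close>

definition moderate_num :: "(real \<Rightarrow> complex) \<Rightarrow> bool" where
  "moderate_num z \<longleftrightarrow> (\<exists>N::nat. bigO_eps (\<lambda>\<epsilon>. ennreal (cmod (z \<epsilon>))) (- real N))"

definition negligible_num :: "(real \<Rightarrow> complex) \<Rightarrow> bool" where
  "negligible_num z \<longleftrightarrow> (\<forall>q::nat. bigO_eps (\<lambda>\<epsilon>. ennreal (cmod (z \<epsilon>))) (real q))"

definition gnum_rel :: "(real \<Rightarrow> complex) \<Rightarrow> (real \<Rightarrow> complex) \<Rightarrow> bool" where
  "gnum_rel z z' \<longleftrightarrow>
     moderate_num z \<and> moderate_num z' \<and> negligible_num (\<lambda>\<epsilon>. z \<epsilon> - z' \<epsilon>)"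

lemma bigO_eps_cmod_iff:
  "bigO_eps (\<lambda>\<epsilon>. ennreal (cmod (z \<epsilon>))) b \<longleftrightarrow>
     (\<exists>C\<ge>0. \<forall>\<^sub>F \<epsilon> in at_right 0. cmod (z \<epsilon>) \<le> C * \<epsilon> powr b)"
proof
  assume "bigO_eps (\<lambda>\<epsilon>. ennreal (cmod (z \<epsilon>))) b"
  then obtain C where C: "\<forall>\<^sub>F \<epsilon> in at_right 0. ennreal (cmod (z \<epsilon>)) \<le> ennreal (C * \<epsilon> powr b)"
    by (auto simp: bigO_eps_def)
  have "\<forall>\<^sub>F \<epsilon> in at_right 0. cmod (z \<epsilon>) \<le> \<bar>C\<bar> * \<epsilon> powr b"
    using C
  proof eventually_elim
    case (elim \<epsilon>)
    have "C * \<epsilon> powr b \<le> \<bar>C\<bar> * \<epsilon> powr b"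
      by (intro mult_right_mono) auto
    then have "ennreal (cmod (z \<epsilon>)) \<le> ennreal (\<bar>C\<bar> * \<epsilon> powr b)"
      using elim by (meson ennreal_leI order_trans)
    then show ?case by (subst (asm) ennreal_le_iff) auto
  qed
  then show "\<exists>C\<ge>0. \<forall>\<^sub>F \<epsilon> in at_right 0. cmod (z \<epsilon>) \<le> C * \<epsilon> powr b"
    by (intro exI[of _ "\<bar>C\<bar>"]) auto
next
  assume "\<exists>C\<ge>0. \<forall>\<^sub>F \<epsilon> in at_right 0. cmod (z \<epsilon>) \<le> C * \<epsilon> powr b"
  then obtain C where "\<forall>\<^sub>F \<epsilon> in at_right 0. cmod (z \<epsilon>) \<le> C * \<epsilon> powr b" by blast
  then have "\<forall>\<^sub>F \<epsilon> in at_right 0. ennreal (cmod (z \<epsilon>)) \<le> ennreal (C * \<epsilon> powr b)"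
    by eventually_elim (rule ennreal_leI)
  then show "bigO_eps (\<lambda>\<epsilon>. ennreal (cmod (z \<epsilon>))) b"
    by (auto simp: bigO_eps_def)
qed

lemma bigO_eps_add:
  assumes "bigO_eps (\<lambda>\<epsilon>. ennreal (cmod (x \<epsilon>))) b" "bigO_eps (\<lambda>\<epsilon>. ennreal (cmod (y \<epsilon>))) b"
  shows "bigO_eps (\<lambda>\<epsilon>. ennreal (cmod (x \<epsilon> + y \<epsilon>))) b"
proof -
  obtain C D where CD: "C \<ge> 0" "D \<ge> 0"
      "\<forall>\<^sub>F \<epsilon> in at_right 0. cmod (x \<epsilon>) \<le> C * \<epsilon> powr b"
      "\<forall>\<^sub>F \<epsilon> in at_right 0. cmod (y \<epsilon>) \<le> D * \<epsilon> powr b"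
    using assms unfolding bigO_eps_cmod_iff by blast
  have "\<forall>\<^sub>F \<epsilon> in at_right 0. cmod (x \<epsilon> + y \<epsilon>) \<le> (C + D) * \<epsilon> powr b"
    using CD(3,4)
  proof eventually_elim
    case (elim \<epsilon>)
    then show ?case
      using norm_triangle_ineq[of "x \<epsilon>" "y \<epsilon>"] by (simp add: distrib_right)
  qed
  then show ?thesis
    unfolding bigO_eps_cmod_iff using CD(1,2) by (intro exI[of _ "C + D"]) auto
qed

lemma bigO_eps_mult:
  assumes "bigO_eps (\<lambda>\<epsilon>. ennreal (cmod (x \<epsilon>))) a" "bigO_eps (\<lambda>\<epsilon>. ennreal (cmod (y \<epsilon>))) b"
  shows "bigO_eps (\<lambda>\<epsilon>. ennreal (cmod (x \<epsilon> * y \<epsilon>))) (a + b)"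
proof -
  obtain C D where CD: "C \<ge> 0" "D \<ge> 0"
      "\<forall>\<^sub>F \<epsilon> in at_right 0. cmod (x \<epsilon>) \<le> C * \<epsilon> powr a"
      "\<forall>\<^sub>F \<epsilon> in at_right 0. cmod (y \<epsilon>) \<le> D * \<epsilon> powr b"
    using assms unfolding bigO_eps_cmod_iff by blast
  have "\<forall>\<^sub>F \<epsilon> in at_right 0. cmod (x \<epsilon> * y \<epsilon>) \<le> (C * D) * \<epsilon> powr (a + b)"
    using CD(3,4)
  proof eventually_elim
    case (elim \<epsilon>)
    then have "cmod (x \<epsilon>) * cmod (y \<epsilon>) \<le> (C * \<epsilon> powr a) * (D * \<epsilon> powr b)"
      using CD(1) by (intro mult_mono) auto
    then show ?case by (simp add: norm_mult powr_add mult_ac)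
  qed
  then show ?thesis
    unfolding bigO_eps_cmod_iff using CD(1,2) by (intro exI[of _ "C * D"]) auto
qed

lemma bigO_eps_mono:
  assumes "bigO_eps r a" "b \<le> a"
  shows "bigO_eps r b"
proof -
  obtain C where C: "\<forall>\<^sub>F \<epsilon> in at_right 0. r \<epsilon> \<le> ennreal (C * \<epsilon> powr a)"
    using assms by (auto simp: bigO_eps_def)
  have "\<forall>\<^sub>F \<epsilon> in at_right (0::real). \<epsilon> \<in> {0<..<1}"
    using eventually_at_right_real[of 0 1] by simp
  with C have "\<forall>\<^sub>F \<epsilon> in at_right 0. r \<epsilon> \<le> ennreal (\<bar>C\<bar> * \<epsilon> powr b)"
  proof eventually_elim
    case (elim \<epsilon>)
    have "\<epsilon> powr a \<le> \<epsilon> powr b"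
      using elim assms(2) by (intro powr_mono') auto
    then have "C * \<epsilon> powr a \<le> \<bar>C\<bar> * \<epsilon> powr b"
      by (intro mult_mono) auto
    then show ?case
      using elim(1) by (meson ennreal_leI order_trans)
  qed
  then show ?thesis by (auto simp: bigO_eps_def)
qed

lemma moderate_num_const: "moderate_num (\<lambda>_. c)"
  unfolding moderate_num_def bigO_eps_cmod_iff
proof (intro exI conjI)
  show "\<forall>\<^sub>F \<epsilon> in at_right 0. cmod c \<le> cmod c * \<epsilon> powr (- real 0)"
    using eventually_at_right_less[of "0::real"] by eventually_elim simp
qed simp

lemma moderate_num_add:
  assumes "moderate_num x" "moderate_num y"
  shows "moderate_num (\<lambda>\<epsilon>. x \<epsilon> + y \<epsilon>)"
proof -
  obtain M N where MN: "bigO_eps (\<lambda>\<epsilon>. ennreal (cmod (x \<epsilon>))) (- real M)"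
      "bigO_eps (\<lambda>\<epsilon>. ennreal (cmod (y \<epsilon>))) (- real N)"
    using assms unfolding moderate_num_def by blast
  have "bigO_eps (\<lambda>\<epsilon>. ennreal (cmod (x \<epsilon>))) (- real (max M N))"
      "bigO_eps (\<lambda>\<epsilon>. ennreal (cmod (y \<epsilon>))) (- real (max M N))"
    by (rule bigO_eps_mono[OF MN(1)] bigO_eps_mono[OF MN(2)]; simp)+
  then show ?thesis
    unfolding moderate_num_def by (blast intro: bigO_eps_add)
qed

lemma moderate_num_mult:
  assumes "moderate_num x" "moderate_num y"
  shows "moderate_num (\<lambda>\<epsilon>. x \<epsilon> * y \<epsilon>)"
proof -
  obtain M N where "bigO_eps (\<lambda>\<epsilon>. ennreal (cmod (x \<epsilon>))) (- real M)"
      "bigO_eps (\<lambda>\<epsilon>. ennreal (cmod (y \<epsilon>))) (- real N)"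
    using assms unfolding moderate_num_def by blast
  then have "bigO_eps (\<lambda>\<epsilon>. ennreal (cmod (x \<epsilon> * y \<epsilon>))) (- real (M + N))"
    using bigO_eps_mult by fastforce
  then show ?thesis unfolding moderate_num_def by blast
qed

lemma moderate_num_uminus: "moderate_num x \<Longrightarrow> moderate_num (\<lambda>\<epsilon>. - x \<epsilon>)"
  by (simp add: moderate_num_def)

lemma moderate_num_diff:
  assumes "moderate_num x" "moderate_num y"
  shows "moderate_num (\<lambda>\<epsilon>. x \<epsilon> - y \<epsilon>)"
  using moderate_num_add[OF assms(1) moderate_num_uminus[OF assms(2)]] by simp

lemma negligible_num_zero: "negligible_num (\<lambda>_. 0)"
  by (auto simp: negligible_num_def bigO_eps_def)

lemma negligible_num_add:
  "negligible_num x \<Longrightarrow> negligible_num y \<Longrightarrow> negligible_num (\<lambda>\<epsilon>. x \<epsilon> + y \<epsilon>)"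
  by (simp add: negligible_num_def bigO_eps_add)

lemma negligible_num_uminus: "negligible_num x \<Longrightarrow> negligible_num (\<lambda>\<epsilon>. - x \<epsilon>)"
  by (simp add: negligible_num_def)

lemma negligible_num_mult:
  assumes "negligible_num x" "moderate_num y"
  shows "negligible_num (\<lambda>\<epsilon>. x \<epsilon> * y \<epsilon>)"
  unfolding negligible_num_def
proof
  fix q :: nat
  obtain N where "bigO_eps (\<lambda>\<epsilon>. ennreal (cmod (y \<epsilon>))) (- real N)"
    using assms unfolding moderate_num_def by blast
  moreover have "bigO_eps (\<lambda>\<epsilon>. ennreal (cmod (x \<epsilon>))) (real (q + N))"
    using assms unfolding negligible_num_def by blast
  ultimately show "bigO_eps (\<lambda>\<epsilon>. ennreal (cmod (x \<epsilon> * y \<epsilon>))) (real q)"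
    using bigO_eps_mult by fastforce
qed

lemma not_negligible_num_one: "\<not> negligible_num (\<lambda>_. 1)"
proof
  assume "negligible_num (\<lambda>_. 1)"
  then have "bigO_eps (\<lambda>\<epsilon>. ennreal (cmod 1)) (real 1)"
    unfolding negligible_num_def by blast
  then obtain C where C: "C \<ge> 0" "\<forall>\<^sub>F \<epsilon> in at_right 0. cmod 1 \<le> C * \<epsilon> powr real 1"
    unfolding bigO_eps_cmod_iff by blast
  have "\<forall>\<^sub>F \<epsilon> in at_right (0::real). \<epsilon> \<in> {0<..<inverse (C + 1)}"
    using C(1) by (intro eventually_at_right_real) simp
  with C(2) have "\<forall>\<^sub>F \<epsilon> in at_right (0::real). False"
  proof eventually_elim
    case (elim \<epsilon>)
    then have "(C + 1) * \<epsilon> < 1" "1 \<le> C * \<epsilon>" "0 < \<epsilon>"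
      using C(1) by (auto simp: field_simps)
    then show ?case by (simp add: distrib_right)
  qed
  then show False by simp
qed

lemma part_equivp_gnum_rel: "part_equivp gnum_rel"
proof (rule part_equivpI)
  show "\<exists>z. gnum_rel z z"
    by (rule exI[of _ "\<lambda>_. 0"])
       (simp add: gnum_rel_def moderate_num_const negligible_num_zero)
  show "symp gnum_rel"
  proof (rule sympI)
    fix x y assume "gnum_rel x y"
    then show "gnum_rel y x"
      using negligible_num_uminus[of "\<lambda>\<epsilon>. x \<epsilon> - y \<epsilon>"] by (simp add: gnum_rel_def)
  qed
  show "transp gnum_rel"
  proof (rule transpI)
    fix x y z assume "gnum_rel x y" "gnum_rel y z"
    then show "gnum_rel x z"
      using negligible_num_add[of "\<lambda>\<epsilon>. x \<epsilon> - y \<epsilon>" "\<lambda>\<epsilon>. y \<epsilon> - z \<epsilon>"]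
      by (simp add: gnum_rel_def)
  qed
qed

quotient_type gnum = "real \<Rightarrow> complex" / partial: gnum_rel
  by (rule part_equivp_gnum_rel)

instantiation gnum :: comm_ring_1
begin

lift_definition zero_gnum :: gnum is "\<lambda>_. 0"
  by (simp add: gnum_rel_def moderate_num_const negligible_num_zero)

lift_definition one_gnum :: gnum is "\<lambda>_. 1"
  by (simp add: gnum_rel_def moderate_num_const negligible_num_zero)

lift_definition plus_gnum :: "gnum \<Rightarrow> gnum \<Rightarrow> gnum" is "\<lambda>x y \<epsilon>. x \<epsilon> + y \<epsilon>"
proof -
  fix x x' y y' assume "gnum_rel x x'" "gnum_rel y y'"
  then show "gnum_rel (\<lambda>\<epsilon>. x \<epsilon> + y \<epsilon>) (\<lambda>\<epsilon>. x' \<epsilon> + y' \<epsilon>)"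
    using negligible_num_add[of "\<lambda>\<epsilon>. x \<epsilon> - x' \<epsilon>" "\<lambda>\<epsilon>. y \<epsilon> - y' \<epsilon>"]
    by (simp add: gnum_rel_def moderate_num_add algebra_simps)
qed

lift_definition uminus_gnum :: "gnum \<Rightarrow> gnum" is "\<lambda>x \<epsilon>. - x \<epsilon>"
proof -
  fix x x' assume "gnum_rel x x'"
  then show "gnum_rel (\<lambda>\<epsilon>. - x \<epsilon>) (\<lambda>\<epsilon>. - x' \<epsilon>)"
    using negligible_num_uminus[of "\<lambda>\<epsilon>. x \<epsilon> - x' \<epsilon>"]
    by (simp add: gnum_rel_def moderate_num_uminus)
qed

lift_definition minus_gnum :: "gnum \<Rightarrow> gnum \<Rightarrow> gnum" is "\<lambda>x y \<epsilon>. x \<epsilon> - y \<epsilon>"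
proof -
  fix x x' y y' assume *: "gnum_rel x x'" "gnum_rel y y'"
  then have "negligible_num (\<lambda>\<epsilon>. (x \<epsilon> - x' \<epsilon>) + - (y \<epsilon> - y' \<epsilon>))"
    by (intro negligible_num_add negligible_num_uminus) (auto simp: gnum_rel_def)
  then show "gnum_rel (\<lambda>\<epsilon>. x \<epsilon> - y \<epsilon>) (\<lambda>\<epsilon>. x' \<epsilon> - y' \<epsilon>)"
    using * by (simp add: gnum_rel_def moderate_num_diff algebra_simps)
qed

lift_definition times_gnum :: "gnum \<Rightarrow> gnum \<Rightarrow> gnum" is "\<lambda>x y \<epsilon>. x \<epsilon> * y \<epsilon>"
proof -
  fix x x' y y' assume *: "gnum_rel x x'" "gnum_rel y y'"
  then have "negligible_num (\<lambda>\<epsilon>. (x \<epsilon> - x' \<epsilon>) * y \<epsilon> + (y \<epsilon> - y' \<epsilon>) * x' \<epsilon>)"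
    by (intro negligible_num_add negligible_num_mult) (auto simp: gnum_rel_def)
  then show "gnum_rel (\<lambda>\<epsilon>. x \<epsilon> * y \<epsilon>) (\<lambda>\<epsilon>. x' \<epsilon> * y' \<epsilon>)"
    using * by (simp add: gnum_rel_def moderate_num_mult algebra_simps)
qed

instance
proof
  fix a b c :: gnum
  note mod = moderate_num_add moderate_num_mult moderate_num_uminus moderate_num_const moderate_num_diff
  show "a * b * c = a * (b * c)"
    by transfer (auto simp: gnum_rel_def negligible_num_zero mod mult.assoc)
  show "a * b = b * a"
    by transfer (auto simp: gnum_rel_def negligible_num_zero mod mult.commute)
  show "1 * a = a"
    by transfer (auto simp: gnum_rel_def negligible_num_zero mod)
  show "a + b + c = a + (b + c)"
    by transfer (auto simp: gnum_rel_def negligible_num_zero mod add.assoc)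
  show "a + b = b + a"
    by transfer (auto simp: gnum_rel_def negligible_num_zero mod add.commute)
  show "0 + a = a"
    by transfer (auto simp: gnum_rel_def negligible_num_zero mod)
  show "- a + a = 0"
    by transfer (auto simp: gnum_rel_def negligible_num_zero mod)
  show "a - b = a + - b"
    by transfer (auto simp: gnum_rel_def negligible_num_zero mod)
  show "(a + b) * c = a * c + b * c"
    by transfer (auto simp: gnum_rel_def negligible_num_zero mod distrib_right)
  show "(0::gnum) \<noteq> 1"
    by transfer
       (use negligible_num_uminus[of "\<lambda>_. - 1"] not_negligible_num_one in
         \<open>auto simp: gnum_rel_def\<close>)
qed

end

definition abs_e :: "gnum \<Rightarrow> real" where
  "abs_e z = sharp_value (\<lambda>\<epsilon>. ennreal (cmod (rep_gnum z \<epsilon>)))"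

definition gnum_topology :: "gnum topology" where
  "gnum_topology = Metric_space.mtopology UNIV (\<lambda>z z'. abs_e (z - z'))"

section \<open>Smooth functions and partial derivatives\<close>

text \<open>
  A function on an open set \<open>\<Omega>\<close> is a total function whose values outside \<open>\<Omega>\<close> are irrelevant;
  partial derivatives at points of \<open>\<Omega>\<close> only depend on the values in \<open>\<Omega>\<close>.
\<close>

definition partial_deriv :: "'n::finite \<Rightarrow> (real^'n \<Rightarrow> complex) \<Rightarrow> real^'n \<Rightarrow> complex" where
  "partial_deriv i f x = vector_derivative (\<lambda>t::real. f (x + t *\<^sub>R axis i 1)) (at 0)"

fun Ck_on :: "nat \<Rightarrow> (real^'n::finite) set \<Rightarrow> (real^'n \<Rightarrow> complex) \<Rightarrow> bool" where
  "Ck_on 0 S f \<longleftrightarrow> continuous_on S f"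
| "Ck_on (Suc k) S f \<longleftrightarrow> continuous_on S f \<and>
     (\<forall>i. (\<forall>x\<in>S. (\<lambda>t::real. f (x + t *\<^sub>R axis i 1)) differentiable (at 0)) \<and>
          Ck_on k S (partial_deriv i f))"

definition smooth_on :: "(real^'n::finite) set \<Rightarrow> (real^'n \<Rightarrow> complex) \<Rightarrow> bool" where
  "smooth_on S f \<longleftrightarrow> (\<forall>k. Ck_on k S f)"

text \<open>
  Multi-indices are functions \<open>'n \<Rightarrow> nat\<close>.  A derivative \<open>\<partial>\<^sup>\<alpha>\<close> applies \<open>\<partial>\<^sub>i\<close> exactly \<open>\<alpha> i\<close> times for
  each coordinate \<open>i\<close>, in a fixed but arbitrary order of the coordinates (the order is immaterial
  for smooth functions).
\<close>

type_synonym 'n multi_index = "'n \<Rightarrow> nat"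

definition coords :: "'n::finite list" where
  "coords = (SOME is. distinct is \<and> set is = UNIV)"

definition multi_deriv :: "'n::finite multi_index \<Rightarrow> (real^'n \<Rightarrow> complex) \<Rightarrow> real^'n \<Rightarrow> complex" where
  "multi_deriv \<alpha> f = foldr (\<lambda>i. partial_deriv i ^^ \<alpha> i) coords f"

definition mi_order :: "'n::finite multi_index \<Rightarrow> nat" where
  "mi_order \<alpha> = (\<Sum>i\<in>UNIV. \<alpha> i)"

definition mi_monomial :: "'n::finite multi_index \<Rightarrow> real^'n \<Rightarrow> real" where
  "mi_monomial \<alpha> y = (\<Prod>i\<in>UNIV. (y $ i) ^ \<alpha> i)"

definition sup_seminorm :: "(real^'n::finite) set \<Rightarrow> nat \<Rightarrow> (real^'n \<Rightarrow> complex) \<Rightarrow> ennreal" where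
  "sup_seminorm K j f =
     (SUP \<alpha>\<in>{\<alpha>. mi_order \<alpha> \<le> j}. SUP x\<in>K. ennreal (cmod (multi_deriv \<alpha> f x)))"

definition schwartz_seminorm :: "nat \<Rightarrow> (real^'n::finite \<Rightarrow> complex) \<Rightarrow> ennreal" where
  "schwartz_seminorm j f =
     (SUP \<alpha>\<in>{\<alpha>. mi_order \<alpha> \<le> j}. SUP x. ennreal ((1 + norm x) ^ j * cmod (multi_deriv \<alpha> f x)))"

definition schwartz :: "(real^'n::finite \<Rightarrow> complex) set" where
  "schwartz = {f. smooth_on UNIV f \<and> (\<forall>j. schwartz_seminorm j f < \<infinity>)}"

text \<open>\<open>sup\<^sub>x (1 + |x|)\<^sup>-\<^sup>N |\<partial>\<^sup>\<alpha> f(x)|\<close>\<close>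

definition growth_seminorm ::
    "nat \<Rightarrow> 'n::finite multi_index \<Rightarrow> (real^'n \<Rightarrow> complex) \<Rightarrow> ennreal" where
  "growth_seminorm N \<alpha> f = (SUP x. ennreal (cmod (multi_deriv \<alpha> f x) / (1 + norm x) ^ N))"

definition slowly_increasing :: "(real^'n::finite \<Rightarrow> complex) set" where
  "slowly_increasing = {f. smooth_on UNIV f \<and> (\<forall>\<alpha>. \<exists>N. growth_seminorm N \<alpha> f < \<infinity>)}"

section \<open>Distributions\<close>

definition linear_on :: "('a \<Rightarrow> complex) set \<Rightarrow> (('a \<Rightarrow> complex) \<Rightarrow> complex) \<Rightarrow> bool" where
  "linear_on X w \<longleftrightarrow>
     (\<forall>f\<in>X. \<forall>g\<in>X. w (\<lambda>x. f x + g x) = w f + w g) \<and>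
     (\<forall>c. \<forall>f\<in>X. w (\<lambda>x. c * f x) = c * w f)"

definition test_functions :: "(real^'n::finite) set \<Rightarrow> (real^'n \<Rightarrow> complex) set" where
  "test_functions \<Omega> = {f. smooth_on UNIV f \<and> (\<exists>K. compact K \<and> K \<subseteq> \<Omega> \<and> (\<forall>x. x \<notin> K \<longrightarrow> f x = 0))}"

definition distributions ::
    "(real^'n::finite) set \<Rightarrow> ((real^'n \<Rightarrow> complex) \<Rightarrow> complex) set" where
  "distributions \<Omega> = {w. linear_on (test_functions \<Omega>) w \<and>
     (\<forall>K. compact K \<and> K \<subseteq> \<Omega> \<longrightarrow> (\<exists>(C::real) j. \<forall>f\<in>test_functions \<Omega>.
        (\<forall>x. x \<notin> K \<longrightarrow> f x = 0) \<longrightarrow> ennreal (cmod (w f)) \<le> ennreal C * sup_seminorm K j f))}"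

text \<open>
  The space \<open>\<E>'(\<Omega>)\<close> as the dual of \<open>C\<^sup>\<infinity>(\<Omega>)\<close>.  The estimate and linearity force \<open>w f\<close> to depend only
  on the values of \<open>f\<close> in \<open>\<Omega>\<close>.
\<close>

definition compact_distributions ::
    "(real^'n::finite) set \<Rightarrow> ((real^'n \<Rightarrow> complex) \<Rightarrow> complex) set" where
  "compact_distributions \<Omega> = {w. linear_on {f. smooth_on \<Omega> f} w \<and>
     (\<exists>K (C::real) j. compact K \<and> K \<subseteq> \<Omega> \<and>
        (\<forall>f. smooth_on \<Omega> f \<longrightarrow> ennreal (cmod (w f)) \<le> ennreal C * sup_seminorm K j f))}"

definition tempered_distributions :: "((real^'n::finite \<Rightarrow> complex) \<Rightarrow> complex) set" where
  "tempered_distributions = {w. linear_on schwartz w \<and>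
     (\<exists>(C::real) j. \<forall>f\<in>schwartz. ennreal (cmod (w f)) \<le> ennreal C * schwartz_seminorm j f)}"

definition dist_supp ::
    "(real^'n::finite) set \<Rightarrow> ((real^'n \<Rightarrow> complex) \<Rightarrow> complex) \<Rightarrow> (real^'n) set" where
  "dist_supp \<Omega> w = \<Omega> - {x\<in>\<Omega>. \<exists>V. open V \<and> x \<in> V \<and> V \<subseteq> \<Omega> \<and> (\<forall>f\<in>test_functions V. w f = 0)}"

definition dist_sing_supp ::
    "(real^'n::finite) set \<Rightarrow> ((real^'n \<Rightarrow> complex) \<Rightarrow> complex) \<Rightarrow> (real^'n) set" where
  "dist_sing_supp \<Omega> w = \<Omega> - {x\<in>\<Omega>. \<exists>V. open V \<and> x \<in> V \<and> V \<subseteq> \<Omega> \<and>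
     (\<exists>g. smooth_on V g \<and> (\<forall>f\<in>test_functions V. w f = (LINT y:V|lborel. g y * f y)))}"

section \<open>Quotient modules of nets\<close>

type_synonym 'n net = "real \<Rightarrow> real^'n \<Rightarrow> complex"

text \<open>An algebra or module of generalized functions: moderate nets modulo negligible nets.\<close>

record 'n net_quotient =
  moderate_nets :: "'n net set"
  negligible_nets :: "'n net set"

definition cls :: "'n::finite net_quotient \<Rightarrow> 'n net \<Rightarrow> 'n net set" where
  "cls A u = {v \<in> moderate_nets A. (\<lambda>\<epsilon> x. v \<epsilon> x - u \<epsilon> x) \<in> negligible_nets A}"

definition elems :: "'n::finite net_quotient \<Rightarrow> 'n net set set" where
  "elems A = cls A ` moderate_nets A"

text \<open>
  Operations on classes are computed on arbitrarily chosen representatives; none of them depends on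
  the choice.
\<close>

definition rep :: "'n::finite net set \<Rightarrow> 'n net" where
  "rep U = (SOME u. u \<in> U)"

definition gzero :: "'n::finite net_quotient \<Rightarrow> 'n net set" where
  "gzero A = cls A (\<lambda>\<epsilon> x. 0)"

definition gadd :: "'n::finite net_quotient \<Rightarrow> 'n net set \<Rightarrow> 'n net set \<Rightarrow> 'n net set" where
  "gadd A U V = cls A (\<lambda>\<epsilon> x. rep U \<epsilon> x + rep V \<epsilon> x)"

definition gdiff :: "'n::finite net_quotient \<Rightarrow> 'n net set \<Rightarrow> 'n net set \<Rightarrow> 'n net set" where
  "gdiff A U V = cls A (\<lambda>\<epsilon> x. rep U \<epsilon> x - rep V \<epsilon> x)"

definition gmult :: "'n::finite net_quotient \<Rightarrow> 'n net set \<Rightarrow> 'n net set \<Rightarrow> 'n net set" where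
  "gmult A U V = cls A (\<lambda>\<epsilon> x. rep U \<epsilon> x * rep V \<epsilon> x)"

definition gscale :: "'n::finite net_quotient \<Rightarrow> gnum \<Rightarrow> 'n net set \<Rightarrow> 'n net set" where
  "gscale A z U = cls A (\<lambda>\<epsilon> x. rep_gnum z \<epsilon> * rep U \<epsilon> x)"

definition ultra_pseudo_seminorm ::
    "'n::finite net_quotient \<Rightarrow> 'n net set set \<Rightarrow> ('n net set \<Rightarrow> real) \<Rightarrow> bool" where
  "ultra_pseudo_seminorm A M P \<longleftrightarrow>
     (\<forall>U\<in>M. 0 \<le> P U) \<and> P (gzero A) = 0 \<and>
     (\<forall>z. \<forall>U\<in>M. P (gscale A z U) \<le> abs_e z * P U) \<and>
     (\<forall>c a. c \<noteq> 0 \<longrightarrow> (\<forall>U\<in>M.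
        P (gscale A (abs_gnum (\<lambda>\<epsilon>. c * of_real (\<epsilon> powr a))) U)
          = abs_e (abs_gnum (\<lambda>\<epsilon>. c * of_real (\<epsilon> powr a))) * P U)) \<and>
     (\<forall>U\<in>M. \<forall>V\<in>M. P (gadd A U V) \<le> max (P U) (P V))"

text \<open>The topology on the submodule \<open>M\<close> of \<open>A\<close> determined by a family of ultra-pseudo-seminorms.\<close>

definition seminorm_topology ::
    "'n::finite net_quotient \<Rightarrow> 'n net set set \<Rightarrow> ('n net set \<Rightarrow> real) set \<Rightarrow> 'n net set topology" where
  "seminorm_topology A M \<P> = topology_generated_by
     (insert M {{V\<in>M. P (gdiff A V U) < r} | P U r. P \<in> \<P> \<and> U \<in> M \<and> 0 < r})"

text \<open>The space \<open>\<L>(M, \<complex>~)\<close>, for a submodule \<open>M\<close> of \<open>A\<close> with topology \<open>X\<close>.\<close>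

definition cont_dual ::
    "'n::finite net_quotient \<Rightarrow> 'n net set set \<Rightarrow> 'n net set topology \<Rightarrow> ('n net set \<Rightarrow> gnum) set" where
  "cont_dual A M X = {T.
     (\<forall>U\<in>M. \<forall>V\<in>M. T (gadd A U V) = T U + T V) \<and>
     (\<forall>z. \<forall>U\<in>M. T (gscale A z U) = z * T U) \<and>
     continuous_map X gnum_topology T}"

section \<open>The algebras of generalized functions\<close>

definition nets_in :: "(real^'n::finite \<Rightarrow> complex) set \<Rightarrow> 'n net set" where
  "nets_in X = {u. \<forall>\<epsilon>\<in>{0<..1}. u \<epsilon> \<in> X}"

definition E_M :: "(real^'n::finite) set \<Rightarrow> 'n net set" where
  "E_M \<Omega> = {u \<in> nets_in {f. smooth_on \<Omega> f}. \<forall>K \<alpha>. compact K \<and> K \<subseteq> \<Omega> \<longrightarrow>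
     (\<exists>N::nat. bigO_eps (\<lambda>\<epsilon>. SUP x\<in>K. ennreal (cmod (multi_deriv \<alpha> (u \<epsilon>) x))) (- real N))}"

definition E_M_inf :: "(real^'n::finite) set \<Rightarrow> 'n net set" where
  "E_M_inf \<Omega> = {u \<in> nets_in {f. smooth_on \<Omega> f}. \<forall>K. compact K \<and> K \<subseteq> \<Omega> \<longrightarrow>
     (\<exists>N::nat. \<forall>\<alpha>. bigO_eps (\<lambda>\<epsilon>. SUP x\<in>K. ennreal (cmod (multi_deriv \<alpha> (u \<epsilon>) x))) (- real N))}"

definition N_M :: "(real^'n::finite) set \<Rightarrow> 'n net set" where
  "N_M \<Omega> = {u \<in> nets_in {f. smooth_on \<Omega> f}. \<forall>K \<alpha> (q::nat). compact K \<and> K \<subseteq> \<Omega> \<longrightarrow>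
     bigO_eps (\<lambda>\<epsilon>. SUP x\<in>K. ennreal (cmod (multi_deriv \<alpha> (u \<epsilon>) x))) (real q)}"

definition G :: "(real^'n::finite) set \<Rightarrow> 'n net_quotient" where
  "G \<Omega> = \<lparr>moderate_nets = E_M \<Omega>, negligible_nets = N_M \<Omega>\<rparr>"

definition G_inf :: "(real^'n::finite) set \<Rightarrow> 'n net set set" where
  "G_inf \<Omega> = cls (G \<Omega>) ` E_M_inf \<Omega>"

definition grestrict :: "(real^'n::finite) set \<Rightarrow> 'n net set \<Rightarrow> 'n net set" where
  "grestrict V U = cls (G V) (rep U)"

definition gsupp :: "(real^'n::finite) set \<Rightarrow> 'n net set \<Rightarrow> (real^'n) set" where
  "gsupp \<Omega> U = \<Omega> - \<Union>{V. open V \<and> V \<subseteq> \<Omega> \<and> grestrict V U = gzero (G V)}"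

definition gsing_supp :: "(real^'n::finite) set \<Rightarrow> 'n net set \<Rightarrow> (real^'n) set" where
  "gsing_supp \<Omega> U = \<Omega> - {x\<in>\<Omega>. \<exists>V. open V \<and> x \<in> V \<and> V \<subseteq> \<Omega> \<and> grestrict V U \<in> G_inf V}"

definition G_c :: "(real^'n::finite) set \<Rightarrow> 'n net set set" where
  "G_c \<Omega> = {U \<in> elems (G \<Omega>). compact (gsupp \<Omega> U)}"

definition G_c_inf :: "(real^'n::finite) set \<Rightarrow> 'n net set set" where
  "G_c_inf \<Omega> = {U \<in> G_inf \<Omega>. compact (gsupp \<Omega> U)}"

definition G_K :: "(real^'n::finite) set \<Rightarrow> (real^'n) set \<Rightarrow> 'n net set set" where
  "G_K \<Omega> K = {U \<in> elems (G \<Omega>). gsupp \<Omega> U \<subseteq> K}"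

definition E_S :: "'n::finite net set" where
  "E_S = {u \<in> nets_in schwartz. \<forall>j. \<exists>N::nat. bigO_eps (\<lambda>\<epsilon>. schwartz_seminorm j (u \<epsilon>)) (- real N)}"

definition E_S_inf :: "'n::finite net set" where
  "E_S_inf = {u \<in> nets_in schwartz. \<exists>N::nat. \<forall>j. bigO_eps (\<lambda>\<epsilon>. schwartz_seminorm j (u \<epsilon>)) (- real N)}"

definition N_S :: "'n::finite net set" where
  "N_S = {u \<in> nets_in schwartz. \<forall>j (q::nat). bigO_eps (\<lambda>\<epsilon>. schwartz_seminorm j (u \<epsilon>)) (real q)}"

definition G_S :: "'n::finite net_quotient" where
  "G_S = \<lparr>moderate_nets = E_S, negligible_nets = N_S\<rparr>"

definition G_S_inf :: "'n::finite net set set" where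
  "G_S_inf = cls G_S ` E_S_inf"

definition E_tau :: "'n::finite net set" where
  "E_tau = {u \<in> nets_in slowly_increasing.
     \<forall>\<alpha>. \<exists>N::nat. bigO_eps (\<lambda>\<epsilon>. growth_seminorm N \<alpha> (u \<epsilon>)) (- real N)}"

definition N_tau :: "'n::finite net set" where
  "N_tau = {u \<in> nets_in slowly_increasing.
     \<forall>\<alpha>. \<exists>N. \<forall>q::nat. bigO_eps (\<lambda>\<epsilon>. growth_seminorm N \<alpha> (u \<epsilon>)) (real q)}"

definition G_tau :: "'n::finite net_quotient" where
  "G_tau = \<lparr>moderate_nets = E_tau, negligible_nets = N_tau\<rparr>"

section \<open>Topologies\<close>

definition P_Kj :: "(real^'n::finite) set \<Rightarrow> nat \<Rightarrow> 'n net set \<Rightarrow> real" where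
  "P_Kj K j U = sharp_value (\<lambda>\<epsilon>. sup_seminorm K j (rep U \<epsilon>))"

definition G_topology :: "(real^'n::finite) set \<Rightarrow> 'n net set topology" where
  "G_topology \<Omega> = seminorm_topology (G \<Omega>) (elems (G \<Omega>)) {P_Kj K j | K j. compact K \<and> K \<subseteq> \<Omega>}"

definition G_S_topology :: "'n::finite net set topology" where
  "G_S_topology = seminorm_topology G_S (elems G_S)
     {(\<lambda>U. sharp_value (\<lambda>\<epsilon>. schwartz_seminorm j (rep U \<epsilon>))) | j. True}"

text \<open>
  On \<open>G_K \<Omega> K\<close> the seminorms \<open>P_Kj K' j\<close> coincide for all admissible \<open>K'\<close>, so all of them may be
  used at once.
\<close>

definition G_K_topology :: "(real^'n::finite) set \<Rightarrow> (real^'n) set \<Rightarrow> 'n net set topology" where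
  "G_K_topology \<Omega> K = seminorm_topology (G \<Omega>) (G_K \<Omega> K)
     {P_Kj K' j | K' j. compact K' \<and> K' \<subseteq> \<Omega> \<and> K \<subseteq> interior K'}"

text \<open>
  The finest topology on \<open>G_c \<Omega>\<close> determined by ultra-pseudo-seminorms for which all inclusions
  \<open>G_K \<Omega> K \<subseteq> G_c \<Omega>\<close> are continuous: it is determined by the union of all families with that
  property.  Ranging over all compact subsets instead of those of an exhausting sequence gives the
  same topology, since each compact subset is contained in a member of the sequence.
\<close>

definition G_c_topology :: "(real^'n::finite) set \<Rightarrow> 'n net set topology" where
  "G_c_topology \<Omega> = seminorm_topology (G \<Omega>) (G_c \<Omega>)
     (\<Union>{\<P>. (\<forall>P\<in>\<P>. ultra_pseudo_seminorm (G \<Omega>) (G_c \<Omega>) P) \<and>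
        (\<forall>K. compact K \<and> K \<subseteq> \<Omega> \<longrightarrow>
          continuous_map (G_K_topology \<Omega> K) (seminorm_topology (G \<Omega>) (G_c \<Omega>) \<P>) (\<lambda>U. U))})"

section \<open>Integration, restriction and supports of functionals\<close>

definition gintegral :: "(real^'n::finite) set \<Rightarrow> 'n net set \<Rightarrow> gnum" where
  "gintegral \<Omega> H =
     (let K = (SOME K. compact K \<and> K \<subseteq> \<Omega> \<and> gsupp \<Omega> H \<subseteq> interior K)
      in abs_gnum (\<lambda>\<epsilon>. LINT y:K|lborel. rep H \<epsilon> y))"

text \<open>
  A representative of \<open>U \<in> G_c \<Omega>\<close> whose members are supported in a fixed compact subset of \<open>\<Omega>\<close>.
  As total functions they vanish outside that set, i.e. they are extended by zero to the whole space.
\<close>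

definition crep :: "(real^'n::finite) set \<Rightarrow> 'n net set \<Rightarrow> 'n net" where
  "crep \<Omega> U = (SOME u. u \<in> U \<and>
     (\<exists>K. compact K \<and> K \<subseteq> \<Omega> \<and> (\<forall>\<epsilon>\<in>{0<..1}. \<forall>x. x \<notin> K \<longrightarrow> u \<epsilon> x = 0)))"

text \<open>The inclusion \<open>G_c V \<rightarrow> G_c \<Omega>\<close> for \<open>V \<subseteq> \<Omega>\<close>.\<close>

definition gextend ::
    "(real^'n::finite) set \<Rightarrow> (real^'n) set \<Rightarrow> 'n net set \<Rightarrow> 'n net set" where
  "gextend V \<Omega> U = cls (G \<Omega>) (crep V U)"

definition functional_restrict ::
    "(real^'n::finite) set \<Rightarrow> (real^'n) set \<Rightarrow> ('n net set \<Rightarrow> gnum) \<Rightarrow> 'n net set \<Rightarrow> gnum" where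
  "functional_restrict \<Omega> V T = (\<lambda>U. T (gextend V \<Omega> U))"

definition functional_supp ::
    "(real^'n::finite) set \<Rightarrow> ('n net set \<Rightarrow> gnum) \<Rightarrow> (real^'n) set" where
  "functional_supp \<Omega> T = \<Omega> - {x\<in>\<Omega>. \<exists>V. open V \<and> x \<in> V \<and> V \<subseteq> \<Omega> \<and>
     (\<forall>U\<in>G_c V. functional_restrict \<Omega> V T U = 0)}"

definition functional_sing_supp ::
    "(real^'n::finite) set \<Rightarrow> ('n net set \<Rightarrow> gnum) \<Rightarrow> (real^'n) set" where
  "functional_sing_supp \<Omega> T = \<Omega> - {x\<in>\<Omega>. \<exists>V. open V \<and> x \<in> V \<and> V \<subseteq> \<Omega> \<and>
     (\<exists>v\<in>G_inf V. \<forall>U\<in>G_c V. functional_restrict \<Omega> V T U = gintegral V (gmult (G V) v U))}"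

section \<open>The embeddings\<close>

definition mollifier :: "(real^'n::finite \<Rightarrow> complex) \<Rightarrow> bool" where
  "mollifier \<phi> \<longleftrightarrow> \<phi> \<in> schwartz \<and> (LINT y|lborel. \<phi> y) = 1 \<and>
     (\<forall>\<alpha>. \<alpha> \<noteq> (\<lambda>_. 0) \<longrightarrow> (LINT y|lborel. of_real (mi_monomial \<alpha> y) * \<phi> y) = 0)"

definition mollifier_eps :: "(real^'n::finite \<Rightarrow> complex) \<Rightarrow> real \<Rightarrow> real^'n \<Rightarrow> complex" where
  "mollifier_eps \<phi> \<epsilon> y = \<phi> (y /\<^sub>R \<epsilon>) / of_real (\<epsilon> ^ CARD('n))"

definition dist_conv ::
    "((real^'n::finite \<Rightarrow> complex) \<Rightarrow> complex) \<Rightarrow> (real^'n \<Rightarrow> complex) \<Rightarrow> real^'n \<Rightarrow> complex" where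
  "dist_conv w f x = w (\<lambda>y. f (x - y))"

text \<open>
  The product \<open>\<psi> w \<in> \<E>'(\<Omega>)\<close> of a distribution \<open>w\<close> on \<open>\<Omega>\<close> and a test function \<open>\<psi>\<close>; the product
  \<open>\<psi> f\<close> is again a test function since \<open>\<psi>\<close> vanishes outside a compact subset of \<open>\<Omega>\<close>.
\<close>

definition cutoff_dist ::
    "(real^'n::finite \<Rightarrow> complex) \<Rightarrow> ((real^'n \<Rightarrow> complex) \<Rightarrow> complex) \<Rightarrow> (real^'n \<Rightarrow> complex) \<Rightarrow> complex" where
  "cutoff_dist \<psi> w f = w (\<lambda>y. \<psi> y * f y)"

definition iota_c ::
    "(real^'n::finite \<Rightarrow> complex) \<Rightarrow> (real^'n) set \<Rightarrow> ((real^'n \<Rightarrow> complex) \<Rightarrow> complex) \<Rightarrow> 'n net set" where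
  "iota_c \<phi> \<Omega> w = cls (G \<Omega>) (\<lambda>\<epsilon>. dist_conv w (mollifier_eps \<phi> \<epsilon>))"

definition iota ::
    "(real^'n::finite \<Rightarrow> complex) \<Rightarrow> (real^'n) set \<Rightarrow> ((real^'n \<Rightarrow> complex) \<Rightarrow> complex) \<Rightarrow> 'n net set" where
  "iota \<phi> \<Omega> w = (THE U. U \<in> elems (G \<Omega>) \<and>
     (\<forall>\<Omega>\<^sub>1 \<psi>. open \<Omega>\<^sub>1 \<and> compact (closure \<Omega>\<^sub>1) \<and> closure \<Omega>\<^sub>1 \<subseteq> \<Omega> \<and>
        \<psi> \<in> test_functions \<Omega> \<and> (\<exists>W. open W \<and> closure \<Omega>\<^sub>1 \<subseteq> W \<and> (\<forall>x\<in>W. \<psi> x = 1)) \<longrightarrow>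
        grestrict \<Omega>\<^sub>1 U =
          cls (G \<Omega>\<^sub>1) (\<lambda>\<epsilon>. dist_conv (cutoff_dist \<psi> w) (mollifier_eps \<phi> \<epsilon>))))"

definition iota_tau ::
    "(real^'n::finite \<Rightarrow> complex) \<Rightarrow> ((real^'n \<Rightarrow> complex) \<Rightarrow> complex) \<Rightarrow> 'n net set" where
  "iota_tau \<phi> w = cls G_tau (\<lambda>\<epsilon>. dist_conv w (mollifier_eps \<phi> \<epsilon>))"

text \<open>
  The functionals \<open>\<iota>'(w)\<close> and \<open>\<iota>\<^sub>d(w)\<close>, in three versions each: on \<open>G_c \<Omega>\<close> (for \<open>w \<in> \<D>'(\<Omega>)\<close>),
  on \<open>G \<Omega>\<close> (for \<open>w \<in> \<E>'(\<Omega>)\<close>, suffix \<open>c\<close>) and on \<open>G_S\<close> (for \<open>w \<in> \<S>'\<close>, suffix \<open>S\<close>).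
\<close>

definition iota_prime ::
    "(real^'n::finite \<Rightarrow> complex) \<Rightarrow> (real^'n) set \<Rightarrow> ((real^'n \<Rightarrow> complex) \<Rightarrow> complex) \<Rightarrow>
      'n net set \<Rightarrow> gnum" where
  "iota_prime \<phi> \<Omega> w = (\<lambda>V. gintegral \<Omega> (gmult (G \<Omega>) (iota \<phi> \<Omega> w) V))"

definition iota_prime_c ::
    "(real^'n::finite \<Rightarrow> complex) \<Rightarrow> (real^'n) set \<Rightarrow> ((real^'n \<Rightarrow> complex) \<Rightarrow> complex) \<Rightarrow>
      'n net set \<Rightarrow> gnum" where
  "iota_prime_c \<phi> \<Omega> w = (\<lambda>V. gintegral \<Omega> (gmult (G \<Omega>) (iota_c \<phi> \<Omega> w) V))"

definition iota_prime_S ::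
    "(real^'n::finite \<Rightarrow> complex) \<Rightarrow> ((real^'n \<Rightarrow> complex) \<Rightarrow> complex) \<Rightarrow> 'n net set \<Rightarrow> gnum" where
  "iota_prime_S \<phi> w = (\<lambda>V. abs_gnum (\<lambda>\<epsilon>. LINT y|lborel. rep (iota_tau \<phi> w) \<epsilon> y * rep V \<epsilon> y))"

definition iota_d ::
    "(real^'n::finite) set \<Rightarrow> ((real^'n \<Rightarrow> complex) \<Rightarrow> complex) \<Rightarrow> 'n net set \<Rightarrow> gnum" where
  "iota_d \<Omega> w = (\<lambda>U. abs_gnum (\<lambda>\<epsilon>. w (crep \<Omega> U \<epsilon>)))"

definition iota_d_c ::
    "((real^'n::finite \<Rightarrow> complex) \<Rightarrow> complex) \<Rightarrow> 'n net set \<Rightarrow> gnum" where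
  "iota_d_c w = (\<lambda>U. abs_gnum (\<lambda>\<epsilon>. w (rep U \<epsilon>)))"

definition iota_d_S ::
    "((real^'n::finite \<Rightarrow> complex) \<Rightarrow> complex) \<Rightarrow> 'n net set \<Rightarrow> gnum" where
  "iota_d_S w = (\<lambda>U. abs_gnum (\<lambda>\<epsilon>. w (rep U \<epsilon>)))"

end

theory Submission
  imports Defs
begin

text \<open>
  The moment conditions on \<open>\<phi>\<close> and Taylor's formula give \<open>f * \<phi>\<^sub>e - f = O(e\<^sup>r)\<close> for every \<open>r\<close>, with a
  constant controlled by the derivatives of order \<open>r\<close> of \<open>f\<close>.  If all derivatives of a net \<open>f\<^sub>e\<close> grow at the
  same rate, \<open>f\<^sub>e * \<phi>\<^sub>e - f\<^sub>e\<close> is therefore negligible; applied to the reflected mollifier, this says that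
  \<open>\<integral> (w * \<phi>\<^sub>e) f\<^sub>e = w (f\<^sub>e)\<close> up to negligible numbers, so the two functionals agree on regular elements.

  A functional on compactly supported nets determines nets through the test nets
  \<open>\<psi>(y) \<phi>\<^sub>\<eta>(x\<^sub>e - y)\<close>, where \<open>x\<^sub>e\<close> is a maximum point of the net to be estimated and \<open>\<eta>\<close> is a power of
  \<open>e\<close>; this compares the (singular) supports of \<open>\<iota>(w)\<close>, \<open>\<iota>'(w)\<close> and \<open>\<iota>\<^sub>d(w)\<close>.  If \<open>u\<^sub>e = w * \<phi>\<^sub>e\<close> is
  regular near a point, then \<open>u\<^sub>e * \<phi>\<^sub>\<eta> = u\<^sub>\<eta> * \<phi>\<^sub>e\<close> with \<open>\<eta> = e / 2\<close> shows that \<open>u\<^sub>e - u\<^sub>\<eta>\<close> is negligible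
  there, so \<open>u\<^sub>e\<close> converges with all derivatives along \<open>e = 2\<^sup>-\<^sup>m\<close> and \<open>w\<close> is smooth near that point.
\<close>

text \<open>All analysis is done for tempered distributions on the whole space. A distribution on an
  open set enters through its products with cutoffs, and two cutoffs that agree on an open set give
  regularised nets with negligible difference there. Such differences are estimated on values only:
  a moderate net that is negligible in order zero is negligible in all orders.

  Well-definedness and continuity of the functionals have one common cause: on nets they are bounded
  by a single seminorm with a constant of order \<open>e powr (- N)\<close>. The locale
  \<open>net_space\<close> draws the consequences once for all spaces.

  For the supports, consider four properties of an open set: A for \<open>w\<close>, B for its
  embedding, C and D for the functionals defined by integration and by \<open>w\<close>. A passes
  directly to D, test nets lead from D to B, and B and C are equivalent on each open set. The step
  from B back to A is the one that recovers classical information: for supports it uses that a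
  negligible constant is 0, for singular supports that regularity in \<open>e\<close> forces
  convergence.\<close>

abbreviation (input) ev0 :: "(real => bool) => bool" (binder "EV " 10) where
  "ev0 P == eventually P (at_right 0)"

type_synonym 'n fn = "real^'n => complex"

abbreviation (input) "tempered == tempered_distributions"
abbreviation (input) "test == test_functions"
abbreviation (input) "meps == mollifier_eps"
abbreviation (input) "pd == partial_deriv"

section \<open>Smooth functions of several real variables\<close>

text \<open>\<open>partial_deriv\<close> has a value even where no derivative exists. This relation
  adds existence, and it composes under sums, products and affine substitutions.\<close>

definition has_partial :: "'n::finite => ('n fn) => complex => real^'n => bool" where
 "has_partial i f D x \<longleftrightarrow> ((%t::real. f (x + t *\<^sub>R axis i 1)) has_vector_derivative D) (at 0)"

lemma has_partialD: "has_partial i f D x ==> pd i f x = D"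
 unfolding has_partial_def partial_deriv_def by (rule vector_derivative_at)

lemma has_partial_pd:
 "(%t::real. f (x + t *\<^sub>R axis i 1)) differentiable (at 0) ==> has_partial i f (pd i f x) x"
 unfolding has_partial_def partial_deriv_def by (simp add: vector_derivative_works)

lemma has_partial_imp_differentiable:
 "has_partial i f D x ==> (%t::real. f (x + t *\<^sub>R axis i 1)) differentiable (at 0)"
 unfolding has_partial_def by (rule differentiableI_vector)

lemma has_partial_const: "has_partial i (%_. c) 0 x"
 unfolding has_partial_def by (auto intro!: derivative_eq_intros)

lemma has_partial_add:
 "has_partial i f D x ==> has_partial i g E x ==> has_partial i (%x. f x + g x) (D + E) x"
 unfolding has_partial_def by (auto intro!: derivative_eq_intros)

lemma has_partial_diff:
 "has_partial i f D x ==> has_partial i g E x ==> has_partial i (%x. f x - g x) (D - E) x"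
 unfolding has_partial_def by (auto intro!: derivative_eq_intros)

lemma has_partial_mult:
 "has_partial i f D x ==> has_partial i g E x ==>
  has_partial i (%x. f x * g x) (D * g x + f x * E) x"
 unfolding has_partial_def
 by (drule has_vector_derivative_mult, assumption) (simp add: algebra_simps)

lemma has_partial_cmult: "has_partial i f D x ==> has_partial i (%x. c * f x) (c * D) x"
 using has_partial_mult[OF has_partial_const[of i c x]] by simp

text \<open>Partial derivatives are taken at parameter 0; shifting the base point gives
  differentiability along a whole segment, as the mean value inequality requires.\<close>

lemma has_partial_shift:
 "((%t::real. f (x + t *\<^sub>R axis i 1)) has_vector_derivative D) (at s) \<longleftrightarrow> has_partial i f D (x + s *\<^sub>R axis i 1)"
proof
 let ?F = "%t::real. f (x + t *\<^sub>R axis i 1)"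
 have d: "((%t::real. t + c) has_real_derivative 1) (at z)" for c z by (auto intro!: derivative_eq_intros)
 {
  assume "(?F has_vector_derivative D) (at s)"
  then have "(?F has_vector_derivative D) (at (0 + s))" by simp
  from vector_diff_chain_at[OF d[unfolded has_real_derivative_iff_has_vector_derivative] this]
  show "has_partial i f D (x + s *\<^sub>R axis i 1)"
   unfolding has_partial_def by (simp add: o_def algebra_simps)
 next
  assume "has_partial i f D (x + s *\<^sub>R axis i 1)"
  then have "((%t. f (x + s *\<^sub>R axis i 1 + t *\<^sub>R axis i 1)) has_vector_derivative D) (at (s + - s))"
   unfolding has_partial_def by simp
  from vector_diff_chain_at[OF d[unfolded has_real_derivative_iff_has_vector_derivative] this]
  show "(?F has_vector_derivative D) (at s)"
   by (simp add: o_def algebra_simps)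
 }
qed

lemma has_partial_affine:
 assumes "has_partial i f D (a + c *\<^sub>R x)"
 shows "has_partial i (%x. f (a + c *\<^sub>R x)) (of_real c * D) x"
proof -
 let ?F = "%s::real. f ((a + c *\<^sub>R x) + s *\<^sub>R axis i 1)"
 have F: "(?F has_vector_derivative D) (at (c * 0))"
  using assms unfolding has_partial_def by simp
 have "((%t::real. c * t) has_real_derivative c) (at 0)"
  by (auto intro!: derivative_eq_intros)
 from vector_diff_chain_at[OF this[unfolded has_real_derivative_iff_has_vector_derivative] F]
 show ?thesis unfolding has_partial_def by (simp add: o_def algebra_simps scaleR_conv_of_real)
qed

lemma has_partial_transform:
 assumes "has_partial i f D x" "open S" "x:S" "!!y. y:S ==> f y = g y"
 shows "has_partial i g D x"
proof -
 have "open ((%t::real. x + t *\<^sub>R axis i 1) -` S)"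
  by (intro open_vimage assms(2) continuous_intros)
 then have "\<forall>\<^sub>F t in nhds 0. x + t *\<^sub>R axis i (1::real) : S"
  unfolding eventually_nhds by (rule_tac exI[of _ "(%t::real. x + t *\<^sub>R axis i 1) -` S"]) (use assms(3) in auto)
 then have "\<forall>\<^sub>F t in nhds 0. f (x + t *\<^sub>R axis i 1) = g (x + t *\<^sub>R axis i (1::real))"
  by eventually_elim (use assms(4) in auto)
 with assms(1) show ?thesis
  unfolding has_partial_def has_vector_derivative_def
  by (rule_tac has_derivative_transform_eventually[where f = "%t. f (x + t *\<^sub>R axis i 1)"])
   (use assms in \<open>auto simp: eventually_at_filter elim: eventually_mono\<close>)
qed

lemma pd_cong:
 assumes "open S" "x:S" "!!y. y:S ==> f y = g y"
 shows "pd i f x = pd i g x"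
proof -
 have *: "has_partial i f D x \<longleftrightarrow> has_partial i g D x" for D
  by (rule iffI; erule has_partial_transform[OF _ assms(1,2)]) (simp_all add: assms(3))
 have "(%D. has_partial i f D x) = (%D. has_partial i g D x)" using * by blast
 then show ?thesis unfolding partial_deriv_def vector_derivative_def has_partial_def by (simp only: )
qed

section \<open>Closure properties of differentiability of finite and infinite order\<close>

lemma Ck_on_cont: "Ck_on k S f ==> continuous_on S f"
 by (cases k) auto

lemma Ck_on_has_partial: "Ck_on (Suc k) S f ==> x:S ==> has_partial i f (pd i f x) x"
 by (intro has_partial_pd) auto

lemma Ck_on_partial: "Ck_on (Suc k) S f ==> Ck_on k S (pd i f)"
 by auto

lemma Ck_on_cong:
 assumes "open S" "!!y. y:S ==> f y = g y" "Ck_on k S f"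
 shows "Ck_on k S g"
 using assms(2,3)
proof (induction k arbitrary: f g)
 case 0
 then show ?case using continuous_on_cong[of S S f g] by simp
next
 case (Suc k)
 have "has_partial i g (pd i f x) x" if "x:S" for x i
  using has_partial_transform[OF Ck_on_has_partial[OF Suc.prems(2) that] assms(1) that Suc.prems(1)] by auto
 moreover have "Ck_on k S (pd i g)" for i
  by (rule Suc.IH[of "pd i f"])
   (use Suc.prems pd_cong[OF assms(1) _ Suc.prems(1)] in auto)
 ultimately show ?case
  using Suc.prems continuous_on_cong[of S S f g] by (auto intro: has_partial_imp_differentiable)
qed

text \<open>Explicit derivatives \<open>f' i\<close> replace \<open>partial_deriv\<close>, with
  which they agree on the open set only. The closure lemmas below become inductions on the order
  with the usual differentiation rules as witnesses.\<close>

lemma Ck_on_SucI: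
 assumes "open S" "continuous_on S f" "!!i x. x:S ==> has_partial i f (f' i x) x" "!!i. Ck_on k S (f' i)"
 shows "Ck_on (Suc k) S f"
proof -
 have "Ck_on k S (pd i f)" for i
  by (rule Ck_on_cong[OF assms(1) _ assms(4)[of i]]) (use has_partialD[OF assms(3)] in auto)
 then show ?thesis using assms by (auto intro: has_partial_imp_differentiable)
qed

lemma Ck_on_Suc_imp: "Ck_on (Suc k) S f ==> Ck_on k S f"
 by (induction k arbitrary: f) auto

lemma Ck_on_subset: "Ck_on k S f ==> T <= S ==> Ck_on k T f"
 by (induction k arbitrary: f) (auto intro: continuous_on_subset)

lemma Ck_on_const: "open S ==> Ck_on k S (%_. c)"
proof (induction k arbitrary: c)
 case (Suc k)
 show ?case by (rule Ck_on_SucI[where f' = "%_ _. 0"]) (use Suc in \<open>auto intro: has_partial_const\<close>)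
qed simp

lemma Ck_on_add:
 "open S ==> Ck_on k S f ==> Ck_on k S g ==> Ck_on k S (%x. f x + g x)"
proof (induction k arbitrary: f g)
 case (Suc k)
 show ?case
  by (rule Ck_on_SucI[where f' = "%i x. pd i f x + pd i g x"])
   (use Suc in \<open>auto intro!: has_partial_add has_partial_pd continuous_intros simp del: Ck_on.simps(1)\<close>)
qed (auto intro: continuous_intros)

lemma Ck_on_mult:
 "open S ==> Ck_on k S f ==> Ck_on k S g ==> Ck_on k S (%x. f x * g x)"
proof (induction k arbitrary: f g)
 case (Suc k)
 have fg: "Ck_on k S f" "Ck_on k S g" using Suc.prems by (auto intro: Ck_on_Suc_imp)
 have "Ck_on k S (%x. pd i f x * g x + f x * pd i g x)" for i
  by (intro Ck_on_add Suc.IH) (use Suc.prems fg in auto)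
 then show ?case
  by (intro Ck_on_SucI[where f' = "%i x. pd i f x * g x + f x * pd i g x"])
   (use Suc.prems in \<open>auto intro!: has_partial_mult has_partial_pd continuous_intros\<close>)
qed (auto intro: continuous_intros)

lemma has_partial_inverse:
 assumes "has_partial i f D x" "f x ~= 0"
 shows "has_partial i (%x. inverse (f x)) (- (D * (inverse (f x) * inverse (f x)))) x"
proof -
 have "(inverse has_field_derivative - (inverse (f x) * inverse (f x))) (at (f (x + 0 *\<^sub>R axis i 1)))"
  using DERIV_inverse[of "f x"] assms(2) by (simp add: power2_eq_square numeral_2_eq_2)
 from field_vector_diff_chain_at[OF assms(1)[unfolded has_partial_def] this]
 show ?thesis unfolding has_partial_def by (simp add: o_def)
qed

lemma Ck_on_inverse:
 "open S ==> (!!x. x:S ==> f x ~= 0) ==> Ck_on k S f ==> Ck_on k S (%x. inverse (f x))"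
proof (induction k)
 case (Suc k)
 have "Ck_on k S (%x. inverse (f x))" by (rule Suc.IH) (use Suc.prems in \<open>auto intro: Ck_on_Suc_imp\<close>)
 then have "Ck_on k S (%x. (- 1) * pd i f x * (inverse (f x) * inverse (f x)))" for i
  by (intro Ck_on_mult Ck_on_const) (use Suc.prems in auto)
 then show ?case
  by (intro Ck_on_SucI[where f' = "%i x. - pd i f x * (inverse (f x) * inverse (f x))"])
   (use Suc.prems in \<open>auto intro!: has_partial_inverse has_partial_pd continuous_intros\<close>)
qed (auto intro: continuous_intros)

lemma Ck_on_affine:
 "open S ==> Ck_on k S f ==> Ck_on k {x. a + c *\<^sub>R x:S} (%x. f (a + c *\<^sub>R x))"
proof (induction k arbitrary: f)
 case 0
 then show ?case by (auto intro!: continuous_on_compose2[of S f] continuous_intros)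
next
 case (Suc k)
 have op: "open {x. a + c *\<^sub>R x:S}"
  using open_vimage[OF Suc.prems(1), of "%x. a + c *\<^sub>R x"] by (simp add: vimage_def continuous_intros)
 have "Ck_on k {x. a + c *\<^sub>R x:S} (%x. of_real c * pd i f (a + c *\<^sub>R x))" for i
  using Ck_on_mult[OF op Ck_on_const[OF op] Suc.IH[OF Suc.prems(1)]] Suc.prems by auto
 then show ?case
  using Suc.prems op
  by (intro Ck_on_SucI[where f' = "%i x. of_real c * pd i f (a + c *\<^sub>R x)"])
   (auto intro!: has_partial_affine has_partial_pd continuous_on_compose2[of S f] continuous_intros)
qed

lemma smooth_on_has_partial: "smooth_on S f ==> x:S ==> has_partial i f (pd i f x) x"
 unfolding smooth_on_def using Ck_on_has_partial by blast

lemma smooth_on_partial: "smooth_on S f ==> smooth_on S (pd i f)"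
 unfolding smooth_on_def using Ck_on_partial by blast

lemma smooth_on_cont: "smooth_on S f ==> continuous_on S f"
 unfolding smooth_on_def using Ck_on_cont by blast

lemma smooth_on_const: "open S ==> smooth_on S (%_. d)"
 and smooth_on_add: "open S ==> smooth_on S f ==> smooth_on S g ==> smooth_on S (%x. f x + g x)"
 and smooth_on_mult: "open S ==> smooth_on S f ==> smooth_on S g ==> smooth_on S (%x. f x * g x)"
 and smooth_on_inverse: "open S ==> smooth_on S f ==> (!!x. x:S ==> f x ~= 0) ==> smooth_on S (%x. inverse (f x))"
 and smooth_on_affine: "open S ==> smooth_on S f ==> smooth_on {x. a + c *\<^sub>R x:S} (%x. f (a + c *\<^sub>R x))"
 and smooth_on_subset: "smooth_on S f ==> T <= S ==> smooth_on T f"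
 and smooth_on_cong: "open S ==> (!!y. y:S ==> f y = g y) ==> smooth_on S f ==> smooth_on S g"
 unfolding smooth_on_def
 by (simp_all add: Ck_on_const Ck_on_add Ck_on_mult Ck_on_inverse Ck_on_affine)
  (blast intro: Ck_on_subset, metis Ck_on_cong)

lemma smooth_on_cmult: "open S ==> smooth_on S f ==> smooth_on S (%x. c * f x)"
 by (intro smooth_on_mult smooth_on_const)

lemma smooth_on_diff: "open S ==> smooth_on S f ==> smooth_on S g ==> smooth_on S (%x. f x - g x)"
 using smooth_on_add[OF _ _ smooth_on_cmult[of S g "-1"], of f] by simp

lemma smooth_on_prod:
 "open S ==> (!!k. k:I ==> smooth_on S (f k)) ==> smooth_on S (%x. \<Prod>k\<in>I. f k x)"
 by (induction I rule: infinite_finite_induct) (auto intro: smooth_on_mult smooth_on_const)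

lemma smooth_on_affine_UNIV: "smooth_on UNIV f ==> smooth_on UNIV (%x. f (a + c *\<^sub>R x))"
 using smooth_on_affine[of UNIV f a c] by simp

text \<open>Continuity and differentiability are pointwise conditions, and the induction on the
  order carries the covering over to the partial derivatives.\<close>

lemma smooth_on_local:
 assumes "open S" "!!x. x:S ==> EX T. open T & x:T & T <= S & smooth_on T f"
 shows "smooth_on S f"
proof -
 have "Ck_on k S f" if "!!x. x:S ==> EX T. open T & x:T & T <= S & Ck_on k T f" for k and f :: "real^'a => complex"
  using that
 proof (induction k arbitrary: f)
  case 0
  then have "ALL x:S. isCont f x"
   by (metis Ck_on.simps(1) continuous_on_eq_continuous_at)
  then show ?case by (simp add: continuous_at_imp_continuous_on)
 next
  case (Suc k)
  have "continuous_on S f"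
  proof (rule continuous_at_imp_continuous_on, rule ballI)
   fix x assume "x:S"
   from Suc.prems[OF this] obtain T where "open T" "x:T" "T <= S" "continuous_on T f" by auto
   then show "isCont f x" using continuous_on_eq_continuous_at by blast
  qed
  moreover have "(%t::real. f (x + t *\<^sub>R axis i 1)) differentiable (at 0)" if "x:S" for x i
   using Suc.prems[OF that] by auto
  moreover have "Ck_on k S (pd i f)" for i
  proof (rule Suc.IH)
   fix x assume "x:S"
   from Suc.prems[OF this] obtain T where "open T" "x:T" "T <= S" "Ck_on (Suc k) T f" by blast
   then show "EX T. open T & x:T & T <= S & Ck_on k T (pd i f)"
    using Ck_on_partial by blast
  qed
  ultimately show ?case by auto
 qed
 moreover have "EX T. open T & x:T & T <= S & Ck_on k T f" if "x:S" for x k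
  using assms(2)[OF that] unfolding smooth_on_def by blast
 ultimately show ?thesis unfolding smooth_on_def by blast
qed

section \<open>Mean value estimates, total derivative and symmetry of mixed derivatives\<close>

lemma mvt_partial:
 assumes "!!\<tau>. \<bar>\<tau>\<bar> <= \<bar>t\<bar> ==> has_partial i f (f' (x + \<tau> *\<^sub>R axis i 1)) (x + \<tau> *\<^sub>R axis i 1)"
  and "!!\<tau>. \<bar>\<tau>\<bar> <= \<bar>t\<bar> ==> cmod (f' (x + \<tau> *\<^sub>R axis i 1) - c) <= B"
 shows "cmod (f (x + t *\<^sub>R axis i 1) - f x - of_real t * c) <= B * \<bar>t\<bar>"
proof -
 \<comment> \<open>Subtracting the linear function with slope \<open>c\<close> turns closeness of
   the derivative to \<open>c\<close> into a bound for the deviation from the affine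
   approximation.\<close>
 let ?h = "%\<tau>. f (x + \<tau> *\<^sub>R axis i 1) - of_real \<tau> * c"
 have der: "(?h has_derivative (%s. s *\<^sub>R (f' (x + \<tau> *\<^sub>R axis i 1) - c))) (at \<tau> within {-\<bar>t\<bar>..\<bar>t\<bar>})"
  if "\<tau> : {-\<bar>t\<bar>..\<bar>t\<bar>}" for \<tau>
 proof -
  have "((%\<tau>. f (x + \<tau> *\<^sub>R axis i 1)) has_vector_derivative f' (x + \<tau> *\<^sub>R axis i 1)) (at \<tau>)"
   using assms(1)[of \<tau>] that by (simp add: has_partial_shift abs_le_iff)
  then have "(?h has_vector_derivative (f' (x + \<tau> *\<^sub>R axis i 1) - c)) (at \<tau>)"
   by (auto intro!: derivative_eq_intros)
  then show ?thesis
   unfolding has_vector_derivative_def by (rule has_derivative_at_withinI)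
 qed
 have "norm (?h t - ?h 0) <= B * norm (t - 0)"
 proof (rule differentiable_bound[where S = "{-\<bar>t\<bar>..\<bar>t\<bar>}", OF _ der])
  fix \<tau> assume "\<tau> : {-\<bar>t\<bar>..\<bar>t\<bar>}"
  then have "cmod (f' (x + \<tau> *\<^sub>R axis i 1) - c) <= B" by (intro assms(2)) auto
  then show "onorm (%s. s *\<^sub>R (f' (x + \<tau> *\<^sub>R axis i 1) - c)) <= B"
   by (intro onorm_bound order_trans[OF norm_ge_zero]) (auto simp: mult.commute[of B] intro: mult_left_mono)
 qed auto
 then show ?thesis by (simp add: algebra_simps)
qed

text \<open>The increment \<open>h\<close> is built up one coordinate at a time. Each change is a
  mean value estimate in a coordinate direction, and continuity of the partial derivatives controls
  its error.\<close>

lemma Ck_on_has_derivative: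
 fixes f :: "'n::finite fn"
 assumes "open S" "x:S" "Ck_on (Suc 0) S f"
 shows "(f has_derivative (%h. \<Sum>i\<in>UNIV. of_real (h $ i) * pd i f x)) (at x)"
proof -
 let ?D = "%i. pd i f"
 have cont: "isCont (?D i) x" for i
  using assms by (auto simp: continuous_on_eq_continuous_at)
 have est: "EX d>0. ALL h. norm h < d -->
   cmod (f (x + h) - f x - (\<Sum>i\<in>UNIV. of_real (h $ i) * ?D i x)) <= e * norm h" if "e > 0" for e
 proof -
  \<comment> \<open>There are \<open>CARD('n)\<close> coordinate changes, each with error at most
    \<eta> times \<open>norm h\<close>.\<close>
  define \<eta> where "\<eta> = e / CARD('n)"
  have \<eta>: "\<eta> > 0" using that by (simp add: \<eta>_def)
  obtain d0 where d0: "d0 > 0" "ball x d0 <= S" using assms(1,2) open_contains_ball by blast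
  have "ALL i. EX d>0. ALL y. dist y x < d --> dist (?D i y) (?D i x) < \<eta>"
   using cont \<eta> unfolding continuous_at_eps_delta by blast
  then obtain di where di: "!!i. di i > 0" "!!i y. dist y x < di i ==> dist (?D i y) (?D i x) < \<eta>" by metis
  define d where "d = Min (insert d0 (range di))"
  have d: "d > 0" "d <= d0" "!!i. d <= di i"       subgoal unfolding d_def using d0(1) di(1) by (subst Min_gr_iff) auto
   subgoal unfolding d_def by (rule Min_le) auto
   subgoal unfolding d_def by (rule Min_le) auto
   done
  show ?thesis
  proof (intro exI[of _ d] conjI d(1) allI impI)
   fix h :: "real^'n" assume h: "norm h < d"
   define hI where "hI I = (\<Sum>i\<in>I. h $ i *\<^sub>R axis i (1::real))" for I
   have hIc: "hI I $ i = (if i:I then h $ i else 0)" for I i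
    unfolding hI_def by (simp add: axis_def if_distrib[of "%z. _ * z"] sum.If_cases cong: if_cong)
   have *: "cmod (f (x + hI I) - f x - (\<Sum>i\<in>I. of_real (h $ i) * ?D i x)) <= (\<Sum>i\<in>I. \<eta> * \<bar>h $ i\<bar>)"
    for I :: "'n set"
   proof (induction I rule: infinite_finite_induct)
    case (insert j I)
    \<comment> \<open>Compared componentwise, the intermediate points are no further from
      \<open>x\<close> than \<open>x + h\<close>, so they stay where the partial derivatives are
      nearly constant.\<close>
    have lt: "norm (hI I + \<tau> *\<^sub>R axis j 1) < d" if "\<bar>\<tau>\<bar> <= \<bar>h $ j\<bar>" for \<tau>
    proof -
     have "norm (hI I + \<tau> *\<^sub>R axis j 1) <= norm h"
      by (rule norm_le_componentwise_cart) (use insert.hyps that in \<open>auto simp: hIc axis_def\<close>)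
     then show ?thesis using h by simp
    qed
    have "cmod (f ((x + hI I) + h $ j *\<^sub>R axis j 1) - f (x + hI I) - of_real (h $ j) * ?D j x) <= \<eta> * \<bar>h $ j\<bar>"
    proof (rule mvt_partial[where f' = "?D j"])
     fix \<tau> assume t: "\<bar>\<tau>\<bar> <= \<bar>h $ j\<bar>"
     have ds: "dist (x + hI I + \<tau> *\<^sub>R axis j 1) x < d"
      using lt[OF t] by (simp add: dist_norm add.assoc)
     then have "x + hI I + \<tau> *\<^sub>R axis j 1:S" using d0(2) d(2) by (auto simp: dist_commute subset_iff)
     then show "has_partial j f (?D j (x + hI I + \<tau> *\<^sub>R axis j 1)) (x + hI I + \<tau> *\<^sub>R axis j 1)"
      using Ck_on_has_partial[OF assms(3)] by blast
     show "cmod (?D j (x + hI I + \<tau> *\<^sub>R axis j 1) - ?D j x) <= \<eta>"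
      using di(2)[of "x + hI I + \<tau> *\<^sub>R axis j 1" j] ds d(3)[of j] by (simp add: dist_norm)
    qed
    moreover have "hI (insert j I) = hI I + h $ j *\<^sub>R axis j 1"
     using insert.hyps by (simp add: hI_def add.commute)
    ultimately have a: "cmod (f (x + hI (insert j I)) - f (x + hI I) - of_real (h $ j) * ?D j x) <= \<eta> * \<bar>h $ j\<bar>"
     by (simp add: add.assoc)
    have eq: "f (x + hI (insert j I)) - f x - (\<Sum>i\<in>insert j I. of_real (h $ i) * ?D i x) =
     (f (x + hI (insert j I)) - f (x + hI I) - of_real (h $ j) * ?D j x)
     + (f (x + hI I) - f x - (\<Sum>i\<in>I. of_real (h $ i) * ?D i x))"
     using insert.hyps by simp
    show ?case
     unfolding eq using norm_triangle_mono[OF a insert.IH] insert.hyps by (simp del: norm_triangle_ineq)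
   qed (simp_all add: hI_def)
   have hU: "hI UNIV = h" using hIc[of UNIV] by (simp add: vec_eq_iff)
   have "(\<Sum>i\<in>UNIV. \<eta> * \<bar>h $ i\<bar>) <= (\<Sum>i\<in>(UNIV::'n set). \<eta> * norm h)"
    using \<eta> by (intro sum_mono mult_left_mono) (auto simp: component_le_norm_cart)
   also have "... = e * norm h" by (simp add: \<eta>_def)
   finally show "cmod (f (x + h) - f x - (\<Sum>i\<in>UNIV. of_real (h $ i) * ?D i x)) <= e * norm h"
    using *[of UNIV] hU by simp
  qed
 qed
 have "bounded_linear (%h::real^'n. \<Sum>i\<in>UNIV. of_real (h $ i) * ?D i x)"
  by (intro bounded_linear_sum bounded_linear_mult_const bounded_linear_compose[OF bounded_linear_of_real] bounded_linear_vec_nth)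
 then show ?thesis
  unfolding has_derivative_at_alt
 proof (intro conjI allI impI, assumption)
  fix e :: real assume "e > 0"
  from est[OF this] obtain d where d: "d > 0" "!!h. norm h < d ==>
   cmod (f (x + h) - f x - (\<Sum>i\<in>UNIV. of_real (h $ i) * ?D i x)) <= e * norm h" by blast
  show "EX d>0. ALL y. norm (y - x) < d -->
    cmod (f y - f x - (\<Sum>i\<in>UNIV. of_real ((y - x) $ i) * ?D i x)) <= e * norm (y - x)"
   using d(1) d(2)[of "y - x" for y] by (intro exI[of _ d]) auto
 qed
qed

lemma smooth_on_has_derivative:
 "open S ==> x:S ==> smooth_on S f ==>
  (f has_derivative (%h. \<Sum>i\<in>UNIV. of_real (h $ i) * pd i f x)) (at x)"
 unfolding smooth_on_def by (blast intro: Ck_on_has_derivative)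

text \<open>Two mean value estimates: in direction \<open>j\<close> for the derivative
  \<open>pd i f\<close>, then in direction \<open>i\<close> for the increment of \<open>f\<close> in
  direction \<open>j\<close>.\<close>

lemma second_difference_bound:
 assumes "open S" "x:S" "smooth_on S f" "e > 0"
 shows "EX d>0. ALL s t. \<bar>s\<bar> < d --> \<bar>t\<bar> < d -->
  cmod (f (x + s *\<^sub>R axis i 1 + t *\<^sub>R axis j 1) - f (x + s *\<^sub>R axis i 1) - f (x + t *\<^sub>R axis j 1) + f x
   - of_real (s * t) * pd j (pd i f) x) <= e * \<bar>s * t\<bar>"
proof -
 let ?g = "pd j (pd i f)"
 obtain d0 where d0: "d0 > 0" "ball x d0 <= S" using assms(1,2) open_contains_ball by blast
 have sm: "smooth_on S (pd i f)" "smooth_on S ?g"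
  using assms by (auto intro: smooth_on_partial)
 then have "isCont ?g x" using assms(1,2) smooth_on_cont continuous_on_eq_continuous_at by blast
 then obtain d1 where d1: "d1 > 0" "!!y. dist y x < d1 ==> dist (?g y) (?g x) < e"
  using assms(4) unfolding continuous_at_eps_delta by blast
 define d where "d = min d0 d1 / 2"
 have "d > 0" using d0 d1 by (simp add: d_def)
 moreover have near: "x + s *\<^sub>R axis i 1 + t *\<^sub>R axis j 1:S & dist (x + s *\<^sub>R axis i 1 + t *\<^sub>R axis j 1) x < d1"
  if "\<bar>s\<bar> < d" "\<bar>t\<bar> < d" for s t
 proof -
  have "norm (s *\<^sub>R axis i 1 + t *\<^sub>R axis j (1::real)) <= \<bar>s\<bar> + \<bar>t\<bar>"
   using norm_triangle_ineq[of "s *\<^sub>R axis i (1::real)" "t *\<^sub>R axis j (1::real)"] by simp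
  then have "dist (x + s *\<^sub>R axis i 1 + t *\<^sub>R axis j 1) x < min d0 d1"
   using that by (simp add: dist_norm add.assoc d_def field_simps)
  then show ?thesis using d0(2) by (auto simp: dist_commute subset_iff)
 qed
 moreover have "cmod (f (x + s *\<^sub>R axis i 1 + t *\<^sub>R axis j 1) - f (x + s *\<^sub>R axis i 1) - f (x + t *\<^sub>R axis j 1) + f x
   - of_real (s * t) * ?g x) <= e * \<bar>s * t\<bar>" if st: "\<bar>s\<bar> < d" "\<bar>t\<bar> < d" for s t
 proof -
  have "cmod (pd i f (x + \<sigma> *\<^sub>R axis i 1 + t *\<^sub>R axis j 1) - pd i f (x + \<sigma> *\<^sub>R axis i 1)
    - of_real t * ?g x) <= e * \<bar>t\<bar>" if "\<bar>\<sigma>\<bar> <= \<bar>s\<bar>" for \<sigma>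
  proof (rule mvt_partial[where f' = ?g])
   fix \<tau> assume "\<bar>\<tau>\<bar> <= \<bar>t\<bar>"
   with near[of \<sigma> \<tau>] st that have n: "x + \<sigma> *\<^sub>R axis i 1 + \<tau> *\<^sub>R axis j 1:S"
    "dist (x + \<sigma> *\<^sub>R axis i 1 + \<tau> *\<^sub>R axis j 1) x < d1" by auto
   then show "has_partial j (pd i f) (?g (x + \<sigma> *\<^sub>R axis i 1 + \<tau> *\<^sub>R axis j 1)) (x + \<sigma> *\<^sub>R axis i 1 + \<tau> *\<^sub>R axis j 1)"
    using sm smooth_on_has_partial by blast
   show "cmod (?g (x + \<sigma> *\<^sub>R axis i 1 + \<tau> *\<^sub>R axis j 1) - ?g x) <= e"
    using d1(2)[OF n(2)] by (simp add: dist_norm)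
  qed
  note inner = this
  let ?h = "%y. f (t *\<^sub>R axis j 1 + 1 *\<^sub>R y) - f y"
  let ?h' = "%y. pd i f (t *\<^sub>R axis j 1 + y) - pd i f y"
  have "cmod (?h (x + s *\<^sub>R axis i 1) - ?h x - of_real s * (of_real t * ?g x)) <= (e * \<bar>t\<bar>) * \<bar>s\<bar>"
  proof (rule mvt_partial[where f' = ?h'])
   fix \<sigma> assume s: "\<bar>\<sigma>\<bar> <= \<bar>s\<bar>"
   have "x + \<sigma> *\<^sub>R axis i 1 + t *\<^sub>R axis j 1:S" "x + \<sigma> *\<^sub>R axis i 1:S"
    using near[of \<sigma> t] near[of \<sigma> 0] s st \<open>d > 0\<close> by auto
   then have p: "has_partial i f (pd i f (t *\<^sub>R axis j 1 + 1 *\<^sub>R (x + \<sigma> *\<^sub>R axis i 1))) (t *\<^sub>R axis j 1 + 1 *\<^sub>R (x + \<sigma> *\<^sub>R axis i 1))"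
    "has_partial i f (pd i f (x + \<sigma> *\<^sub>R axis i 1)) (x + \<sigma> *\<^sub>R axis i 1)"
    by (auto intro!: smooth_on_has_partial[OF assms(3)] simp: add_ac)
   show "has_partial i ?h (?h' (x + \<sigma> *\<^sub>R axis i 1)) (x + \<sigma> *\<^sub>R axis i 1)"
    using has_partial_diff[OF has_partial_affine[OF p(1)] p(2)] by simp
   show "cmod (?h' (x + \<sigma> *\<^sub>R axis i 1) - of_real t * ?g x) <= e * \<bar>t\<bar>"
    using inner[OF s] by (simp add: add_ac)
  qed
  then show ?thesis by (simp add: algebra_simps abs_mult)
 qed
 ultimately show ?thesis by blast
qed

text \<open>With equal steps \<open>s\<close> in both directions the second difference is symmetric
  in \<open>i\<close> and \<open>j\<close>; divided by \<open>s * s\<close> it approximates both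
  mixed derivatives.\<close>

lemma pd_commute:
 assumes "open S" "x:S" "smooth_on S f"
 shows "pd i (pd j f) x = pd j (pd i f) x"
proof -
 let ?a = "pd i (pd j f) x" and ?b = "pd j (pd i f) x"
 have "cmod (?a - ?b) <= 0 + e" if "e > 0" for e
 proof -
  have e: "e / 2 > 0" using that by simp
  obtain d1 where d1: "d1 > 0" "!!s t. \<bar>s\<bar> < d1 ==> \<bar>t\<bar> < d1 ==>
   cmod (f (x + s *\<^sub>R axis i 1 + t *\<^sub>R axis j 1) - f (x + s *\<^sub>R axis i 1) - f (x + t *\<^sub>R axis j 1) + f x
   - of_real (s * t) * ?b) <= e/2 * \<bar>s * t\<bar>" using second_difference_bound[OF assms e] by meson
  obtain d2 where d2: "d2 > 0" "!!s t. \<bar>s\<bar> < d2 ==> \<bar>t\<bar> < d2 ==>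
   cmod (f (x + s *\<^sub>R axis j 1 + t *\<^sub>R axis i 1) - f (x + s *\<^sub>R axis j 1) - f (x + t *\<^sub>R axis i 1) + f x
   - of_real (s * t) * ?a) <= e/2 * \<bar>s * t\<bar>" using second_difference_bound[OF assms e] by meson
  define s where "s = min d1 d2 / 2"
  have s: "s > 0" "\<bar>s\<bar> < d1" "\<bar>s\<bar> < d2" using d1(1) d2(1) by (auto simp: s_def)
  let ?D = "f (x + s *\<^sub>R axis i 1 + s *\<^sub>R axis j 1) - f (x + s *\<^sub>R axis i 1) - f (x + s *\<^sub>R axis j 1) + f x"
  have "cmod (?D - of_real (s * s) * ?b) <= e/2 * \<bar>s * s\<bar>" using d1(2)[OF s(2) s(2)] .
  moreover have "cmod (?D - of_real (s * s) * ?a) <= e/2 * \<bar>s * s\<bar>"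
   using d2(2)[OF s(3) s(3)] by (simp add: add_ac diff_diff_add)
  ultimately have "cmod ((?D - of_real (s * s) * ?b) - (?D - of_real (s * s) * ?a)) <= e/2 * \<bar>s * s\<bar> + e/2 * \<bar>s * s\<bar>"
   by (rule norm_triangle_le_diff[OF add_mono])
  also have "(?D - of_real (s * s) * ?b) - (?D - of_real (s * s) * ?a) = of_real (s * s) * (?a - ?b)"
   by (simp add: algebra_simps)
  also have "cmod (of_real (s * s) * (?a - ?b)) = (s * s) * cmod (?a - ?b)" by (simp add: norm_mult)
  finally have "(s * s) * cmod (?a - ?b) <= (s * s) * e" by (simp add: mult_ac)
  then show ?thesis using s(1) by (simp add: mult_le_cancel_left)
 qed
 then have "cmod (?a - ?b) <= 0" by (rule field_le_epsilon)
 then show ?thesis by simp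
qed

subsection \<open>Iterated partial derivatives\<close>

text \<open>Lists of directions replace multi-indices since one more derivative is then a list
  constructor. The order of the entries is immaterial for smooth functions, see
  \<open>ideriv_mset\<close>.\<close>

definition ideriv :: "'n::finite list => ('n fn) => 'n fn" where
 "ideriv is f = foldr pd is f"

lemma ideriv_Nil [simp]: "ideriv [] f = f"
 and ideriv_Cons: "ideriv (i # is) f = pd i (ideriv is f)"
 and ideriv_append: "ideriv (is @ js) f = ideriv is (ideriv js f)"
 by (simp_all add: ideriv_def)

lemma smooth_on_ideriv: "smooth_on S f ==> smooth_on S (ideriv is f)"
 by (induction "is") (auto simp: ideriv_Cons intro: smooth_on_partial)

lemma ideriv_cong:
 assumes "open S" "!!y. y:S ==> f y = g y" "x:S"
 shows "ideriv is f x = ideriv is g x"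
 using assms(3)
proof (induction "is" arbitrary: x)
 case (Cons i "is")
 show ?case unfolding ideriv_Cons by (rule pd_cong[OF assms(1) Cons.prems Cons.IH])
qed (use assms in auto)

lemma ideriv_has_partial:
 "smooth_on S f ==> x:S ==> has_partial i (ideriv is f) (ideriv (i # is) f x) x"
 unfolding ideriv_Cons by (intro smooth_on_has_partial smooth_on_ideriv)

lemma ideriv_move:
 assumes "open S" "smooth_on S f" "x:S"
 shows "ideriv (as @ i # bs) f x = ideriv (i # as @ bs) f x"
 using assms(3)
proof (induction as arbitrary: x)
 case (Cons a as)
 have "ideriv ((a # as) @ i # bs) f x = pd a (pd i (ideriv (as @ bs) f)) x"
  using pd_cong[OF assms(1) Cons.prems Cons.IH] by (simp add: ideriv_Cons)
 also have "... = pd i (pd a (ideriv (as @ bs) f)) x"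
  by (rule pd_commute[OF assms(1) Cons.prems smooth_on_ideriv[OF assms(2)]])
 finally show ?case by (simp add: ideriv_Cons)
qed simp

lemma ideriv_mset:
 assumes "open S" "smooth_on S f" "x:S" "mset is = mset js"
 shows "ideriv is f x = ideriv js f x"
 using assms(3,4)
proof (induction "is" arbitrary: js x)
 case (Cons i "is")
 then have "i:set js" by (metis list.set_intros(1) mset_eq_setD)
 then obtain as bs where js: "js = as @ i # bs" by (meson split_list)
 then have m: "mset is = mset (as @ bs)" using Cons.prems by simp
 have "ideriv (i # is) f x = ideriv (i # as @ bs) f x"
  unfolding ideriv_Cons by (rule pd_cong[OF assms(1) Cons.prems(1) Cons.IH[OF _ m]])
 then show ?case using ideriv_move[OF assms(1,2) Cons.prems(1)] js by simp
qed simp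

definition mi_list :: "'n::finite multi_index => 'n list" where
 "mi_list \<alpha> = concat (map (%i. replicate (\<alpha> i) i) coords)"

lemma coords: "distinct (coords :: 'n::finite list)" "set (coords :: 'n list) = UNIV"
proof -
 obtain xs :: "'n list" where "distinct xs & set xs = UNIV"
  using finite_distinct_list[OF finite[of UNIV]] by blast
 then have "distinct (coords :: 'n list) & set (coords :: 'n list) = UNIV"
  unfolding coords_def by (rule someI)
 then show "distinct (coords :: 'n list)" "set (coords :: 'n list) = UNIV" by auto
qed

lemma multi_deriv_ideriv: "multi_deriv \<alpha> f = ideriv (mi_list \<alpha>) f"
proof -
 have r: "foldr pd (replicate m i) g = (pd i ^^ m) g" for m i and g :: "real^'a => complex"
  by (induction m) auto
 have "foldr (%i. pd i ^^ \<alpha> i) xs f = foldr pd (concat (map (%i. replicate (\<alpha> i) i) xs)) f" for xs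
  by (induction xs) (auto simp: r)
 then show ?thesis by (simp add: multi_deriv_def ideriv_def mi_list_def)
qed

lemma count_mi_list: "count (mset (mi_list \<alpha>)) i = \<alpha> i"
proof -
 have "count (mset (concat (map (%i. replicate (\<alpha> i) i) xs))) i = (if i:set xs then \<alpha> i else 0)"
  if "distinct xs" for xs
  using that by (induction xs) auto
 from this[OF coords(1)] show ?thesis unfolding mi_list_def coords(2) by simp
qed

lemma length_mi_list: "length (mi_list \<alpha>) = mi_order \<alpha>"
proof -
 have "length (mi_list \<alpha>) = sum_list (map \<alpha> coords)"
  by (simp add: mi_list_def length_concat o_def)
 also have "... = (\<Sum>i\<in>UNIV. \<alpha> i)" using coords by (metis sum_list_distinct_conv_sum_set)
 finally show ?thesis by (simp add: mi_order_def)
qed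

lemma mset_mi_list: "mset (mi_list (count (mset is))) = mset is"
 by (intro multiset_eqI) (simp add: count_mi_list)

text \<open>Lists with the same multiset of entries give the same derivative, so a list may be
  sorted into the order fixed by \<open>coords\<close>. Bounds over multi-indices and bounds over
  lists thus become interchangeable.\<close>

lemma ideriv_multi_deriv:
 assumes "open S" "smooth_on S f" "x:S"
 shows "ideriv is f x = multi_deriv (count (mset is)) f x"
 unfolding multi_deriv_ideriv using ideriv_mset[OF assms mset_mi_list[symmetric]] .

lemma mi_order_count: "mi_order (count (mset is)) = length is"
 unfolding length_mi_list[symmetric] by (metis mset_mi_list size_mset)

section \<open>Seminorm bounds through lists of derivatives, and rules for iterated
  derivatives\<close>

lemma SUP_ennreal_le_iff:
 "0 <= C ==> (SUP x\<in>K. ennreal (r x)) <= ennreal C \<longleftrightarrow> (ALL x:K. r x <= C)"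
 by (auto simp: SUP_le_iff)

lemma sup_seminorm_le_iff:
 assumes "open S" "smooth_on S f" "K <= S" "0 <= C"
 shows "sup_seminorm K j f <= ennreal C \<longleftrightarrow> (ALL is. length is <= j --> (ALL x:K. cmod (ideriv is f x) <= C))"
proof -
 have "sup_seminorm K j f <= ennreal C \<longleftrightarrow> (ALL \<alpha>. mi_order \<alpha> <= j --> (ALL x:K. cmod (multi_deriv \<alpha> f x) <= C))"
  unfolding sup_seminorm_def by (simp add: SUP_le_iff assms(4))
 also have "... \<longleftrightarrow> (ALL is. length is <= j --> (ALL x:K. cmod (ideriv is f x) <= C))"
  using ideriv_multi_deriv[OF assms(1,2)] assms(3) mi_order_count
  by (metis (no_types, opaque_lifting) length_mi_list multi_deriv_ideriv subsetD)
 finally show ?thesis .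
qed

lemma schwartz_seminorm_le_iff:
 assumes "smooth_on UNIV f" "0 <= C"
 shows "schwartz_seminorm j f <= ennreal C \<longleftrightarrow>
  (ALL is. length is <= j --> (ALL x. (1 + norm x) ^ j * cmod (ideriv is f x) <= C))"
proof -
 have "schwartz_seminorm j f <= ennreal C \<longleftrightarrow>
   (ALL \<alpha>. mi_order \<alpha> <= j --> (ALL x. (1 + norm x) ^ j * cmod (multi_deriv \<alpha> f x) <= C))"
  unfolding schwartz_seminorm_def by (simp add: SUP_le_iff assms)
 also have "... \<longleftrightarrow> (ALL is. length is <= j --> (ALL x. (1 + norm x) ^ j * cmod (ideriv is f x) <= C))"
  using ideriv_multi_deriv[OF open_UNIV assms(1)] mi_order_count
  by (metis (no_types, opaque_lifting) length_mi_list multi_deriv_ideriv UNIV_I)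
 finally show ?thesis .
qed

lemma ideriv_add:
 assumes "open S" "smooth_on S f" "smooth_on S g" "x:S"
 shows "ideriv is (%y. f y + g y) x = ideriv is f x + ideriv is g x"
 using assms(4)
proof (induction "is" arbitrary: x)
 case (Cons i "is")
 have "ideriv (i # is) (%y. f y + g y) x = pd i (%y. ideriv is f y + ideriv is g y) x"
  unfolding ideriv_Cons by (rule pd_cong[OF assms(1) Cons.prems Cons.IH])
 also have "... = ideriv (i # is) f x + ideriv (i # is) g x"
  by (intro has_partialD has_partial_add ideriv_has_partial[OF assms(2)] ideriv_has_partial[OF assms(3)] Cons.prems)
 finally show ?case .
qed simp

lemma ideriv_cmult:
 assumes "open S" "smooth_on S f" "x:S"
 shows "ideriv is (%y. c * f y) x = c * ideriv is f x"
 using assms(3)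
proof (induction "is" arbitrary: x)
 case (Cons i "is")
 have "ideriv (i # is) (%y. c * f y) x = pd i (%y. c * ideriv is f y) x"
  unfolding ideriv_Cons by (rule pd_cong[OF assms(1) Cons.prems Cons.IH])
 also have "... = c * ideriv (i # is) f x"
  by (intro has_partialD has_partial_cmult ideriv_has_partial[OF assms(2)] Cons.prems)
 finally show ?case .
qed simp

lemma ideriv_diff:
 assumes "open S" "smooth_on S f" "smooth_on S g" "x:S"
 shows "ideriv is (%y. f y - g y) x = ideriv is f x - ideriv is g x"
 using ideriv_add[OF assms(1,2) smooth_on_cmult[OF assms(1,3), of "-1"] assms(4), of "is"]
  ideriv_cmult[OF assms(1,3,4), of "is" "-1"] by simp

lemma ideriv_const: "ideriv is (%_. c) x = (if is = [] then c else 0)"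
proof (induction "is" arbitrary: x)
 case (Cons i "is")
 have "ideriv (i # is) (%_. c) x = pd i (%_. if is = [] then c else 0) x"
  unfolding ideriv_Cons by (rule pd_cong[OF open_UNIV UNIV_I Cons.IH])
 then show ?case by (simp add: has_partialD[OF has_partial_const])
qed simp

lemma ideriv_affine:
 assumes "open S" "smooth_on S f" "a + c *\<^sub>R x:S"
 shows "ideriv is (%y. f (a + c *\<^sub>R y)) x = of_real (c ^ length is) * ideriv is f (a + c *\<^sub>R x)"
 using assms(3)
proof (induction "is" arbitrary: x)
 case (Cons i "is")
 let ?T = "{x. a + c *\<^sub>R x:S}"
 have op: "open ?T"
  using open_vimage[OF assms(1), of "%x. a + c *\<^sub>R x"] by (simp add: vimage_def continuous_intros)
 have "ideriv (i # is) (%y. f (a + c *\<^sub>R y)) x =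
   pd i (%y. of_real (c ^ length is) * ideriv is f (a + c *\<^sub>R y)) x"
  unfolding ideriv_Cons by (rule pd_cong[OF op _ Cons.IH]) (use Cons.prems in auto)
 also have "... = of_real (c ^ length is) * (of_real c * ideriv (i # is) f (a + c *\<^sub>R x))"
  by (intro has_partialD has_partial_cmult has_partial_affine ideriv_has_partial[OF assms(2)] Cons.prems)
 finally show ?case by (simp add: mult_ac)
qed simp

lemma ideriv_affine_UNIV:
 "smooth_on UNIV f ==> ideriv is (%y. f (a + c *\<^sub>R y)) x = of_real (c ^ length is) * ideriv is f (a + c *\<^sub>R x)"
 by (rule ideriv_affine[OF open_UNIV]) auto

text \<open>A coarse Leibniz rule: every derivative doubles the number of products. The induction
  removes the derivative taken first, so that its two summands are again products of smooth
  functions.\<close>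

lemma ideriv_mult_bound:
 assumes "open S" "smooth_on S f" "smooth_on S g" "x:S"
  and "!!js. length js <= length is ==> cmod (ideriv js f x) <= A"
  and "!!js. length js <= length is ==> cmod (ideriv js g x) <= B"
 shows "cmod (ideriv is (%y. f y * g y) x) <= 2 ^ length is * (A * B)"
 using assms(2,3,5,6)
proof (induction "is" arbitrary: f g rule: rev_induct)
 case Nil
 have "cmod (f x) <= A" "cmod (g x) <= B" using Nil(3)[of "[]"] Nil(4)[of "[]"] by auto
 then show ?case by (simp add: norm_mult mult_mono order_trans[OF norm_ge_zero])
next
 case (snoc i "is")
 let ?f = "pd i f" and ?g = "pd i g"
 have sm: "smooth_on S ?f" "smooth_on S ?g" using snoc.prems smooth_on_partial by auto
 have "ideriv (is @ [i]) (%y. f y * g y) x = ideriv is (%y. ?f y * g y + f y * ?g y) x"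
  unfolding ideriv_append
  by (rule ideriv_cong[OF assms(1) _ assms(4)])
   (auto simp: ideriv_Cons intro!: has_partialD has_partial_mult smooth_on_has_partial snoc.prems)
 also have "... = ideriv is (%y. ?f y * g y) x + ideriv is (%y. f y * ?g y) x"
  by (intro ideriv_add[OF assms(1) _ _ assms(4)] smooth_on_mult assms(1) sm snoc.prems)
 finally have eq: "ideriv (is @ [i]) (%y. f y * g y) x = ..." .
 have "cmod (ideriv js ?f x) <= A" "cmod (ideriv js ?g x) <= B" if "length js <= length is" for js
  using snoc.prems(3)[of "js @ [i]"] snoc.prems(4)[of "js @ [i]"] that by (auto simp: ideriv_append ideriv_Cons)
 then have "cmod (ideriv is (%y. ?f y * g y) x) <= 2 ^ length is * (A * B)"
  "cmod (ideriv is (%y. f y * ?g y) x) <= 2 ^ length is * (A * B)"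
  by (auto intro!: snoc.IH sm snoc.prems)
 from norm_triangle_mono[OF this] show ?case unfolding eq by (simp add: mult_ac)
qed

subsection \<open>Cutoff functions\<close>

text \<open>Powers of \<open>1/t\<close> times \<open>exp (- 1/t)\<close>, extended by 0.
  Derivatives are combinations of members of higher index, so smoothness at 0 follows for the whole
  family at once by induction on the order.\<close>

definition flat_exp :: "nat => real => real" where
 "flat_exp m t = (if t > 0 then inverse t ^ m * exp (- inverse t) else 0)"

lemma flat_exp_deriv:
 "(flat_exp m has_real_derivative (flat_exp (m + 2) t - real m * flat_exp (m + 1) t)) (at t)"
proof -
 consider "t > 0" | "t < 0" | "t = 0" by linarith
 then show ?thesis
 proof cases
  case 1
  have "((%t. inverse t ^ m * exp (- inverse t)) has_real_derivative
    (flat_exp (m + 2) t - real m * flat_exp (m + 1) t)) (at t)"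
  proof -
   have p: "real m * inverse t ^ (m - Suc 0) * (inverse t * inverse t) = real m * inverse t ^ (m + 1)"
    by (cases m) (simp_all add: mult_ac)
   have "((%t. inverse t ^ m * exp (- inverse t)) has_real_derivative
     (real m * inverse t ^ (m - Suc 0) * (- (inverse t * inverse t))) * exp (- inverse t)
     + inverse t ^ m * (exp (- inverse t) * (inverse t * inverse t))) (at t)"
    using 1 by (auto intro!: derivative_eq_intros simp: algebra_simps)
   also have "(real m * inverse t ^ (m - Suc 0) * (- (inverse t * inverse t))) * exp (- inverse t)
     + inverse t ^ m * (exp (- inverse t) * (inverse t * inverse t)) =
    - (real m * inverse t ^ (m - Suc 0) * (inverse t * inverse t)) * exp (- inverse t)
     + inverse t ^ m * (exp (- inverse t) * (inverse t * inverse t))" by (simp only: mult_minus_right mult_minus_left)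
   also have "... = flat_exp (m + 2) t - real m * flat_exp (m + 1) t"
    unfolding p using 1 by (simp add: flat_exp_def power_add power2_eq_square mult_ac)
   finally show ?thesis .
  qed
  then show ?thesis
   by (rule has_field_derivative_transform_within_open[where S = "{0<..}"]) (use 1 in \<open>auto simp: flat_exp_def\<close>)
 next
  case 2
  have "((%t. 0) has_real_derivative 0) (at t)" by simp
  then have "(flat_exp m has_real_derivative 0) (at t)"
   by (rule has_field_derivative_transform_within_open[where S = "{..<0}"]) (use 2 in \<open>auto simp: flat_exp_def\<close>)
  then show ?thesis using 2 by (simp add: flat_exp_def)
 next
  case 3
  \<comment> \<open>With \<open>s = 1/t\<close> the difference quotient at 0 from the right is
    \<open>s ^ (m + 1) / exp s\<close>.\<close>
  have "((%s::real. s ^ (m + 1) / exp s) \<longlongrightarrow> 0) at_top" by (rule tendsto_power_div_exp_0)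
  then have "((%t. inverse t ^ (m + 1) / exp (inverse t)) \<longlongrightarrow> 0) (at_right (0::real))"
   by (rule filterlim_compose[OF _ filterlim_inverse_at_top_right])
  then have r: "((%h. (flat_exp m (0 + h) - flat_exp m 0) / h) \<longlongrightarrow> 0) (at_right 0)"
   by (rule Lim_transform_eventually)
    (use eventually_at_right_less[of "0::real"] in \<open>eventually_elim, auto simp: flat_exp_def exp_minus field_simps\<close>)
  have l: "((%h. (flat_exp m (0 + h) - flat_exp m 0) / h) \<longlongrightarrow> 0) (at_left 0)"
   by (rule Lim_transform_eventually[OF tendsto_const])
    (auto simp: eventually_at_left_field flat_exp_def intro!: exI[of _ "-1"])
  show ?thesis unfolding DERIV_def using filterlim_split_at[OF l r] 3 by (simp add: flat_exp_def)
 qed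
qed

lemma has_partial_coord:
 assumes "(h has_real_derivative h') (at (x $ j))"
 shows "has_partial i (%x. of_real (h (x $ j))) (if i = j then of_real h' else 0) x"
proof (cases "i = j")
 case True
 have "((%t. x $ j + t) has_real_derivative 1) (at 0)" by (auto intro!: derivative_eq_intros)
 from DERIV_chain[OF _ this, of h h'] assms have "((%t. h (x $ j + t)) has_real_derivative h') (at 0)"
  by (simp add: o_def)

 from has_vector_derivative_of_real[OF this] show ?thesis unfolding has_partial_def using True by (simp add: axis_def)
next
 case False
 then have "(%t. complex_of_real (h ((x + t *\<^sub>R axis i 1) $ j))) = (%t. of_real (h (x $ j)))" by (auto simp: axis_def)
 then show ?thesis unfolding has_partial_def using False by simp
qed

lemma smooth_on_flat_exp: "smooth_on UNIV (%x::real^'n::finite. of_real (flat_exp m (x $ j)))"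
proof -
 have cont: "continuous_on UNIV (%x::real^'n. complex_of_real (flat_exp m (x $ j)))" for m
 proof -
  have "continuous_on UNIV (flat_exp m)"
   by (rule continuous_at_imp_continuous_on) (intro ballI DERIV_isCont[OF flat_exp_deriv])
  then have "continuous_on UNIV (%x::real^'n. flat_exp m (x $ j))"
   by (rule continuous_on_compose2) (auto intro: continuous_on_component continuous_on_id)
  then show ?thesis by (rule continuous_on_of_real)
 qed
 have "Ck_on k UNIV (%x::real^'n. complex_of_real (flat_exp m (x $ j)))" for k
 proof (induction k arbitrary: m)
  case (Suc k)
  let ?f' = "%i (x::real^'n). if i = j then complex_of_real (flat_exp (m + 2) (x $ j) - real m * flat_exp (m + 1) (x $ j)) else 0"
  have "Ck_on k UNIV (%x::real^'n. of_real (flat_exp (m + 2) (x $ j)) + (- of_real (real m)) * complex_of_real (flat_exp (m + 1) (x $ j)))"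
   by (intro Ck_on_add Ck_on_mult Ck_on_const Suc.IH open_UNIV)
  then have "Ck_on k UNIV (?f' i)" for i
   by (cases "i = j") (auto intro: Ck_on_const)
  moreover have "has_partial i (%x. complex_of_real (flat_exp m (x $ j))) (?f' i x) x" for i x
   using has_partial_coord[OF flat_exp_deriv[of m "x $ j"], of i] .
  ultimately show ?case by (intro Ck_on_SucI[where f' = ?f'] cont) auto
 qed (use cont in auto)
 then show ?thesis unfolding smooth_on_def by blast
qed

text \<open>In one coordinate \<open>t\<close>, \<open>A\<close> is nonzero exactly for
  \<bar>t\<bar> < 2 and \<open>B\<close> exactly for \<bar>t\<bar> > 1, so
  \<open>A / (A + B)\<close> is 1 on [-1, 1] and 0 outside of (-2, 2). The product over the
  coordinates is a bump on cubes, which is then rescaled.\<close>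

lemma bump_exists:
 fixes a :: "real^'n::finite"
 assumes "r > 0"
 shows "EX b r'. 0 < r' & smooth_on UNIV b & (ALL x:ball a r'. b x = 1) & (ALL x. x ~: cball a r --> b x = 0)"
proof -
 define e where "e c s j x = complex_of_real (flat_exp 0 (c + s * x $ j))" for c s j and x :: "real^'n"
 have e: "smooth_on UNIV (e c s j)" for c s j
  using smooth_on_affine_UNIV[OF smooth_on_flat_exp[of 0 j], of "\<chi> i. c" s] by (simp add: e_def[abs_def])
 define A where "A j x = e 2 1 j x * e 2 (-1) j x" for j x
 define B where "B j x = e (-1) 1 j x + e (-1) (-1) j x" for j x
 define Q where "Q x = (\<Prod>j\<in>UNIV. A j x * inverse (A j x + B j x))" for x
 have fe: "flat_exp 0 t = 0 \<longleftrightarrow> t <= 0" "flat_exp 0 t >= 0" for t by (auto simp: flat_exp_def)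
 have nz: "A j x + B j x ~= 0" for j x
 proof -
  have "flat_exp 0 (2 + 1 * x $ j) * flat_exp 0 (2 + - 1 * x $ j) + (flat_exp 0 (- 1 + 1 * x $ j) + flat_exp 0 (- 1 + - 1 * x $ j)) > 0"
  proof (cases "\<bar>x $ j\<bar> < 2")
   case True
   then have "flat_exp 0 (2 + 1 * x $ j) * flat_exp 0 (2 + - 1 * x $ j) > 0" by (simp add: flat_exp_def)
   then show ?thesis using fe(2)[of "- 1 + 1 * x $ j"] fe(2)[of "- 1 + - 1 * x $ j"] by linarith
  next
   case False
   then have "- 1 + 1 * x $ j > 0 \<or> - 1 + - 1 * x $ j > 0" by linarith
   then have "flat_exp 0 (- 1 + 1 * x $ j) > 0 \<or> flat_exp 0 (- 1 + - 1 * x $ j) > 0"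
    unfolding flat_exp_def by (elim disjE) simp_all
   moreover have "flat_exp 0 (2 + 1 * x $ j) * flat_exp 0 (2 + - 1 * x $ j) >= 0" by (intro mult_nonneg_nonneg fe)
   ultimately show ?thesis using fe(2)[of "- 1 + 1 * x $ j"] fe(2)[of "- 1 + - 1 * x $ j"] by linarith
  qed
  from less_imp_neq[OF this, THEN not_sym] show ?thesis
   unfolding A_def B_def e_def of_real_mult[symmetric] of_real_add[symmetric] of_real_eq_0_iff .
 qed
 have Q: "smooth_on UNIV Q"
 proof -
  have A: "smooth_on UNIV (A j)" for j
   unfolding A_def[abs_def] by (rule smooth_on_mult[OF open_UNIV e e])
  have "smooth_on UNIV (B j)" for j
   unfolding B_def[abs_def] by (rule smooth_on_add[OF open_UNIV e e])
  then have "smooth_on UNIV (%x. A j x * inverse (A j x + B j x))" for j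
   by (intro smooth_on_mult[OF open_UNIV A] smooth_on_inverse[OF open_UNIV] smooth_on_add[OF open_UNIV A] nz)
  then show ?thesis unfolding Q_def[abs_def] by (rule smooth_on_prod[OF open_UNIV])
 qed
 have Q1: "Q x = 1" if "!!j. \<bar>x $ j\<bar> <= 1" for x
 proof -
  have "B j x = 0" for j
  proof -
   have "flat_exp 0 (- 1 + 1 * x $ j) = 0" "flat_exp 0 (- 1 + - 1 * x $ j) = 0"
    using that[of j] by (intro fe(1)[THEN iffD2], linarith)+
   then show ?thesis unfolding B_def e_def by (simp only: of_real_0 add_0_left)
  qed
  then have "A j x * inverse (A j x + B j x) = 1" for j using nz[of j x] by simp
  then show ?thesis unfolding Q_def by simp
 qed
 have Q0: "Q x = 0" if "\<bar>x $ j\<bar> >= 2" for x j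
 proof -
  have "2 + 1 * x $ j <= 0 \<or> 2 + - 1 * x $ j <= 0" using that by linarith
  then have "flat_exp 0 (2 + 1 * x $ j) = 0 \<or> flat_exp 0 (2 + - 1 * x $ j) = 0" using fe(1) by blast
  then have "A j x = 0" unfolding A_def e_def mult_eq_0_iff of_real_eq_0_iff .
  then show ?thesis unfolding Q_def by (intro prod_zero) auto
 qed
 \<comment> \<open>A point whose coordinates all differ from those of \<open>a\<close> by less than
   \<open>2 * d\<close> has distance at most \<open>r\<close> from \<open>a\<close>, as the norm is
   bounded by the sum of the coordinates.\<close>
 define d where "d = r / (2 * CARD('n))"
 have d: "d > 0" using assms by (simp add: d_def)
 define b where "b x = Q ((- inverse d) *\<^sub>R a + inverse d *\<^sub>R x)" for x
 have bj: "\<bar>((- inverse d) *\<^sub>R a + inverse d *\<^sub>R x) $ j\<bar> = inverse d * \<bar>x $ j - a $ j\<bar>" for x j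
 proof -
  have "((- inverse d) *\<^sub>R a + inverse d *\<^sub>R x) $ j = inverse d * (x $ j - a $ j)" by (simp add: algebra_simps)
  then show ?thesis using d by (simp add: abs_mult)
 qed
 have "b x = 1" if "x:ball a d" for x
  unfolding b_def
 proof (rule Q1)
  fix j
  have "\<bar>x $ j - a $ j\<bar> <= d" using that component_le_norm_cart[of "x - a" j] by (simp add: dist_norm norm_minus_commute)
  then show "\<bar>((- inverse d) *\<^sub>R a + inverse d *\<^sub>R x) $ j\<bar> <= 1" using d unfolding bj by (simp add: field_simps)
 qed
 moreover have "b x = 0" if "x ~: cball a r" for x
 proof -
  have "EX j. \<bar>x $ j - a $ j\<bar> >= 2 * d"
  proof (rule ccontr)
   assume "\<nexists>j. \<bar>x $ j - a $ j\<bar> >= 2 * d"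
   then have "(\<Sum>j\<in>UNIV. \<bar>(x - a) $ j\<bar>) <= (\<Sum>j\<in>(UNIV::'n set). 2 * d)" by (intro sum_mono) (auto simp: not_le less_imp_le)
   then have "norm (x - a) <= r" using norm_le_l1_cart[of "x - a"] by (simp add: d_def)
   then show False using that by (simp add: dist_norm norm_minus_commute)
  qed
  then obtain j where "\<bar>x $ j - a $ j\<bar> >= 2 * d" by blast
  then have "\<bar>((- inverse d) *\<^sub>R a + inverse d *\<^sub>R x) $ j\<bar> >= 2" using d unfolding bj by (simp add: field_simps)
  then show ?thesis unfolding b_def by (rule Q0)
 qed
 moreover have "smooth_on UNIV b" unfolding b_def[abs_def] by (rule smooth_on_affine_UNIV[OF Q])
 ultimately show ?thesis using d by (intro exI[of _ b] exI[of _ d] conjI ballI allI impI)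
qed

lemma cutoff_exists:
 fixes X :: "(real^'n::finite) set"
 assumes "open X" "compact K" "K <= X"
 obtains \<psi> W where "\<psi>:test X" "open W" "K <= W" "!!x. x:W ==> \<psi> x = 1"
proof -
 have "ALL a:K. EX r. r > 0 & cball a r <= X"
  using assms(1,3) open_contains_cball by blast
 then obtain r where r: "!!a. a:K ==> r a > 0" "!!a. a:K ==> cball a (r a) <= X"
  by (auto dest!: bchoice)
 let ?P = "%a b r'. 0 < r' & smooth_on UNIV b & (ALL x:ball a r'. b x = (1::complex)) & (ALL x. x ~: cball a (r a) --> b x = 0)"
 have "ALL a:K. EX t. ?P a (fst t) (snd t)"
 proof
  fix a assume "a:K"
  from bump_exists[OF r(1)[OF this], of a] obtain b r' where "?P a b r'" by (elim exE)
  then show "EX t. ?P a (fst t) (snd t)" by (intro exI[of _ "(b, r')"]) simp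
 qed
 then obtain t where t: "ALL a:K. ?P a (fst (t a)) (snd (t a))"
  by (rule bchoice[THEN exE])
 define b where "b a = fst (t a)" for a
 define r' where "r' a = snd (t a)" for a
 have H: "r a > 0 & cball a (r a) <= X & 0 < r' a & smooth_on UNIV (b a) &
   (ALL x:ball a (r' a). b a x = 1) & (ALL x. x ~: cball a (r a) --> b a x = 0)" if "a:K" for a
  using that r t by (simp add: b_def r'_def)
 have "K <= (\<Union>a\<in>K. ball a (r' a))" using H by force
 then obtain C where C: "C <= K" "finite C" "K <= (\<Union>a\<in>C. ball a (r' a))"
  using compactE_image[OF assms(2), of K "%a. ball a (r' a)"] by auto
 \<comment> \<open>The product vanishes wherever some bump is 1, and it is 1 wherever all bumps
   vanish.\<close>
 define \<psi> where "\<psi> x = 1 - (\<Prod>a\<in>C. 1 - b a x)" for x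
 have "smooth_on UNIV \<psi>"
  unfolding \<psi>_def[abs_def] using H C(1)
  by (intro smooth_on_diff[OF open_UNIV] smooth_on_prod[OF open_UNIV] smooth_on_const[OF open_UNIV]) auto
 moreover have "compact (\<Union>a\<in>C. cball a (r a))" using C(2) by (intro compact_UN) auto
 moreover have "(\<Union>a\<in>C. cball a (r a)) <= X" using H C(1) by auto
 moreover have "\<psi> x = 0" if "x ~: (\<Union>a\<in>C. cball a (r a))" for x
 proof -
  have "(\<Prod>a\<in>C. 1 - b a x) = 1" using H C(1) that by (intro prod.neutral) auto
  then show ?thesis by (simp add: \<psi>_def)
 qed
 ultimately have "\<psi>:test X" unfolding test_functions_def by blast
 moreover have "\<psi> x = 1" if "x : (\<Union>a\<in>C. ball a (r' a))" for x
 proof -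
  from that obtain a where a: "a:C" "x:ball a (r' a)" by blast
  then have "1 - b a x = 0" using H[of a] C(1) by auto
  then have "(\<Prod>a\<in>C. 1 - b a x) = 0" using C(2) a(1) by (intro prod_zero) auto
  then show ?thesis by (simp add: \<psi>_def)
 qed
 ultimately show ?thesis using that[OF _ _ C(3)] by (simp add: open_UN)
qed

subsection \<open>Taylor expansion\<close>

text \<open>The derivative of order \<open>k\<close> of \<open>g\<close> along the line in direction
  \<open>v\<close>, hence \<open>fact k\<close> times the Taylor term of degree \<open>k\<close>.
  Summing over sequences of coordinates avoids multinomial coefficients.\<close>

fun dir_deriv :: "nat => real^'n::finite => ('n fn) => 'n fn" where
 "dir_deriv 0 v g y = g y"
| "dir_deriv (Suc k) v g y = (\<Sum>i\<in>UNIV. of_real (v $ i) * dir_deriv k v (pd i g) y)"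

lemma dir_deriv_line:
 assumes "smooth_on UNIV g"
 shows "((%t::real. dir_deriv k v g (x + t *\<^sub>R v)) has_vector_derivative dir_deriv (Suc k) v g (x + t *\<^sub>R v)) (at t)"
 using assms
proof (induction k arbitrary: g)
 case 0
 have 1: "((%t::real. x + t *\<^sub>R v) has_vector_derivative v) (at t)" by (auto intro!: derivative_eq_intros)
 have "(g has_derivative (%h. \<Sum>i\<in>UNIV. of_real (h $ i) * pd i g (x + t *\<^sub>R v))) (at (x + t *\<^sub>R v))"
  by (rule smooth_on_has_derivative[OF open_UNIV UNIV_I 0])
 from vector_derivative_diff_chain_within[OF 1 has_derivative_at_withinI[OF this]]
 show ?case by (simp add: o_def)
next
 case (Suc k)
 show ?case
  by (simp only: dir_deriv.simps(2)[of "Suc k"] dir_deriv.simps(2)[of k])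
   (intro has_vector_derivative_sum has_vector_derivative_mult_right, rule Suc.IH[OF smooth_on_partial[OF Suc.prems], unfolded dir_deriv.simps(2)])
qed

lemma dir_deriv_bound:
 assumes "!!is. length is = k ==> cmod (ideriv is g y) <= B"
 shows "cmod (dir_deriv k v g y) <= (\<Sum>i\<in>UNIV. \<bar>v $ i\<bar>) ^ k * B"
 using assms
proof (induction k arbitrary: g)
 case 0
 then show ?case using 0[of "[]"] by simp
next
 case (Suc k)
 have "cmod (dir_deriv k v (pd i g) y) <= (\<Sum>i\<in>UNIV. \<bar>v $ i\<bar>) ^ k * B" for i
 proof (rule Suc.IH)
  fix "is" :: "'a list" assume "length is = k"
  then show "cmod (ideriv is (pd i g) y) <= B"
   using Suc.prems[of "is @ [i]"] by (simp add: ideriv_append ideriv_Cons)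
 qed
 then have "cmod (dir_deriv (Suc k) v g y) <= (\<Sum>i\<in>UNIV. \<bar>v $ i\<bar> * ((\<Sum>i\<in>UNIV. \<bar>v $ i\<bar>) ^ k * B))"
  by (auto intro!: sum_norm_le mult_left_mono simp: norm_mult)
 also have "... = (\<Sum>i\<in>UNIV. \<bar>v $ i\<bar>) * ((\<Sum>i\<in>UNIV. \<bar>v $ i\<bar>) ^ k * B)" by (rule sum_distrib_right[symmetric])
 finally show ?case by (simp only: power_Suc mult_ac)
qed

lemma dir_deriv_scale: "dir_deriv k (c *\<^sub>R v) g y = of_real (c ^ k) * dir_deriv k v g y"
 by (induction k arbitrary: g) (simp_all add: sum_distrib_left mult_ac)

text \<open>Induction on the order: the remainder vanishes at 0, and its derivative is the
  remainder, of one order less, of the derivative. On the unit interval each integration keeps the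
  bound \<open>B\<close>.\<close>

lemma taylor_bound_real:
 fixes h :: "nat => real => complex"
 assumes "!!k t. k < r ==> t : {0..1} ==> (h k has_vector_derivative h (Suc k) t) (at t)"
  and "!!t. t : {0..1} ==> cmod (h r t) <= B" and "t : {0..1}"
 shows "cmod (h 0 t - (\<Sum>k<r. h k 0 * of_real (t ^ k / fact k))) <= B"
 using assms
proof (induction r arbitrary: h t)
 case (Suc r)
 define R where "R t = h 0 t - (\<Sum>k<Suc r. h k 0 * of_real (t ^ k / fact k))" for t
 define R' where "R' t = h 1 t - (\<Sum>k<r. h (Suc k) 0 * of_real (t ^ k / fact k))" for t
 have R': "cmod (R' s) <= B" if "s : {0..1}" for s
  unfolding R'_def One_nat_def by (rule Suc.IH[of "%k. h (Suc k)"]) (use Suc.prems that in auto)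
 have p: "((%t. t ^ Suc k / fact (Suc k)) has_real_derivative s ^ k / fact k) (at s)" for k :: nat and s :: real
 proof -
  have "((%t. t ^ Suc k / fact (Suc k)) has_real_derivative (real (Suc k) * s ^ k / fact (Suc k))) (at s)"
   by (rule derivative_eq_intros refl | simp)+
  also have "real (Suc k) * s ^ k / fact (Suc k) = s ^ k / fact k"
   by (simp add: field_simps del: of_nat_Suc)
  finally show ?thesis .
 qed
 have der: "(R has_vector_derivative R' s) (at s)" if "s : {0..1}" for s
 proof -
  have "((%t. h (Suc k) 0 * of_real (t ^ Suc k / fact (Suc k))) has_vector_derivative h (Suc k) 0 * of_real (s ^ k / fact k)) (at s)" for k
   using p[of k s] by (intro has_vector_derivative_mult_right has_vector_derivative_of_real)
    (simp add: has_real_derivative_iff_has_vector_derivative)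
  then have "((%t. h 0 t - (h 0 0 + (\<Sum>k<r. h (Suc k) 0 * of_real (t ^ Suc k / fact (Suc k))))) has_vector_derivative
    (h 1 s - (0 + (\<Sum>k<r. h (Suc k) 0 * of_real (s ^ k / fact k))))) (at s)"
   using Suc.prems(1)[of 0 s] that
   by (intro has_vector_derivative_diff has_vector_derivative_add has_vector_derivative_sum has_vector_derivative_const) auto
  then show ?thesis unfolding R_def[abs_def] R'_def sum.lessThan_Suc_shift by simp
 qed
 have "norm (R t - R 0) <= B * norm (t - 0)"
 proof (rule differentiable_bound[where S = "{0..1}"])
  fix s :: real assume s: "s : {0..1}"
  show "(R has_derivative (%x. x *\<^sub>R R' s)) (at s within {0..1})"
   using der[OF s] unfolding has_vector_derivative_def by (rule has_derivative_at_withinI)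
  show "onorm (%x. x *\<^sub>R R' s) <= B"
   using R'[OF s] by (intro onorm_bound order_trans[OF norm_ge_zero R'[OF s]]) (auto simp: mult.commute[of B] intro: mult_left_mono)
 qed (use Suc.prems in auto)
 moreover have "R 0 = 0" by (simp add: R_def sum.lessThan_Suc_shift)
 moreover have "B * norm (t - 0) <= B"
  using Suc.prems(3) order_trans[OF norm_ge_zero R'[OF Suc.prems(3)]] by (simp add: mult_left_le)
 ultimately show ?case by (simp add: R_def)
qed simp

text \<open>An inequality of Peetre type: a weight at \<open>x\<close> may be moved to
  \<open>x + y\<close> at the price of a weight at \<open>y\<close>.\<close>

lemma one_plus_norm_mult:
 fixes x y :: "'a::real_normed_vector"
 shows "(1 + norm x) ^ j <= (1 + norm (x + y)) ^ j * (1 + norm y) ^ j"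
proof -
 have "norm x <= norm (x + y) + norm y" using norm_triangle_ineq4[of "x + y" y] by simp
 moreover have "(1 + norm (x + y)) * (1 + norm y) = 1 + norm (x + y) + norm y + norm (x + y) * norm y" by (simp add: algebra_simps)
 ultimately have "1 + norm x <= (1 + norm (x + y)) * (1 + norm y)" by (simp add: add_increasing2)
 then show ?thesis by (simp add: power_mult_distrib[symmetric] power_mono)
qed

text \<open>Along the segment from \<open>x\<close> to \<open>x + v\<close> the weight changes by a
  factor of at most \<open>(1 + norm v) ^ j\<close>, so the one-dimensional estimate applies with
  weighted derivatives. The factor \<open>CARD('n) * norm v\<close> bounds the sum of coordinates in
  \<open>dir_deriv_bound\<close>.\<close>

lemma taylor_bound:
 fixes g :: "'n::finite fn"
 assumes "smooth_on UNIV g" "!!is y. length is = r ==> (1 + norm y) ^ j * cmod (ideriv is g y) <= B"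
 shows "(1 + norm x) ^ j * cmod (g (x + v) - (\<Sum>k<r. dir_deriv k v g x / fact k))
  <= (CARD('n) * norm v) ^ r * (1 + norm v) ^ j * B"
proof -
 have B: "B >= 0" using assms(2)[of "replicate r undefined" 0] by (meson length_replicate norm_ge_zero order_trans mult_nonneg_nonneg zero_le_power add_nonneg_nonneg zero_le_one)
 have v1: "(\<Sum>i\<in>UNIV. \<bar>v $ i\<bar>) <= CARD('n) * norm v"
  using sum_mono[of UNIV "%i. \<bar>v $ i\<bar>" "%i. norm v"] component_le_norm_cart[of v] by simp
 have "cmod (dir_deriv r v g (x + t *\<^sub>R v)) <= (CARD('n) * norm v) ^ r * ((1 + norm v) ^ j * B / (1 + norm x) ^ j)"
  if "t : {0..1}" for t
 proof -
  have tv: "norm (t *\<^sub>R v) <= norm v" using that by (simp add: mult_left_le_one_le)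
  have "cmod (dir_deriv r v g (x + t *\<^sub>R v)) <= (\<Sum>i\<in>UNIV. \<bar>v $ i\<bar>) ^ r * ((1 + norm v) ^ j * B / (1 + norm x) ^ j)"
  proof (rule dir_deriv_bound)
   fix "is" :: "'n list" assume l: "length is = r"
   let ?y = "x + t *\<^sub>R v"
   have "(1 + norm x) ^ j * cmod (ideriv is g ?y) <= ((1 + norm ?y) ^ j * (1 + norm (t *\<^sub>R v)) ^ j) * cmod (ideriv is g ?y)"
    by (intro mult_right_mono one_plus_norm_mult) auto
   also have "... = (1 + norm (t *\<^sub>R v)) ^ j * ((1 + norm ?y) ^ j * cmod (ideriv is g ?y))" by (simp only: mult_ac)
   also have "... <= (1 + norm v) ^ j * B"
    using tv by (intro mult_mono power_mono assms(2) l) auto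
   finally have *: "(1 + norm x) ^ j * cmod (ideriv is g ?y) <= (1 + norm v) ^ j * B" .
   have "(1 + norm x) ^ j > 0" by (simp add: add_pos_nonneg)
   with * show "cmod (ideriv is g ?y) <= (1 + norm v) ^ j * B / (1 + norm x) ^ j" 
    by (subst pos_le_divide_eq) (simp_all add: mult.commute)
  qed
  also have "... <= (CARD('n) * norm v) ^ r * ((1 + norm v) ^ j * B / (1 + norm x) ^ j)"
   using B v1 by (intro mult_right_mono power_mono divide_nonneg_nonneg mult_nonneg_nonneg sum_nonneg) auto
  finally show ?thesis .
 qed
 then have "cmod (dir_deriv 0 v g (x + 1 *\<^sub>R v) - (\<Sum>k<r. dir_deriv k v g (x + 0 *\<^sub>R v) * of_real (1 ^ k / fact k)))
  <= (CARD('n) * norm v) ^ r * ((1 + norm v) ^ j * B / (1 + norm x) ^ j)"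
  by (intro taylor_bound_real[of r "%k t. dir_deriv k v g (x + t *\<^sub>R v)"] dir_deriv_line assms(1)) auto
 then have "cmod (g (x + v) - (\<Sum>k<r. dir_deriv k v g x / fact k)) <= ((CARD('n) * norm v) ^ r * (1 + norm v) ^ j * B) / (1 + norm x) ^ j"
  by (simp add: divide_inverse)
 moreover have "(1 + norm x) ^ j > 0" by (simp add: add_pos_nonneg)
 ultimately show ?thesis by (subst (asm) pos_le_divide_eq) (simp_all add: mult.commute)
qed

subsection \<open>Rapidly decreasing functions\<close>

text \<open>The bound \<open>schwartz_seminorm j f <= ennreal B\<close> for smooth functions, in
  real numbers and over lists of directions, see \<open>sbound_iff\<close>.\<close>

definition sbound :: "nat => ('n::finite fn) => real => bool" where
 "sbound j f B \<longleftrightarrow> (ALL is x. length is <= j --> (1 + norm x) ^ j * cmod (ideriv is f x) <= B)"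

lemma one_le_weight: "1 <= (1 + norm x) ^ j"
 by (rule one_le_power) simp

lemma weight_pos: "0 < (1 + norm x) ^ j"
 using one_le_weight[of x j] by linarith

lemma le_weight_mult: "0 <= c ==> c <= (1 + norm x) ^ j * c"
 using mult_right_mono[OF one_le_weight] by fastforce

lemma sboundD: "sbound j f B ==> length is <= j ==> (1 + norm x) ^ j * cmod (ideriv is f x) <= B"
 by (simp add: sbound_def)

lemma sbound_le: "sbound j f B ==> length is <= j ==> cmod (ideriv is f x) <= B"
 using sboundD[of j f B "is" x] le_weight_mult[of "cmod (ideriv is f x)" x j] by simp

lemma sbound_nonneg: "sbound j f B ==> 0 <= B"
 using sbound_le[of j f B "[]" 0] by (simp add: order_trans[OF norm_ge_zero])

lemma sbound_mono: "sbound k f B ==> j <= k ==> B <= C ==> sbound j f C"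
 unfolding sbound_def
proof (intro allI impI)
 fix "is" :: "'a list" and x :: "real^'a"
 assume a: "ALL is x. length is <= k --> (1 + norm x) ^ k * cmod (ideriv is f x) <= B" "j <= k" "B <= C" "length is <= j"
 have "(1 + norm x) ^ j * cmod (ideriv is f x) <= (1 + norm x) ^ k * cmod (ideriv is f x)"
  using a(2) by (intro mult_right_mono power_increasing) auto
 also have "... <= C" using a by (meson order_trans)
 finally show "(1 + norm x) ^ j * cmod (ideriv is f x) <= C" .
qed

lemma sbound_iff: "smooth_on UNIV f ==> 0 <= B ==> sbound j f B \<longleftrightarrow> schwartz_seminorm j f <= ennreal B"
 by (auto simp: sbound_def schwartz_seminorm_le_iff)

lemma ennreal_finiteE:
 assumes "r < (\<infinity>::ennreal)" obtains C where "0 <= C" "r = ennreal C"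
 using assms by (cases r) auto

lemma schwartz_iff: "f:schwartz \<longleftrightarrow> smooth_on UNIV f & (ALL j. EX B. sbound j f B)"
proof
 assume "f:schwartz"
 then have s: "smooth_on UNIV f" "!!j. schwartz_seminorm j f < \<infinity>" by (auto simp: schwartz_def)
 have "EX B. sbound j f B" for j
 proof -
  from s(2)[of j] obtain C where "0 <= C" "schwartz_seminorm j f = ennreal C" by (rule ennreal_finiteE)
  then have "sbound j f C" using sbound_iff[OF s(1)] by simp
  then show ?thesis by blast
 qed
 with s(1) show "smooth_on UNIV f & (ALL j. EX B. sbound j f B)" by blast
next
 assume a: "smooth_on UNIV f & (ALL j. EX B. sbound j f B)"
 have "schwartz_seminorm j f < \<infinity>" for j
 proof -
  obtain B where B: "sbound j f B" using a by blast
  then have "schwartz_seminorm j f <= ennreal B" using sbound_iff[of f B j] sbound_nonneg[OF B] a by simp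
  then show ?thesis by (simp add: order_le_less_trans[OF _ ennreal_less_top])
 qed
 with a show "f:schwartz" by (simp add: schwartz_def)
qed

lemma schwartz_smooth: "f:schwartz ==> smooth_on UNIV f"
 by (simp add: schwartz_iff)

lemma schwartz_sbound: "f:schwartz ==> EX B. sbound j f B"
 by (simp add: schwartz_iff)

lemma schwartz_uniform_bound:
 assumes "f:schwartz"
 shows "EX B>=0. ALL is x. length is <= k --> (1 + norm x) ^ j * cmod (ideriv is f x) <= B"
proof -
 obtain B where B: "sbound (max j k) f B" using schwartz_sbound[OF assms] by blast
 have "(1 + norm x) ^ j * cmod (ideriv is f x) <= B" if "length is <= k" for "is" x
 proof -
  have "(1 + norm x) ^ j * cmod (ideriv is f x) <= (1 + norm x) ^ max j k * cmod (ideriv is f x)"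
   by (intro mult_right_mono power_increasing) auto
  also have "... <= B" using sboundD[OF B, of "is" x] that by auto
  finally show ?thesis .
 qed
 with sbound_nonneg[OF B] show ?thesis by blast
qed

lemma sbound_ideriv: "sbound (j + length js) f B ==> sbound j (ideriv js f) B"
 unfolding sbound_def[of j]
proof (intro allI impI)
 fix "is" :: "'a list" and x :: "real^'a"
 assume a: "sbound (j + length js) f B" "length is <= j"
 have "(1 + norm x) ^ j * cmod (ideriv is (ideriv js f) x) <= (1 + norm x) ^ (j + length js) * cmod (ideriv (is @ js) f x)"
  unfolding ideriv_append by (intro mult_right_mono power_increasing) auto
 also have "... <= B" using a by (intro sboundD) auto
 finally show "(1 + norm x) ^ j * cmod (ideriv is (ideriv js f) x) <= B" .
qed

lemma schwartz_ideriv: "f:schwartz ==> ideriv is f:schwartz"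
 unfolding schwartz_iff[of "ideriv is f"]
 using schwartz_sbound sbound_ideriv by (blast intro: smooth_on_ideriv schwartz_smooth)

lemma schwartz_partial: "f:schwartz ==> pd i f:schwartz"
 using schwartz_ideriv[of f "[i]"] by (simp add: ideriv_Cons)

lemma sbound_add:
 assumes "smooth_on UNIV f" "smooth_on UNIV g" "sbound j f A" "sbound j g B"
 shows "sbound j (%x. f x + g x) (A + B)"
 unfolding sbound_def
proof (intro allI impI)
 fix "is" :: "'a list" and x :: "real^'a" assume l: "length is <= j"
 have "cmod (ideriv is (%x. f x + g x) x) <= cmod (ideriv is f x) + cmod (ideriv is g x)"
  using ideriv_add[OF open_UNIV assms(1,2) UNIV_I] norm_triangle_ineq by simp
 then have "(1 + norm x) ^ j * cmod (ideriv is (%x. f x + g x) x) <= (1 + norm x) ^ j * (cmod (ideriv is f x) + cmod (ideriv is g x))"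
  by (intro mult_left_mono) auto
 also have "... <= A + B" unfolding distrib_left using sboundD[OF assms(3) l] sboundD[OF assms(4) l] by (rule add_mono)
 finally show "(1 + norm x) ^ j * cmod (ideriv is (%x. f x + g x) x) <= A + B" .
qed

lemma sbound_cmult:
 assumes "smooth_on UNIV f" "sbound j f A"
 shows "sbound j (%x. c * f x) (cmod c * A)"
 unfolding sbound_def
proof (intro allI impI)
 fix "is" :: "'a list" and x :: "real^'a" assume l: "length is <= j"
 have "(1 + norm x) ^ j * cmod (ideriv is (%x. c * f x) x) = cmod c * ((1 + norm x) ^ j * cmod (ideriv is f x))"
  using ideriv_cmult[OF open_UNIV assms(1) UNIV_I] by (simp add: norm_mult)
 also have "... <= cmod c * A" by (intro mult_left_mono sboundD[OF assms(2) l]) auto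
 finally show "(1 + norm x) ^ j * cmod (ideriv is (%x. c * f x) x) <= cmod c * A" .
qed

lemma schwartz_add: "f:schwartz ==> g:schwartz ==> (%x. f x + g x) : schwartz"
 unfolding schwartz_iff using sbound_add smooth_on_add[OF open_UNIV] by blast

lemma schwartz_cmult: "f:schwartz ==> (%x. c * f x) : schwartz"
 unfolding schwartz_iff using sbound_cmult smooth_on_cmult[OF open_UNIV] by blast

lemma schwartz_diff: "f:schwartz ==> g:schwartz ==> (%x. f x - g x) : schwartz"
 using schwartz_add[OF _ schwartz_cmult[of g "-1"], of f] by simp

lemma schwartz_zero: "(%_. 0) : schwartz"
 by (auto simp: schwartz_iff sbound_def ideriv_const intro: smooth_on_const)

lemma schwartz_sum: "(!!i. i:I ==> f i:schwartz) ==> (%x. \<Sum>i\<in>I. f i x) : schwartz"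
 by (induction I rule: infinite_finite_induct) (auto intro: schwartz_add schwartz_zero)

text \<open>The cases \<open>c = 1\<close> and \<open>c = -1\<close> are translations and point
  reflections. They preserve the norm up to the shift \<open>a\<close>, which costs one weight at
  \<open>a\<close>.\<close>

lemma sbound_isometry:
 assumes "smooth_on UNIV f" "sbound j f B" "\<bar>c\<bar> = 1"
 shows "sbound j (%y. f (a + c *\<^sub>R y)) ((1 + norm a) ^ j * B)"
 unfolding sbound_def
proof (intro allI impI)
 fix "is" :: "'a list" and x :: "real^'a" assume l: "length is <= j"
 have n: "norm (c *\<^sub>R x) = norm x" using assms(3) by simp
 have "(1 + norm x) ^ j <= (1 + norm (c *\<^sub>R x + a)) ^ j * (1 + norm a) ^ j"
  using one_plus_norm_mult[of "c *\<^sub>R x" j a] unfolding n .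
 then have "(1 + norm x) ^ j * cmod (ideriv is (%y. f (a + c *\<^sub>R y)) x) <=
   ((1 + norm (c *\<^sub>R x + a)) ^ j * (1 + norm a) ^ j) * cmod (ideriv is f (a + c *\<^sub>R x))"
  unfolding ideriv_affine_UNIV[OF assms(1)] by (simp add: norm_mult norm_power assms(3) mult_right_mono)
 also have "... = (1 + norm a) ^ j * ((1 + norm (a + c *\<^sub>R x)) ^ j * cmod (ideriv is f (a + c *\<^sub>R x)))"
  by (simp add: mult_ac add.commute)
 also have "... <= (1 + norm a) ^ j * B" by (intro mult_left_mono sboundD[OF assms(2) l]) auto
 finally show "(1 + norm x) ^ j * cmod (ideriv is (%y. f (a + c *\<^sub>R y)) x) <= (1 + norm a) ^ j * B" .
qed

lemma schwartz_isometry: "f:schwartz ==> \<bar>c\<bar> = 1 ==> (%y. f (a + c *\<^sub>R y)) : schwartz"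
 unfolding schwartz_iff using sbound_isometry smooth_on_affine_UNIV by blast

lemma schwartz_translate: "f:schwartz ==> (%y. f (y + a)) : schwartz"
 using schwartz_isometry[of f 1 a] by (simp add: add.commute)

lemma schwartz_reflect: "f:schwartz ==> (%y. f (x - y)) : schwartz"
 using schwartz_isometry[of f "-1" x] by simp

lemma sbound_scale:
 assumes "smooth_on UNIV f" "sbound j f B" "1 <= c"
 shows "sbound j (%y. f (c *\<^sub>R y)) (c ^ j * B)"
 unfolding sbound_def
proof (intro allI impI)
 fix "is" :: "'a list" and x :: "real^'a" assume l: "length is <= j"
 have "norm x <= norm (c *\<^sub>R x)" using assms(3) by (simp add: mult_le_cancel_right1)
 then have "(1 + norm x) ^ j * cmod (ideriv is f (0 + c *\<^sub>R x)) <= (1 + norm (c *\<^sub>R x)) ^ j * cmod (ideriv is f (c *\<^sub>R x))"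
  by (intro mult_mono power_mono) auto
 also have "... <= B" by (rule sboundD[OF assms(2) l])
 finally have "c ^ length is * ((1 + norm x) ^ j * cmod (ideriv is f (0 + c *\<^sub>R x))) <= c ^ j * B"
  using assms(3) l sbound_nonneg[OF assms(2)] by (intro mult_mono power_increasing) auto
 then show "(1 + norm x) ^ j * cmod (ideriv is (%y. f (c *\<^sub>R y)) x) <= c ^ j * B"
  using ideriv_affine_UNIV[OF assms(1), of "is" 0 c x] assms(3) by (simp add: norm_mult norm_power mult_ac)
qed

lemma schwartz_scale: "f:schwartz ==> 1 <= c ==> (%y. f (c *\<^sub>R y)) : schwartz"
 unfolding schwartz_iff using sbound_scale smooth_on_affine_UNIV[of f 0] by fastforce

lemma ideriv_outside:
 assumes "closed K" "!!x. x ~: K ==> f x = 0" "x ~: K"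
 shows "ideriv is f x = 0"
proof -
 have "ideriv is f x = ideriv is (%_. 0) x"
  by (rule ideriv_cong[of "- K"]) (use assms in auto)
 then show ?thesis by (simp add: ideriv_const)
qed

lemma sbound_compact_support:
 assumes "closed K" "!!x. x ~: K ==> f x = 0" "!!x. x:K ==> norm x <= R" "0 <= R" "0 <= B"
  and "!!is x. length is <= j ==> x:K ==> cmod (ideriv is f x) <= B"
 shows "sbound j f ((1 + R) ^ j * B)"
 unfolding sbound_def
proof (intro allI impI)
 fix "is" :: "'a list" and x :: "real^'a" assume l: "length is <= j"
 show "(1 + norm x) ^ j * cmod (ideriv is f x) <= (1 + R) ^ j * B"
 proof (cases "x:K")
  case True
  then show ?thesis using assms l by (intro mult_mono power_mono add_left_mono) auto
 next
  case False
  then show ?thesis using ideriv_outside[OF assms(1,2) False] assms(4,5) by simp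
 qed
qed

lemma ideriv_bounded_compact:
 assumes "smooth_on S f" "compact K" "K <= S"
 shows "EX B>=0. ALL is x. length is <= j --> x:K --> cmod (ideriv is f x) <= B"
proof -
 have "EX B>=0. ALL x:K. cmod (ideriv is f x) <= B" for "is"
 proof -
  have "continuous_on K (ideriv is f)"
   using smooth_on_cont[OF smooth_on_ideriv[OF assms(1)]] assms(3) continuous_on_subset by blast
  then have "bounded (ideriv is f ` K)" using compact_continuous_image assms(2) compact_imp_bounded by blast
  then obtain B where "ALL x:K. cmod (ideriv is f x) <= B" unfolding bounded_iff by auto
  then show ?thesis by (intro exI[of _ "max B 0"]) (simp add: le_max_iff_disj)
 qed
 then obtain b where b: "!!is. b is >= 0" "!!is x. x:K ==> cmod (ideriv is f x) <= b is" by metis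
 have fin: "finite {is :: 'a list. length is <= j}" using finite_lists_length_le[of "UNIV :: 'a set" j] by simp
 have "cmod (ideriv is f x) <= (\<Sum>is\<in>{is. length is <= j}. b is)" if "length is <= j" "x:K" for "is" x
  using b(2)[OF that(2), of "is"] member_le_sum[of "is" "{is. length is <= j}" b] b(1) fin that(1) by force
 then show ?thesis using b(1) by (intro exI[of _ "\<Sum>is\<in>{is. length is <= j}. b is"]) (auto intro: sum_nonneg)
qed

section \<open>Test functions\<close>

lemma test_smooth: "f:test X ==> smooth_on UNIV f"
 by (simp add: test_functions_def)

lemma testE:
 assumes "f:test X"
 obtains K where "compact K" "K <= X" "!!x. x ~: K ==> f x = 0"
 using assms by (auto simp: test_functions_def)

lemma test_schwartz:
 assumes "f:test X"
 shows "f:schwartz"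
proof -
 obtain K where K: "compact K" "K <= X" "!!x. x ~: K ==> f x = 0" using testE[OF assms] by metis
 obtain R where R: "!!x. x:K ==> norm x <= R" using compact_imp_bounded[OF K(1)] unfolding bounded_iff by blast
 have sm: "smooth_on UNIV f" by (rule test_smooth[OF assms])
 have "EX B. sbound j f B" for j
 proof -
  obtain B where "B >= 0" "!!is x. length is <= j ==> x:K ==> cmod (ideriv is f x) <= B"
   using ideriv_bounded_compact[OF sm K(1) subset_UNIV, of j] by blast
  then have "sbound j f ((1 + \<bar>R\<bar>) ^ j * B)"
   by (intro sbound_compact_support[OF compact_imp_closed[OF K(1)] K(3)]) (use R in force)+
  then show ?thesis by blast
 qed
 with sm show ?thesis by (simp add: schwartz_iff)
qed

text \<open>\<open>X\<close> and the complement of \<open>K\<close> are open, cover the space, and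
  \<open>f\<close> is smooth on each of them.\<close>

lemma smooth_extend_zero:
 assumes "open X" "smooth_on X f" "closed K" "K <= X" "!!x. x ~: K ==> f x = 0"
 shows "smooth_on UNIV f"
proof (rule smooth_on_local)
 fix x
 show "EX T. open T & x:T & T <= UNIV & smooth_on T f"
 proof (cases "x:K")
  case False
  have "smooth_on (- K) f"
   by (rule smooth_on_cong[of _ "%_. 0"]) (use assms in \<open>auto intro: smooth_on_const\<close>)
  then show ?thesis using False assms(3) by (intro exI[of _ "- K"]) auto
 qed (use assms in auto)
qed auto

lemma test_mult:
 assumes "open X" "\<psi>:test X" "smooth_on X f"
 shows "(%x. \<psi> x * f x) : test X"
proof -
 obtain K where K: "compact K" "K <= X" "!!x. x ~: K ==> \<psi> x = 0" using testE[OF assms(2)] by metis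
 have "smooth_on X (%x. \<psi> x * f x)"
  using assms smooth_on_subset[OF test_smooth[OF assms(2)]] by (intro smooth_on_mult) auto
 then have "smooth_on UNIV (%x. \<psi> x * f x)"
  by (rule smooth_extend_zero[OF assms(1) _ compact_imp_closed[OF K(1)] K(2)]) (simp add: K(3))
 then show ?thesis using K unfolding test_functions_def by auto
qed

subsection \<open>Integrability\<close>

lemma nn_integral_inverse_quadratic: "(\<integral>\<^sup>+t. ennreal (1 / (1 + t\<^sup>2)) \<partial>lborel) < \<infinity>"
proof -
 let ?f = "%t::real. 1 / (1 + t\<^sup>2)"
 have half: "(\<integral>\<^sup>+t. ennreal (?f t) * indicator {0..} t \<partial>lborel) = ennreal (pi / 2 - arctan 0)"
 proof (rule nn_integral_FTC_atLeast)
  show "(arctan has_real_derivative ?f t) (at t)" for t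
   using DERIV_arctan[of t] by (simp add: inverse_eq_divide)
 qed (auto intro: tendsto_arctan_at_top)
 have "(\<integral>\<^sup>+t. ennreal (?f t) * indicator {0..} t \<partial>lborel) = ennreal \<bar>- 1\<bar> * (\<integral>\<^sup>+t. ennreal (?f (0 + (- 1) * t)) * indicator {0..} (0 + (- 1) * t) \<partial>lborel)"
  by (rule nn_integral_real_affine) auto
 then have half': "(\<integral>\<^sup>+t. ennreal (?f t) * indicator {..0} t \<partial>lborel) = ennreal (pi / 2 - arctan 0)"
  unfolding half by (simp add: indicator_def)
 have "(\<integral>\<^sup>+t. ennreal (?f t) \<partial>lborel) <= (\<integral>\<^sup>+t. (ennreal (?f t) * indicator {0..} t + ennreal (?f t) * indicator {..0} t) \<partial>lborel)"
  by (intro nn_integral_mono) (auto simp: indicator_def)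
 also have "... = (\<integral>\<^sup>+t. ennreal (?f t) * indicator {0..} t \<partial>lborel) + (\<integral>\<^sup>+t. ennreal (?f t) * indicator {..0} t \<partial>lborel)"
  by (rule nn_integral_add) auto
 also have "... < \<infinity>" unfolding half half' by simp
 finally show ?thesis .
qed

text \<open>The square of \<open>1 + norm x\<close> dominates 1 plus the square of every coordinate.
  The weight is therefore at most a product of one-dimensional functions
  \<open>1 / (1 + t^2)\<close>, whose integrals are finite by the arctangent.\<close>

lemma integrable_weight: "integrable lborel (%x::real^'n::finite. 1 / (1 + norm x) ^ (2 * CARD('n)))"
proof (rule integrableI_bounded)
 have "integral\<^sup>N lborel (%x::real^'n. ennreal (norm (1 / (1 + norm x) ^ (2 * CARD('n)))))
   <= integral\<^sup>N lborel (%x::real^'n. \<Prod>b\<in>Basis. ennreal (1 / (1 + (x \<bullet> b)\<^sup>2)))"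
 proof (rule nn_integral_mono)
  fix x :: "real^'n"
  have "1 + (x \<bullet> b)\<^sup>2 <= (1 + norm x)\<^sup>2" if "b:Basis" for b
  proof -
   have "\<bar>x \<bullet> b\<bar>\<^sup>2 <= (norm x)\<^sup>2" using Basis_le_norm[OF that] by (intro power_mono) auto
   moreover have "(1 + norm x)\<^sup>2 = 1 + 2 * norm x + (norm x)\<^sup>2" by (simp add: power2_sum)
   ultimately show ?thesis using norm_ge_zero[of x] by (simp del: norm_ge_zero)
  qed
  then have "(\<Prod>b\<in>(Basis :: (real^'n) set). 1 + (x \<bullet> b)\<^sup>2) <= (\<Prod>b\<in>(Basis :: (real^'n) set). (1 + norm x)\<^sup>2)"
   by (intro prod_mono) auto
  also have "... = (1 + norm x) ^ (2 * CARD('n))" by (simp add: power_mult)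
  finally have "1 / (1 + norm x) ^ (2 * CARD('n)) <= 1 / (\<Prod>b\<in>(Basis :: (real^'n) set). 1 + (x \<bullet> b)\<^sup>2)"
   by (intro divide_left_mono mult_pos_pos prod_pos weight_pos) (auto simp: add_pos_nonneg)
  also have "... = (\<Prod>b\<in>(Basis :: (real^'n) set). 1 / (1 + (x \<bullet> b)\<^sup>2))" by (simp add: prod_dividef)
  finally show "ennreal (norm (1 / (1 + norm x) ^ (2 * CARD('n)))) <= (\<Prod>b\<in>Basis. ennreal (1 / (1 + (x \<bullet> b)\<^sup>2)))"
   by (subst prod_ennreal) (auto intro!: ennreal_leI simp: weight_pos less_imp_le)
 qed
 also have "... = (\<Prod>b\<in>(Basis :: (real^'n) set). \<integral>\<^sup>+t. ennreal (1 / (1 + t\<^sup>2)) \<partial>lborel)"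
  by (rule nn_integral_lborel_prod) auto
 also have "... < \<infinity>" using nn_integral_inverse_quadratic by (simp add: power_less_top_ennreal)
 finally show "integral\<^sup>N lborel (%x::real^'n. ennreal (norm (1 / (1 + norm x) ^ (2 * CARD('n))))) < \<infinity>" .
qed auto

text \<open>Decay in the integrated sense is what a kernel has to provide in a correlation:
  derivatives can all be put on the other factor.\<close>

definition rapid :: "('n::finite fn) => bool" where
 "rapid h \<longleftrightarrow> h:borel_measurable borel & (ALL j. integrable lborel (%y. (1 + norm y) ^ j * cmod (h y)))"

lemma smooth_measurable: "smooth_on UNIV f ==> f:borel_measurable borel"
 using smooth_on_cont borel_measurable_continuous_onI by blast

lemma rapidI:
 assumes "h:borel_measurable borel" "!!j. EX B. ALL x. (1 + norm x) ^ j * cmod (h x) <= B"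
 shows "rapid h"
 unfolding rapid_def
proof (intro conjI allI assms(1))
 fix j
 obtain B where B: "!!x. (1 + norm x) ^ (j + 2 * CARD('a)) * cmod (h x) <= B" using assms(2) by blast
 have "integrable lborel (%x::real^'a. B * (1 / (1 + norm x) ^ (2 * CARD('a))))"
  using integrable_weight by (rule integrable_mult_right)
 then show "integrable lborel (%y. (1 + norm y) ^ j * cmod (h y))"
 proof (rule Bochner_Integration.integrable_bound)
  show "(%y. (1 + norm y) ^ j * cmod (h y)) : borel_measurable lborel" using assms(1) by simp
  show "AE x in lborel. norm ((1 + norm x) ^ j * cmod (h x)) <= norm (B * (1 / (1 + norm x) ^ (2 * CARD('a))))"
  proof (rule AE_I2)
   fix x :: "real^'a"
   have "((1 + norm x) ^ j * cmod (h x)) * (1 + norm x) ^ (2 * CARD('a)) <= B"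
    using B[of x] by (simp add: power_add mult_ac)
   then have "(1 + norm x) ^ j * cmod (h x) <= B / (1 + norm x) ^ (2 * CARD('a))"
    by (subst pos_le_divide_eq[OF weight_pos])
   moreover have "0 <= B" using B[of 0] by (meson mult_nonneg_nonneg norm_ge_zero order_trans less_imp_le weight_pos)
   ultimately show "norm ((1 + norm x) ^ j * cmod (h x)) <= norm (B * (1 / (1 + norm x) ^ (2 * CARD('a))))"
    by (simp add: abs_mult)
  qed
 qed
qed

lemma schwartz_rapid:
 assumes "f:schwartz" shows "rapid f"
proof (rule rapidI)
 show "f:borel_measurable borel" by (rule smooth_measurable[OF schwartz_smooth[OF assms]])
 fix j
 obtain B where "sbound j f B" using schwartz_sbound[OF assms] by blast
 then show "EX B. ALL x. (1 + norm x) ^ j * cmod (f x) <= B"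
  using sboundD[of j f B "[]"] by auto
qed

lemma rapid_mult_integrable:
 assumes "rapid h" "f:borel_measurable borel" "!!x. cmod (f x) <= C * (1 + norm x) ^ j"
 shows "integrable lborel (%y. f y * h y)"
proof -
 have "integrable lborel (%y. C * ((1 + norm y) ^ j * cmod (h y)))"
  using assms(1) unfolding rapid_def by (intro integrable_mult_right) auto
 then show ?thesis
 proof (rule Bochner_Integration.integrable_bound)
  show "(%y. f y * h y) : borel_measurable lborel" using assms(1,2) by (auto simp: rapid_def)
  show "AE x in lborel. norm (f x * h x) <= norm (C * ((1 + norm x) ^ j * cmod (h x)))"
  proof (rule AE_I2)
   fix x
   have "norm (f x * h x) <= (C * (1 + norm x) ^ j) * cmod (h x)"
    unfolding norm_mult by (intro mult_right_mono assms(3)) auto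
   then show "norm (f x * h x) <= norm (C * ((1 + norm x) ^ j * cmod (h x)))" by (simp add: mult.assoc)
  qed
 qed
qed

subsection \<open>Correlations\<close>

lemma taylor1:
 fixes g :: "'n::finite fn"
 assumes "smooth_on UNIV g" "!!i y. (1 + norm y) ^ j * cmod (pd i g y) <= B"
 shows "(1 + norm x) ^ j * cmod (g (x + v) - g x) <= (CARD('n) * norm v) * (1 + norm v) ^ j * B"
proof -
 have "(1 + norm y) ^ j * cmod (ideriv is g y) <= B" if "length is = 1" for "is" y
  using that assms(2) by (auto simp: length_Suc_conv ideriv_Cons)
 from taylor_bound[OF assms(1), where r = 1, OF this] show ?thesis by simp
qed

lemma taylor2_axis:
 fixes g :: "'n::finite fn" and t B :: real
 assumes "smooth_on UNIV g" "!!is y. length is = 2 ==> (1 + norm y) ^ j * cmod (ideriv is g y) <= B"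
 shows "(1 + norm x) ^ j * cmod (g (x + t *\<^sub>R axis i 1) - g x - of_real t * pd i g x)
   <= (CARD('n) * \<bar>t\<bar>)\<^sup>2 * (1 + \<bar>t\<bar>) ^ j * B"
proof -
 have "(\<Sum>l\<in>UNIV. of_real ((t *\<^sub>R axis i 1 :: real^'n) $ l) * pd l g x) = (\<Sum>l\<in>UNIV. if i = l then of_real t * pd l g x else 0)"
  by (intro sum.cong) (auto simp: axis_def)
 also have "... = of_real t * pd i g x" by simp
 finally have d1: "dir_deriv 1 (t *\<^sub>R axis i 1) g x = of_real t * pd i g x" by simp
 have eq: "(\<Sum>k<2. dir_deriv k (t *\<^sub>R axis i 1) g x / fact k) = g x + of_real t * pd i g x"
  using d1 by (simp add: numeral_2_eq_2)
 show ?thesis using taylor_bound[OF assms(1), where r = 2, OF assms(2), where x = x and v = "t *\<^sub>R axis i 1"] unfolding eq by (simp add: diff_diff_add)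
qed

text \<open>A quadratic remainder determines the derivative. This reduces differentiation under an
  integral, and inside a distribution, to a second order Taylor estimate.\<close>

lemma has_partial_quadratic:
 assumes "!!t. \<bar>t\<bar> <= 1 ==> cmod (f (x + t *\<^sub>R axis i 1) - f x - of_real t * D) <= C * t\<^sup>2"
 shows "has_partial i f D x"
 unfolding has_partial_def has_vector_derivative_def has_derivative_at_alt
proof (intro conjI allI impI)
 show "bounded_linear (%t. t *\<^sub>R D)" by (rule bounded_linear_scaleR_left)
 fix e :: real assume e: "e > 0"
 show "EX d>0. ALL y. norm (y - 0) < d -->
   norm (f (x + y *\<^sub>R axis i 1) - f (x + 0 *\<^sub>R axis i 1) - (y - 0) *\<^sub>R D) <= e * norm (y - 0)"
 proof (intro exI[of _ "min 1 (e / (1 + \<bar>C\<bar>))"] conjI allI impI)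
  show "0 < min 1 (e / (1 + \<bar>C\<bar>))" using e by simp
  fix t :: real assume t: "norm (t - 0) < min 1 (e / (1 + \<bar>C\<bar>))"
  then have "\<bar>t\<bar> * (1 + \<bar>C\<bar>) <= e" by (simp add: pos_less_divide_eq)
  then have "\<bar>C\<bar> * \<bar>t\<bar> <= e" by (simp add: algebra_simps)
  then have "(\<bar>C\<bar> * \<bar>t\<bar>) * \<bar>t\<bar> <= e * \<bar>t\<bar>" by (rule mult_right_mono) simp
  moreover have "C * t\<^sup>2 <= (\<bar>C\<bar> * \<bar>t\<bar>) * \<bar>t\<bar>"
   by (simp add: power2_eq_square mult.assoc mult_right_mono)
  moreover have "cmod (f (x + t *\<^sub>R axis i 1) - f x - of_real t * D) <= C * t\<^sup>2" using t by (intro assms) simp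
  ultimately show "norm (f (x + t *\<^sub>R axis i 1) - f (x + 0 *\<^sub>R axis i 1) - (t - 0) *\<^sub>R D) <= e * norm (t - 0)"
   by (simp add: scaleR_conv_of_real)
 qed
qed

lemma cont_lipschitz_ball:
 fixes f :: "'a::real_normed_vector => 'b::real_normed_vector"
 assumes "!!x. EX L. ALL v. norm v <= 1 --> norm (f (x + v) - f x) <= L * norm v"
 shows "continuous_on UNIV f"
proof (rule continuous_at_imp_continuous_on, rule ballI)
 fix x
 obtain L where L: "!!v. norm v <= 1 ==> norm (f (x + v) - f x) <= L * norm v" using assms by blast
 have "((%y. f y - f x) \<longlongrightarrow> 0) (at x)"
 proof (rule Lim_null_comparison)
  have "\<forall>\<^sub>F y in at x. dist y x < 1" by (auto simp: eventually_at intro!: exI[of _ 1])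
  then show "\<forall>\<^sub>F y in at x. norm (f y - f x) <= L * norm (y - x)"
   by eventually_elim (use L[of "y - x" for y] in \<open>auto simp: dist_norm\<close>)
  have "((%y. L * norm (y - x)) \<longlongrightarrow> L * norm (x - x)) (at x)" by (intro tendsto_intros)
  then show "((%y. L * norm (y - x)) \<longlongrightarrow> 0) (at x)" by simp
 qed
 then show "isCont f x" unfolding isCont_def using Lim_null by blast
qed

text \<open>The convolution of \<open>k\<close> with the reflection of \<open>h\<close>. The sign is
  chosen so that correlation with a kernel is the transpose of convolution with it, see
  \<open>dist_conv_pairing\<close>.\<close>

definition correlate :: "('n::finite fn) => ('n fn) => 'n fn" where
 "correlate k h z = (LINT y|lborel. k (z + y) * h y)"

definition weighted_norm :: "nat => ('n::finite fn) => real" where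
 "weighted_norm j h = (LINT y|lborel. (1 + norm y) ^ j * cmod (h y))"

lemma weighted_norm_nonneg: "0 <= weighted_norm j h"
 unfolding weighted_norm_def by (intro integral_nonneg_AE AE_I2 mult_nonneg_nonneg less_imp_le[OF weight_pos]) auto

lemma rapid_integrable: "rapid h ==> integrable lborel (%y. (1 + norm y) ^ j * cmod (h y))"
 by (simp add: rapid_def)

lemma integral_rapid_bound:
 fixes F :: "'n::finite fn"
 assumes "rapid h" "F:borel_measurable borel" "!!y. c * cmod (F y) <= C * (1 + norm y) ^ j" "0 < c"
 shows "c * cmod (LINT y|lborel. F y * h y) <= C * weighted_norm j h"
proof -
 have F: "cmod (F y) <= (C / c) * (1 + norm y) ^ j" for y
  using assms(3)[of y] assms(4) by (simp add: field_simps)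
 have "cmod (LINT y|lborel. F y * h y) <= (LINT y|lborel. (C / c) * ((1 + norm y) ^ j * cmod (h y)))"
 proof (rule Bochner_Integration.integral_norm_bound_integral)
  show "integrable lborel (%y. F y * h y)" by (rule rapid_mult_integrable[OF assms(1,2) F])
  show "integrable lborel (%y. (C / c) * ((1 + norm y) ^ j * cmod (h y)))"
   by (intro integrable_mult_right rapid_integrable assms(1))
  show "norm (F y * h y) <= (C / c) * ((1 + norm y) ^ j * cmod (h y))" for y
   using mult_right_mono[OF F[of y], of "cmod (h y)"] by (simp add: norm_mult mult.assoc)
 qed
 also have "... = (C / c) * weighted_norm j h" unfolding weighted_norm_def by (rule integral_mult_right_zero)
 finally show ?thesis using assms(4) by (simp add: field_simps)
qed

lemma schwartz_meas_shift: "k:schwartz ==> (%y. k (z + y)) : borel_measurable borel"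
 using smooth_measurable[OF schwartz_smooth[OF schwartz_translate[of k z]]] by (simp add: add.commute)

lemma weight_translate:
 assumes "!!x. (1 + norm x) ^ j * cmod (k x) <= B"
 shows "(1 + norm z) ^ j * cmod (k (z + y)) <= B * (1 + norm y) ^ j"
proof -
 have "(1 + norm z) ^ j * cmod (k (z + y)) <= ((1 + norm (z + y)) ^ j * (1 + norm y) ^ j) * cmod (k (z + y))"
  by (intro mult_right_mono one_plus_norm_mult) auto
 also have "... <= B * (1 + norm y) ^ j"
  using mult_right_mono[OF assms[of "z + y"], of "(1 + norm y) ^ j"] by (simp add: mult_ac)
 finally show ?thesis .
qed

lemma correlate_bound:
 assumes "k:schwartz" "rapid h" "!!x. (1 + norm x) ^ j * cmod (k x) <= B"
 shows "(1 + norm z) ^ j * cmod (correlate k h z) <= B * weighted_norm j h"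
 unfolding correlate_def
 by (rule integral_rapid_bound[OF assms(2) schwartz_meas_shift[OF assms(1)] weight_translate[OF assms(3)] weight_pos])

lemma correlate_integrable:
 assumes "k:schwartz" "rapid h" shows "integrable lborel (%y. k (z + y) * h y)"
proof -
 obtain B where "B >= 0" "!!x. cmod (k x) <= B"
  using schwartz_uniform_bound[OF assms(1), of 0 0] by auto
 then show ?thesis
  by (intro rapid_mult_integrable[OF assms(2) schwartz_meas_shift[OF assms(1)], of _ B 0]) auto
qed

lemma correlate_has_partial:
 fixes k :: "'n::finite fn"
 assumes "k:schwartz" "rapid h"
 shows "has_partial i (correlate k h) (correlate (pd i k) h z) z"
proof -
 obtain B where B: "B >= 0" "!!is x. length is <= 2 ==> (1 + norm x) ^ 0 * cmod (ideriv is k x) <= B"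
  using schwartz_uniform_bound[OF assms(1), of 2 0] by blast
 let ?e = "axis i (1::real)"
 show ?thesis
 proof (rule has_partial_quadratic[where C = "(CARD('n))\<^sup>2 * B * weighted_norm 0 h"])
  fix t :: real
  let ?F = "%y. k (z + t *\<^sub>R ?e + y) - k (z + y) - of_real t * pd i k (z + y)"
  have "correlate k h (z + t *\<^sub>R ?e) - correlate k h z - of_real t * correlate (pd i k) h z
    = (LINT y|lborel. k (z + t *\<^sub>R ?e + y) * h y) - (LINT y|lborel. k (z + y) * h y) - (LINT y|lborel. of_real t * (pd i k (z + y) * h y))"
   unfolding correlate_def by simp
  also have "... = (LINT y|lborel. k (z + t *\<^sub>R ?e + y) * h y - k (z + y) * h y - of_real t * (pd i k (z + y) * h y))"
   by (subst Bochner_Integration.integral_diff | intro Bochner_Integration.integrable_diff integrable_mult_right correlate_integrable schwartz_partial assms | simp)+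
  also have "... = (LINT y|lborel. ?F y * h y)" by (simp add: algebra_simps)
  finally have eq: "correlate k h (z + t *\<^sub>R ?e) - correlate k h z - of_real t * correlate (pd i k) h z = ..." .
  have "1 * cmod (LINT y|lborel. ?F y * h y) <= ((CARD('n))\<^sup>2 * t\<^sup>2 * B) * weighted_norm 0 h"
  proof (rule integral_rapid_bound[OF assms(2)])
   show "?F:borel_measurable borel"
    by (intro borel_measurable_diff borel_measurable_times borel_measurable_const schwartz_meas_shift schwartz_partial assms)
   show "1 * cmod (?F y) <= ((CARD('n))\<^sup>2 * t\<^sup>2 * B) * (1 + norm y) ^ 0" for y
    using taylor2_axis[OF schwartz_smooth[OF assms(1)] B(2), of "z + y" t i] by (simp add: add_ac power_mult_distrib)
  qed simp
  then show "cmod (correlate k h (z + t *\<^sub>R ?e) - correlate k h z - of_real t * correlate (pd i k) h z)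
    <= (CARD('n))\<^sup>2 * B * weighted_norm 0 h * t\<^sup>2" unfolding eq by (simp add: mult_ac)
 qed
qed

lemma correlate_cont:
 fixes k :: "'n::finite fn"
 assumes "k:schwartz" "rapid h"
 shows "continuous_on UNIV (correlate k h)"
proof (rule cont_lipschitz_ball)
 fix z
 obtain B where B: "B >= 0" "!!is x. length is <= 1 ==> (1 + norm x) ^ 0 * cmod (ideriv is k x) <= B"
  using schwartz_uniform_bound[OF assms(1), of 1 0] by blast
 have B': "(1 + norm x) ^ 0 * cmod (pd i k x) <= B" for i x
  using B(2)[of "[i]" x] by (simp add: ideriv_Cons)
 have "cmod (correlate k h (z + v) - correlate k h z) <= (CARD('n) * B * weighted_norm 0 h) * norm v" for v
 proof -
  have eq: "correlate k h (z + v) - correlate k h z = (LINT y|lborel. (k (z + v + y) - k (z + y)) * h y)"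
   unfolding correlate_def left_diff_distrib
   by (rule Bochner_Integration.integral_diff[symmetric]) (intro correlate_integrable assms)+
  have "1 * cmod (LINT y|lborel. (k (z + v + y) - k (z + y)) * h y) <= (CARD('n) * norm v * B) * weighted_norm 0 h"
  proof (rule integral_rapid_bound[OF assms(2)])
   show "(%y. k (z + v + y) - k (z + y)) : borel_measurable borel"
    by (intro borel_measurable_diff schwartz_meas_shift assms)
   show "1 * cmod (k (z + v + y) - k (z + y)) <= (CARD('n) * norm v * B) * (1 + norm y) ^ 0" for y
    using taylor1[OF schwartz_smooth[OF assms(1)] B', of "z + y" v] by (simp add: add_ac)
  qed simp
  then show ?thesis unfolding eq by (simp add: mult_ac)
 qed
 then show "EX L. ALL v. norm v <= 1 --> norm (correlate k h (z + v) - correlate k h z) <= L * norm v" by blast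
qed

lemma correlate_smooth:
 assumes "k:schwartz" "rapid h" shows "smooth_on UNIV (correlate k h)"
proof -
 have "Ck_on m UNIV (correlate k h)" for m
  using assms(1)
 proof (induction m arbitrary: k)
  case 0
  then show ?case using correlate_cont[OF _ assms(2)] by simp
 next
  case (Suc m)
  show ?case
   by (rule Ck_on_SucI[where f' = "%i. correlate (pd i k) h"])
    (use Suc assms(2) in \<open>auto intro: correlate_has_partial correlate_cont schwartz_partial\<close>)
 qed
 then show ?thesis by (simp add: smooth_on_def)
qed

lemma ideriv_correlate:
 assumes "k:schwartz" "rapid h" shows "ideriv is (correlate k h) = correlate (ideriv is k) h"
proof (induction "is")
 case (Cons i "is")
 have "ideriv (i # is) (correlate k h) z = correlate (ideriv (i # is) k) h z" for z
  unfolding ideriv_Cons Cons by (intro has_partialD correlate_has_partial schwartz_ideriv assms)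
 then show ?case by blast
qed simp

lemma sbound_correlate:
 assumes "k:schwartz" "rapid h" "sbound j k B"
 shows "sbound j (correlate k h) (B * weighted_norm j h)"
 unfolding sbound_def ideriv_correlate[OF assms(1,2)]
 by (intro allI impI correlate_bound schwartz_ideriv assms sboundD)

lemma correlate_schwartz: "k:schwartz ==> rapid h ==> correlate k h:schwartz"
 unfolding schwartz_iff[of "correlate k h"] using schwartz_sbound sbound_correlate correlate_smooth by blast

subsection \<open>Tempered distributions\<close>

text \<open>Continuity of \<open>w\<close> with respect to one Schwartz seminorm, in the real-valued
  form that matches \<open>sbound\<close>.\<close>

definition tbound :: "(('n::finite fn) => complex) => real => nat => bool" where
 "tbound w C j \<longleftrightarrow> 0 <= C & (ALL f:schwartz. ALL B. sbound j f B --> cmod (w f) <= C * B)"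

lemma tempered_iff: "w:tempered \<longleftrightarrow> linear_on schwartz w & (EX C j. tbound w C j)"
proof
 assume "w:tempered"
 then obtain C :: real and j where *: "linear_on schwartz w" "!!f. f:schwartz ==> ennreal (cmod (w f)) <= ennreal C * schwartz_seminorm j f"
  by (auto simp: tempered_distributions_def)
 have "cmod (w f) <= max C 0 * B" if "f:schwartz" "sbound j f B" for f B
 proof -
  have B: "B >= 0" using sbound_nonneg[OF that(2)] .
  have "ennreal (cmod (w f)) <= ennreal C * schwartz_seminorm j f" by (rule *(2)[OF that(1)])
  also have "... <= ennreal (max C 0) * ennreal B"
   using that sbound_iff[OF schwartz_smooth[OF that(1)] B] by (intro mult_mono ennreal_leI) auto
  also have "... = ennreal (max C 0 * B)" using B by (simp add: ennreal_mult)
  finally show ?thesis using B by (subst (asm) ennreal_le_iff) auto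
 qed
 then have "tbound w (max C 0) j" by (simp add: tbound_def)
 with *(1) show "linear_on schwartz w & (EX C j. tbound w C j)" by blast
next
 assume "linear_on schwartz w & (EX C j. tbound w C j)"
 then obtain C j where l: "linear_on schwartz w" and t: "tbound w C j" by blast
 have "ennreal (cmod (w f)) <= ennreal C * schwartz_seminorm j f" if f: "f:schwartz" for f
 proof -
  have "schwartz_seminorm j f < \<infinity>" using f by (simp add: schwartz_def)
  then obtain B where B: "0 <= B" "schwartz_seminorm j f = ennreal B" by (rule ennreal_finiteE)
  then have "sbound j f B" using sbound_iff[OF schwartz_smooth[OF f]] by simp
  then have "cmod (w f) <= C * B" "0 <= C" using t f by (auto simp: tbound_def)
  then show ?thesis using B by (simp add: ennreal_mult[symmetric] ennreal_leI)
 qed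
 with l show "w:tempered" by (auto simp: tempered_distributions_def)
qed

lemma tempered_tbound: "w:tempered ==> EX C j. tbound w C j"
 by (simp add: tempered_iff)

lemma tboundD: "tbound w C j ==> f:schwartz ==> sbound j f B ==> cmod (w f) <= C * B"
 by (simp add: tbound_def)

lemma tempered_linear:
 assumes "w:tempered"
 shows tempered_add: "f:schwartz ==> g:schwartz ==> w (%x. f x + g x) = w f + w g"
  and tempered_cmult: "f:schwartz ==> w (%x. c * f x) = c * w f"
  and tempered_diff: "f:schwartz ==> g:schwartz ==> w (%x. f x - g x) = w f - w g"
proof -
 have l: "linear_on schwartz w" using assms by (simp add: tempered_iff)
 show a: "w (%x. f x + g x) = w f + w g" if "f:schwartz" "g:schwartz" for f g
  using l that by (simp add: linear_on_def)
 show c: "w (%x. c * f x) = c * w f" if "f:schwartz" for f c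
  using l that by (simp add: linear_on_def)
 show "w (%x. f x - g x) = w f - w g" if "f:schwartz" "g:schwartz" for f g
  using a[OF that(1) schwartz_cmult[OF that(2)], of "-1"] c[OF that(2), of "-1"] by simp
qed

lemma tempered_sum:
 assumes "w:tempered" "finite I" "!!i. i:I ==> f i:schwartz"
 shows "w (%x. \<Sum>i\<in>I. c i * f i x) = (\<Sum>i\<in>I. c i * w (f i))"
 using assms(2,3)
proof (induction I)
 case empty
 have "w (%x. 0 * (%_. 0) x) = 0 * w (%_. 0)" by (rule tempered_cmult[OF assms(1) schwartz_zero])
 then show ?case by simp
next
 case (insert i I)
 have "(%x. \<Sum>l\<in>I. c l * f l x) : schwartz" "(%x. c i * f i x) : schwartz" using insert
  by (auto intro!: schwartz_sum schwartz_cmult)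
 then show ?case using insert tempered_add[OF assms(1)] tempered_cmult[OF assms(1)] by simp
qed

lemma sbound_translate:
 "k:schwartz ==> sbound j k B ==> sbound j (%z. k (z + a)) ((1 + norm a) ^ j * B)"
 using sbound_isometry[of k j B 1 a] by (simp add: schwartz_smooth add.commute)

lemma ideriv_translate: "smooth_on UNIV k ==> ideriv is (%z. k (z + a)) x = ideriv is k (x + a)"
 using ideriv_affine_UNIV[of k "is" a 1 x] by (simp add: add.commute)

text \<open>The mean value estimate for a derivative of \<open>k\<close> costs one further
  derivative, hence the bound at level \<open>Suc j\<close>. The weight is moved from
  \<open>z\<close> to \<open>z + b\<close>.\<close>

lemma translate_diff_bound:
 fixes k :: "'n::finite fn"
 assumes "k:schwartz" "sbound (Suc j) k B" "length is <= j"
 shows "(1 + norm z) ^ j * cmod (ideriv is k (z + a) - ideriv is k (z + b))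
  <= (1 + norm b) ^ j * ((CARD('n) * norm (a - b)) * (1 + norm (a - b)) ^ j * B)"
proof -
 let ?k = "ideriv is k"
 have "(1 + norm y) ^ j * cmod (pd i ?k y) <= B" for i y
 proof -
  have "(1 + norm y) ^ j * cmod (pd i ?k y) <= (1 + norm y) ^ Suc j * cmod (ideriv (i # is) k y)"
   unfolding ideriv_Cons by (intro mult_right_mono power_increasing) auto
  also have "... <= B" using assms by (intro sboundD) auto
  finally show ?thesis .
 qed
 then have *: "(1 + norm (z + b)) ^ j * cmod (?k (z + b + (a - b)) - ?k (z + b)) <= (CARD('n) * norm (a - b)) * (1 + norm (a - b)) ^ j * B"
  by (intro taylor1 schwartz_smooth schwartz_ideriv assms)
 have "(1 + norm z) ^ j * cmod (?k (z + a) - ?k (z + b)) <= ((1 + norm (z + b)) ^ j * (1 + norm b) ^ j) * cmod (?k (z + a) - ?k (z + b))"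
  by (intro mult_right_mono one_plus_norm_mult) auto
 also have "... = (1 + norm b) ^ j * ((1 + norm (z + b)) ^ j * cmod (?k (z + b + (a - b)) - ?k (z + b)))"
  by (simp add: mult_ac)
 also have "... <= (1 + norm b) ^ j * ((CARD('n) * norm (a - b)) * (1 + norm (a - b)) ^ j * B)"
  by (intro mult_left_mono *) auto
 finally show ?thesis .
qed

lemma sbound_translate_diff:
 fixes k :: "'n::finite fn"
 assumes "k:schwartz" "sbound (Suc j) k B"
 shows "sbound j (%z. k (z + a) - k (z + b)) ((1 + norm b) ^ j * ((CARD('n) * norm (a - b)) * (1 + norm (a - b)) ^ j * B))"
 unfolding sbound_def
proof (intro allI impI)
 fix "is" :: "'n list" and x :: "real^'n" assume l: "length is <= j"
 have s: "smooth_on UNIV k" "smooth_on UNIV (%z. k (z + a))" "smooth_on UNIV (%z. k (z + b))"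
  using assms(1) schwartz_translate schwartz_smooth by auto
 show "(1 + norm x) ^ j * cmod (ideriv is (%z. k (z + a) - k (z + b)) x) <= (1 + norm b) ^ j * ((CARD('n) * norm (a - b)) * (1 + norm (a - b)) ^ j * B)"
  unfolding ideriv_diff[OF open_UNIV s(2,3) UNIV_I] ideriv_translate[OF s(1)]
  by (rule translate_diff_bound[OF assms l])
qed

lemma tempered_translate_cont:
 fixes k :: "'n::finite fn"
 assumes "w:tempered" "k:schwartz"
 shows "continuous_on UNIV (%y. w (%z. k (z + y)))"
proof (rule cont_lipschitz_ball)
 fix x
 obtain C j where C: "tbound w C j" using tempered_tbound[OF assms(1)] by blast
 obtain B where B: "sbound (Suc j) k B" using schwartz_sbound[OF assms(2)] by blast
 have "cmod (w (%z. k (z + (x + v))) - w (%z. k (z + x))) <= (C * ((1 + norm x) ^ j * (CARD('n) * 2 ^ j * B))) * norm v"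
  if "norm v <= 1" for v
 proof -
  have "cmod (w (%z. k (z + (x + v))) - w (%z. k (z + x))) = cmod (w (%z. k (z + (x + v)) - k (z + x)))"
   by (subst tempered_diff[OF assms(1)]) (intro schwartz_translate assms | simp)+
  also have "... <= C * ((1 + norm x) ^ j * ((CARD('n) * norm (x + v - x)) * (1 + norm (x + v - x)) ^ j * B))"
   by (intro tboundD[OF C] schwartz_diff schwartz_translate assms sbound_translate_diff B)
  also have "... <= C * ((1 + norm x) ^ j * ((CARD('n) * norm (x + v - x)) * 2 ^ j * B))"
   using that C sbound_nonneg[OF B] by (intro mult_left_mono mult_right_mono power_mono) (auto simp: tbound_def)
  finally show ?thesis by (simp add: mult_ac)
 qed
 then show "EX L. ALL v. norm v <= 1 --> norm (w (%z. k (z + (x + v))) - w (%z. k (z + x))) <= L * norm v" by blast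
qed

lemma ideriv_sum_translates:
 assumes "smooth_on UNIV k" "finite R"
 shows "smooth_on UNIV (%z. \<Sum>p\<in>R. c p * k (z + p)) & ideriv is (%z. \<Sum>p\<in>R. c p * k (z + p)) x = (\<Sum>p\<in>R. c p * ideriv is k (x + p))"
 using assms(2)
proof (induction R)
 case empty
 then show ?case by (simp add: ideriv_const smooth_on_const)
next
 case (insert p R)
 have s: "smooth_on UNIV (%z. k (z + p))" using smooth_on_affine_UNIV[OF assms(1), of p 1] by (simp add: add.commute)
 then show ?case
  using insert ideriv_add[OF open_UNIV smooth_on_cmult[OF open_UNIV s, of "c p"], of _ x "is"]
   ideriv_cmult[OF open_UNIV s UNIV_I, of "is" "c p" x] ideriv_translate[OF assms(1), of "is" p x]
  by (simp add: smooth_on_add[OF open_UNIV] smooth_on_cmult[OF open_UNIV s])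
qed

text \<open>
 Interchanging a tempered distribution with an integral: the integration variable is discretised
 by simple functions, for which the integral is a finite sum.
\<close>

lemma tempered_correlate:
 fixes k :: "'n::finite fn"
 assumes w: "w:tempered" and k: "k:schwartz" and h: "rapid h"
 shows "w (correlate k h) = (LINT y|lborel. w (%z. k (z + y)) * h y)"
proof -
 obtain C j where C: "tbound w C j" using tempered_tbound[OF w] by blast
 then have C0: "C >= 0" by (simp add: tbound_def)
 obtain B where B: "sbound (Suc j) k B" using schwartz_sbound[OF k] by blast
 have B0: "B >= 0" by (rule sbound_nonneg[OF B])
 have Bj: "sbound j k B" by (rule sbound_mono[OF B]) auto
 let ?u = "%y. w (%z. k (z + y))"
 have ucont: "continuous_on UNIV ?u" by (rule tempered_translate_cont[OF w k])
 have ubound: "cmod (?u y) <= (C * B) * (1 + norm y) ^ j" for y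
  using tboundD[OF C schwartz_translate[OF k] sbound_translate[OF k Bj, of y]] by (simp add: mult_ac)
 have hm: "h:borel_measurable borel" using h by (simp add: rapid_def)
 \<comment> \<open>Simple functions approximate the identity map pointwise; the bound by
   \<open>2 * norm y\<close> provides dominating functions for the limits below.\<close>
 obtain s :: "nat => real^'n => real^'n" where s: "!!m. simple_function borel (s m)" "!!y. (%m. s m y) \<longlonglongrightarrow> y"
  "!!m y. norm (s m y) <= 2 * norm y"
  using borel_measurable_implies_sequence_metric[of "%y::real^'n. y" borel 0] by (auto simp: dist_norm)
 have smeas: "s m:borel_measurable borel" for m using borel_measurable_simple_function[OF s(1)] by simp
 have fin: "finite (range (s m))" for m using s(1)[of m] by (simp add: simple_function_def)
 define c where "c m p = (LINT y|lborel. indicator (s m -` {p}) y * h y)" for m p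
 have ind: "integrable lborel (%y. indicator (s m -` {p}) y * h y)" for m p
 proof (rule rapid_mult_integrable[OF h, of _ 1 0])
  show "indicator (s m -` {p}) : borel_measurable borel"
   using measurable_sets[OF smeas, of "{p}" m] by (intro borel_measurable_indicator) simp
 qed (auto simp: indicator_def)
 have disc: "(LINT y|lborel. F (s m y) * h y) = (\<Sum>p\<in>range (s m). c m p * F p)" for F :: "'n fn" and m
 proof -
  have "F (s m y) * h y = (\<Sum>p\<in>range (s m). F p * (indicator (s m -` {p}) y * h y))" for y
  proof -
   have "(\<Sum>p\<in>range (s m). F p * (indicator (s m -` {p}) y * h y)) = (\<Sum>p\<in>range (s m). if s m y = p then F p * h y else 0)"
    by (intro sum.cong) (auto simp: indicator_def)
   then show ?thesis using fin by simp
  qed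
  then have "(LINT y|lborel. F (s m y) * h y) = (\<Sum>p\<in>range (s m). LINT y|lborel. F p * (indicator (s m -` {p}) y * h y))"
   using ind by (simp add: Bochner_Integration.integral_sum)
  then show ?thesis by (simp add: c_def mult.commute)
 qed
 \<comment> \<open>The correlation with its integration variable discretised: a finite combination
   of translates of \<open>k\<close>, on which \<open>w\<close> acts by linearity.\<close>
 define K where "K m z = (\<Sum>p\<in>range (s m). c m p * k (z + p))" for m z
 have Ks: "K m:schwartz" for m
  unfolding K_def[abs_def] by (intro schwartz_sum schwartz_cmult schwartz_translate k)
 have wK: "w (K m) = (LINT y|lborel. ?u (s m y) * h y)" for m
  unfolding K_def[abs_def] disc[of ?u] by (rule tempered_sum[OF w fin schwartz_translate[OF k]])
 have weight2: "(1 + norm (s m y)) ^ j <= 2 ^ j * (1 + norm y) ^ j" for m y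
  using s(3)[of m y] by (subst power_mult_distrib[symmetric]) (intro power_mono, auto)
 have lim1: "(%m. LINT y|lborel. ?u (s m y) * h y) \<longlonglongrightarrow> (LINT y|lborel. ?u y * h y)"
 proof (rule integral_dominated_convergence[where w = "%y. (C * B * 2 ^ j) * ((1 + norm y) ^ j * cmod (h y))"])
  have um: "?u:borel_measurable borel" by (rule borel_measurable_continuous_onI[OF ucont])
  show "(%y. ?u y * h y) : borel_measurable lborel" using um hm by simp
  show "(%y. ?u (s m y) * h y) : borel_measurable lborel" for m
   using measurable_compose[OF smeas um] hm by simp
  show "integrable lborel (%y. (C * B * 2 ^ j) * ((1 + norm y) ^ j * cmod (h y)))"
   by (intro integrable_mult_right rapid_integrable h)
  show "AE y in lborel. (%m. ?u (s m y) * h y) \<longlonglongrightarrow> ?u y * h y"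
  proof (rule AE_I2)
   fix y
   have "(%m. ?u (s m y)) \<longlonglongrightarrow> ?u y"
    by (rule continuous_on_tendsto_compose[OF ucont s(2)]) auto
   then show "(%m. ?u (s m y) * h y) \<longlonglongrightarrow> ?u y * h y" by (intro tendsto_intros)
  qed
  show "AE y in lborel. norm (?u (s m y) * h y) <= (C * B * 2 ^ j) * ((1 + norm y) ^ j * cmod (h y))" for m
  proof (rule AE_I2)
   fix y
   have "cmod (?u (s m y)) <= (C * B) * (2 ^ j * (1 + norm y) ^ j)"
    using order_trans[OF ubound[of "s m y"] mult_left_mono[OF weight2[of m y]]] C0 B0 by simp
   from mult_right_mono[OF this, of "cmod (h y)"]
   show "norm (?u (s m y) * h y) <= (C * B * 2 ^ j) * ((1 + norm y) ^ j * cmod (h y))"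
    by (simp add: norm_mult mult_ac)
  qed
 qed
 \<comment> \<open>The estimate for the translates by \<open>s m y\<close> and \<open>y\<close>,
   weighted with \<open>h\<close>. It tends to 0 pointwise and has a majorant in which the weight
   has exponent \<open>Suc j + j\<close>.\<close>
 define g where "g m y = (1 + norm y) ^ j * ((CARD('n) * norm (s m y - y)) * (1 + norm (s m y - y)) ^ j * B) * cmod (h y)" for m y
 define e where "e m = (LINT y|lborel. g m y)" for m
 have gdom: "norm (g m y) <= (CARD('n) * 3 * 3 ^ j * B) * ((1 + norm y) ^ (Suc j + j) * cmod (h y))" for m y
 proof -
  have n3: "norm (s m y - y) <= 3 * (1 + norm y)"
  proof -
   have "norm (s m y - y) <= 2 * norm y + norm y"
    by (rule order_trans[OF norm_triangle_ineq4 add_right_mono[OF s(3)]])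
   then show ?thesis by simp
  qed
  have n4: "1 + norm (s m y - y) <= 3 * (1 + norm y)"
  proof -
   have "norm (s m y - y) <= 2 * norm y + norm y"
    by (rule order_trans[OF norm_triangle_ineq4 add_right_mono[OF s(3)]])
   then show ?thesis by simp
  qed
  have "norm (g m y) = (1 + norm y) ^ j * ((CARD('n) * norm (s m y - y)) * (1 + norm (s m y - y)) ^ j * B) * cmod (h y)"
   unfolding g_def using B0 by (simp add: abs_mult)
  also have "... <= (1 + norm y) ^ j * ((CARD('n) * (3 * (1 + norm y))) * (3 * (1 + norm y)) ^ j * B) * cmod (h y)"
   using n3 n4 B0 by (intro mult_right_mono mult_left_mono mult_mono power_mono mult_nonneg_nonneg) auto
  also have "... = (CARD('n) * 3 * 3 ^ j * B) * ((1 + norm y) ^ (Suc j + j) * cmod (h y))"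
  proof -
   have "N ^ j * ((c * (3 * N)) * (3 * N) ^ j * B) * d = (c * 3 * 3 ^ j * B) * (N ^ (Suc j + j) * d)" for N c d :: real
    by (simp add: power_mult_distrib power_add mult_ac)
   from this[of "1 + norm y" "real CARD('n)" "cmod (h y)"] show ?thesis by simp
  qed
  finally show ?thesis .
 qed
 have gmeas: "g m:borel_measurable lborel" for m
  unfolding g_def[abs_def] using smeas[of m] hm by measurable
 have gint: "integrable lborel (g m)" for m
  by (rule Bochner_Integration.integrable_bound[OF integrable_mult_right[OF rapid_integrable[OF h, of "Suc j + j"], of "CARD('n) * 3 * 3 ^ j * B"] gmeas])
   (intro AE_I2 order_trans[OF gdom], simp)
 have e0: "e \<longlonglongrightarrow> 0"
 proof -
  have "(%m. LINT y|lborel. g m y) \<longlonglongrightarrow> (LINT y|(lborel :: (real^'n) measure). 0)"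
  proof (rule integral_dominated_convergence[where w = "%y. (CARD('n) * 3 * 3 ^ j * B) * ((1 + norm y) ^ (Suc j + j) * cmod (h y))"])
   show "integrable lborel (%y. (CARD('n) * 3 * 3 ^ j * B) * ((1 + norm y) ^ (Suc j + j) * cmod (h y)))"
    by (intro integrable_mult_right rapid_integrable h)
   show "AE y in lborel. (%m. g m y) \<longlonglongrightarrow> 0"
   proof (rule AE_I2)
    fix y
    have "(%m. s m y - y) \<longlonglongrightarrow> y - y" by (intro tendsto_intros s)
    then have "(%m. norm (s m y - y)) \<longlonglongrightarrow> norm (y - y)" by (rule tendsto_norm)
    then have "(%m. norm (s m y - y)) \<longlonglongrightarrow> 0" by simp
    from this have "(%m. g m y) \<longlonglongrightarrow> (1 + norm y) ^ j * ((real CARD('n) * 0) * (1 + 0) ^ j * B) * cmod (h y)"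
     unfolding g_def by (intro tendsto_intros)
    then show "(%m. g m y) \<longlonglongrightarrow> 0" by simp
   qed
  qed (use gmeas gdom in auto)
  then show ?thesis unfolding e_def[abs_def] by simp
 qed
 \<comment> \<open>The discretisation error is estimated in the seminorm that bounds
   \<open>w\<close>, so that \<open>w (K m)\<close> converges to
   \<open>w (correlate k h)\<close>.\<close>
 have sb: "sbound j (%z. K m z - correlate k h z) (e m)" for m
  unfolding sbound_def
 proof (intro allI impI)
  fix "is" :: "'n list" and z assume l: "length is <= j"
  let ?k = "ideriv is k"
  have "ideriv is (%z. K m z - correlate k h z) z = ideriv is (K m) z - correlate ?k h z"
   using ideriv_diff[OF open_UNIV schwartz_smooth[OF Ks] correlate_smooth[OF k h] UNIV_I] ideriv_correlate[OF k h] by simp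
  also have "ideriv is (K m) z = (LINT y|lborel. ?k (z + s m y) * h y)"
   using ideriv_sum_translates[OF schwartz_smooth[OF k] fin[of m], of "c m" "is" z] disc[of "%p. ?k (z + p)" m]
   unfolding K_def[abs_def] by simp
  also have "(LINT y|lborel. ?k (z + s m y) * h y) - correlate ?k h z = (LINT y|lborel. (?k (z + s m y) - ?k (z + y)) * h y)"
  proof -
   obtain D where "D >= 0" "!!x. cmod (?k x) <= D"
    using schwartz_uniform_bound[OF schwartz_ideriv[OF k, of "is"], of 0 0] by auto
   then have "integrable lborel (%y. ?k (z + s m y) * h y)"
    by (intro rapid_mult_integrable[OF h, of _ D 0] measurable_compose[OF smeas schwartz_meas_shift[OF schwartz_ideriv[OF k]]]) auto
   then show ?thesis
    unfolding correlate_def left_diff_distrib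
    by (intro Bochner_Integration.integral_diff[symmetric] correlate_integrable schwartz_ideriv k h)
  qed
  finally have eq: "ideriv is (%z. K m z - correlate k h z) z = ..." .
  have pt: "cmod ((?k (z + s m y) - ?k (z + y)) * h y) <= g m y / (1 + norm z) ^ j" for y
   using mult_right_mono[OF translate_diff_bound[OF k B l, of z "s m y" y], of "cmod (h y)"]
   by (subst pos_le_divide_eq[OF weight_pos]) (simp add: g_def norm_mult mult_ac)
  have "cmod (LINT y|lborel. (?k (z + s m y) - ?k (z + y)) * h y) <= (LINT y|lborel. g m y / (1 + norm z) ^ j)"
  proof (rule Bochner_Integration.integral_norm_bound_integral[OF _ _ pt])
   show gi: "integrable lborel (%y. g m y / (1 + norm z) ^ j)" by (intro integrable_divide gint)
   show "integrable lborel (%y. (?k (z + s m y) - ?k (z + y)) * h y)"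
   proof (rule Bochner_Integration.integrable_bound[OF gi])
    show "(%y. (?k (z + s m y) - ?k (z + y)) * h y) : borel_measurable lborel"
     using measurable_compose[OF smeas[of m] schwartz_meas_shift[OF schwartz_ideriv[OF k, of "is"], of z]]
      schwartz_meas_shift[OF schwartz_ideriv[OF k, of "is"], of z] hm by simp
    show "AE y in lborel. norm ((?k (z + s m y) - ?k (z + y)) * h y) <= norm (g m y / (1 + norm z) ^ j)"
     by (intro AE_I2 order_trans[OF pt]) (unfold real_norm_def, rule abs_ge_self)
   qed
  qed
  also have "... = e m / (1 + norm z) ^ j" by (simp add: e_def)
  finally show "(1 + norm z) ^ j * cmod (ideriv is (%z. K m z - correlate k h z) z) <= e m"
   unfolding eq by (subst (asm) pos_le_divide_eq[OF weight_pos]) (simp add: mult.commute)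
 qed
 have "(%m. w (K m) - w (correlate k h)) \<longlonglongrightarrow> 0"
 proof (rule Lim_null_comparison)
  show "\<forall>\<^sub>F m in sequentially. norm (w (K m) - w (correlate k h)) <= C * e m"
  proof (rule always_eventually, rule allI)
   fix m
   show "norm (w (K m) - w (correlate k h)) <= C * e m"
    using tboundD[OF C schwartz_diff[OF Ks correlate_schwartz[OF k h]] sb[of m]] tempered_diff[OF w Ks correlate_schwartz[OF k h], of m] by simp
  qed
  show "(%m. C * e m) \<longlonglongrightarrow> 0" using tendsto_mult_left[OF e0, of C] by simp
 qed
 then have "(%m. w (K m)) \<longlonglongrightarrow> w (correlate k h)" by (rule LIM_zero_cancel)
 from LIMSEQ_unique[OF this[unfolded wK] lim1] show ?thesis .
qed

subsection \<open>Mollification\<close>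

lemma integral_lborel_affine:
 fixes f :: "'a::euclidean_space => complex"
 assumes "f:borel_measurable borel" "c ~= 0"
 shows "(LINT y|lborel. f y) = of_real (\<bar>c\<bar> ^ DIM('a)) * (LINT y|lborel. f (t + c *\<^sub>R y))"
proof -
 have "(LINT y|lborel. f y) = (LINT y|density (distr lborel borel (%x. t + c *\<^sub>R x)) (%_. \<bar>c\<bar>^DIM('a)). f y)"
  using lborel_affine[OF assms(2), of t] by simp
 also have "... = (LINT y|distr lborel borel (%x. t + c *\<^sub>R x). \<bar>c\<bar>^DIM('a) *\<^sub>R f y)"
  by (rule integral_density) (use assms in auto)
 also have "... = (LINT y|lborel. \<bar>c\<bar>^DIM('a) *\<^sub>R f (t + c *\<^sub>R y))"
  by (rule integral_distr) (use assms in auto)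
 finally show ?thesis by (simp add: scaleR_conv_of_real)
qed

lemma integral_lborel_reflect:
 fixes f :: "'a::euclidean_space => complex"
 assumes "f:borel_measurable borel"
 shows "(LINT y|lborel. f y) = (LINT y|lborel. f (x - y))"
 using integral_lborel_affine[OF assms, of "-1" x] by simp

lemma meps_alt:
 "meps \<phi> e = (%y::real^'n::finite. of_real (inverse e ^ CARD('n)) * \<phi> (inverse e *\<^sub>R y))"
 by (rule ext) (simp add: mollifier_eps_def divide_inverse mult.commute power_inverse)

lemma sbound_meps:
 fixes \<phi> :: "'n::finite fn"
 assumes "\<phi>:schwartz" "sbound j \<phi> B" "0 < e" "e <= 1"
 shows "sbound j (meps \<phi> e) (inverse e ^ (CARD('n) + j) * B)"
proof -
 have c: "1 <= inverse e" using assms by (simp add: one_le_inverse)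
 have "smooth_on UNIV (%y. \<phi> (inverse e *\<^sub>R y))"
  using schwartz_smooth[OF schwartz_scale[OF assms(1) c]] .
 from sbound_cmult[OF this sbound_scale[OF schwartz_smooth[OF assms(1)] assms(2) c], of "of_real (inverse e ^ CARD('n))"]
 show ?thesis unfolding meps_alt using assms(3) by (simp add: norm_power power_add mult_ac norm_inverse)
qed

lemma meps_schwartz:
 assumes "\<phi>:schwartz" "0 < e" "e <= 1"
 shows "meps \<phi> e:schwartz"
 unfolding meps_alt using assms by (intro schwartz_cmult schwartz_scale) (auto simp: one_le_inverse)

lemma correlate_meps:
 fixes g :: "'n::finite fn"
 assumes "g:schwartz" "\<phi>:schwartz" "0 < e"
 shows "correlate g (meps \<phi> e) x = (LINT z|lborel. g (x + e *\<^sub>R z) * \<phi> z)"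
proof -
 have [measurable]: "g:borel_measurable borel" "\<phi>:borel_measurable borel"
  using assms by (auto intro: smooth_measurable schwartz_smooth)
 have m: "(%y. g (x + y) * meps \<phi> e y) : borel_measurable borel"
  unfolding meps_alt by measurable
 have "correlate g (meps \<phi> e) x = of_real (\<bar>e\<bar> ^ CARD('n)) * (LINT z|lborel. g (x + e *\<^sub>R z) * meps \<phi> e (e *\<^sub>R z))"
  unfolding correlate_def using integral_lborel_affine[OF m, of e 0] assms(3) by simp
 also have "... = (LINT z|lborel. of_real (\<bar>e\<bar> ^ CARD('n)) * (g (x + e *\<^sub>R z) * meps \<phi> e (e *\<^sub>R z)))"
  by (rule integral_mult_right_zero[symmetric])
 also have "(%z. of_real (\<bar>e\<bar> ^ CARD('n)) * (g (x + e *\<^sub>R z) * meps \<phi> e (e *\<^sub>R z))) = (%z. g (x + e *\<^sub>R z) * \<phi> z)"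
  using assms(3) by (auto simp: meps_alt power_inverse)
 finally show ?thesis .
qed

lemma prod_list_monomial: "prod_list (map (%j. z $ j) js) = mi_monomial (count (mset js)) z"
proof (induction js)
 case Nil
 then show ?case by (simp add: mi_monomial_def)
next
 case (Cons j js)
 have "mi_monomial (count (mset (j # js))) z = (\<Prod>i\<in>UNIV. (if i = j then z $ i else 1) * (z $ i) ^ count (mset js) i)"
  unfolding mi_monomial_def by (intro prod.cong) auto
 also have "... = z $ j * mi_monomial (count (mset js)) z"
  by (simp add: prod.distrib mi_monomial_def)
 finally show ?case using Cons by (simp del: count_add_mset mset.simps)
qed

lemma monomial_bound: "\<bar>prod_list (map (%j. z $ j) js)\<bar> <= (1 + norm z) ^ length js"
proof (induction js)
 case (Cons j js)
 have "\<bar>z $ j\<bar> <= 1 + norm z" using component_le_norm_cart[of z j] by linarith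
 with Cons show ?case by (simp add: abs_mult mult_mono)
qed simp

lemma monomial_measurable: "(%z::real^'n::finite. complex_of_real (prod_list (map (%j. z $ j) js))) : borel_measurable borel"
proof (intro borel_measurable_continuous_onI continuous_on_of_real)
 show "continuous_on UNIV (%z::real^'n. prod_list (map (%j. z $ j) js))"
  by (induction js) (auto intro!: continuous_intros)
qed

text \<open>Every step of the recursion for \<open>dir_deriv\<close> contributes a factor
  \<open>z $ i\<close>. The list \<open>js\<close> collects these factors, so that the induction
  ends with moments of \<phi>.\<close>

lemma mollifier_moment:
 fixes \<phi> :: "'n::finite fn"
 assumes "mollifier \<phi>"
 shows "integrable lborel (%z. of_real (prod_list (map (%j. z $ j) js)) * dir_deriv k z g x * \<phi> z) &
  (0 < k + length js --> (LINT z|lborel. of_real (prod_list (map (%j. z $ j) js)) * dir_deriv k z g x * \<phi> z) = 0)"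
proof (induction k arbitrary: g js)
 case 0
 have s: "\<phi>:schwartz" using assms by (simp add: mollifier_def)
 have i: "integrable lborel (%z. of_real (prod_list (map (%j. z $ j) js)) * \<phi> z)"
  by (rule rapid_mult_integrable[OF schwartz_rapid[OF s] monomial_measurable, of _ 1 "length js"])
   (use monomial_bound in auto)
 have "(LINT z|lborel. of_real (prod_list (map (%j. z $ j) js)) * \<phi> z) = 0" if "js ~= []"
 proof -
  have "count (mset js) ~= (%_. 0)" using that by (cases js) (auto simp: fun_eq_iff)
  then show ?thesis using assms unfolding mollifier_def prod_list_monomial by blast
 qed
 moreover have "of_real (prod_list (map (%j. z $ j) js)) * dir_deriv 0 z g x * \<phi> z = g x * (of_real (prod_list (map (%j. z $ j) js)) * \<phi> z)" for z
  by simp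
 ultimately show ?case using i by (simp only:) auto
next
 case (Suc k)
 have eq: "of_real (prod_list (map (%j. z $ j) js)) * dir_deriv (Suc k) z g x * \<phi> z
   = (\<Sum>i\<in>UNIV. of_real (prod_list (map (%j. z $ j) (i # js))) * dir_deriv k z (pd i g) x * \<phi> z)" for z
  by (simp add: sum_distrib_left sum_distrib_right mult_ac)
 show ?case unfolding eq
 proof (intro conjI impI)
  show "integrable lborel (%z. \<Sum>i\<in>UNIV. of_real (prod_list (map (%j. z $ j) (i # js))) * dir_deriv k z (pd i g) x * \<phi> z)"
   by (intro Bochner_Integration.integrable_sum conjunct1[OF Suc.IH])
  show "(LINT z|lborel. (\<Sum>i\<in>UNIV. of_real (prod_list (map (%j. z $ j) (i # js))) * dir_deriv k z (pd i g) x * \<phi> z)) = 0"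
   by (subst Bochner_Integration.integral_sum, intro conjunct1[OF Suc.IH], intro sum.neutral ballI mp[OF conjunct2[OF Suc.IH]]) simp
 qed
qed

text \<open>In the Taylor remainder, \<open>CARD('n) ^ r\<close> comes from the sum of coordinates,
  and the weight of exponent \<open>r + j\<close> from the product of \<open>norm z ^ r\<close> with
  \<open>(1 + norm z) ^ j\<close>.\<close>

definition moll_const :: "('n::finite fn) => nat => nat => real" where
 "moll_const \<phi> r j = CARD('n) ^ r * weighted_norm (r + j) \<phi>"

lemma moll_const_nonneg: "0 <= moll_const \<phi> r j"
 by (simp add: moll_const_def weighted_norm_nonneg)

text \<open>
 Since all moments of \<open>\<phi>\<close> vanish, the Taylor polynomial integrates to \<open>g x\<close>, and only the
 remainder of order \<open>e\<^sup>r\<close> is left.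
\<close>

lemma mollify_approx:
 fixes g :: "'n::finite fn"
 assumes \<phi>: "mollifier \<phi>" and g: "g:schwartz" and e: "0 < e" "e <= 1" and r: "0 < r"
  and B: "!!is y. length is = r ==> (1 + norm y) ^ j * cmod (ideriv is g y) <= B"
 shows "(1 + norm x) ^ j * cmod (correlate g (meps \<phi> e) x - g x) <= moll_const \<phi> r j * e ^ r * B"
proof -
 have s: "\<phi>:schwartz" and one: "(LINT z|lborel. \<phi> z) = 1" using \<phi> by (auto simp: mollifier_def)
 have gs: "smooth_on UNIV g" by (rule schwartz_smooth[OF g])
 have B0: "B >= 0" using B[of "replicate r undefined" 0] by (simp add: order_trans[OF norm_ge_zero])
 let ?T = "%z. \<Sum>k<r. dir_deriv k (e *\<^sub>R z) g x / fact k"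
 have mom: "integrable lborel (%z. dir_deriv k z g x * \<phi> z)" "0 < k ==> (LINT z|lborel. dir_deriv k z g x * \<phi> z) = 0" for k
  using mollifier_moment[OF \<phi>, of "[]" k g x] by auto
 have Teq: "?T z * \<phi> z = (\<Sum>k<r. (of_real (e ^ k) / fact k) * (dir_deriv k z g x * \<phi> z))" for z
  by (simp add: dir_deriv_scale sum_distrib_right sum_distrib_left mult_ac)
 have Tint: "integrable lborel (%z. ?T z * \<phi> z)"
  unfolding Teq by (intro Bochner_Integration.integrable_sum integrable_mult_right mom)
 have "(LINT z|lborel. ?T z * \<phi> z) = (\<Sum>k<r. (of_real (e ^ k) / fact k) * (LINT z|lborel. dir_deriv k z g x * \<phi> z))"
  unfolding Teq by (subst Bochner_Integration.integral_sum) (auto intro!: mom)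
 also have "... = (\<Sum>k<r. if k = 0 then g x else 0)"
  by (intro sum.cong) (auto simp: mom one)
 also have "... = g x" using r by simp
 finally have T: "(LINT z|lborel. ?T z * \<phi> z) = g x" .
 have [measurable]: "g:borel_measurable borel" "\<phi>:borel_measurable borel"
  using smooth_measurable[OF gs] smooth_measurable[OF schwartz_smooth[OF s]] .
 obtain D where D: "D >= 0" "!!y. cmod (g y) <= D" using schwartz_uniform_bound[OF g, of 0 0] by auto
 have gint: "integrable lborel (%z. g (x + e *\<^sub>R z) * \<phi> z)"
  by (rule rapid_mult_integrable[OF schwartz_rapid[OF s], of _ D 0]) (use D in auto)
 have pt: "norm (g (x + e *\<^sub>R z) * \<phi> z - ?T z * \<phi> z) <= (CARD('n) ^ r * e ^ r * B / (1 + norm x) ^ j) * ((1 + norm z) ^ (r + j) * cmod (\<phi> z))" for z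
 proof -
  \<comment> \<open>As \<open>e <= 1\<close>, the weight of the shift is at most the weight of
    \<open>z\<close>; the power \<open>e ^ r\<close> is kept from the first factor of the
    remainder.\<close>
  have n: "norm (e *\<^sub>R z) <= norm z" using e by (simp add: mult_left_le_one_le)
  have "(1 + norm x) ^ j * cmod (g (x + e *\<^sub>R z) - ?T z) <= (CARD('n) * norm (e *\<^sub>R z)) ^ r * (1 + norm (e *\<^sub>R z)) ^ j * B"
   by (rule taylor_bound[OF gs B])
  also have "... <= (CARD('n) * (e * (1 + norm z))) ^ r * (1 + norm z) ^ j * B"
   using e n B0 by (intro mult_right_mono mult_mono power_mono mult_left_mono) auto
  also have "... = CARD('n) ^ r * e ^ r * B * (1 + norm z) ^ (r + j)"
   by (simp add: power_mult_distrib power_add mult_ac)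
  finally have "cmod (g (x + e *\<^sub>R z) - ?T z) <= (CARD('n) ^ r * e ^ r * B * (1 + norm z) ^ (r + j)) / (1 + norm x) ^ j"
   by (subst pos_le_divide_eq[OF weight_pos]) (simp add: mult.commute)
  from mult_right_mono[OF this, of "cmod (\<phi> z)"] show ?thesis
   by (simp add: left_diff_distrib[symmetric] norm_mult mult.assoc)
 qed
 have "correlate g (meps \<phi> e) x - g x = (LINT z|lborel. g (x + e *\<^sub>R z) * \<phi> z - ?T z * \<phi> z)"
  unfolding correlate_meps[OF g s e(1)] Bochner_Integration.integral_diff[OF gint Tint] T ..
 also have "cmod ... <= (LINT z|lborel. (CARD('n) ^ r * e ^ r * B / (1 + norm x) ^ j) * ((1 + norm z) ^ (r + j) * cmod (\<phi> z)))"
  by (rule Bochner_Integration.integral_norm_bound_integral[OF Bochner_Integration.integrable_diff[OF gint Tint] _ pt])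
   (intro integrable_mult_right rapid_integrable schwartz_rapid s)
 also have "... = (moll_const \<phi> r j * e ^ r * B) / (1 + norm x) ^ j"
  by (simp add: weighted_norm_def moll_const_def)
 finally show ?thesis by (subst (asm) pos_le_divide_eq[OF weight_pos]) (simp add: mult.commute)
qed

lemma sbound_mollify:
 fixes g :: "'n::finite fn"
 assumes \<phi>: "mollifier \<phi>" and g: "g:schwartz" and e: "0 < e" "e <= 1" and r: "0 < r" and B: "sbound (j + r) g B"
 shows "sbound j (%x. correlate g (meps \<phi> e) x - g x) (moll_const \<phi> r j * e ^ r * B)"
 unfolding sbound_def
proof (intro allI impI)
 fix "is" :: "'n list" and x :: "real^'n" assume l: "length is <= j"
 have m: "rapid (meps \<phi> e)"
  using \<phi> e by (intro schwartz_rapid meps_schwartz) (auto simp: mollifier_def)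
 have eq: "ideriv is (%x. correlate g (meps \<phi> e) x - g x) x = correlate (ideriv is g) (meps \<phi> e) x - ideriv is g x"
  using ideriv_diff[OF open_UNIV correlate_smooth[OF g m] schwartz_smooth[OF g] UNIV_I] ideriv_correlate[OF g m] by simp
 show "(1 + norm x) ^ j * cmod (ideriv is (%x. correlate g (meps \<phi> e) x - g x) x) <= moll_const \<phi> r j * e ^ r * B"
  unfolding eq
 proof (rule mollify_approx[OF \<phi> schwartz_ideriv[OF g] e r])
  fix js :: "'n list" and y :: "real^'n" assume "length js = r"
  then have lj: "length (js @ is) <= j + r" using l by simp
  have "(1 + norm y) ^ j * cmod (ideriv js (ideriv is g) y) <= (1 + norm y) ^ (j + r) * cmod (ideriv (js @ is) g y)"
   unfolding ideriv_append by (intro mult_right_mono power_increasing) auto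
  also have "... <= B" by (rule sboundD[OF B lj])
  finally show "(1 + norm y) ^ j * cmod (ideriv js (ideriv is g) y) <= B" .
 qed
qed

subsection \<open>Regularisation of tempered distributions\<close>

text \<open>The second order Taylor remainder is quadratic in \<open>t\<close> in the very Schwartz
  seminorm that bounds \<open>w\<close>, so differentiation can be carried out inside
  \<open>w\<close>.\<close>

lemma tempered_translate_has_partial:
 fixes k :: "'n::finite fn"
 assumes "w:tempered" "k:schwartz"
 shows "has_partial i (%a. w (%z. k (z + a))) (w (%z. pd i k (z + a))) a"
proof -
 obtain C j where C: "tbound w C j" using tempered_tbound[OF assms(1)] by blast
 obtain B where B: "B >= 0" "!!is x. length is <= j + 2 ==> (1 + norm x) ^ j * cmod (ideriv is k x) <= B"
  using schwartz_uniform_bound[OF assms(2), of "j + 2" j] by blast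
 let ?e = "axis i (1::real)"
 let ?d = "pd i k"
 have tr: "(%z. k (z + b)) : schwartz" "(%z. ?d (z + b)) : schwartz" for b
  using assms(2) by (auto intro: schwartz_translate schwartz_partial)
 show ?thesis
 proof (rule has_partial_quadratic[where C = "C * ((1 + norm a) ^ j * ((CARD('n))\<^sup>2 * 2 ^ j * B))"])
  fix t :: real assume t: "\<bar>t\<bar> <= 1"
  let ?F = "%z. k (z + (a + t *\<^sub>R ?e)) - k (z + a) - of_real t * ?d (z + a)"
  have "sbound j ?F ((1 + norm a) ^ j * ((CARD('n))\<^sup>2 * 2 ^ j * B) * t\<^sup>2)"
   unfolding sbound_def
  proof (intro allI impI)
   fix "is" :: "'n list" and x :: "real^'n" assume l: "length is <= j"
   let ?k = "ideriv is k"
   have comm: "ideriv is (pd i k) y = pd i ?k y" for y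
    using ideriv_move[OF open_UNIV schwartz_smooth[OF assms(2)] UNIV_I, of "is" i "[]" y]
    by (simp add: ideriv_append ideriv_Cons)
   have s: "smooth_on UNIV (%z. k (z + b))" "smooth_on UNIV (%z. ?d (z + b))" "smooth_on UNIV (%z. of_real t * ?d (z + b))" for b
    using tr schwartz_smooth schwartz_cmult by blast+
   have "ideriv is ?F x = ideriv is (%z. k (z + (a + t *\<^sub>R ?e)) - k (z + a)) x - ideriv is (%z. of_real t * ?d (z + a)) x"
    by (rule ideriv_diff[OF open_UNIV _ s(3) UNIV_I]) (intro smooth_on_diff[OF open_UNIV] s)
   also have "... = ?k (x + (a + t *\<^sub>R ?e)) - ?k (x + a) - of_real t * pd i ?k (x + a)"
    unfolding ideriv_diff[OF open_UNIV s(1) s(1) UNIV_I] ideriv_cmult[OF open_UNIV s(2) UNIV_I]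
     ideriv_translate[OF schwartz_smooth[OF assms(2)]] ideriv_translate[OF schwartz_smooth[OF schwartz_partial[OF assms(2)]]] comm ..
   finally have eq: "ideriv is ?F x = ?k (x + a + t *\<^sub>R ?e) - ?k (x + a) - of_real t * pd i ?k (x + a)"
    by (simp add: add.assoc)
   have *: "(1 + norm (x + a)) ^ j * cmod (ideriv is ?F x) <= (CARD('n) * \<bar>t\<bar>)\<^sup>2 * (1 + \<bar>t\<bar>) ^ j * B"
    unfolding eq
   proof (rule taylor2_axis)
    show "smooth_on UNIV ?k" by (intro smooth_on_ideriv schwartz_smooth assms)
    fix js :: "'n list" and y :: "real^'n" assume "length js = 2"
    then show "(1 + norm y) ^ j * cmod (ideriv js ?k y) <= B"
     using B(2)[of "js @ is" y] l by (simp add: ideriv_append)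
   qed
   have "(1 + norm x) ^ j * cmod (ideriv is ?F x) <= ((1 + norm (x + a)) ^ j * (1 + norm a) ^ j) * cmod (ideriv is ?F x)"
    by (intro mult_right_mono one_plus_norm_mult) auto
   also have "... = (1 + norm a) ^ j * ((1 + norm (x + a)) ^ j * cmod (ideriv is ?F x))" by (simp add: mult_ac)
   also have "... <= (1 + norm a) ^ j * ((CARD('n) * \<bar>t\<bar>)\<^sup>2 * 2 ^ j * B)"
    using t B(1) by (intro mult_left_mono order_trans[OF *] mult_right_mono mult_left_mono power_mono) auto
   finally show "(1 + norm x) ^ j * cmod (ideriv is ?F x) <= (1 + norm a) ^ j * ((CARD('n))\<^sup>2 * 2 ^ j * B) * t\<^sup>2"
    by (simp add: power_mult_distrib mult_ac)
  qed
  moreover have F: "?F:schwartz" by (intro schwartz_diff schwartz_cmult tr)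
  ultimately have "cmod (w ?F) <= C * ((1 + norm a) ^ j * ((CARD('n))\<^sup>2 * 2 ^ j * B) * t\<^sup>2)"
   using tboundD[OF C] by blast
  moreover have "w ?F = w (%z. k (z + (a + t *\<^sub>R ?e))) - w (%z. k (z + a)) - of_real t * w (%z. ?d (z + a))"
   using tempered_diff[OF assms(1) schwartz_diff[OF tr(1) tr(1)] schwartz_cmult[OF tr(2)]]
    tempered_diff[OF assms(1) tr(1) tr(1)] tempered_cmult[OF assms(1) tr(2)] by simp
  ultimately show "cmod (w (%z. k (z + (a + t *\<^sub>R ?e))) - w (%z. k (z + a)) - of_real t * w (%z. ?d (z + a)))
   <= C * ((1 + norm a) ^ j * ((CARD('n))\<^sup>2 * 2 ^ j * B)) * t\<^sup>2" by (simp add: mult_ac)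
 qed
qed

lemma tempered_translate_smooth:
 fixes k :: "'n::finite fn"
 assumes "w:tempered" "k:schwartz"
 shows "smooth_on UNIV (%a. w (%z. k (z + a)))"
proof -
 have "Ck_on m UNIV (%a. w (%z. k (z + a)))" for m
  using assms(2)
 proof (induction m arbitrary: k)
  case 0
  then show ?case using tempered_translate_cont[OF assms(1)] by simp
 next
  case (Suc m)
  show ?case
   by (rule Ck_on_SucI[where f' = "%i a. w (%z. pd i k (z + a))"])
    (use Suc assms(1) in \<open>auto intro: tempered_translate_has_partial tempered_translate_cont schwartz_partial\<close>)
 qed
 then show ?thesis by (simp add: smooth_on_def)
qed

lemma ideriv_tempered_translate:
 assumes "w:tempered" "k:schwartz"
 shows "ideriv is (%a. w (%z. k (z + a))) = (%a. w (%z. ideriv is k (z + a)))"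
proof (induction "is")
 case (Cons i "is")
 show ?case
  unfolding ideriv_Cons Cons by (intro ext has_partialD tempered_translate_has_partial schwartz_ideriv assms)
qed simp

lemma dist_conv_alt: "dist_conv w k x = (%a. w (%z. (%y. k (- y)) (z + a))) (0 + (- 1) *\<^sub>R x)"
 by (simp add: dist_conv_def)

lemma schwartz_uminus: "k:schwartz ==> (%y. k (- y)) : schwartz"
 using schwartz_reflect[of k 0] by simp

lemma dist_conv_smooth:
 assumes "w:tempered" "k:schwartz"
 shows "smooth_on UNIV (dist_conv w k)"
proof -
 have "smooth_on UNIV (%x. (%a. w (%z. (%y. k (- y)) (z + a))) (0 + (- 1) *\<^sub>R x))"
  by (rule smooth_on_affine_UNIV[OF tempered_translate_smooth[OF assms(1) schwartz_uminus[OF assms(2)]]])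
 then show ?thesis unfolding dist_conv_alt[symmetric] .
qed

lemma ideriv_dist_conv:
 fixes k :: "'n::finite fn"
 assumes "w:tempered" "k:schwartz"
 shows "ideriv is (dist_conv w k) = dist_conv w (ideriv is k)"
proof
 fix x
 let ?k = "%y. k (- y)"
 let ?T = "%a. w (%z. ?k (z + a))"
 have k: "?k:schwartz" by (rule schwartz_uminus[OF assms(2)])
 have "dist_conv w k = (%x. ?T (0 + (- 1) *\<^sub>R x))" by (rule ext) (rule dist_conv_alt)
 then have "ideriv is (dist_conv w k) x = of_real ((- 1) ^ length is) * ideriv is ?T (0 + (- 1) *\<^sub>R x)"
  using ideriv_affine_UNIV[OF tempered_translate_smooth[OF assms(1) k], of "is" 0 "-1" x] by simp
 also have "ideriv is ?T (0 + (- 1) *\<^sub>R x) = w (%z. ideriv is ?k (z - x))"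
  unfolding ideriv_tempered_translate[OF assms(1) k] by simp
 also have "(%z. ideriv is ?k (z - x)) = (%z. of_real ((- 1) ^ length is) * ideriv is k (x - z))"
  using ideriv_affine_UNIV[OF schwartz_smooth[OF assms(2)], of "is" 0 "-1"] by simp
 also have "w ... = of_real ((- 1) ^ length is) * dist_conv w (ideriv is k) x"
  unfolding dist_conv_def by (rule tempered_cmult[OF assms(1) schwartz_reflect[OF schwartz_ideriv[OF assms(2)]]])
 also have "of_real ((- 1) ^ length is) * (of_real ((- 1) ^ length is) * dist_conv w (ideriv is k) x) = dist_conv w (ideriv is k) x"
  by (simp add: mult.assoc[symmetric] power_mult_distrib[symmetric])
 finally show "ideriv is (dist_conv w k) x = dist_conv w (ideriv is k) x" .
qed

lemma dist_conv_bound: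
 assumes "tbound w C j" "k:schwartz" "sbound j k B"
 shows "cmod (dist_conv w k x) <= C * B * (1 + norm x) ^ j"
proof -
 have "sbound j (%y. k (x - y)) ((1 + norm x) ^ j * B)"
  using sbound_isometry[OF schwartz_smooth[OF assms(2)] assms(3), of "-1" x] by simp
 from tboundD[OF assms(1) schwartz_reflect[OF assms(2)] this] show ?thesis
  by (simp add: dist_conv_def mult_ac)
qed

lemma dist_conv_integrable:
 assumes "w:tempered" "k:schwartz" "rapid h"
 shows "integrable lborel (%y. dist_conv w k y * h y)"
proof -
 obtain C j where C: "tbound w C j" using tempered_tbound[OF assms(1)] by blast
 obtain B where B: "sbound j k B" using schwartz_sbound[OF assms(2)] by blast
 show ?thesis
  by (rule rapid_mult_integrable[OF assms(3) smooth_measurable[OF dist_conv_smooth[OF assms(1,2)]] dist_conv_bound[OF C assms(2) B]])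
qed

text \<open>After reflecting \<open>k\<close> and \<open>f\<close> the left side is an integral over
  translates, where \<open>tempered_correlate\<close> moves \<open>w\<close> outside.\<close>

lemma dist_conv_pairing:
 fixes f :: "'n::finite fn"
 assumes w: "w:tempered" and k: "k:schwartz" and f: "f:schwartz"
 shows "(LINT y|lborel. dist_conv w k y * f y) = w (correlate f k)"
proof -
 let ?k = "%y. k (- y)" and ?f = "%y. f (- y)"
 have k': "?k:schwartz" and f': "?f:schwartz" using k f schwartz_uminus by auto
 have m: "(%y. dist_conv w k y * f y) : borel_measurable borel"
  by (intro borel_measurable_times smooth_measurable dist_conv_smooth w k schwartz_smooth f)
 have "(LINT y|lborel. dist_conv w k y * f y) = (LINT y|lborel. dist_conv w k (- y) * f (- y))"
  using integral_lborel_reflect[OF m, of 0] by simp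
 also have "... = (LINT y|lborel. w (%z. ?k (z + y)) * ?f y)"
  by (simp add: dist_conv_def minus_add_distrib[symmetric] algebra_simps)
 also have "... = w (correlate ?k ?f)"
  by (rule tempered_correlate[OF w k' schwartz_rapid[OF f'], symmetric])
 also have "correlate ?k ?f = correlate f k"
 proof
  fix z
  have [measurable]: "k:borel_measurable borel" "f:borel_measurable borel" using k f smooth_measurable schwartz_smooth by auto
  have "correlate ?k ?f z = (LINT y|lborel. k (- z - y) * f (- y))"
   by (simp only: correlate_def minus_add_distrib diff_conv_add_uminus)
  also have "... = (LINT y|lborel. k (- z - (- z - y)) * f (- (- z - y)))"
   by (rule integral_lborel_reflect) measurable
  also have "... = correlate f k z" by (simp add: correlate_def algebra_simps)
  finally show "correlate ?k ?f z = correlate f k z" .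
 qed
 finally show ?thesis .
qed

text \<open>Convolution of \<open>w\<close> with two kernels does not depend on their order: read as
  pairings, both sides apply \<open>w\<close> to the same function.\<close>

lemma dist_conv_symmetric:
 fixes k l :: "'n::finite fn"
 assumes w: "w:tempered" and k: "k:schwartz" and l: "l:schwartz"
 shows "(LINT y|lborel. dist_conv w k y * l (x - y)) = (LINT y|lborel. dist_conv w l y * k (x - y))"
proof -
 have "correlate (%y. l (x - y)) k = correlate (%y. k (x - y)) l"
 proof
  fix z
  have [measurable]: "k:borel_measurable borel" "l:borel_measurable borel" using k l smooth_measurable schwartz_smooth by auto
  have "correlate (%y. l (x - y)) k z = (LINT y|lborel. l (x - (z + y)) * k y)" by (simp add: correlate_def)
  also have "... = (LINT y|lborel. l (x - (z + ((x - z) - y))) * k ((x - z) - y))"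
   by (rule integral_lborel_reflect) measurable
  also have "... = correlate (%y. k (x - y)) l z" by (simp add: correlate_def algebra_simps)
  finally show "correlate (%y. l (x - y)) k z = correlate (%y. k (x - y)) l z" .
 qed
 then show ?thesis
  unfolding dist_conv_pairing[OF w k schwartz_reflect[OF l]] dist_conv_pairing[OF w l schwartz_reflect[OF k]] by simp
qed

section \<open>Asymptotic estimates and nets\<close>

text \<open>An estimate uniform on \<open>K\<close> with a real constant. \<open>K\<close> ranges
  over sets of points, over sets of pairs of a list and a point, and over a one-element set for nets
  of numbers.\<close>

definition uO :: "'a set => (real => 'a => complex) => real => bool" where
 "uO K F b \<longleftrightarrow> (EX C>=0. EV e. ALL x:K. cmod (F e x) <= C * e powr b)"

lemma EV_unit: "EV e. 0 < e & e < 1"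
 using eventually_at_right_real[of 0 1] by (auto elim: eventually_mono)

lemma uOI:
 assumes "!!e x. 0 < e ==> e < 1 ==> x:K ==> cmod (F e x) <= C * e powr b"
 shows "uO K F b"
proof -
 have "EV e. ALL x:K. cmod (F e x) <= \<bar>C\<bar> * e powr b"
  using EV_unit
 proof eventually_elim
  case (elim e)
  have "C * e powr b <= \<bar>C\<bar> * e powr b" by (intro mult_right_mono) auto
  then show ?case using assms elim by (meson order_trans)
 qed
 then show ?thesis unfolding uO_def by (intro exI[of _ "\<bar>C\<bar>"]) simp
qed

lemma uOE:
 assumes "uO K F b"
 obtains C where "0 <= C" "EV e. 0 < e & e < 1 & (ALL x:K. cmod (F e x) <= C * e powr b)"
proof -
 from assms obtain C where C: "0 <= C" "EV e. ALL x:K. cmod (F e x) <= C * e powr b"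
  unfolding uO_def by blast
 have "EV e. 0 < e & e < 1 & (ALL x:K. cmod (F e x) <= C * e powr b)"
  using C(2) EV_unit by eventually_elim simp
 with C(1) show ?thesis using that by blast
qed

lemma uO_eventuallyI:
 assumes "EV e. ALL x:K. cmod (F e x) <= C * e powr b"
 shows "uO K F b"
proof -
 have "EV e. ALL x:K. cmod (F e x) <= \<bar>C\<bar> * e powr b"
  using assms
 proof eventually_elim
  case (elim e)
  have "C * e powr b <= \<bar>C\<bar> * e powr b" by (intro mult_right_mono) auto
  then show ?case using elim by (meson order_trans)
 qed
 then show ?thesis unfolding uO_def by (intro exI[of _ "\<bar>C\<bar>"]) simp
qed

text \<open>The dominating value may be taken at another point of another set. This covers subsets,
  congruence, scalar factors and evaluation at maximum points.\<close>

lemma uO_dominated: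
 assumes "uO L H b" "0 <= c"
  and "!!e x. 0 < e ==> e < 1 ==> x:K ==> EX y:L. cmod (F e x) <= c * cmod (H e y)"
 shows "uO K F b"
proof -
 from assms(1) obtain C where C: "0 <= C" "EV e. 0 < e & e < 1 & (ALL x:L. cmod (H e x) <= C * e powr b)"
  by (rule uOE)
 have "EV e. ALL x:K. cmod (F e x) <= (c * C) * e powr b"
  using C(2)
 proof eventually_elim
  case (elim e)
  show ?case
  proof
   fix x assume "x:K"
   then obtain y where "y:L" "cmod (F e x) <= c * cmod (H e y)" using assms(3) elim by blast
   moreover have "c * cmod (H e y) <= c * (C * e powr b)" using elim \<open>y:L\<close> assms(2) by (intro mult_left_mono) auto
   ultimately show "cmod (F e x) <= (c * C) * e powr b" by simp
  qed
 qed
 then show ?thesis by (rule uO_eventuallyI)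
qed

lemma uO_mono: "uO K F a ==> b <= a ==> uO K F b"
proof (erule uOE)
 fix C assume C: "0 <= C" "EV e. 0 < e & e < 1 & (ALL x:K. cmod (F e x) <= C * e powr a)" and "b <= a"
 have "EV e. ALL x:K. cmod (F e x) <= C * e powr b"
  using C(2)
 proof eventually_elim
  case (elim e)
  have "C * e powr a <= C * e powr b" using elim C(1) \<open>b <= a\<close> by (intro mult_left_mono powr_mono') auto
  then show ?case using elim by (meson order_trans)
 qed
 then show ?thesis by (rule uO_eventuallyI)
qed

lemma uO_subset: "uO K F a ==> L <= K ==> uO L F a"
 by (rule uO_dominated[of K F a 1]) auto

lemma uO_add:
 assumes "uO K F b" "uO K H b" shows "uO K (%e x. F e x + H e x) b"
proof -
 from assms(1) obtain C where C: "0 <= C" "EV e. 0 < e & e < 1 & (ALL x:K. cmod (F e x) <= C * e powr b)" by (rule uOE)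
 from assms(2) obtain D where D: "0 <= D" "EV e. 0 < e & e < 1 & (ALL x:K. cmod (H e x) <= D * e powr b)" by (rule uOE)
 have "EV e. ALL x:K. cmod (F e x + H e x) <= (C + D) * e powr b"
  using C(2) D(2)
 proof eventually_elim
  case (elim e)
  then show ?case using norm_triangle_mono unfolding distrib_right by blast
 qed
 then show ?thesis by (rule uO_eventuallyI)
qed

lemma uO_mult:
 assumes "uO K F a" "uO K H b" shows "uO K (%e x. F e x * H e x) (a + b)"
proof -
 from assms(1) obtain C where C: "0 <= C" "EV e. 0 < e & e < 1 & (ALL x:K. cmod (F e x) <= C * e powr a)" by (rule uOE)
 from assms(2) obtain D where D: "0 <= D" "EV e. 0 < e & e < 1 & (ALL x:K. cmod (H e x) <= D * e powr b)" by (rule uOE)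
 have "EV e. ALL x:K. cmod (F e x * H e x) <= (C * D) * e powr (a + b)"
  using C(2) D(2)
 proof eventually_elim
  case (elim e)
  show ?case
  proof
   fix x assume "x:K"
   then have "cmod (F e x) * cmod (H e x) <= (C * e powr a) * (D * e powr b)"
    using elim C(1) by (intro mult_mono) auto
   then show "cmod (F e x * H e x) <= (C * D) * e powr (a + b)"
    by (simp add: norm_mult powr_add mult_ac)
  qed
 qed
 then show ?thesis by (rule uO_eventuallyI)
qed

lemma uO_const_net: "uO K (%e x. f x) 0" if "!!x. x:K ==> cmod (f x) <= C"
 by (rule uOI[of _ _ C]) (use that in auto)

lemma uO_cmult: "uO K F b ==> uO K (%e x. c * F e x) b"
 by (rule uO_dominated[of K F b "cmod c"]) (auto simp: norm_mult)

lemma uO_diff: "uO K F b ==> uO K H b ==> uO K (%e x. F e x - H e x) b"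
 using uO_add[of K F b "%e x. - 1 * H e x"] uO_cmult[of K H b "-1"] by simp

lemma uO_zero: "uO K (%_ _. 0) b"
 by (rule uOI[of _ _ 0]) auto

lemma uO_cong:
 "uO K F b ==> (!!e x. 0 < e ==> e < 1 ==> x:K ==> F e x = H e x) ==> uO K H b"
 by (rule uO_dominated[of K F b 1]) auto

lemma uO_Un: assumes "uO K F b" "uO L F b" shows "uO (K \<union> L) F b"
proof -
 from assms(1) obtain C where C: "0 <= C" "EV e. 0 < e & e < 1 & (ALL x:K. cmod (F e x) <= C * e powr b)" by (rule uOE)
 from assms(2) obtain D where D: "0 <= D" "EV e. 0 < e & e < 1 & (ALL x:L. cmod (F e x) <= D * e powr b)" by (rule uOE)
 have "EV e. ALL x:K \<union> L. cmod (F e x) <= (C + D) * e powr b"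
  using C(2) D(2)
 proof eventually_elim
  case (elim e)
  have "C * e powr b <= (C + D) * e powr b" "D * e powr b <= (C + D) * e powr b"
   using C(1) D(1) by (auto intro!: mult_right_mono)
  then show ?case using elim by (auto intro: order_trans)
 qed
 then show ?thesis by (rule uO_eventuallyI)
qed

lemma uO_UN: "finite I ==> (!!i. i:I ==> uO (K i) F b) ==> uO (\<Union>i\<in>I. K i) F b"
proof (induction I rule: finite_induct)
 case empty
 then show ?case by (auto intro: uOI)
next
 case (insert i I)
 then show ?case using uO_Un[of "K i" F b "\<Union>i\<in>I. K i"] by simp
qed

definition umod :: "'a set => (real => 'a => complex) => bool" where
 "umod K F \<longleftrightarrow> (EX N::nat. uO K F (- real N))"

definition unegl :: "'a set => (real => 'a => complex) => bool" where
 "unegl K F \<longleftrightarrow> (ALL q::nat. uO K F (real q))"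

lemma unegl_uO: "unegl K F ==> uO K F b"
proof -
 assume "unegl K F"
 then have "uO K F (real (nat \<lceil>b\<rceil>))" by (simp add: unegl_def)
 then show ?thesis by (rule uO_mono) linarith
qed

lemma uneglI: "(!!q::nat. uO K F (real q)) ==> unegl K F"
 by (simp add: unegl_def)

lemma umodI: "uO K F b ==> umod K F"
proof -
 assume "uO K F b"
 then have "uO K F (- real (nat \<lceil>- b\<rceil>))" by (rule uO_mono) linarith
 then show ?thesis by (auto simp: umod_def)
qed

lemma unegl_imp_umod: "unegl K F ==> umod K F"
 by (rule umodI[OF unegl_uO])

lemma unegl_add: "unegl K F ==> unegl K H ==> unegl K (%e x. F e x + H e x)"
 and unegl_diff: "unegl K F ==> unegl K H ==> unegl K (%e x. F e x - H e x)"
 and unegl_cmult: "unegl K F ==> unegl K (%e x. c * F e x)"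
 and unegl_subset: "unegl K F ==> L <= K ==> unegl L F"
 and unegl_zero: "unegl K (%_ _. 0)"
 and unegl_cong: "unegl K F ==> (!!e x. 0 < e ==> e < 1 ==> x:K ==> F e x = H e x) ==> unegl K H"
 and unegl_UN: "finite I ==> (!!i. i:I ==> unegl (M i) F) ==> unegl (\<Union>i\<in>I. M i) F"
 unfolding unegl_def by (simp_all add: uO_add uO_diff uO_cmult uO_zero uO_UN) (blast intro: uO_subset, rule allI, erule allE, erule uO_cong, simp)

lemma umod_add: "umod K F ==> umod K H ==> umod K (%e x. F e x + H e x)"
proof -
 assume "umod K F" "umod K H"
 then obtain M N :: nat where *: "uO K F (- real M)" "uO K H (- real N)" by (auto simp: umod_def)
 have "uO K F (- real (max M N))" "uO K H (- real (max M N))"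
  by (rule uO_mono[OF *(1)], simp, rule uO_mono[OF *(2)], simp)
 then show ?thesis by (intro umodI uO_add)
qed

lemma umod_mult: "umod K F ==> umod K H ==> umod K (%e x. F e x * H e x)"
 unfolding umod_def[of _ F] umod_def[of _ H] by (blast intro: umodI uO_mult)

lemma umod_cong: "umod K F ==> (!!e x. 0 < e ==> e < 1 ==> x:K ==> F e x = H e x) ==> umod K H"
proof -
 assume a: "umod K F" "!!e x. 0 < e ==> e < 1 ==> x:K ==> F e x = H e x"
 then obtain N :: nat where "uO K F (- real N)" by (auto simp: umod_def)
 then have "uO K H (- real N)" by (rule uO_cong) (rule a(2))
 then show ?thesis by (rule umodI)
qed

lemma unegl_mult: "unegl K F ==> umod K H ==> unegl K (%e x. F e x * H e x)"
proof (rule uneglI)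
 fix q :: nat
 assume "unegl K F" "umod K H"
 then obtain N :: nat where "uO K H (- real N)" by (auto simp: umod_def)
 moreover have "uO K F (real (q + N))" by (rule unegl_uO[OF \<open>unegl K F\<close>])
 ultimately show "uO K (%e x. F e x * H e x) (real q)" using uO_mult[of K F "real (q + N)" H "- real N"] by simp
qed

section \<open>Numbers and suprema expressed by uniform estimates\<close>

lemma bigO_eps_num_iff: "bigO_eps (%e. ennreal (cmod (z e))) b \<longleftrightarrow> uO (UNIV :: unit set) (%e _. z e) b"
 by (auto simp: bigO_eps_cmod_iff uO_def)

lemma negl_num_iff: "negligible_num z \<longleftrightarrow> unegl (UNIV :: unit set) (%e _. z e)"
 by (simp add: negligible_num_def unegl_def bigO_eps_num_iff)

lemma mod_num_iff: "moderate_num z \<longleftrightarrow> umod (UNIV :: unit set) (%e _. z e)"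
 by (simp add: moderate_num_def umod_def bigO_eps_num_iff)

lemma num_uO_lift: "uO (UNIV :: unit set) (%e _. z e) b ==> uO K (%e _. z e) b"
 by (rule uO_dominated[of UNIV "%e _. z e" b 1]) auto

lemma negl_num_cong:
 "negligible_num z ==> (!!e. 0 < e ==> e < 1 ==> z e = z' e) ==> negligible_num z'"
 unfolding negl_num_iff by (erule unegl_cong) auto

lemma bigO_SUP_iff: "bigO_eps (%e. SUP x\<in>K. ennreal (cmod (F e x))) b \<longleftrightarrow> uO K F b"
proof
 assume "bigO_eps (%e. SUP x\<in>K. ennreal (cmod (F e x))) b"
 then obtain C where C: "EV e. (SUP x\<in>K. ennreal (cmod (F e x))) <= ennreal (C * e powr b)"
  by (auto simp: bigO_eps_def)
 have "EV e. ALL x:K. cmod (F e x) <= \<bar>C\<bar> * e powr b"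
  using C
 proof eventually_elim
  case (elim e)
  have "C * e powr b <= \<bar>C\<bar> * e powr b" by (intro mult_right_mono) auto
  then have "(SUP x\<in>K. ennreal (cmod (F e x))) <= ennreal (\<bar>C\<bar> * e powr b)"
   using elim by (meson ennreal_leI order_trans)
  then show ?case by (subst (asm) SUP_ennreal_le_iff) auto
 qed
 then show "uO K F b" by (rule uO_eventuallyI)
next
 assume "uO K F b"
 then obtain C where C: "0 <= C" "EV e. 0 < e & e < 1 & (ALL x:K. cmod (F e x) <= C * e powr b)" by (rule uOE)
 have "EV e. (SUP x\<in>K. ennreal (cmod (F e x))) <= ennreal (C * e powr b)"
  using C(2) by eventually_elim (use C(1) in \<open>subst SUP_ennreal_le_iff, auto\<close>)
 then show "bigO_eps (%e. SUP x\<in>K. ennreal (cmod (F e x))) b" by (auto simp: bigO_eps_def)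
qed

section \<open>Moderate, negligible and regular nets of smooth functions\<close>

definition smooth_nets :: "(real^'n::finite) set => 'n net set" where
 "smooth_nets X = {u. ALL e:{0<..1}. smooth_on X (u e)}"

lemma smooth_netsD: "u:smooth_nets X ==> 0 < e ==> e <= 1 ==> smooth_on X (u e)"
 by (simp add: smooth_nets_def)

lemma uO_multi_deriv_iff:
 assumes "open X" "u:smooth_nets X" "K <= X"
 shows "uO K (%e. ideriv is (u e)) b \<longleftrightarrow> uO K (%e. multi_deriv (count (mset is)) (u e)) b"
proof -
 have "ideriv is (u e) x = multi_deriv (count (mset is)) (u e) x" if "0 < e" "e < 1" "x:K" for e x
  by (rule ideriv_multi_deriv[OF assms(1) smooth_netsD[OF assms(2)]]) (use that assms(3) in auto)
 note eq = this
 show ?thesis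
 proof
  show "uO K (%e. multi_deriv (count (mset is)) (u e)) b" if "uO K (%e. ideriv is (u e)) b"
   using that by (rule uO_cong) (rule eq)
  show "uO K (%e. ideriv is (u e)) b" if "uO K (%e. multi_deriv (count (mset is)) (u e)) b"
   using that by (rule uO_cong) (rule eq[symmetric])
 qed
qed

lemma all_multi_deriv_iff:
 assumes "!!is. Q (%e. ideriv is (u e)) \<longleftrightarrow> Q (%e. multi_deriv (count (mset is)) (u e))"
 shows "(ALL \<alpha>. Q (%e. multi_deriv \<alpha> (u e))) \<longleftrightarrow> (ALL is. Q (%e. ideriv is (u e)))"
proof
 show "ALL is. Q (%e. ideriv is (u e))" if "ALL \<alpha>. Q (%e. multi_deriv \<alpha> (u e))"
  using that assms by simp
 show "ALL \<alpha>. Q (%e. multi_deriv \<alpha> (u e))" if "ALL is. Q (%e. ideriv is (u e))"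
  using that unfolding multi_deriv_ideriv by simp
qed

lemma E_M_iff:
 assumes "open X"
 shows "u:E_M X \<longleftrightarrow> u:smooth_nets X & (ALL K is. compact K & K <= X --> umod K (%e. ideriv is (u e)))"
proof -
 have "(ALL \<alpha>. umod K (%e. multi_deriv \<alpha> (u e))) \<longleftrightarrow> (ALL is. umod K (%e. ideriv is (u e)))" if "u:smooth_nets X" "K <= X" for K
  by (rule all_multi_deriv_iff[of "umod K"]) (simp add: umod_def uO_multi_deriv_iff[OF assms that])
 note eq = this
 have "u:E_M X \<longleftrightarrow> u:smooth_nets X & (ALL K. compact K & K <= X --> (ALL \<alpha>. umod K (%e. multi_deriv \<alpha> (u e))))"
  unfolding E_M_def nets_in_def smooth_nets_def bigO_SUP_iff umod_def[symmetric] mem_Collect_eq by blast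
 also have "... \<longleftrightarrow> u:smooth_nets X & (ALL K. compact K & K <= X --> (ALL is. umod K (%e. ideriv is (u e))))"
  by (intro conj_cong refl all_cong1 imp_cong) (simp add: eq)
 finally show ?thesis by simp
qed

lemma N_M_iff:
 assumes "open X"
 shows "u:N_M X \<longleftrightarrow> u:smooth_nets X & (ALL K is. compact K & K <= X --> unegl K (%e. ideriv is (u e)))"
proof -
 have "(ALL \<alpha>. unegl K (%e. multi_deriv \<alpha> (u e))) \<longleftrightarrow> (ALL is. unegl K (%e. ideriv is (u e)))" if "u:smooth_nets X" "K <= X" for K
  by (rule all_multi_deriv_iff[of "unegl K"]) (simp add: unegl_def uO_multi_deriv_iff[OF assms that])
 then have "(ALL \<alpha> q::nat. uO K (%e. multi_deriv \<alpha> (u e)) (real q)) \<longleftrightarrow> (ALL is. unegl K (%e. ideriv is (u e)))" if "u:smooth_nets X" "K <= X" for K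
  using that unfolding unegl_def by simp
 note eq = this
 have "u:N_M X \<longleftrightarrow> u:smooth_nets X & (ALL K. compact K & K <= X --> (ALL \<alpha> q::nat. uO K (%e. multi_deriv \<alpha> (u e)) (real q)))"
  unfolding N_M_def nets_in_def smooth_nets_def bigO_SUP_iff mem_Collect_eq by blast
 also have "... \<longleftrightarrow> u:smooth_nets X & (ALL K. compact K & K <= X --> (ALL is. unegl K (%e. ideriv is (u e))))"
  by (intro conj_cong refl all_cong1 imp_cong) (simp add: eq)
 finally show ?thesis by simp
qed

lemma E_M_inf_iff:
 assumes "open X"
 shows "u:E_M_inf X \<longleftrightarrow> u:smooth_nets X & (ALL K. compact K & K <= X --> (EX N::nat. ALL is. uO K (%e. ideriv is (u e)) (- real N)))"
proof -
 have "(ALL \<alpha>. uO K (%e. multi_deriv \<alpha> (u e)) b) \<longleftrightarrow> (ALL is. uO K (%e. ideriv is (u e)) b)" if "u:smooth_nets X" "K <= X" for K b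
  by (rule all_multi_deriv_iff[of "%F. uO K F b"]) (rule uO_multi_deriv_iff[OF assms that])
 note eq = this have "u:E_M_inf X \<longleftrightarrow> u:smooth_nets X & (ALL K. compact K & K <= X --> (EX N::nat. ALL \<alpha>. uO K (%e. multi_deriv \<alpha> (u e)) (- real N)))"
  unfolding E_M_inf_def nets_in_def smooth_nets_def bigO_SUP_iff mem_Collect_eq by blast
 also have "... \<longleftrightarrow> u:smooth_nets X & (ALL K. compact K & K <= X --> (EX N::nat. ALL is. uO K (%e. ideriv is (u e)) (- real N)))"
  by (intro conj_cong refl all_cong1 imp_cong) (simp add: eq)
 finally show ?thesis .
qed

lemma E_M_smooth: "open X ==> u:E_M X ==> u:smooth_nets X"
 by (simp add: E_M_iff)

lemma E_M_umod: "open X ==> u:E_M X ==> compact K ==> K <= X ==> umod K (%e. ideriv is (u e))"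
 by (simp add: E_M_iff)

lemma N_M_unegl: "open X ==> u:N_M X ==> compact K ==> K <= X ==> unegl K (%e. ideriv is (u e))"
 by (simp add: N_M_iff)

lemma N_M_subset_E_M: "open X ==> N_M X <= E_M X"
 by (auto simp: E_M_iff N_M_iff) (rule unegl_imp_umod, simp)

lemma E_M_inf_subset_E_M: "open X ==> E_M_inf X <= E_M X"
proof
 fix u assume X: "open X" and u: "u:E_M_inf X"
 show "u:E_M X"
  unfolding E_M_iff[OF X]
 proof (intro conjI allI impI)
  show "u:smooth_nets X" using u by (simp add: E_M_inf_iff[OF X])
  fix K "is" assume "compact K & K <= X"
  then obtain N :: nat where "ALL is. uO K (%e. ideriv is (u e)) (- real N)" using u unfolding E_M_inf_iff[OF X] by blast
  then show "umod K (%e. ideriv is (u e))" by (intro umodI) blast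
 qed
qed

lemma net_restrict:
 assumes "open X" "open V" "V <= X"
 shows "u:E_M X ==> u:E_M V" "u:N_M X ==> u:N_M V" "u:E_M_inf X ==> u:E_M_inf V"
 using assms(3) unfolding E_M_iff[OF assms(1)] E_M_iff[OF assms(2)] N_M_iff[OF assms(1)] N_M_iff[OF assms(2)]
  E_M_inf_iff[OF assms(1)] E_M_inf_iff[OF assms(2)] smooth_nets_def
 by (auto intro: smooth_on_subset)

section \<open>Negligibility from estimates of order zero\<close>

lemma landau_bound:
 fixes v :: "'n::finite fn"
 assumes "smooth_on X v" "cball x \<delta> <= X" "0 < t" "t <= \<delta>"
  and A: "!!y. y:cball x \<delta> ==> cmod (v y) <= A"
  and B: "!!y. y:cball x \<delta> ==> cmod (pd i (pd i v) y) <= B"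
 shows "cmod (pd i v x) <= 2 * A / t + B * t"
proof -
 let ?e = "axis i (1::real)"
 have inb: "x + \<tau> *\<^sub>R ?e:cball x \<delta>" if "\<bar>\<tau>\<bar> <= t" for \<tau>
  using that assms(4) by (simp add: dist_norm)
 have hp: "has_partial i v (pd i v y) y" "has_partial i (pd i v) (pd i (pd i v) y) y"
  if "y:cball x \<delta>" for y
  using that assms(2) smooth_on_has_partial[OF assms(1)] smooth_on_has_partial[OF smooth_on_partial[OF assms(1)]] by blast+
 have d1: "cmod (pd i v (x + \<tau> *\<^sub>R ?e) - pd i v x) <= B * t" if \<tau>: "\<bar>\<tau>\<bar> <= t" for \<tau>
 proof -
  have "cmod (pd i v (x + \<tau> *\<^sub>R ?e) - pd i v x - of_real \<tau> * 0) <= B * \<bar>\<tau>\<bar>"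
  proof (rule mvt_partial[where f' = "pd i (pd i v)"])
   fix \<sigma> assume "\<bar>\<sigma>\<bar> <= \<bar>\<tau>\<bar>"
   then have "x + \<sigma> *\<^sub>R ?e:cball x \<delta>" using inb \<tau> by simp
   then show "has_partial i (pd i v) (pd i (pd i v) (x + \<sigma> *\<^sub>R ?e)) (x + \<sigma> *\<^sub>R ?e)"
    "cmod (pd i (pd i v) (x + \<sigma> *\<^sub>R ?e) - 0) <= B"
    using hp B by auto
  qed
  also have "... <= B * t" using \<tau> order_trans[OF norm_ge_zero B[of x]] assms(3,4) by (intro mult_left_mono) auto
  finally show ?thesis by simp
 qed
 \<comment> \<open>The first order expansion is solved for the derivative: the values contribute
   \<open>2 * A / t\<close>, the remainder \<open>B * t\<close>.\<close>
 have "cmod (v (x + t *\<^sub>R ?e) - v x - of_real t * pd i v x) <= (B * t) * \<bar>t\<bar>"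
  by (rule mvt_partial[where f' = "pd i v"]) (use d1 hp inb assms(3) in auto)
 moreover have "cmod (v (x + t *\<^sub>R ?e)) <= A" "cmod (v x) <= A" using A inb[of t] inb[of 0] assms(3) by auto
 ultimately have "cmod (of_real t * pd i v x) <= 2 * A + (B * t) * t"
  using assms(3) norm_triangle_ineq4[of "v (x + t *\<^sub>R ?e) - v x" "v (x + t *\<^sub>R ?e) - v x - of_real t * pd i v x"]
   norm_triangle_ineq4[of "v (x + t *\<^sub>R ?e)" "v x"] by simp
 then have "t * cmod (pd i v x) <= 2 * A + (B * t) * t" using assms(3) by (simp add: norm_mult)
 then show ?thesis using assms(3) by (simp add: field_simps)
qed

lemma compact_thicken:
 fixes K :: "'a::euclidean_space set"
 assumes "compact K" "open S" "K <= S"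
 obtains \<delta> where "0 < \<delta>" "compact (\<Union>x\<in>K. cball x \<delta>)" "(\<Union>x\<in>K. cball x \<delta>) <= S"
proof -
 obtain \<delta> where \<delta>: "\<delta> > 0" "(\<Union>x\<in>K. cball x \<delta>) <= S"
  using compact_subset_open_imp_cball_epsilon_subset[OF assms] by blast
 have "(\<Union>x\<in>K. cball x \<delta>) = {x + y | x y. x:K & y:cball 0 \<delta>}"
 proof safe
  fix a x assume "x:K" "a:cball x \<delta>"
  then show "EX xa y. a = xa + y & xa:K & y:cball 0 \<delta>"
   by (intro exI[of _ x] exI[of _ "a - x"]) (auto simp: dist_norm norm_minus_commute)
 next
  fix x y assume "x:K" "y:cball (0::'a) \<delta>"
  then show "x + y : (\<Union>x\<in>K. cball x \<delta>)" by (intro UN_I[of x]) (auto simp: dist_norm)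
 qed
 then have "compact (\<Union>x\<in>K. cball x \<delta>)" using compact_sums[OF assms(1) compact_cball, of 0 \<delta>] by simp
 with \<delta> show ?thesis using that by blast
qed

lemma unegl_partial:
 fixes v :: "'n::finite net"
 assumes X: "open X" and v: "v:smooth_nets X" and K: "compact K" "K <= X"
  and n: "!!K. compact K ==> K <= X ==> unegl K v"
  and m: "!!K. compact K ==> K <= X ==> umod K (%e. pd i (pd i (v e)))"
 shows "unegl K (%e. pd i (v e))"
proof (rule uneglI)
 fix q :: nat
 obtain \<delta> where \<delta>: "0 < \<delta>" "compact (\<Union>x\<in>K. cball x \<delta>)" "(\<Union>x\<in>K. cball x \<delta>) <= X"
  using compact_thicken[OF K(1) X K(2)] .
 let ?L = "\<Union>x\<in>K. cball x \<delta>"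
 obtain N :: nat where N: "uO ?L (%e. pd i (pd i (v e))) (- real N)"
  using m[OF \<delta>(2,3)] by (auto simp: umod_def)
 then obtain B where B: "0 <= B" "EV e. 0 < e & e < 1 & (ALL x:?L. cmod (pd i (pd i (v e)) x) <= B * e powr (- real N))"
  by (rule uOE)
 \<comment> \<open>The step in the interpolation is \<open>t = e powr s\<close>: values of order
   \<open>q + s\<close> give \<open>e powr q\<close> after division by \<open>t\<close>, and second
   derivatives of order \<open>- N\<close> give \<open>e powr (q + 1)\<close>.\<close>
 define s where "s = real q + real N + 1"
 have "uO ?L v (real q + s)" by (rule unegl_uO[OF n[OF \<delta>(2,3)]])
 then obtain A where A: "0 <= A" "EV e. 0 < e & e < 1 & (ALL x:?L. cmod (v e x) <= A * e powr (real q + s))"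
  by (rule uOE)
 have "((%e::real. e powr s) \<longlongrightarrow> 0 powr s) (at_right 0)"
  by (rule tendsto_powr') (auto intro!: tendsto_intros simp: s_def eventually_at_right_less[THEN eventually_mono] less_imp_le)
 then have "\<forall>\<^sub>F e::real in at_right 0. e powr s < \<delta>"
  using \<delta>(1) by (auto dest!: order_tendstoD(2)[of _ _ _ \<delta>])
 then have "EV e. ALL x:K. cmod (pd i (v e) x) <= (2 * A + B) * e powr real q"
  using A(2) B(2)
 proof eventually_elim
  case (elim e)
  show ?case
  proof
   fix x assume x: "x:K"
   have "cmod (pd i (v e) x) <= 2 * (A * e powr (real q + s)) / e powr s + (B * e powr (- real N)) * e powr s"
   proof (rule landau_bound[of X _ _ \<delta>])
    show "smooth_on X (v e)" using smooth_netsD[OF v] elim by simp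
   qed (use elim x \<delta> in auto)
   also have "2 * (A * e powr (real q + s)) / e powr s = 2 * A * e powr real q"
    using elim by (simp add: powr_add)
   also have "(B * e powr (- real N)) * e powr s <= B * e powr real q"
   proof -
    have "(B * e powr (- real N)) * e powr s = B * e powr (real q + 1)"
     using elim by (simp add: s_def powr_add[symmetric])
    also have "... <= B * e powr real q" using elim B(1) by (intro mult_left_mono powr_mono') auto
    finally show ?thesis .
   qed
   finally show "cmod (pd i (v e) x) <= (2 * A + B) * e powr real q"
    by (simp add: distrib_right)
  qed
 qed
 then show "uO K (%e. pd i (v e)) (real q)" by (rule uO_eventuallyI)
qed

text \<open>Negligible values and moderate second derivatives force negligible first derivatives;
  repeating this along the list of directions reaches every order. Negligibility of a moderate net
  can henceforth be checked on its values.\<close>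

lemma N_M_zeroth_order:
 fixes u :: "'n::finite net"
 assumes X: "open X" and u: "u:E_M X" and n: "!!K. compact K ==> K <= X ==> unegl K u"
 shows "u:N_M X"
proof -
 have "ALL K. compact K & K <= X --> unegl K (%e. ideriv is (u e))" for "is"
 proof (induction "is")
  case Nil
  then show ?case using n by simp
 next
  case (Cons i "is")
  have sm: "(%e. ideriv is (u e)) : smooth_nets X"
   using E_M_smooth[OF X u] by (simp add: smooth_nets_def smooth_on_ideriv)
  show ?case
   unfolding ideriv_Cons
  proof (intro allI impI, elim conjE)
   fix K assume K: "compact K" "K <= X"
   show "unegl K (%e. pd i (ideriv is (u e)))"
   proof (rule unegl_partial[OF X sm K])
    fix L assume L: "compact L" "L <= X"
    show "unegl L (%e. ideriv is (u e))" using Cons L by blast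
    show "umod L (%e. pd i (pd i (ideriv is (u e))))"
     using E_M_umod[OF X u L, of "i # i # is"] by (simp add: ideriv_Cons)
   qed
  qed
 qed
 then show ?thesis using E_M_smooth[OF X u] by (simp add: N_M_iff[OF X])
qed

section \<open>Algebraic operations on nets\<close>

lemma smooth_nets_add: "open X ==> u:smooth_nets X ==> v:smooth_nets X ==> (%e x. u e x + v e x) : smooth_nets X"
 and smooth_nets_mult: "open X ==> u:smooth_nets X ==> v:smooth_nets X ==> (%e x. u e x * v e x) : smooth_nets X"
 and smooth_nets_scale: "open X ==> u:smooth_nets X ==> (%e x. z e * u e x) : smooth_nets X"
 by (auto simp: smooth_nets_def intro: smooth_on_add smooth_on_mult smooth_on_cmult)

lemma E_M_add:
 assumes X: "open X" and uv: "u:E_M X" "v:E_M X" shows "(%e x. u e x + v e x) : E_M X"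
 unfolding E_M_iff[OF X]
proof (intro conjI allI impI)
 show "(%e x. u e x + v e x) : smooth_nets X" using smooth_nets_add[OF X] uv E_M_smooth[OF X] by blast
 fix K "is" assume K: "compact K & K <= X"
 have "umod K (%e x. ideriv is (u e) x + ideriv is (v e) x)" using K by (intro umod_add E_M_umod[OF X] uv) auto
 then show "umod K (%e. ideriv is (%x. u e x + v e x))"
  by (rule umod_cong) (use K uv E_M_smooth[OF X] in \<open>auto intro!: ideriv_add[OF X, symmetric] smooth_netsD\<close>)
qed

lemma E_M_scale:
 assumes X: "open X" and u: "u:E_M X" and z: "moderate_num z" shows "(%e x. z e * u e x) : E_M X"
 unfolding E_M_iff[OF X]
proof (intro conjI allI impI)
 show "(%e x. z e * u e x) : smooth_nets X" using smooth_nets_scale[OF X] u E_M_smooth[OF X] by blast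
 fix K "is" assume K: "compact K & K <= X"
 have "umod K (%e _. z e)" using z num_uO_lift unfolding mod_num_iff umod_def by blast
 then have "umod K (%e x. z e * ideriv is (u e) x)" using K by (intro umod_mult E_M_umod[OF X] u) auto
 then show "umod K (%e. ideriv is (%x. z e * u e x))"
  by (rule umod_cong) (use K u E_M_smooth[OF X] in \<open>auto intro!: ideriv_cmult[OF X, symmetric] smooth_netsD\<close>)
qed

lemma uO_all_lists:
 fixes F :: "'n::finite list => real => 'a => complex"
 assumes "!!is. length is <= k ==> uO K (F is) b"
 obtains C where "0 <= C" "EV e. 0 < e & e < 1 & (ALL is. length is <= k --> (ALL x:K. cmod (F is e x) <= C * e powr b))"
proof -
 have fin: "finite {is :: 'n list. length is <= k}" using finite_lists_length_le[of "UNIV :: 'n set" k] by simp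
 \<comment> \<open>Making the list part of the point turns finitely many estimates into one on a
   finite union, hence with one constant.\<close>
 have "uO (\<Union>is\<in>{is. length is <= k}. {is} \<times> K) (%e p. F (fst p) e (snd p)) b"
 proof (rule uO_UN[OF fin])
  fix "is" :: "'n list" assume "is : {is. length is <= k}"
  then have "uO K (F is) b" using assms by simp
  then show "uO ({is} \<times> K) (%e p. F (fst p) e (snd p)) b"
   by (rule uO_dominated[of _ _ _ 1]) auto
 qed
 then obtain C where C: "0 <= C" "EV e. 0 < e & e < 1 & (ALL p:(\<Union>is\<in>{is. length is <= k}. {is} \<times> K). cmod (F (fst p) e (snd p)) <= C * e powr b)"
  by (rule uOE)
 have "EV e. 0 < e & e < 1 & (ALL is. length is <= k --> (ALL x:K. cmod (F is e x) <= C * e powr b))"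
  using C(2)
 proof eventually_elim
  case (elim e)
  have "cmod (F is e x) <= C * e powr b" if "length is <= k" "x:K" for "is" x
   using bspec[OF conjunct2[OF conjunct2[OF elim]], of "(is, x)"] that by auto
  then show ?case using elim by simp
 qed
 with C(1) show ?thesis by (rule that)
qed

lemma uO_ideriv_mult:
 assumes X: "open X" and uv: "u:smooth_nets X" "v:smooth_nets X" and K: "K <= X"
  and a: "!!js. length js <= length is ==> uO K (%e. ideriv js (u e)) a"
  and b: "!!js. length js <= length is ==> uO K (%e. ideriv js (v e)) b"
 shows "uO K (%e. ideriv is (%x. u e x * v e x)) (a + b)"
proof -
 obtain A where A: "A >= 0" "EV e. 0 < e & e < 1 & (ALL js. length js <= length is --> (ALL x:K. cmod (ideriv js (u e) x) <= A * e powr a))"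
  by (rule uO_all_lists[of "length is" K "%js e. ideriv js (u e)" a, OF a])
 obtain B where B: "B >= 0" "EV e. 0 < e & e < 1 & (ALL js. length js <= length is --> (ALL x:K. cmod (ideriv js (v e) x) <= B * e powr b))"
  by (rule uO_all_lists[of "length is" K "%js e. ideriv js (v e)" b, OF b])
 have "EV e. ALL x:K. cmod (ideriv is (%x. u e x * v e x) x) <= (2 ^ length is * (A * B)) * e powr (a + b)"
  using A(2) B(2)
 proof eventually_elim
  case (elim e)
  show ?case
  proof
   fix x assume x: "x:K"
   have "cmod (ideriv is (%x. u e x * v e x) x) <= 2 ^ length is * ((A * e powr a) * (B * e powr b))"
    by (rule ideriv_mult_bound[OF X]) (use elim x K smooth_netsD[OF uv(1)] smooth_netsD[OF uv(2)] in auto)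
   then show "cmod (ideriv is (%x. u e x * v e x) x) <= (2 ^ length is * (A * B)) * e powr (a + b)"
    by (simp add: powr_add mult_ac)
  qed
 qed
 then show ?thesis by (rule uO_eventuallyI)
qed

lemma umod_all_lists:
 fixes F :: "'n::finite list => real => 'a => complex"
 assumes "!!is. length is <= k ==> umod K (F is)"
 shows "EX N::nat. ALL is. length is <= k --> uO K (F is) (- real N)"
proof -
 have fin: "finite {is :: 'n list. length is <= k}" using finite_lists_length_le[of "UNIV :: 'n set" k] by simp
 have "ALL is:{is. length is <= k}. EX N::nat. uO K (F is) (- real N)" using assms by (auto simp: umod_def)
 then obtain N :: "'n list => nat" where N: "ALL is:{is. length is <= k}. uO K (F is) (- real (N is))" by (rule bchoice[THEN exE])
 show ?thesis
 proof (intro exI[of _ "\<Sum>is\<in>{is. length is <= k}. N is"] allI impI)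
  fix "is" :: "'n list" assume l: "length is <= k"
  then have "N is <= (\<Sum>is\<in>{is. length is <= k}. N is)" by (intro member_le_sum[OF _ _ fin]) simp_all
  then have "- real (\<Sum>is\<in>{is. length is <= k}. N is) <= - real (N is)" by (simp only: neg_le_iff_le of_nat_le_iff)
  moreover have "uO K (F is) (- real (N is))" using N l by blast
  ultimately show "uO K (F is) (- real (\<Sum>is\<in>{is. length is <= k}. N is))" by (rule uO_mono[rotated])
 qed
qed

lemma E_M_mult:
 fixes u v :: "'n::finite net"
 assumes X: "open X" and uv: "u:E_M X" "v:E_M X" shows "(%e x. u e x * v e x) : E_M X"
 unfolding E_M_iff[OF X]
proof (intro conjI allI impI)
 show "(%e x. u e x * v e x) : smooth_nets X" using smooth_nets_mult[OF X] uv E_M_smooth[OF X] by blast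
 fix K and "is" :: "'n list" assume K: "compact K & K <= X"
 obtain M :: nat where "ALL js. length js <= length is --> uO K (%e. ideriv js (u e)) (- real M)"
  using umod_all_lists[of "length is" K "%js e. ideriv js (u e)"] E_M_umod[OF X uv(1)] K by blast
 moreover obtain N :: nat where "ALL js. length js <= length is --> uO K (%e. ideriv js (v e)) (- real N)"
  using umod_all_lists[of "length is" K "%js e. ideriv js (v e)"] E_M_umod[OF X uv(2)] K by blast
 ultimately have "uO K (%e. ideriv is (%x. u e x * v e x)) (- real M + - real N)"
  using K uv E_M_smooth[OF X] by (intro uO_ideriv_mult[OF X]) auto
 then show "umod K (%e. ideriv is (%x. u e x * v e x))" by (rule umodI)
qed

lemma N_M_mult: 
 assumes X: "open X" and uv: "u:N_M X" "v:E_M X" shows "(%e x. u e x * v e x) : N_M X"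
proof (rule N_M_zeroth_order[OF X])
 show "(%e x. u e x * v e x) : E_M X" using uv N_M_subset_E_M[OF X] by (intro E_M_mult[OF X]) auto
 fix K assume K: "compact K" "K <= X"
 show "unegl K (%e x. u e x * v e x)"
  using N_M_unegl[OF X uv(1) K, of "[]"] E_M_umod[OF X uv(2) K, of "[]"] by (intro unegl_mult) auto
qed

lemma E_M_uminus: "open X ==> v:E_M X ==> (%e x. - v e x) : E_M X"
 using E_M_scale[OF _ _ moderate_num_const[of "-1"], of X v] by simp

lemma E_M_diff: "open X ==> u:E_M X ==> v:E_M X ==> (%e x. u e x - v e x) : E_M X"
 using E_M_add[OF _ _ E_M_uminus[of X v], of u] by simp

lemma N_M_add:
 assumes X: "open X" and uv: "u:N_M X" "v:N_M X" shows "(%e x. u e x + v e x) : N_M X"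
proof (rule N_M_zeroth_order[OF X])
 show "(%e x. u e x + v e x) : E_M X" using uv N_M_subset_E_M[OF X] by (intro E_M_add[OF X]) auto
 fix K assume K: "compact K" "K <= X"
 show "unegl K (%e x. u e x + v e x)"
  using N_M_unegl[OF X uv(1) K, of "[]"] N_M_unegl[OF X uv(2) K, of "[]"] by (intro unegl_add) auto
qed

lemma N_M_scale:
 assumes X: "open X" and u: "u:N_M X" and z: "moderate_num z" shows "(%e x. z e * u e x) : N_M X"
proof (rule N_M_zeroth_order[OF X])
 show "(%e x. z e * u e x) : E_M X" using u z N_M_subset_E_M[OF X] by (intro E_M_scale[OF X]) auto
 fix K assume K: "compact K" "K <= X"
 have "umod K (%e _. z e)" using z num_uO_lift unfolding mod_num_iff umod_def by blast
 then have "unegl K (%e x. u e x * z e)" using N_M_unegl[OF X u K, of "[]"] by (intro unegl_mult) auto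
 then show "unegl K (%e x. z e * u e x)" by (simp add: mult.commute)
qed

lemma N_M_scale_negligible:
 assumes X: "open X" and u: "u:E_M X" and z: "negligible_num z" "moderate_num z" shows "(%e x. z e * u e x) : N_M X"
proof (rule N_M_zeroth_order[OF X])
 show "(%e x. z e * u e x) : E_M X" using u z by (intro E_M_scale[OF X]) auto
 fix K assume K: "compact K" "K <= X"
 have "unegl K (%e _. z e)" using z num_uO_lift unfolding negl_num_iff unegl_def by blast
 then show "unegl K (%e x. z e * u e x)" using E_M_umod[OF X u K, of "[]"] by (intro unegl_mult) auto
qed

lemma N_M_zero: "open X ==> (%e x. 0) : N_M X"
proof -
 assume X: "open X"
 have "ideriv is (%_. 0) = (%_. 0)" for "is" :: "'a list" by (rule ext) (simp add: ideriv_const)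
 then show ?thesis using X by (simp add: N_M_iff smooth_nets_def smooth_on_const unegl_zero)
qed

lemma N_M_diff: "open X ==> u:N_M X ==> v:N_M X ==> (%e x. u e x - v e x) : N_M X"
 using N_M_add[OF _ _ N_M_scale[OF _ _ moderate_num_const[of "-1"], of X v], of u] by simp

text \<open>A negligible net obeys the bound with the exponent of \<open>u\<close> for every
  derivative. Regularity is therefore a property of the class.\<close>

lemma E_M_inf_perturb:
 assumes X: "open X" and u: "u:E_M_inf X" and v: "(%e x. v e x - u e x) : N_M X"
 shows "v:E_M_inf X"
 unfolding E_M_inf_iff[OF X]
proof (intro conjI allI impI)
 have us: "u:smooth_nets X" using u by (simp add: E_M_inf_iff[OF X])
 have ds: "(%e x. v e x - u e x) : smooth_nets X" using v by (simp add: N_M_iff[OF X])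
 show vs: "v:smooth_nets X" using smooth_nets_add[OF X us ds] by simp
 fix K assume K: "compact K & K <= X"
 then have "EX N::nat. ALL is. uO K (%e. ideriv is (u e)) (- real N)" using u unfolding E_M_inf_iff[OF X] by blast
 then obtain N :: nat where N: "!!is. uO K (%e. ideriv is (u e)) (- real N)" by blast
 have "uO K (%e. ideriv is (v e)) (- real N)" for "is"
 proof -
  have "uO K (%e x. ideriv is (u e) x + ideriv is (%x. v e x - u e x) x) (- real N)"
   using K by (intro uO_add N unegl_uO N_M_unegl[OF X v]) auto
  then show ?thesis
  proof (rule uO_cong)
   fix e x assume "0 < e" "e < (1::real)" "x:K"
   then show "ideriv is (u e) x + ideriv is (%x. v e x - u e x) x = ideriv is (v e) x"
    using ideriv_diff[OF X smooth_netsD[OF vs] smooth_netsD[OF us], of e e x "is"] K by auto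
  qed
 qed
 then show "EX N::nat. ALL is. uO K (%e. ideriv is (v e)) (- real N)" by blast
qed

section \<open>The sharp topology\<close>

text \<open>A set of exponents closed downwards. Comparisons of \<open>sharp_value\<close> become
  inclusions between such sets.\<close>

definition orders :: "(real => ennreal) => real set" where
 "orders r = {b. bigO_eps r b}"

lemma orders_down: "b:orders r ==> a <= b ==> a:orders r"
 unfolding orders_def by (auto intro: bigO_eps_mono)

lemma not_bdd_above_UNIV: "\<not> bdd_above (UNIV :: real set)"
proof
 assume "bdd_above (UNIV :: real set)"
 then obtain M :: real where "!!x. x <= M" by (auto simp: bdd_above_def)
 from this[of "M + 1"] show False by simp
qed

lemma sharp_value_alt: "sharp_value r = (if bdd_above (orders r) then exp (- Sup (orders r)) else 0)"
 by (simp add: sharp_value_def orders_def)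

lemma sharp_value_nonneg: "0 <= sharp_value r"
 by (simp add: sharp_value_alt)

lemma orders_unbounded: "\<not> bdd_above (orders r) ==> b:orders r"
proof -
 assume "\<not> bdd_above (orders r)"
 then obtain c where "c:orders r" "\<not> c <= b" unfolding bdd_above_def by blast
 then show ?thesis by (intro orders_down[of c r b]) auto
qed

text \<open>The supremum of the orders need not be attained, which is why the condition concerns
  exponents strictly below \<open>- ln t\<close>.\<close>

lemma sharp_value_le_iff:
 assumes "orders r ~= {}" "0 < t"
 shows "sharp_value r <= t \<longleftrightarrow> (ALL b. b < - ln t --> b:orders r)"
proof (cases "bdd_above (orders r)")
 case False
 then show ?thesis using orders_unbounded[OF False] assms(2) by (simp add: sharp_value_alt)
next
 case True
 have "sharp_value r <= t \<longleftrightarrow> - ln t <= Sup (orders r)"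
 proof -
  have "exp (- Sup (orders r)) <= t \<longleftrightarrow> - Sup (orders r) <= ln t" using assms(2) ln_ge_iff by blast
  then show ?thesis using True by (auto simp: sharp_value_alt)
 qed
 also have "... \<longleftrightarrow> (ALL b. b < - ln t --> b:orders r)"
 proof
  assume a: "- ln t <= Sup (orders r)"
  show "ALL b. b < - ln t --> b:orders r"
  proof (intro allI impI)
   fix b assume "b < - ln t"
   then have "b < Sup (orders r)" using a by simp
   then obtain c where "c:orders r" "b < c" using less_cSup_iff[OF assms(1) True] by blast
   then show "b:orders r" by (intro orders_down[of c r b]) auto
  qed
 next
  assume a: "ALL b. b < - ln t --> b:orders r"
  show "- ln t <= Sup (orders r)"
   by (rule dense_le) (use a True in \<open>auto intro: cSup_upper\<close>)
 qed
 finally show ?thesis .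
qed

lemma sharp_value_shift:
 assumes "orders r ~= {}" "!!b. b:orders r ==> b - c:orders r'"
 shows "sharp_value r' <= exp c * sharp_value r"
proof (cases "bdd_above (orders r')")
 case False
 then show ?thesis by (simp add: sharp_value_alt)
next
 case True
 have bd: "b <= Sup (orders r') + c" if "b:orders r" for b
  using cSup_upper[OF assms(2)[OF that] True] by simp
 then have "bdd_above (orders r)" by (auto simp: bdd_above_def)
 moreover have "Sup (orders r) <= Sup (orders r') + c" by (rule cSup_least[OF assms(1) bd])
 ultimately show ?thesis using True by (simp add: sharp_value_alt exp_add[symmetric])
qed

section \<open>The ultrametric on generalized numbers\<close>

definition num_orders :: "(real => complex) => real set" where
 "num_orders z = orders (%e. ennreal (cmod (z e)))"

lemma num_orders_iff: "b:num_orders z \<longleftrightarrow> uO (UNIV :: unit set) (%e _. z e) b"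
 by (simp add: num_orders_def orders_def bigO_eps_num_iff)

lemma num_orders_nonempty: "moderate_num z ==> num_orders z ~= {}"
 by (auto simp: mod_num_iff umod_def num_orders_iff)

lemma num_orders_cong:
 assumes "negligible_num (%e. z e - z' e)"
 shows "num_orders z = num_orders z'"
proof -
 have n: "uO (UNIV :: unit set) (%e _. z e - z' e) b" for b
  using assms unegl_uO unfolding negl_num_iff by blast
 have "b:num_orders z \<longleftrightarrow> b:num_orders z'" for b
 proof
  assume "b:num_orders z"
  then show "b:num_orders z'"
   unfolding num_orders_iff using uO_diff[OF _ n, of "%e _. z e" b] by simp
 next
  assume "b:num_orders z'"
  then show "b:num_orders z"
   unfolding num_orders_iff using uO_add[OF _ n, of "%e _. z' e" b] by simp
 qed
 then show ?thesis by blast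
qed

lemma gnum_rel_rep: "gnum_rel (rep_gnum z) (rep_gnum z)"
 using Quotient_rep_reflp[OF Quotient_gnum] .

lemma moderate_rep_gnum: "moderate_num (rep_gnum z)"
 using gnum_rel_rep by (simp add: gnum_rel_def)

lemma gnum_rel_refl: "moderate_num x ==> gnum_rel x x"
 by (simp add: gnum_rel_def negligible_num_zero)

lemma rep_abs_gnum: "moderate_num x ==> negligible_num (%e. rep_gnum (abs_gnum x) e - x e)"
 using Quotient_rep_abs[OF Quotient_gnum gnum_rel_refl] by (simp add: gnum_rel_def)

lemma abs_rep_gnum: "abs_gnum (rep_gnum z) = z"
 by (rule Quotient_abs_rep[OF Quotient_gnum])

lemma abs_gnum_eqI: "moderate_num x ==> moderate_num y ==> negligible_num (%e. x e - y e) ==> abs_gnum x = abs_gnum y"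
 by (rule Quotient_rel_abs[OF Quotient_gnum]) (simp add: gnum_rel_def)

lemma abs_gnum_eqD:
 assumes "moderate_num x" "moderate_num y" "abs_gnum x = abs_gnum y"
 shows "negligible_num (%e. x e - y e)"
 using Quotient_rel[OF Quotient_gnum, of x y] assms gnum_rel_refl by (auto simp: gnum_rel_def)

lemma negl_num_imp_moderate: "negligible_num z ==> moderate_num z"
 unfolding negl_num_iff mod_num_iff by (rule unegl_imp_umod)

lemma mod_num_perturb:
 assumes "moderate_num x" "negligible_num (%e. y e - x e)" shows "moderate_num y"
 using moderate_num_add[OF assms(1) negl_num_imp_moderate[OF assms(2)]] by simp

lemma abs_gnum_eqI':
 assumes "moderate_num x" "negligible_num (%e. x e - y e)" shows "abs_gnum x = abs_gnum y"
proof (rule abs_gnum_eqI[OF assms(1) _ assms(2)])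
 show "moderate_num y"
  using moderate_num_diff[OF assms(1) negl_num_imp_moderate[OF assms(2)]] by simp
qed

lemma abs_gnum_cong:
 "moderate_num x ==> (!!e. 0 < e ==> e < 1 ==> x e = y e) ==> abs_gnum x = abs_gnum y"
 by (rule abs_gnum_eqI') (auto intro: negl_num_cong[OF negligible_num_zero])

lemma mod_num_cong:
 "moderate_num z ==> (!!e. 0 < e ==> e < 1 ==> z e = z' e) ==> moderate_num z'"
 unfolding mod_num_iff by (erule umod_cong) auto

lemma abs_gnum_plus: "moderate_num x ==> moderate_num y ==> abs_gnum x + abs_gnum y = abs_gnum (%e. x e + y e)"
 by (rule plus_gnum.abs_eq) (auto intro: gnum_rel_refl)

lemma abs_gnum_times: "moderate_num x ==> moderate_num y ==> abs_gnum x * abs_gnum y = abs_gnum (%e. x e * y e)"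
 by (rule times_gnum.abs_eq) (auto intro: gnum_rel_refl)

lemma abs_gnum_zero: "0 = abs_gnum (%_. 0)"
 by (simp add: zero_gnum_def)

lemma abs_gnum_eq_0_iff: "moderate_num x ==> abs_gnum x = 0 \<longleftrightarrow> negligible_num x"
 unfolding abs_gnum_zero
 using abs_gnum_eqD[of x "%_. 0"] abs_gnum_eqI'[of x "%_. 0"] moderate_num_const[of 0] by auto

lemma abs_e_abs_gnum: "moderate_num x ==> abs_e (abs_gnum x) = sharp_value (%e. ennreal (cmod (x e)))"
 unfolding abs_e_def sharp_value_alt
 using num_orders_cong[OF rep_abs_gnum] by (simp add: num_orders_def)

lemma abs_e_le_iff:
 assumes "moderate_num x" "0 < t"
 shows "abs_e (abs_gnum x) <= t \<longleftrightarrow> (ALL b. b < - ln t --> b:num_orders x)"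
 unfolding abs_e_abs_gnum[OF assms(1)] num_orders_def
 by (rule sharp_value_le_iff[OF num_orders_nonempty[OF assms(1), unfolded num_orders_def] assms(2)])

lemma abs_e_nonneg: "0 <= abs_e z"
 by (simp add: abs_e_def sharp_value_nonneg)

lemma abs_e_zero: "abs_e 0 = 0"
proof -
 have "b:num_orders (%_. 0)" for b by (simp add: num_orders_iff uO_zero)
 then have "num_orders (%_. 0) = UNIV" by blast
 then show ?thesis unfolding abs_gnum_zero abs_e_abs_gnum[OF moderate_num_const] sharp_value_alt
  by (simp add: num_orders_def not_bdd_above_UNIV)
qed

lemma abs_e_eq_0_iff: "abs_e z = 0 \<longleftrightarrow> z = 0"
proof
 assume z: "abs_e z = 0"
 have "\<not> bdd_above (num_orders (rep_gnum z))"
  using z by (auto simp: abs_e_def sharp_value_alt num_orders_def split: if_splits)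
 then have "b:num_orders (rep_gnum z)" for b
  unfolding num_orders_def by (rule orders_unbounded)
 then have "negligible_num (rep_gnum z)"
  unfolding negl_num_iff by (intro uneglI) (simp add: num_orders_iff)
 then have "abs_gnum (rep_gnum z) = 0" using abs_gnum_eq_0_iff[OF moderate_rep_gnum] by blast
 then show "z = 0" by (simp add: abs_rep_gnum)
qed (simp add: abs_e_zero)

lemma abs_e_add: "abs_e (z + z') <= max (abs_e z) (abs_e z')"
proof (rule dense_ge)
 fix t assume t: "max (abs_e z) (abs_e z') < t"
 then have t0: "0 < t" using abs_e_nonneg[of z] by simp
 let ?x = "rep_gnum z" and ?y = "rep_gnum z'"
 have m: "moderate_num ?x" "moderate_num ?y" "moderate_num (%e. ?x e + ?y e)"
  by (auto intro: moderate_rep_gnum moderate_num_add)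
 have "abs_e (abs_gnum ?x) <= t" "abs_e (abs_gnum ?y) <= t" using t by (auto simp: abs_rep_gnum)
 then have "ALL b. b < - ln t --> b:num_orders ?x" "ALL b. b < - ln t --> b:num_orders ?y"
  using abs_e_le_iff[OF m(1) t0] abs_e_le_iff[OF m(2) t0] by blast+
 then have "ALL b. b < - ln t --> b:num_orders (%e. ?x e + ?y e)"
  unfolding num_orders_iff by (auto intro: uO_add)
 then have "abs_e (abs_gnum (%e. ?x e + ?y e)) <= t" using abs_e_le_iff[OF m(3) t0] by blast
 then show "abs_e (z + z') <= t"
  using abs_gnum_plus[OF m(1,2)] by (simp add: abs_rep_gnum)
qed

lemma abs_e_uminus: "abs_e (- z) = abs_e z"
proof -
 have "- z = abs_gnum (%e. - rep_gnum z e)"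
  using uminus_gnum.abs_eq[OF gnum_rel_rep] by (simp add: abs_rep_gnum)
 then show ?thesis
  using abs_e_abs_gnum[OF moderate_num_uminus[OF moderate_rep_gnum[of z]]] by (simp add: abs_e_def)
qed

lemma abs_e_minus_commute: "abs_e (z - z') = abs_e (z' - z)"
 using abs_e_uminus[of "z - z'"] by simp

lemma abs_e_mult_shift:
 assumes "b:num_orders x" "moderate_num x" "moderate_num y"
 shows "abs_e (abs_gnum (%e. x e * y e)) <= exp (- b) * abs_e (abs_gnum y)"
 unfolding abs_e_abs_gnum[OF moderate_num_mult[OF assms(2,3)]] abs_e_abs_gnum[OF assms(3)]
proof (rule sharp_value_shift)
 show "orders (%e. ennreal (cmod (y e))) ~= {}" using num_orders_nonempty[OF assms(3)] by (simp add: num_orders_def)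
 fix c assume "c:orders (%e. ennreal (cmod (y e)))"
 then have "uO (UNIV :: unit set) (%e _. y e) c" by (simp add: num_orders_def[symmetric] num_orders_iff)
 then have "uO (UNIV :: unit set) (%e _. x e * y e) (b + c)" using assms(1) by (intro uO_mult) (simp_all add: num_orders_iff)
 then have "b + c:num_orders (%e. x e * y e)" by (simp add: num_orders_iff)
 then show "c - - b:orders (%e. ennreal (cmod (x e * y e)))" by (simp add: num_orders_def add.commute)
qed

lemma abs_e_mult: "abs_e (z * z') <= abs_e z * abs_e z'"
proof -
 let ?x = "rep_gnum z" and ?y = "rep_gnum z'"
 have m: "moderate_num ?x" "moderate_num ?y" by (auto intro: moderate_rep_gnum)
 have zz: "z * z' = abs_gnum (%e. ?x e * ?y e)" using abs_gnum_times[OF m] by (simp add: abs_rep_gnum)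
 have sh: "abs_e (z * z') <= exp (- b) * abs_e z'" if "b:num_orders ?x" for b
  using abs_e_mult_shift[OF that m] by (simp add: zz abs_rep_gnum)
 have le: "abs_e (z * z') <= t * abs_e z'" if t: "abs_e z < t" for t
 proof -
  have t0: "0 < t" using t abs_e_nonneg[of z] by linarith
  \<comment> \<open>The characterisation of \<open>abs_e\<close> yields exponents strictly below
    \<open>- ln s\<close> only; with \<open>s\<close> between \<open>abs_e z\<close> and
    \<open>t\<close> the exponent \<open>- ln t\<close> is one of them.\<close>
  define s where "s = (abs_e z + t) / 2"
  have s: "abs_e z < s" "s < t" "0 < s" using t abs_e_nonneg[of z] by (auto simp: s_def)
  have "abs_e (abs_gnum ?x) <= s" using s by (simp add: abs_rep_gnum)
  then have "- ln t:num_orders ?x" using abs_e_le_iff[OF m(1) s(3)] s t0 by simp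
  from sh[OF this] show ?thesis using t0 by simp
 qed
 show ?thesis
 proof (cases "abs_e z' = 0")
  case True
  then show ?thesis by (simp add: abs_e_eq_0_iff abs_e_zero)
 next
  case False
  then have p: "0 < abs_e z'" using abs_e_nonneg[of z'] by simp
  have "abs_e (z * z') / abs_e z' <= abs_e z"
   by (rule dense_ge) (use le p in \<open>simp add: pos_divide_le_eq\<close>)
  then show ?thesis using p by (simp add: pos_divide_le_eq)
 qed
qed

lemma eps_power_moderate: "moderate_num (%e. c * of_real (e powr a))"
 and eps_power_order: "a:num_orders (%e. c * of_real (e powr a))"
proof -
 have u: "uO (UNIV :: unit set) (%e _. c * of_real (e powr a)) a" by (rule uOI[of _ _ "cmod c"]) (simp add: norm_mult)
 then show "a:num_orders (%e. c * of_real (e powr a))" by (simp add: num_orders_iff)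
 from u show "moderate_num (%e. c * of_real (e powr a))" unfolding mod_num_iff by (rule umodI)
qed

text \<open>Powers of \<open>e\<close> are invertible: the general inequality for the power and for
  its inverse gives equality.\<close>

lemma abs_e_eps_power_mult:
 assumes "c ~= 0"
 shows "abs_e (abs_gnum (%e. c * of_real (e powr a)) * z) = exp (- a) * abs_e z"
proof -
 let ?x = "%e. c * of_real (e powr a)" and ?x' = "%e. inverse c * of_real (e powr (- a))"
 let ?y = "rep_gnum z"
 have m: "moderate_num ?y" by (rule moderate_rep_gnum)
 have mx: "moderate_num (%e. ?x e * ?y e)" by (rule moderate_num_mult[OF eps_power_moderate m])
 have eq: "abs_gnum ?x * z = abs_gnum (%e. ?x e * ?y e)"
  using abs_gnum_times[OF eps_power_moderate m] by (simp add: abs_rep_gnum)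
 have "abs_e (abs_gnum (%e. ?x e * ?y e)) <= exp (- a) * abs_e z"
  using abs_e_mult_shift[OF eps_power_order eps_power_moderate m] by (simp add: abs_rep_gnum)
 moreover have "abs_e (abs_gnum (%e. ?x' e * (?x e * ?y e))) <= exp (- (- a)) * abs_e (abs_gnum (%e. ?x e * ?y e))"
  by (rule abs_e_mult_shift[OF eps_power_order eps_power_moderate mx])
 moreover have "abs_gnum (%e. ?x' e * (?x e * ?y e)) = abs_gnum ?y"
 proof (rule abs_gnum_cong[OF moderate_num_mult[OF eps_power_moderate mx]])
  fix e :: real assume e: "0 < e" "e < 1"
  have "complex_of_real (e powr (- a)) * of_real (e powr a) = 1"
   unfolding of_real_mult[symmetric] using e by (simp add: powr_add[symmetric])
  then show "?x' e * (?x e * ?y e) = ?y e" using assms by (simp add: field_simps)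
 qed
 ultimately have "abs_e z <= exp a * abs_e (abs_gnum ?x * z)" by (simp add: abs_rep_gnum eq)
 then have "exp (- a) * abs_e z <= exp (- a) * (exp a * abs_e (abs_gnum ?x * z))" by (intro mult_left_mono) auto
 also have "... = abs_e (abs_gnum ?x * z)" by (simp add: mult.assoc[symmetric] exp_add[symmetric])
 finally show ?thesis using \<open>abs_e (abs_gnum (%e. ?x e * ?y e)) <= exp (- a) * abs_e z\<close> by (simp add: eq)
qed

lemma abs_e_one: "abs_e 1 = 1"
proof -
 have m: "moderate_num (%_. 1)" by (rule moderate_num_const)
 have one: "1 = abs_gnum (%_. 1)" by (simp add: one_gnum_def)
 have ord: "b:num_orders (%_. 1) \<longleftrightarrow> b <= 0" for b
 proof
  assume "b <= 0"
  moreover have "uO (UNIV :: unit set) (%_ _. 1) 0" by (rule uOI[of _ _ 1]) auto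
  ultimately show "b:num_orders (%_. 1)" unfolding num_orders_iff by (blast intro: uO_mono)
 next
  assume "b:num_orders (%_. 1)"
  then have "uO (UNIV :: unit set) (%_ _. 1) b" by (simp add: num_orders_iff)
  then obtain C where C: "0 <= C" "EV e. 0 < e & e < 1 & (ALL x:(UNIV :: unit set). cmod 1 <= C * e powr b)"
   by (rule uOE)
  show "b <= 0"
  proof (rule ccontr)
   assume "\<not> b <= 0"
   then have "((%e::real. C * e powr b) \<longlongrightarrow> C * 0 powr b) (at_right 0)"
    by (intro tendsto_intros tendsto_powr') (auto simp: eventually_at_right_less[THEN eventually_mono] less_imp_le)
   then have "EV e. C * e powr b < 1"
    by (auto dest!: order_tendstoD(2)[of _ _ _ 1])
   with C(2) have "EV e. False" by eventually_elim auto
   then show False by simp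
  qed
 qed
 then have "num_orders (%_. 1) = {..0}" by auto
 then have "orders (%e. ennreal (cmod 1)) = {..0}" by (simp add: num_orders_def)
 then show ?thesis unfolding one abs_e_abs_gnum[OF m] sharp_value_alt by simp
qed

lemma abs_e_eps_power: "c ~= 0 ==> abs_e (abs_gnum (%e. c * of_real (e powr a))) = exp (- a)"
 using abs_e_eps_power_mult[of c a 1] by (simp add: abs_e_one)

interpretation gnum_metric: Metric_space UNIV "%z z'. abs_e (z - z')"
proof
 fix x y z :: gnum
 show "0 <= abs_e (x - y)" by (rule abs_e_nonneg)
 show "abs_e (x - y) = abs_e (y - x)" by (rule abs_e_minus_commute)
 show "(abs_e (x - y) = 0) = (x = y)" by (simp add: abs_e_eq_0_iff)
 have "abs_e (x - z) <= max (abs_e (x - y)) (abs_e (y - z))" using abs_e_add[of "x - y" "y - z"] by simp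
 then show "abs_e (x - z) <= abs_e (x - y) + abs_e (y - z)"
  using abs_e_nonneg[of "x - y"] abs_e_nonneg[of "y - z"] by linarith
qed

section \<open>Spaces of generalized functions\<close>

text \<open>The common frame of the spaces over an open set and of the Schwartz nets.
  \<open>X\<close> contains the single members of the nets, so that functionals on \<open>X\<close>
  can be applied to representatives.\<close>

locale net_space =
 fixes A :: "'n::finite net_quotient" and X :: "('n fn) set"
 assumes moderate_in: "u:moderate_nets A ==> 0 < e ==> e <= 1 ==> u e:X"
  and X_add: "f:X ==> g:X ==> (%x. f x + g x) : X"
  and X_cmult: "f:X ==> (%x. c * f x) : X"
  and negl_moderate: "negligible_nets A <= moderate_nets A"
  and negl_zero: "(%_ _. 0) : negligible_nets A"
  and negl_add: "u:negligible_nets A ==> v:negligible_nets A ==> (%e x. u e x + v e x) : negligible_nets A"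
  and mod_add: "u:moderate_nets A ==> v:moderate_nets A ==> (%e x. u e x + v e x) : moderate_nets A"
  and mod_scale: "u:moderate_nets A ==> moderate_num z ==> (%e x. z e * u e x) : moderate_nets A"
  and negl_scale: "u:negligible_nets A ==> moderate_num z ==> (%e x. z e * u e x) : negligible_nets A"
  and negl_scale_mod: "u:moderate_nets A ==> negligible_num z ==> (%e x. z e * u e x) : negligible_nets A"
begin

lemma negl_uminus: "u:negligible_nets A ==> (%e x. - u e x) : negligible_nets A"
 using negl_scale[OF _ moderate_num_const[of "-1"]] by simp

lemma mod_diff: "u:moderate_nets A ==> v:moderate_nets A ==> (%e x. u e x - v e x) : moderate_nets A"
 using mod_add[OF _ mod_scale[OF _ moderate_num_const[of "-1"]], of u v] by simp

lemma negl_sub_commute: "(%e x. u e x - v e x) : negligible_nets A ==> (%e x. v e x - u e x) : negligible_nets A"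
 using negl_uminus[of "%e x. u e x - v e x"] by simp

lemma negl_sub_trans:
 "(%e x. u e x - v e x) : negligible_nets A ==> (%e x. v e x - w e x) : negligible_nets A ==> (%e x. u e x - w e x) : negligible_nets A"
 using negl_add[of "%e x. u e x - v e x" "%e x. v e x - w e x"] by simp

lemma cls_self: "u:moderate_nets A ==> u:cls A u"
 by (simp add: cls_def negl_zero)

lemma cls_eqI: assumes "(%e x. u e x - v e x) : negligible_nets A" shows "cls A u = cls A v"
 unfolding cls_def
 using negl_sub_trans[OF _ assms] negl_sub_trans[OF _ negl_sub_commute[OF assms]] by blast

lemma cls_eqD: "u:moderate_nets A ==> cls A u = cls A v ==> (%e x. u e x - v e x) : negligible_nets A"
 using cls_self[of u] by (simp add: cls_def)

lemma cls_elem: "u:moderate_nets A ==> cls A u:elems A"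
 by (simp add: elems_def)

lemma mem_elem: assumes "U:elems A" "u:U" shows "u:moderate_nets A" "cls A u = U"
proof -
 obtain v where v: "v:moderate_nets A" "U = cls A v" using assms(1) by (auto simp: elems_def)
 then show "u:moderate_nets A" using assms(2) by (simp add: cls_def)
 show "cls A u = U" unfolding v(2) by (rule cls_eqI) (use assms(2) v in \<open>simp add: cls_def\<close>)
qed

lemma rep_in: assumes "U:elems A" shows "rep U:U"
proof -
 obtain v where v: "v:moderate_nets A" "U = cls A v" using assms by (auto simp: elems_def)
 then have "v:U" using cls_self by simp
 then show ?thesis unfolding rep_def by (rule someI[of "%u. u:U"])
qed

lemma rep_moderate: "U:elems A ==> rep U:moderate_nets A"
 and cls_rep: "U:elems A ==> cls A (rep U) = U"
 using mem_elem rep_in by blast+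

lemma rep_cls: "u:moderate_nets A ==> (%e x. rep (cls A u) e x - u e x) : negligible_nets A"
 by (rule cls_eqD[OF rep_moderate[OF cls_elem] cls_rep[OF cls_elem]])

lemma mem_negl: "U:elems A ==> u:U ==> v:U ==> (%e x. u e x - v e x) : negligible_nets A"
 using mem_elem[of U u] mem_elem[of U v] cls_eqD[of u v] by simp

lemma gadd_elem: "U:elems A ==> V:elems A ==> gadd A U V:elems A"
 unfolding gadd_def by (intro cls_elem mod_add rep_moderate)

lemma gdiff_elem: "U:elems A ==> V:elems A ==> gdiff A U V:elems A"
 unfolding gdiff_def by (intro cls_elem mod_diff rep_moderate)

lemma gscale_elem: "U:elems A ==> gscale A z U:elems A"
 unfolding gscale_def by (intro cls_elem mod_scale rep_moderate moderate_rep_gnum)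

lemma gdiff_alt:
 assumes "U:elems A" "V:elems A"
 shows "gdiff A U V = gadd A U (gscale A (- 1) V)"
 unfolding gdiff_def gadd_def
proof (rule cls_eqI)
 let ?s = "gscale A (- 1) V"
 have "- 1 = abs_gnum (%_. - 1)"
  using uminus_gnum.abs_eq[OF gnum_rel_refl[OF moderate_num_const[of 1]]] by (simp add: one_gnum_def)
 then have "negligible_num (%e. rep_gnum (- 1) e - - 1)"
  using rep_abs_gnum[OF moderate_num_const[of "-1"]] by simp
 then have 1: "(%e x. (rep_gnum (- 1) e - - 1) * rep V e x) : negligible_nets A"
  by (rule negl_scale_mod[OF rep_moderate[OF assms(2)]])
 have 2: "(%e x. rep ?s e x - rep_gnum (- 1) e * rep V e x) : negligible_nets A"
  unfolding gscale_def by (intro rep_cls mod_scale rep_moderate moderate_rep_gnum assms)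
 have "(%e x. (rep ?s e x - rep_gnum (- 1) e * rep V e x) + (rep_gnum (- 1) e - - 1) * rep V e x) : negligible_nets A"
  by (rule negl_add[OF 2 1])
 from negl_uminus[OF this] show "(%e x. rep U e x - rep V e x - (rep U e x + rep ?s e x)) : negligible_nets A"
  by (simp add: algebra_simps)
qed

text \<open>Makes \<open>sharp_value\<close> of a seminorm meaningful on classes: its set of orders
  is nonempty for moderate nets and everything for negligible ones.\<close>

definition admissible :: "(('n fn) => ennreal) => bool" where
 "admissible s \<longleftrightarrow> (ALL u:moderate_nets A. EX b. bigO_eps (%e. s (u e)) b) &
   (ALL u:negligible_nets A. ALL b. bigO_eps (%e. s (u e)) b)"

text \<open>A family of linear functionals controlled by one seminorm up to a moderate constant. The
  exponent \<open>N\<close> is the loss of order, which becomes the Lipschitz constant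
  \<open>exp N\<close> in the sharp topology.\<close>

definition net_functional :: "(real => ('n fn) => complex) => (('n fn) => ennreal) => real => bool" where
 "net_functional L s N \<longleftrightarrow> admissible s &
  (ALL e. 0 < e --> e < 1 --> linear_on X (L e)) &
  (EX C. EV e. ALL f:X. ennreal (cmod (L e f)) <= ennreal (C * e powr (- N)) * s f)"

definition induced :: "(real => ('n fn) => complex) => 'n net set => gnum" where
 "induced L U = abs_gnum (%e. L e (rep U e))"

context
 fixes L s N assumes L: "net_functional L s N"
begin

lemma functional_order:
 assumes "u:moderate_nets A" "bigO_eps (%e. s (u e)) b"
 shows "b - N:num_orders (%e. L e (u e))"
proof -
 obtain C where C: "EV e. ALL f:X. ennreal (cmod (L e f)) <= ennreal (C * e powr (- N)) * s f"
  using L by (auto simp: net_functional_def)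
 obtain D where D: "EV e. s (u e) <= ennreal (D * e powr b)" using assms(2) by (auto simp: bigO_eps_def)
 have "EV e. ennreal (cmod (L e (u e))) <= ennreal ((\<bar>C\<bar> * \<bar>D\<bar>) * e powr (b - N))"
  using C D EV_unit
 proof eventually_elim
  case (elim e)
  have "ennreal (cmod (L e (u e))) <= ennreal (C * e powr (- N)) * s (u e)"
   using elim moderate_in[OF assms(1)] by simp
  also have "... <= ennreal (\<bar>C\<bar> * e powr (- N)) * ennreal (\<bar>D\<bar> * e powr b)"
  proof (rule mult_mono)
   show "ennreal (C * e powr (- N)) <= ennreal (\<bar>C\<bar> * e powr (- N))" by (intro ennreal_leI mult_right_mono) auto
   have "ennreal (D * e powr b) <= ennreal (\<bar>D\<bar> * e powr b)" by (intro ennreal_leI mult_right_mono) auto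
   with elim show "s (u e) <= ennreal (\<bar>D\<bar> * e powr b)" by (blast intro: order_trans)
  qed auto
  also have "... = ennreal ((\<bar>C\<bar> * \<bar>D\<bar>) * e powr (b - N))"
   by (simp add: ennreal_mult[symmetric] powr_diff powr_minus field_simps)
  finally show ?case .
 qed
 then have "bigO_eps (%e. ennreal (cmod (L e (u e)))) (b - N)" unfolding bigO_eps_def by blast
 then show ?thesis by (simp add: num_orders_def orders_def)
qed

lemma functional_moderate: "u:moderate_nets A ==> moderate_num (%e. L e (u e))"
proof -
 assume u: "u:moderate_nets A"
 then obtain b where "bigO_eps (%e. s (u e)) b" using L by (auto simp: net_functional_def admissible_def)
 from functional_order[OF u this] show ?thesis
  unfolding mod_num_iff num_orders_iff by (rule umodI)
qed

lemma functional_negligible: "u:negligible_nets A ==> negligible_num (%e. L e (u e))"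
proof -
 assume u: "u:negligible_nets A"
 have "bigO_eps (%e. s (u e)) b" for b using u L by (auto simp: net_functional_def admissible_def)
 then have "b - N:num_orders (%e. L e (u e))" for b
  using functional_order u negl_moderate by blast
 from this[of "b + N" for b] show ?thesis
  unfolding negl_num_iff by (intro uneglI) (simp add: num_orders_iff)
qed

lemma functional_add: "0 < e ==> e < 1 ==> u:moderate_nets A ==> v:moderate_nets A ==>
  L e (%x. u e x + v e x) = L e (u e) + L e (v e)"
 and functional_cmult: "0 < e ==> e < 1 ==> u:moderate_nets A ==> L e (%x. c * u e x) = c * L e (u e)"
 using L moderate_in[of u e] moderate_in[of v e] by (auto simp: net_functional_def linear_on_def)

lemma functional_cong:
 assumes "u:moderate_nets A" "v:moderate_nets A" "(%e x. u e x - v e x) : negligible_nets A"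
 shows "abs_gnum (%e. L e (u e)) = abs_gnum (%e. L e (v e))"
proof (rule abs_gnum_eqI'[OF functional_moderate[OF assms(1)]])
 show "negligible_num (%e. L e (u e) - L e (v e))"
 proof (rule negl_num_cong[OF functional_negligible[OF assms(3)]])
  fix e :: real assume e: "0 < e" "e < 1"
  have "(%e x. u e x - v e x) : moderate_nets A" using assms(3) negl_moderate by blast
  from functional_add[OF e this assms(2)] show "L e (%x. u e x - v e x) = L e (u e) - L e (v e)" by simp
 qed
qed

lemma induced_cls: "u:moderate_nets A ==> induced L (cls A u) = abs_gnum (%e. L e (u e))"
 unfolding induced_def by (rule functional_cong[OF rep_moderate[OF cls_elem] _ rep_cls])

lemma induced_mem: "U:elems A ==> u:U ==> induced L U = abs_gnum (%e. L e (u e))"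
 using mem_elem[of U u] induced_cls[of u] by simp

lemma induced_add:
 assumes "U:elems A" "V:elems A"
 shows "induced L (gadd A U V) = induced L U + induced L V"
proof -
 note m = rep_moderate[OF assms(1)] rep_moderate[OF assms(2)]
 have "induced L (gadd A U V) = abs_gnum (%e. L e (%x. rep U e x + rep V e x))"
  unfolding gadd_def by (rule induced_cls[OF mod_add[OF m]])
 also have "... = abs_gnum (%e. L e (rep U e) + L e (rep V e))"
  by (rule abs_gnum_cong[OF functional_moderate[OF mod_add[OF m]]]) (rule functional_add[OF _ _ m])
 finally show ?thesis unfolding induced_def by (simp add: abs_gnum_plus functional_moderate m)
qed

lemma induced_scale:
 assumes "U:elems A"
 shows "induced L (gscale A z U) = z * induced L U"
proof -
 note m = rep_moderate[OF assms(1)]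
 have m': "(%e x. rep_gnum z e * rep U e x) : moderate_nets A" by (rule mod_scale[OF m moderate_rep_gnum])
 have "induced L (gscale A z U) = abs_gnum (%e. L e (%x. rep_gnum z e * rep U e x))"
  unfolding gscale_def by (rule induced_cls[OF m'])
 also have "... = abs_gnum (%e. rep_gnum z e * L e (rep U e))"
  by (rule abs_gnum_cong[OF functional_moderate[OF m']]) (rule functional_cmult[OF _ _ m])
 also have "... = abs_gnum (rep_gnum z) * abs_gnum (%e. L e (rep U e))"
  by (rule abs_gnum_times[symmetric, OF moderate_rep_gnum functional_moderate[OF m]])
 finally show ?thesis by (simp add: induced_def abs_rep_gnum)
qed

lemma induced_bound:
 assumes "U:elems A"
 shows "abs_e (induced L U) <= exp N * sharp_value (%e. s (rep U e))"
 unfolding induced_def abs_e_abs_gnum[OF functional_moderate[OF rep_moderate[OF assms]]]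
proof (rule sharp_value_shift)
 show "orders (%e. s (rep U e)) ~= {}"
  using L rep_moderate[OF assms] by (auto simp: net_functional_def admissible_def orders_def)
 show "b - N:orders (%e. ennreal (cmod (L e (rep U e))))" if "b:orders (%e. s (rep U e))" for b
  using functional_order[OF rep_moderate[OF assms], of b] that by (simp add: orders_def num_orders_def)
qed

end

lemma seminorm_topology_topspace: "topspace (seminorm_topology A M \<P>) = M"
 unfolding seminorm_topology_def topology_generated_by_topspace by auto

lemma seminorm_topology_ball:
 "P:\<P> ==> U:M ==> 0 < r ==> openin (seminorm_topology A M \<P>) {V:M. P (gdiff A V U) < r}"
 unfolding seminorm_topology_def by (rule topology_generated_by_Basis) blast

text \<open>For a map compatible with differences, one seminorm of the family that bounds it is
  enough, as the balls of that seminorm are open.\<close>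

lemma cont_map_gnumI:
 assumes T: "!!U V. U:M ==> V:M ==> T (gdiff A V U) = T V - T U"
  and M: "!!U V. U:M ==> V:M ==> gdiff A V U:M"
  and P: "P:\<P>" "0 < c" "!!U. U:M ==> abs_e (T U) <= c * P U"
  and Z: "!!U. U:M ==> P (gdiff A U U) <= 0"
 shows "continuous_map (seminorm_topology A M \<P>) gnum_topology T"
 unfolding gnum_topology_def gnum_metric.continuous_map_to_metric seminorm_topology_topspace
proof (intro ballI allI impI)
 fix U and e :: real assume U: "U:M" and e: "e > 0"
 show "EX O'. openin (seminorm_topology A M \<P>) O' & U:O' & (ALL V:O'. T V:gnum_metric.mball (T U) e)"
 proof (intro exI conjI ballI)
  show "openin (seminorm_topology A M \<P>) {V:M. P (gdiff A V U) < e / c}"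
   using P(1,2) U e by (intro seminorm_topology_ball) auto
  have "0 < e / c" using e P(2) by simp
  then show "U : {V:M. P (gdiff A V U) < e / c}" using U Z[OF U] by simp
  fix V assume V: "V : {V:M. P (gdiff A V U) < e / c}"
  have "abs_e (T V - T U) <= c * P (gdiff A V U)" using T[OF U] P(3)[OF M[OF U]] V by simp
  also have "... < e" using V P(2) by (simp add: field_simps)
  finally show "T V:gnum_metric.mball (T U) e" by (simp add: abs_e_minus_commute)
 qed
qed

lemma gdiff_self_negl: "U:elems A ==> rep (gdiff A U U) : negligible_nets A"
 unfolding gdiff_def
 using rep_cls[OF mod_diff[OF rep_moderate rep_moderate], of U U] by simp

lemma sharp_value_negl:
 assumes "admissible s" "u:negligible_nets A"
 shows "sharp_value (%e. s (u e)) = 0"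
proof -
 have "orders (%e. s (u e)) = UNIV" using assms by (auto simp: admissible_def orders_def)
 then show ?thesis by (simp add: sharp_value_alt not_bdd_above_UNIV)
qed

lemma induced_cont_dual:
 assumes L: "net_functional L s N" and P: "(%U. sharp_value (%e. s (rep U e))) : \<P>"
 shows "induced L:cont_dual A (elems A) (seminorm_topology A (elems A) \<P>)"
proof -
 have ad: "admissible s" using L by (simp add: net_functional_def)
 have d: "induced L (gdiff A V U) = induced L V - induced L U" if "U:elems A" "V:elems A" for U V
  using induced_add[OF L that(2) gscale_elem[OF that(1)], of "- 1"] induced_scale[OF L that(1), of "- 1"] gdiff_alt[OF that(2,1)] by simp
 have "continuous_map (seminorm_topology A (elems A) \<P>) gnum_topology (induced L)"
 proof (rule cont_map_gnumI[where c = "exp N", OF d gdiff_elem P])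
  show "abs_e (induced L U) <= exp N * sharp_value (%e. s (rep U e))" if "U:elems A" for U
   by (rule induced_bound[OF L that])
  show "sharp_value (%e. s (rep (gdiff A U U) e)) <= 0" if "U:elems A" for U
   using sharp_value_negl[OF ad gdiff_self_negl[OF that]] by simp
 qed auto
 then show ?thesis
  unfolding cont_dual_def by (simp add: induced_add[OF L] induced_scale[OF L])
qed

end

section \<open>Nets of Schwartz functions\<close>

lemma schwartz_bigO_iff:
 assumes "u:nets_in schwartz"
 shows "bigO_eps (%e. schwartz_seminorm j (u e)) b \<longleftrightarrow> (EX C>=0. EV e. 0 < e & e < 1 & sbound j (u e) (C * e powr b))"
proof
 assume "bigO_eps (%e. schwartz_seminorm j (u e)) b"
 then obtain C where C: "EV e. schwartz_seminorm j (u e) <= ennreal (C * e powr b)" by (auto simp: bigO_eps_def)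
 have "EV e. 0 < e & e < 1 & sbound j (u e) (\<bar>C\<bar> * e powr b)"
  using C EV_unit
 proof eventually_elim
  case (elim e)
  have "smooth_on UNIV (u e)" using assms elim by (auto simp: nets_in_def intro: schwartz_smooth)
  moreover have "C * e powr b <= \<bar>C\<bar> * e powr b" by (intro mult_right_mono) auto
  then have "schwartz_seminorm j (u e) <= ennreal (\<bar>C\<bar> * e powr b)" using elim by (meson ennreal_leI order_trans)
  ultimately show ?case using elim by (subst sbound_iff) auto
 qed
 then show "EX C>=0. EV e. 0 < e & e < 1 & sbound j (u e) (C * e powr b)"
  by (intro exI[of _ "\<bar>C\<bar>"]) simp
next
 assume "EX C>=0. EV e. 0 < e & e < 1 & sbound j (u e) (C * e powr b)"
 then obtain C where C: "0 <= C" "EV e. 0 < e & e < 1 & sbound j (u e) (C * e powr b)" by (elim exE conjE)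
 have "EV e. schwartz_seminorm j (u e) <= ennreal (C * e powr b)"
  using C(2)
 proof eventually_elim
  case (elim e)
  have "smooth_on UNIV (u e)" using assms elim by (auto simp: nets_in_def intro: schwartz_smooth)
  then show ?case using elim C(1) sbound_iff[of "u e" "C * e powr b" j] by simp
 qed
 then show "bigO_eps (%e. schwartz_seminorm j (u e)) b" by (auto simp: bigO_eps_def)
qed

lemma schwartz_bigO_add:
 assumes "u:nets_in schwartz" "v:nets_in schwartz"
  and "bigO_eps (%e. schwartz_seminorm j (u e)) b" "bigO_eps (%e. schwartz_seminorm j (v e)) b"
 shows "bigO_eps (%e. schwartz_seminorm j (%x. u e x + v e x)) b"
proof -
 have uv: "(%e x. u e x + v e x) : nets_in schwartz" using assms(1,2) by (auto simp: nets_in_def intro: schwartz_add)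
 obtain C where C: "C >= 0" "EV e. 0 < e & e < 1 & sbound j (u e) (C * e powr b)"
  using assms(3) unfolding schwartz_bigO_iff[OF assms(1)] by (elim exE conjE)
 obtain D where D: "D >= 0" "EV e. 0 < e & e < 1 & sbound j (v e) (D * e powr b)"
  using assms(4) unfolding schwartz_bigO_iff[OF assms(2)] by (elim exE conjE)
 have "EV e. 0 < e & e < 1 & sbound j (%x. u e x + v e x) ((C + D) * e powr b)"
  using C(2) D(2)
 proof eventually_elim
  case (elim e)
  then show ?case unfolding distrib_right using assms(1,2)
   by (auto intro!: sbound_add schwartz_smooth simp: nets_in_def)
 qed
 with C(1) D(1) show ?thesis unfolding schwartz_bigO_iff[OF uv] by (intro exI[of _ "C + D"]) simp
qed

lemma schwartz_bigO_scale:
 assumes "u:nets_in schwartz" "bigO_eps (%e. schwartz_seminorm j (u e)) b" "uO (UNIV :: unit set) (%e _. z e) a"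
 shows "bigO_eps (%e. schwartz_seminorm j (%x. z e * u e x)) (a + b)"
proof -
 have zu: "(%e x. z e * u e x) : nets_in schwartz" using assms(1) by (auto simp: nets_in_def intro: schwartz_cmult)
 obtain C where C: "C >= 0" "EV e. 0 < e & e < 1 & sbound j (u e) (C * e powr b)"
  using assms(2) unfolding schwartz_bigO_iff[OF assms(1)] by (elim exE conjE)
 from assms(3) obtain D where D: "0 <= D" "EV e. 0 < e & e < 1 & (ALL x:(UNIV::unit set). cmod (z e) <= D * e powr a)" by (rule uOE)
 have "EV e. 0 < e & e < 1 & sbound j (%x. z e * u e x) ((D * C) * e powr (a + b))"
  using C(2) D(2)
 proof eventually_elim
  case (elim e)
  have "sbound j (%x. z e * u e x) (cmod (z e) * (C * e powr b))"
   using elim assms(1) by (intro sbound_cmult) (auto simp: nets_in_def intro: schwartz_smooth)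
  moreover have "cmod (z e) * (C * e powr b) <= (D * e powr a) * (C * e powr b)"
   using elim C(1) by (intro mult_right_mono) auto
  then have "cmod (z e) * (C * e powr b) <= (D * C) * e powr (a + b)" by (simp add: powr_add mult_ac)
  ultimately show ?case using elim sbound_mono by blast
 qed
 with C(1) D(1) show ?thesis unfolding schwartz_bigO_iff[OF zu] by (intro exI[of _ "D * C"]) simp
qed

lemma N_S_iff: "u:N_S \<longleftrightarrow> u:nets_in schwartz & (ALL j b. bigO_eps (%e. schwartz_seminorm j (u e)) b)"
proof -
 have "bigO_eps (%e. schwartz_seminorm j (u e)) b" if "u:N_S" for j b
  by (rule bigO_eps_mono[of _ "real (nat \<lceil>b\<rceil>)"]) (use that in \<open>auto simp: N_S_def\<close>, linarith)
 then show ?thesis by (auto simp: N_S_def)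
qed

lemma E_S_iff: "u:E_S \<longleftrightarrow> u:nets_in schwartz & (ALL j. EX b. bigO_eps (%e. schwartz_seminorm j (u e)) b)"
proof -
 have "EX N::nat. bigO_eps (%e. schwartz_seminorm j (u e)) (- real N)" if "bigO_eps (%e. schwartz_seminorm j (u e)) b" for j b
  by (rule exI[of _ "nat \<lceil>- b\<rceil>"], rule bigO_eps_mono[OF that]) linarith
 then have "(EX N::nat. bigO_eps (%e. schwartz_seminorm j (u e)) (- real N)) \<longleftrightarrow> (EX b. bigO_eps (%e. schwartz_seminorm j (u e)) b)" for j
  by blast
 then show ?thesis by (simp add: E_S_def)
qed

lemma net_space_G_S: "net_space (G_S :: 'n::finite net_quotient) schwartz"
proof
 have M: "moderate_nets G_S = E_S" and N: "negligible_nets G_S = N_S" by (simp_all add: G_S_def)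
 show "u e:schwartz" if "u:moderate_nets G_S" "0 < e" "e <= 1" for u and e :: real
  using that unfolding M E_S_iff nets_in_def by auto
 show "(%x. f x + g x) : schwartz" if "f:schwartz" "g:schwartz" for f g :: "'n fn" using that by (rule schwartz_add)
 show "(%x. c * f x) : schwartz" if "f:schwartz" for f :: "'n fn" and c using that by (rule schwartz_cmult)
 show "negligible_nets G_S <= moderate_nets G_S" unfolding M N by (auto simp: E_S_iff N_S_iff)
 have z: "sbound j (%_. 0) 0" for j by (auto simp: sbound_def ideriv_const)
 have zn: "(%_ _. 0) : nets_in schwartz" by (simp add: nets_in_def schwartz_zero)
 have ez: "EV e. 0 < e & e < 1 & sbound j (%_. 0) (0 * e powr b)" for j b
  by (rule eventually_mono[OF EV_unit]) (use z in auto)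
 show "(%_ _. 0) : negligible_nets G_S" unfolding N N_S_iff schwartz_bigO_iff[OF zn]
  using zn ez by (intro conjI allI exI[of _ 0]) simp_all
 have na: "(%e x. u e x + v e x) : nets_in schwartz" if "u:nets_in schwartz" "v:nets_in schwartz" for u v
  using that by (auto simp: nets_in_def intro: schwartz_add)
 have nz: "(%e x. z e * u e x) : nets_in schwartz" if "u:nets_in schwartz" for u and z :: "real => complex"
  using that by (auto simp: nets_in_def intro: schwartz_cmult)
 show "(%e x. u e x + v e x) : negligible_nets G_S" if "u:negligible_nets G_S" "v:negligible_nets G_S" for u v
  using that unfolding N N_S_iff by (auto intro: na schwartz_bigO_add)
 show "(%e x. u e x + v e x) : moderate_nets G_S" if uv: "u:moderate_nets G_S" "v:moderate_nets G_S" for u v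
  unfolding M E_S_iff
 proof (intro conjI allI)
  show "(%e x. u e x + v e x) : nets_in schwartz" using uv unfolding M E_S_iff by (auto intro: na)
  fix j
  obtain b c where "bigO_eps (%e. schwartz_seminorm j (u e)) b" "bigO_eps (%e. schwartz_seminorm j (v e)) c"
   using uv unfolding M E_S_iff by blast
  then have "bigO_eps (%e. schwartz_seminorm j (u e)) (min b c)" "bigO_eps (%e. schwartz_seminorm j (v e)) (min b c)"
   by (auto elim: bigO_eps_mono)
  then show "EX b. bigO_eps (%e. schwartz_seminorm j (%x. u e x + v e x)) b"
   using uv unfolding M E_S_iff by (intro exI schwartz_bigO_add) auto
 qed
 show "(%e x. z e * u e x) : moderate_nets G_S" if "u:moderate_nets G_S" "moderate_num z" for u z
  using that unfolding M E_S_iff mod_num_iff umod_def by (blast intro: nz schwartz_bigO_scale)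
 show "(%e x. z e * u e x) : negligible_nets G_S" if uz: "u:negligible_nets G_S" "moderate_num z" for u z
  unfolding N N_S_iff
 proof (intro conjI allI)
  show "(%e x. z e * u e x) : nets_in schwartz" using uz unfolding N N_S_iff by (auto intro: nz)
  fix j b
  obtain a where "uO (UNIV :: unit set) (%e _. z e) a" using uz(2) unfolding mod_num_iff umod_def by blast
  then show "bigO_eps (%e. schwartz_seminorm j (%x. z e * u e x)) b"
   using schwartz_bigO_scale[of u j "b - a" z a] uz unfolding N N_S_iff by simp
 qed
 show "(%e x. z e * u e x) : negligible_nets G_S" if uz: "u:moderate_nets G_S" "negligible_num z" for u z
  unfolding N N_S_iff
 proof (intro conjI allI)
  show "(%e x. z e * u e x) : nets_in schwartz" using uz unfolding M E_S_iff by (auto intro: nz)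
  fix j b
  obtain c where "bigO_eps (%e. schwartz_seminorm j (u e)) c" using uz unfolding M E_S_iff by blast
  moreover have "uO (UNIV :: unit set) (%e _. z e) (b - c)" using uz(2) unfolding negl_num_iff by (rule unegl_uO)
  ultimately show "bigO_eps (%e. schwartz_seminorm j (%x. z e * u e x)) b"
   using schwartz_bigO_scale[of u j c z "b - c"] uz unfolding M E_S_iff by simp
 qed
qed

section \<open>Nets of smooth functions on an open set\<close>

lemma moderate_G [simp]: "moderate_nets (G X) = E_M X" and negligible_G [simp]: "negligible_nets (G X) = N_M X"
 by (simp_all add: G_def)

lemma net_space_G:
 assumes X: "open X" shows "net_space (G X) {f. smooth_on X f}"
proof (unfold_locales, unfold moderate_G negligible_G)
 show "u e : {f. smooth_on X f}" if "u:E_M X" "0 < e" "e <= 1" for u and e :: real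
  using smooth_netsD[OF E_M_smooth[OF X that(1)] that(2,3)] by simp
 show "N_M X <= E_M X" by (rule N_M_subset_E_M[OF X])
 show "(%_ _. 0) : N_M X" by (rule N_M_zero[OF X])
qed (auto intro: smooth_on_add[OF X] smooth_on_cmult[OF X] N_M_add[OF X] E_M_add[OF X] E_M_scale[OF X] N_M_scale[OF X]
  N_M_scale_negligible[OF X] negl_num_imp_moderate)

lemma sup_seminorm_bigO_iff:
 assumes "open X" "u:smooth_nets X" "K <= X"
 shows "bigO_eps (%e. sup_seminorm K j (u e)) b \<longleftrightarrow> (ALL is. length is <= j --> uO K (%e. ideriv is (u e)) b)"
proof
 assume "bigO_eps (%e. sup_seminorm K j (u e)) b"
 then obtain C where C: "EV e. sup_seminorm K j (u e) <= ennreal (C * e powr b)" by (auto simp: bigO_eps_def)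
 show "ALL is. length is <= j --> uO K (%e. ideriv is (u e)) b"
 proof (intro allI impI, rule uO_eventuallyI)
  fix "is" :: "'a list" assume l: "length is <= j"
  show "EV e. ALL x:K. cmod (ideriv is (u e) x) <= \<bar>C\<bar> * e powr b"
   using C EV_unit
  proof eventually_elim
   case (elim e)
   have "C * e powr b <= \<bar>C\<bar> * e powr b" by (intro mult_right_mono) auto
   then have "sup_seminorm K j (u e) <= ennreal (\<bar>C\<bar> * e powr b)" using elim by (meson ennreal_leI order_trans)
   moreover have "smooth_on X (u e)" using smooth_netsD[OF assms(2)] elim by simp
   ultimately show ?case using l sup_seminorm_le_iff[OF assms(1) _ assms(3), of "u e" "\<bar>C\<bar> * e powr b" j] by simp
  qed
 qed
next
 assume a: "ALL is. length is <= j --> uO K (%e. ideriv is (u e)) b"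
 obtain C where C: "0 <= C" "EV e. 0 < e & e < 1 & (ALL is. length is <= j --> (ALL x:K. cmod (ideriv is (u e) x) <= C * e powr b))"
  by (rule uO_all_lists[of j K "%is e. ideriv is (u e)" b, OF a[rule_format]])
 have "EV e. sup_seminorm K j (u e) <= ennreal (C * e powr b)"
  using C(2)
 proof eventually_elim
  case (elim e)
  have "smooth_on X (u e)" using smooth_netsD[OF assms(2)] elim by simp
  then show ?case using elim C(1) sup_seminorm_le_iff[OF assms(1) _ assms(3), of "u e" "C * e powr b" j] by simp
 qed
 then show "bigO_eps (%e. sup_seminorm K j (u e)) b" by (auto simp: bigO_eps_def)
qed

lemma admissible_sup_seminorm:
 assumes X: "open X" and K: "compact K" "K <= X"
 shows "net_space.admissible (G X) (sup_seminorm K j)"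
proof -
 interpret net_space "G X" "{f. smooth_on X f}" by (rule net_space_G[OF X])
 show ?thesis unfolding admissible_def moderate_G negligible_G
 proof (intro conjI ballI allI)
  fix u assume u: "u:E_M X"
  obtain N :: nat where "ALL is. length is <= j --> uO K (%e. ideriv is (u e)) (- real N)"
   using umod_all_lists[of j K "%is e. ideriv is (u e)"] E_M_umod[OF X u K] by blast
  then show "EX b. bigO_eps (%e. sup_seminorm K j (u e)) b"
   using sup_seminorm_bigO_iff[OF X E_M_smooth[OF X u] K(2)] by blast
 next
  fix u b assume u: "u:N_M X"
  then have s: "u:smooth_nets X" by (simp add: N_M_iff[OF X])
  show "bigO_eps (%e. sup_seminorm K j (u e)) b"
   unfolding sup_seminorm_bigO_iff[OF X s K(2)] using unegl_uO[OF N_M_unegl[OF X u K]] by blast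
 qed
qed

lemma admissible_schwartz_seminorm: "net_space.admissible G_S (schwartz_seminorm j)"
proof -
 interpret net_space "G_S :: 'a net_quotient" schwartz by (rule net_space_G_S)
 show ?thesis unfolding admissible_def by (auto simp: G_S_def E_S_iff N_S_iff)
qed

subsection \<open>Supports and compactly supported representatives\<close>

lemma grestrict_zero_iff:
 assumes "open X" "open V" "V <= X" "U:elems (G X)" "u:U"
 shows "grestrict V U = gzero (G V) \<longleftrightarrow> u:N_M V"
proof -
 interpret X: net_space "G X" "{f. smooth_on X f}" by (rule net_space_G[OF assms(1)])
 interpret V: net_space "G V" "{f. smooth_on V f}" by (rule net_space_G[OF assms(2)])
 have r: "rep U:E_M V" using X.rep_moderate[OF assms(4)] net_restrict(1)[OF assms(1-3)] by simp
 have d: "(%e x. u e x - rep U e x) : N_M V"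
  using X.mem_negl[OF assms(4,5) X.rep_in[OF assms(4)]] net_restrict(2)[OF assms(1-3)] by simp
 have "grestrict V U = gzero (G V) \<longleftrightarrow> rep U:N_M V"
  unfolding grestrict_def gzero_def using V.cls_eqD[of "rep U" "%_ _. 0"] V.cls_eqI[of "rep U" "%_ _. 0"] r by auto
 also have "... \<longleftrightarrow> u:N_M V"
  using N_M_add[OF assms(2) _ d, of "rep U"] N_M_diff[OF assms(2) _ d, of u] by auto
 finally show ?thesis .
qed

text \<open>A compact set is covered by finitely many balls on whose closures the net is negligible,
  and \<open>N_M_zeroth_order\<close> reduces the claim to values.\<close>

lemma N_M_local:
 fixes u :: "'n::finite net"
 assumes V: "open V" and s: "u:E_M V" and cov: "!!x. x:V ==> EX W. open W & x:W & W <= V & u:N_M W"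
 shows "u:N_M V"
proof (rule N_M_zeroth_order[OF V s])
 fix K assume K: "compact K" "K <= V"
 have "ALL x:K. EX r. 0 < r & unegl (cball x r) u"
 proof
  fix x assume "x:K"
  then obtain W where W: "open W" "x:W" "W <= V" "u:N_M W" using cov K(2) by blast
  then obtain r where r: "0 < r" "cball x r <= W" using open_contains_cball by blast
  have "unegl (cball x r) (%e. ideriv [] (u e))" by (rule N_M_unegl[OF W(1,4) compact_cball r(2)])
  then show "EX r. 0 < r & unegl (cball x r) u" using r(1) by auto
 qed
 then obtain r where r: "ALL x:K. 0 < r x & unegl (cball x (r x)) u" by (rule bchoice[THEN exE])
 have cK: "K <= (\<Union>x\<in>K. ball x (r x))"
 proof
  fix x assume "x:K"
  then show "x : (\<Union>x\<in>K. ball x (r x))" using bspec[OF r, of x] by (intro UN_I[of x]) simp_all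
 qed
 obtain C where C: "C <= K" "finite C" "K <= (\<Union>x\<in>C. ball x (r x))"
  by (rule compactE_image[OF K(1) _ cK]) simp
 have "unegl (\<Union>x\<in>C. cball x (r x)) u" by (rule unegl_UN[OF C(2)]) (use r C(1) in blast)
 moreover have "(\<Union>x\<in>C. ball x (r x)) <= (\<Union>x\<in>C. cball x (r x))" by (rule UN_mono[OF subset_refl ball_subset_cball])
 then have "K <= (\<Union>x\<in>C. cball x (r x))" using C(3) by (rule order_trans[rotated])
 ultimately show "unegl K u" by (rule unegl_subset)
qed

text \<open>The union of all open sets on which \<open>U\<close> vanishes is again such a set,
  because negligibility is local.\<close>

lemma gsupp_negl:
 assumes X: "open X" and U: "U:elems (G X)" "u:U"
 shows "open (X - gsupp X U)" "u:N_M (X - gsupp X U)"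
proof -
 interpret net_space "G X" "{f. smooth_on X f}" by (rule net_space_G[OF X])
 let ?VV = "{V. open V & V <= X & grestrict V U = gzero (G V)}"
 have eq: "X - gsupp X U = \<Union>?VV" unfolding gsupp_def by blast
 show op: "open (X - gsupp X U)" unfolding eq by (rule open_Union) blast
 have uE: "u:E_M X" using mem_elem(1)[OF U] by simp
 show "u:N_M (X - gsupp X U)"
 proof (rule N_M_local[OF op])
  show "u:E_M (X - gsupp X U)" by (rule net_restrict(1)[OF X op _ uE]) blast
  fix x assume "x:X - gsupp X U"
  then obtain V where V: "open V" "V <= X" "grestrict V U = gzero (G V)" "x:V" unfolding eq by blast
  then have "u:N_M V" using grestrict_zero_iff[OF X V(1,2) U] by simp
  moreover have "V <= X - gsupp X U" unfolding eq using V by blast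
  ultimately show "EX W. open W & x:W & W <= X - gsupp X U & u:N_M W" using V by blast
 qed
qed

lemma gsupp_subset_iff:
 assumes X: "open X" and K: "closed K" and U: "U:elems (G X)" "u:U"
 shows "gsupp X U <= K \<longleftrightarrow> u:N_M (X - K)"
proof
 have op: "open (X - K)" using X K by (rule open_Diff)
 {
  assume "gsupp X U <= K"
  then show "u:N_M (X - K)"
   by (intro net_restrict(2)[OF gsupp_negl(1)[OF X U] op _ gsupp_negl(2)[OF X U]]) blast
 next
  assume "u:N_M (X - K)"
  then have "grestrict (X - K) U = gzero (G (X - K))" using grestrict_zero_iff[OF X op _ U] by blast
  then show "gsupp X U <= K" unfolding gsupp_def using op by blast
 }
qed

lemma compact_gsupp:
 assumes X: "open X" and K: "compact K" "K <= X" and U: "U:elems (G X)" "gsupp X U <= K"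
 shows "compact (gsupp X U)"
proof -
 interpret net_space "G X" "{f. smooth_on X f}" by (rule net_space_G[OF X])
 have "gsupp X U = K - (X - gsupp X U)" using U(2) K(2) by blast
 then show ?thesis using compact_diff[OF K(1) gsupp_negl(1)[OF X U(1) rep_in[OF U(1)]]] by simp
qed

lemma gsupp_subset_domain: "gsupp X U <= X"
 unfolding gsupp_def by blast

lemma const_net_E_M_inf:
 assumes X: "open X" and f: "smooth_on X f" shows "(%e. f) : E_M_inf X"
 unfolding E_M_inf_iff[OF X]
proof (intro conjI allI impI)
 show "(%e. f) : smooth_nets X" using f by (simp add: smooth_nets_def)
 fix K assume K: "compact K & K <= X"
 have "uO K (%e. ideriv is f) 0" for "is"
 proof -
  obtain B where "!!x. x:K ==> cmod (ideriv is f x) <= B" using ideriv_bounded_compact[OF f, of K "length is"] K by blast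
  then show ?thesis by (rule uO_const_net)
 qed
 then show "EX N::nat. ALL is. uO K (%e. ideriv is f) (- real N)" by (intro exI[of _ 0]) simp
qed

lemma const_net_E_M: "open X ==> smooth_on X f ==> (%e. f) : E_M X"
 using const_net_E_M_inf E_M_inf_subset_E_M by blast

lemma test_smooth_on: "f:test V ==> smooth_on S f"
 using smooth_on_subset[OF test_smooth] by blast

lemma test_mono: "f:test V ==> V <= X ==> f:test X"
 unfolding test_functions_def by blast

lemma cutoff_net_E_M:
 assumes "open X" "\<rho>:test V" "u:E_M X" shows "(%e x. \<rho> x * u e x) : E_M X"
 by (rule E_M_mult[OF assms(1) const_net_E_M[OF assms(1) test_smooth_on[OF assms(2)]] assms(3)])

text \<open>On \<open>W\<close> the factor \<rho> changes nothing. The rest of a compact set is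
  compact and disjoint from the support, so \<open>u\<close> is negligible there.\<close>

lemma cutoff_net_mem:
 assumes X: "open X" and U: "U:elems (G X)" "u:U" and \<rho>: "\<rho>:test X"
  and W: "open W" "gsupp X U <= W" "!!x. x:W ==> \<rho> x = 1"
 shows "(%e x. \<rho> x * u e x) : U"
proof -
 interpret net_space "G X" "{f. smooth_on X f}" by (rule net_space_G[OF X])
 have uE: "u:E_M X" using mem_elem(1)[OF U] by simp
 have cE: "(%e x. \<rho> x * u e x) : E_M X" by (rule cutoff_net_E_M[OF X \<rho> uE])
 have "(%e x. \<rho> x * u e x - u e x) : N_M X"
 proof (rule N_M_zeroth_order[OF X E_M_diff[OF X cE uE]])
  fix K assume K: "compact K" "K <= X"
  obtain B where B: "B >= 0" "!!x. x:K ==> cmod (\<rho> x - 1) <= B"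
   using ideriv_bounded_compact[OF smooth_on_diff[OF X test_smooth_on[OF \<rho>] smooth_on_const[OF X, of 1]] K, of 0] by auto
  have KW: "compact (K - W)" by (rule compact_diff[OF K(1) W(1)])
  have "unegl (K - W) (%e. ideriv [] (u e))"
   by (rule N_M_unegl[OF gsupp_negl[OF X U] KW]) (use K W(2) in blast)
  then have n: "uO (K - W) u b" for b using unegl_uO by fastforce
  show "unegl K (%e x. \<rho> x * u e x - u e x)"
  proof (rule uneglI)
   fix q :: nat
   have "uO (K - W) (%e x. \<rho> x * u e x - u e x) (real q)"
   proof (rule uO_dominated[OF n B(1)])
    fix e x assume x: "x:K - W"
    have "cmod (\<rho> x * u e x - u e x) = cmod (\<rho> x - 1) * cmod (u e x)"
     by (simp add: norm_mult[symmetric] left_diff_distrib)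
    also have "... <= B * cmod (u e x)" using B(2)[of x] x by (intro mult_right_mono) auto
    finally show "EX y:K - W. cmod (\<rho> x * u e x - u e x) <= B * cmod (u e y)" using x by blast
   qed
   moreover have "uO (K \<inter> W) (%e x. \<rho> x * u e x - u e x) (real q)"
    by (rule uO_cong[OF uO_zero]) (use W(3) in simp)
   ultimately show "uO K (%e x. \<rho> x * u e x - u e x) (real q)"
    using uO_Un[of "K - W" _ _ "K \<inter> W"] by (simp add: Un_Diff_Int)
  qed
 qed
 then show ?thesis using cls_eqI[of "%e x. \<rho> x * u e x" u] cls_self[of "%e x. \<rho> x * u e x"] cE mem_elem(2)[OF U] by simp
qed

text \<open>Any representative multiplied by a cutoff around the support is a witness for the choice
  made in \<open>crep\<close>.\<close>

lemma crep_props: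
 assumes X: "open X" and U: "U:G_c X"
 shows "crep X U:U" "EX K. compact K & K <= X & (ALL e:{0<..1}. ALL x. x ~: K --> crep X U e x = 0)"
proof -
 interpret net_space "G X" "{f. smooth_on X f}" by (rule net_space_G[OF X])
 have U': "U:elems (G X)" "compact (gsupp X U)" using U by (auto simp: G_c_def)
 obtain \<rho> W where \<rho>: "\<rho>:test X" "open W" "gsupp X U <= W" "!!x. x:W ==> \<rho> x = 1"
  by (rule cutoff_exists[OF X U'(2) gsupp_subset_domain]) blast
 obtain K where K: "compact K" "K <= X" "!!x. x ~: K ==> \<rho> x = 0" using testE[OF \<rho>(1)] by metis
 have "(%e x. \<rho> x * rep U e x) : U" by (rule cutoff_net_mem[OF X U'(1) rep_in[OF U'(1)] \<rho>])
 then have "EX u. u:U & (EX K. compact K & K <= X & (ALL e:{0<..1}. ALL x. x ~: K --> u e x = 0))"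
  using K by (intro exI[of _ "%e x. \<rho> x * rep U e x"] conjI exI[of _ K]) auto
 then have "crep X U:U & (EX K. compact K & K <= X & (ALL e:{0<..1}. ALL x. x ~: K --> crep X U e x = 0))"
  unfolding crep_def by (rule someI_ex)
 then show "crep X U:U" "EX K. compact K & K <= X & (ALL e:{0<..1}. ALL x. x ~: K --> crep X U e x = 0)" by auto
qed

lemma G_c_elem: "U:G_c X ==> U:elems (G X)"
 by (simp add: G_c_def)

lemma vanishing_net_N_M:
 assumes X: "open X" and K: "closed K" and z: "!!e x. 0 < e ==> e <= 1 ==> x ~: K ==> u e x = 0"
 shows "u:N_M (X - K)"
 unfolding N_M_iff[OF open_Diff[OF X K]]
proof (intro conjI allI impI)
 have op: "open (X - K)" using X K by (rule open_Diff)
 show "u:smooth_nets (X - K)"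
  unfolding smooth_nets_def
 proof (intro CollectI ballI)
  fix e :: real assume "e : {0<..1}"
  then show "smooth_on (X - K) (u e)"
   by (intro smooth_on_cong[OF op _ smooth_on_const[OF op, of 0]]) (use z in auto)
 qed
 fix L and "is" :: "'a list" assume L: "compact L & L <= X - K"
 show "unegl L (%e. ideriv is (u e))"
  by (rule unegl_cong[OF unegl_zero]) (use L ideriv_outside[OF K z] in auto)
qed

lemma compact_support_G_c:
 assumes X: "open X" and K: "compact K" "K <= X" and u: "u:E_M X" and z: "!!e x. 0 < e ==> e <= 1 ==> x ~: K ==> u e x = 0"
 shows "cls (G X) u:G_K X K" "cls (G X) u:G_c X" "gsupp X (cls (G X) u) <= K"
proof -
 interpret net_space "G X" "{f. smooth_on X f}" by (rule net_space_G[OF X])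
 have e: "cls (G X) u:elems (G X)" "u:cls (G X) u" using cls_elem cls_self u by auto
 show s: "gsupp X (cls (G X) u) <= K"
  unfolding gsupp_subset_iff[OF X compact_imp_closed[OF K(1)] e]
  by (rule vanishing_net_N_M[OF X compact_imp_closed[OF K(1)] z])
 show "cls (G X) u:G_K X K" using e s by (simp add: G_K_def)
 show "cls (G X) u:G_c X" using e compact_gsupp[OF X K e(1) s] by (simp add: G_c_def)
qed

subsection \<open>Integrals of generalized functions\<close>

lemma set_integral_bound:
 fixes F :: "'n::finite fn"
 assumes "compact K" "S <= K" "!!y. y:S ==> cmod (F y) <= M" "0 <= M"
 shows "cmod (LINT y:S|lborel. F y) <= M * measure lborel K"
proof (cases "integrable lborel (%y. indicator S y *\<^sub>R F y)")
 case True
 have K: "integrable lborel (indicator K :: real^'n => real)"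
  using emeasure_compact_finite[OF assms(1)] assms(1) by (intro integrable_real_indicator) (auto intro: borel_compact)
 have "cmod (LINT y:S|lborel. F y) <= (LINT y|lborel. M * indicator K y)"
  unfolding set_lebesgue_integral_def
 proof (rule Bochner_Integration.integral_norm_bound_integral[OF True])
  show "integrable lborel (%y. M * indicator K y)" by (rule integrable_mult_right[OF K])
  show "norm (indicator S y *\<^sub>R F y) <= M * indicator K y" for y
   using assms(2,3,4) by (auto simp: indicator_def)
 qed
 also have "... = M * measure lborel K" by simp
 finally show ?thesis .
next
 \<comment> \<open>A function that is not integrable has integral 0 by convention, which is below
   the nonnegative bound.\<close>
 case False
 then show ?thesis using assms(4) by (simp add: set_lebesgue_integral_def not_integrable_integral_eq)
qed

lemma set_integrable_cont:
 fixes f :: "'n::finite fn"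
 shows "compact K ==> continuous_on K f ==> set_integrable lborel K f"
 unfolding set_integrable_def by (rule borel_integrable_compact)

lemma uO_set_integral:
 fixes F :: "'n::finite net"
 assumes "compact K" "S <= K" "uO S F b"
 shows "uO (UNIV :: unit set) (%e _. LINT y:S|lborel. F e y) b"
proof -
 from assms(3) obtain C where C: "0 <= C" "EV e. 0 < e & e < 1 & (ALL x:S. cmod (F e x) <= C * e powr b)" by (rule uOE)
 have "EV e. ALL x:(UNIV :: unit set). cmod (LINT y:S|lborel. F e y) <= (C * measure lborel K) * e powr b"
  using C(2)
 proof eventually_elim
  case (elim e)
  have "cmod (LINT y:S|lborel. F e y) <= (C * e powr b) * measure lborel K"
   by (rule set_integral_bound[OF assms(1,2)]) (use elim C(1) in auto)
  then show ?case by (simp add: mult_ac)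
 qed
 then show ?thesis by (rule uO_eventuallyI)
qed

lemma smooth_nets_set_integrable:
 assumes "u:smooth_nets X" "compact K" "K <= X" "0 < e" "e < 1"
 shows "set_integrable lborel K (u e)"
 using set_integrable_cont[OF assms(2) continuous_on_subset[OF smooth_on_cont[OF smooth_netsD[OF assms(1,4)]] assms(3)]] assms(5) by simp

lemma moderate_set_integral:
 assumes X: "open X" and u: "u:E_M X" and K: "compact K" "K <= X"
 shows "moderate_num (%e. LINT y:K|lborel. u e y)"
proof -
 obtain N :: nat where "uO K (%e. ideriv [] (u e)) (- real N)" using E_M_umod[OF X u K] unfolding umod_def by blast
 then have "uO K u (- real N)" by simp
 then show ?thesis unfolding mod_num_iff by (intro umodI[OF uO_set_integral[OF K(1) subset_refl]])
qed

lemma negligible_set_integral: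
 fixes u :: "'n::finite net"
 assumes "compact K" "S <= L" "compact L" "unegl L u"
 shows "negligible_num (%e. LINT y:S|lborel. u e y)"
 unfolding negl_num_iff
 by (intro uneglI uO_set_integral[OF assms(3,2)] uO_subset[OF unegl_uO[OF assms(4)] assms(2)])

lemma set_integral_split:
 fixes f :: "'n::finite fn"
 assumes "compact K" "compact L" "continuous_on (K \<union> L) f"
 shows "(LINT y:K|lborel. f y) - (LINT y:L|lborel. f y) = (LINT y:K - L|lborel. f y) - (LINT y:L - K|lborel. f y)"
proof -
 have i: "set_integrable lborel M f" if "M <= K \<union> L" "M:sets borel" for M
 proof (rule set_integrable_subset[of lborel "K \<union> L"])
  show "set_integrable lborel (K \<union> L) f" by (rule set_integrable_cont[OF compact_Un[OF assms(1,2)] assms(3)])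
 qed (use that in auto)
 have b: "K:sets borel" "L:sets borel" using assms by (auto intro: borel_compact)
 have 1: "(LINT y:(K - L) \<union> (K \<inter> L)|lborel. f y) = (LINT y:K - L|lborel. f y) + (LINT y:K \<inter> L|lborel. f y)"
  by (rule set_integral_Un) (use b in \<open>auto intro!: i\<close>)
 have 2: "(LINT y:(L - K) \<union> (K \<inter> L)|lborel. f y) = (LINT y:L - K|lborel. f y) + (LINT y:K \<inter> L|lborel. f y)"
  by (rule set_integral_Un) (use b in \<open>auto intro!: i\<close>)
 have e: "(K - L) \<union> (K \<inter> L) = K" "(L - K) \<union> (K \<inter> L) = L" by auto
 show ?thesis using 1 2 unfolding e by simp
qed

text \<open>Two admissible compact sets differ only within compact sets that avoid the support,
  where \<open>h\<close> is negligible. Hence neither the choice of the set nor that of the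
  representative matters.\<close>

lemma gintegral_eq:
 assumes X: "open X" and H: "H:elems (G X)" "h:H" and K: "compact K" "K <= X" "gsupp X H <= interior K"
 shows "gintegral X H = abs_gnum (%e. LINT y:K|lborel. h e y)"
proof -
 interpret net_space "G X" "{f. smooth_on X f}" by (rule net_space_G[OF X])
 define L where "L = (SOME K. compact K & K <= X & gsupp X H <= interior K)"
 have "EX K. compact K & K <= X & gsupp X H <= interior K" using K by blast
 then have L: "compact L" "L <= X" "gsupp X H <= interior L"
  unfolding L_def using someI_ex[of "%K. compact K & K <= X & gsupp X H <= interior K"] by auto
 have hE: "h:E_M X" and rE: "rep H:E_M X" using mem_elem(1)[OF H] rep_moderate[OF H(1)] by auto
 have hs: "h:smooth_nets X" and rs: "rep H:smooth_nets X" using E_M_smooth[OF X] hE rE by auto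
 have off: "unegl M h" if "compact M" "M <= X" "M \<inter> gsupp X H = {}" for M
 proof -
  have "unegl M (%e. ideriv [] (h e))" by (rule N_M_unegl[OF gsupp_negl[OF X H] that(1)]) (use that in blast)
  then show ?thesis by simp
 qed
 have c1: "compact (L - interior K)" "compact (K - interior L)" using K L by (auto intro: compact_diff)
 have "negligible_num (%e. LINT y:L|lborel. rep H e y - h e y)"
 proof (rule negligible_set_integral[OF L(1) subset_refl L(1)])
  have "unegl L (%e. ideriv [] (%y. rep H e y - h e y))"
   using mem_negl[OF H(1) rep_in[OF H(1)] H(2)] by (intro N_M_unegl[OF X _ L(1,2)]) simp
  then show "unegl L (%e y. rep H e y - h e y)" by simp
 qed
 moreover have "negligible_num (%e. LINT y:L - K|lborel. h e y)"
 proof (rule negligible_set_integral[OF L(1) _ c1(1) off[OF c1(1)]])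
  show "L - K <= L - interior K" using interior_subset[of K] by blast
 qed (use L K in auto)
 moreover have "negligible_num (%e. LINT y:K - L|lborel. h e y)"
 proof (rule negligible_set_integral[OF K(1) _ c1(2) off[OF c1(2)]])
  show "K - L <= K - interior L" using interior_subset[of L] by blast
 qed (use L K in auto)
 ultimately have "negligible_num (%e. (LINT y:L|lborel. rep H e y - h e y) + ((LINT y:L - K|lborel. h e y) + - (LINT y:K - L|lborel. h e y)))"
  by (intro negligible_num_add negligible_num_uminus)
 then have n: "negligible_num (%e. (LINT y:L|lborel. rep H e y) - (LINT y:K|lborel. h e y))"
 proof (rule negl_num_cong)
  fix e :: real assume e: "0 < e" "e < 1"
  have "continuous_on (L \<union> K) (h e)"
   using continuous_on_subset[OF smooth_on_cont[OF smooth_netsD[OF hs e(1)]], of "L \<union> K"] e L(2) K(2) by auto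
  note s = set_integral_split[OF L(1) K(1) this]
  have d: "(LINT y:L|lborel. rep H e y - h e y) = (LINT y:L|lborel. rep H e y) - (LINT y:L|lborel. h e y)"
   by (rule set_integral_diff(2)[OF smooth_nets_set_integrable[OF rs L(1,2) e] smooth_nets_set_integrable[OF hs L(1,2) e]])
  show "(LINT y:L|lborel. rep H e y - h e y) + ((LINT y:L - K|lborel. h e y) + - (LINT y:K - L|lborel. h e y)) = (LINT y:L|lborel. rep H e y) - (LINT y:K|lborel. h e y)"
   unfolding d add_uminus_conv_diff s[symmetric] by simp
 qed
 have "gintegral X H = abs_gnum (%e. LINT y:L|lborel. rep H e y)" unfolding gintegral_def L_def Let_def ..
 also have "... = abs_gnum (%e. LINT y:K|lborel. h e y)"
  by (rule abs_gnum_eqI'[OF moderate_set_integral[OF X rE L(1,2)] n])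
 finally show ?thesis .
qed

lemma gmult_mem:
 assumes X: "open X" and I: "I:elems (G X)" "a:I" and V: "V:elems (G X)" "v:V"
 shows "gmult (G X) I V:elems (G X)" "(%e x. a e x * v e x) : gmult (G X) I V"
proof -
 interpret net_space "G X" "{f. smooth_on X f}" by (rule net_space_G[OF X])
 have E: "a:E_M X" "rep I:E_M X" "v:E_M X" "rep V:E_M X"
  using mem_elem(1)[OF I] mem_elem(1)[OF V] rep_moderate[OF I(1)] rep_moderate[OF V(1)] by auto
 have 1: "(%e x. (a e x - rep I e x) * v e x) : N_M X"
  using mem_negl[OF I(1,2) rep_in[OF I(1)]] E by (intro N_M_mult[OF X]) auto
 have 2: "(%e x. (v e x - rep V e x) * rep I e x) : N_M X"
  using mem_negl[OF V(1,2) rep_in[OF V(1)]] E by (intro N_M_mult[OF X]) auto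
 have d: "(%e x. a e x * v e x - rep I e x * rep V e x) : N_M X"
  using N_M_add[OF X 1 2] by (simp add: algebra_simps)
 show "gmult (G X) I V:elems (G X)" unfolding gmult_def by (rule cls_elem) (simp add: E_M_mult[OF X] E)
 have "gmult (G X) I V = cls (G X) (%e x. a e x * v e x)"
  unfolding gmult_def by (rule cls_eqI[symmetric]) (simp add: d)
 then show "(%e x. a e x * v e x) : gmult (G X) I V" using cls_self E_M_mult[OF X E(1,3)] by simp
qed

text \<open>The product is negligible wherever one factor is, so a compact neighbourhood of either
  support can serve as domain of integration.\<close>

lemma gintegral_gmult:
 assumes X: "open X" and I: "I:elems (G X)" "a:I" and V: "V:elems (G X)" "v:V"
  and K: "compact K" "K <= X" "gsupp X I <= interior K \<or> gsupp X V <= interior K"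
 shows "gintegral X (gmult (G X) I V) = abs_gnum (%e. LINT y:K|lborel. a e y * v e y)"
proof (rule gintegral_eq[OF X gmult_mem[OF X I V] K(1,2)])
 interpret net_space "G X" "{f. smooth_on X f}" by (rule net_space_G[OF X])
 have E: "a:E_M X" "v:E_M X" using mem_elem(1)[OF I] mem_elem(1)[OF V] by auto
 note g = gsupp_negl[OF X I] gsupp_negl[OF X V]
 have sub: "X - gsupp X I <= X" "X - gsupp X V <= X" by auto
 have 1: "(%e x. a e x * v e x) : N_M (X - gsupp X I)"
  by (rule N_M_mult[OF g(1,2) net_restrict(1)[OF X g(1) sub(1) E(2)]])
 have 2: "(%e x. v e x * a e x) : N_M (X - gsupp X V)"
  by (rule N_M_mult[OF g(3,4) net_restrict(1)[OF X g(3) sub(2) E(1)]])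
 have cl: "gsupp X (gmult (G X) I V) <= gsupp X Z" if "open (X - gsupp X Z)" "(%e x. a e x * v e x) : N_M (X - gsupp X Z)" for Z
 proof -
  have "grestrict (X - gsupp X Z) (gmult (G X) I V) = gzero (G (X - gsupp X Z))"
   using grestrict_zero_iff[OF X that(1) _ gmult_mem[OF X I V]] that(2) by blast
  then show ?thesis using that(1) unfolding gsupp_def[of _ "gmult (G X) I V"] by blast
 qed
 have "gsupp X (gmult (G X) I V) <= gsupp X I" by (rule cl[OF g(1) 1])
 moreover have "gsupp X (gmult (G X) I V) <= gsupp X V" by (rule cl[OF g(3)]) (use 2 in \<open>simp add: mult.commute\<close>)
 ultimately show "gsupp X (gmult (G X) I V) <= interior K" using K(3) by blast
qed

text \<open>Strict positivity of \<open>C\<close> settles the case of an infinite seminorm, where a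
  constant 0 would give \<open>0 * \<infinity> = 0\<close>. Constants are enlarged by 1 for this
  reason.\<close>

lemma seminorm_boundI:
 assumes "0 < C" "!!B. 0 <= B ==> s <= ennreal B ==> r <= C * B"
 shows "ennreal r <= ennreal C * s"
proof (cases s)
 case (real B)
 then have "r <= C * B" by (intro assms(2)) auto
 then show ?thesis using real assms(1) by (simp add: ennreal_mult[symmetric] ennreal_leI)
next
 case top
 then show ?thesis using assms(1) by (simp add: ennreal_mult_top)
qed

lemma pairing_functional:
 assumes X: "open X" and W: "W:E_M X" and K: "compact K" "K <= X"
 shows "EX N. net_space.net_functional (G X) {f. smooth_on X f} (%e f. LINT y:K|lborel. W e y * f y) (sup_seminorm K 0) N"
proof -
 interpret net_space "G X" "{f. smooth_on X f}" by (rule net_space_G[OF X])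
 obtain N :: nat where "uO K (%e. ideriv [] (W e)) (- real N)" using E_M_umod[OF X W K] unfolding umod_def by blast
 then have "uO K W (- real N)" by simp
 then obtain C where C: "0 <= C" "EV e. 0 < e & e < 1 & (ALL x:K. cmod (W e x) <= C * e powr (- real N))" by (rule uOE)
 let ?C = "(C + 1) * (measure lborel K + 1)"
 have Ws: "W:smooth_nets X" by (rule E_M_smooth[OF X W])
 have int: "set_integrable lborel K (%y. W e y * f y)" if "0 < e" "e < 1" "smooth_on X f" for e f
 proof (rule set_integrable_cont[OF K(1)])
  have "smooth_on X (%y. W e y * f y)" using smooth_netsD[OF Ws that(1)] that by (intro smooth_on_mult[OF X]) auto
  then show "continuous_on K (%y. W e y * f y)" using smooth_on_cont continuous_on_subset K(2) by blast
 qed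
 have "net_functional (%e f. LINT y:K|lborel. W e y * f y) (sup_seminorm K 0) (real N)"
  unfolding net_functional_def
 proof (intro conjI allI impI exI[of _ ?C])
  show "admissible (sup_seminorm K 0)" by (rule admissible_sup_seminorm[OF X K])
  fix e :: real assume e: "0 < e" "e < 1"
  show "linear_on {f. smooth_on X f} (%f. LINT y:K|lborel. W e y * f y)"
   unfolding linear_on_def
  proof (intro conjI ballI allI)
   fix f g assume "f : {f. smooth_on X f}" "g : {f. smooth_on X f}"
   then show "(LINT y:K|lborel. W e y * (f y + g y)) = (LINT y:K|lborel. W e y * f y) + (LINT y:K|lborel. W e y * g y)"
    using set_integral_add(2)[OF int[OF e, of f] int[OF e, of g]] by (simp add: distrib_left)
  next
   fix c f
   have "(LINT y:K|lborel. c * (W e y * f y)) = c * (LINT y:K|lborel. W e y * f y)" by (rule set_integral_mult_right)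
   then show "(LINT y:K|lborel. W e y * (c * f y)) = c * (LINT y:K|lborel. W e y * f y)" by (simp add: mult_ac)
  qed
 next
  show "EV e. ALL f:{f. smooth_on X f}. ennreal (cmod (LINT y:K|lborel. W e y * f y)) <= ennreal (?C * e powr (- real N)) * sup_seminorm K 0 f"
   using C(2)
  proof eventually_elim
   case (elim e)
   show ?case
   proof
    fix f assume "f : {f. smooth_on X f}"
    then have f: "smooth_on X f" by simp
    show "ennreal (cmod (LINT y:K|lborel. W e y * f y)) <= ennreal (?C * e powr (- real N)) * sup_seminorm K 0 f"
    proof (rule seminorm_boundI)
     show "0 < ?C * e powr (- real N)" using C(1) elim by (intro mult_pos_pos) (auto simp: add_nonneg_pos)
     fix B :: real assume B: "0 <= B" "sup_seminorm K 0 f <= ennreal B"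
     then have fB: "cmod (f y) <= B" if "y:K" for y
      using sup_seminorm_le_iff[OF X f K(2) B(1), of 0] that by simp
     have "cmod (LINT y:K|lborel. W e y * f y) <= ((C * e powr (- real N)) * B) * measure lborel K"
     proof (rule set_integral_bound[OF K(1) subset_refl])
      show "cmod (W e y * f y) <= (C * e powr (- real N)) * B" if "y:K" for y
       unfolding norm_mult using elim that fB[OF that] C(1) by (intro mult_mono) auto
     qed (use C(1) B(1) in auto)
     also have "... = (C * measure lborel K) * (e powr (- real N) * B)" by (simp add: mult_ac)
     also have "... <= ?C * (e powr (- real N) * B)"
      using C(1) B(1) by (intro mult_right_mono mult_mono) auto
     finally show "cmod (LINT y:K|lborel. W e y * f y) <= ?C * e powr (- real N) * B" by (simp add: mult_ac)
    qed
   qed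
  qed
 qed
 then show ?thesis by blast
qed

subsection \<open>Continuity on compactly supported generalized functions\<close>

lemma G_K_iff:
 assumes X: "open X" and K: "compact K" and U: "U:elems (G X)" "u:U"
 shows "U:G_K X K \<longleftrightarrow> u:N_M (X - K)"
 using gsupp_subset_iff[OF X compact_imp_closed[OF K] U] U by (simp add: G_K_def)

lemma G_K_elem: "U:G_K X K ==> U:elems (G X)"
 by (simp add: G_K_def)

lemma G_K_closed:
 assumes X: "open X" and K: "compact K" and U: "U:G_K X K"
 shows "V:G_K X K ==> gadd (G X) U V:G_K X K" "gscale (G X) z U:G_K X K"
proof -
 interpret net_space "G X" "{f. smooth_on X f}" by (rule net_space_G[OF X])
 have op: "open (X - K)" using open_Diff[OF X compact_imp_closed[OF K]] .
 have r: "rep Z:E_M X" "rep Z:N_M (X - K)" if "Z:G_K X K" for Z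
  using rep_moderate[OF G_K_elem[OF that]] G_K_iff[OF X K G_K_elem[OF that] rep_in[OF G_K_elem[OF that]]] that by auto
 show "gadd (G X) U V:G_K X K" if V: "V:G_K X K"
 proof -
  have "(%e x. rep U e x + rep V e x) : gadd (G X) U V" unfolding gadd_def
   using r(1) U V by (intro cls_self) (simp add: E_M_add[OF X])
  then show ?thesis using G_K_iff[OF X K gadd_elem[OF G_K_elem[OF U] G_K_elem[OF V]]] N_M_add[OF op r(2)[OF U] r(2)[OF V]] by blast
 qed
 show "gscale (G X) z U:G_K X K"
 proof -
  have "(%e x. rep_gnum z e * rep U e x) : gscale (G X) z U" unfolding gscale_def
   using r(1)[OF U] by (intro cls_self) (simp add: E_M_scale[OF X] moderate_rep_gnum)
  then show ?thesis using G_K_iff[OF X K gscale_elem[OF G_K_elem[OF U]]] N_M_scale[OF op r(2)[OF U] moderate_rep_gnum[of z]] by blast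
 qed
qed

lemma G_c_iff: "open X ==> U:G_c X \<longleftrightarrow> (EX K. compact K & K <= X & U:G_K X K)"
proof
 assume X: "open X"
 show "EX K. compact K & K <= X & U:G_K X K" if "U:G_c X"
  using that gsupp_subset_domain[of X U] by (intro exI[of _ "gsupp X U"]) (auto simp: G_c_def G_K_def)
 show "U:G_c X" if "EX K. compact K & K <= X & U:G_K X K"
  using that compact_gsupp[OF X] by (auto simp: G_c_def G_K_def)
qed

lemma G_c_common:
 assumes "U:G_c X" "V:G_c X"
 obtains K where "compact K" "K <= X" "U:G_K X K" "V:G_K X K"
proof (rule that[of "gsupp X U \<union> gsupp X V"])
 show "compact (gsupp X U \<union> gsupp X V)" using assms by (auto simp: G_c_def)
qed (use assms gsupp_subset_domain[of X] in \<open>auto simp: G_c_def G_K_def\<close>)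

text \<open>\<open>U \<mapsto> abs_e (T U)\<close> is itself one of the ultra-pseudo-seminorms of the inductive limit.\<close>

theorem G_c_cont_dual:
 assumes X: "open X"
  and T: "!!K. compact K ==> K <= X ==> EX L K' j N. compact K' & K' <= X & K <= interior K' &
   net_space.net_functional (G X) {f. smooth_on X f} L (sup_seminorm K' j) N &
   (ALL U:G_K X K. T U = net_space.induced L U)"
 shows "T:cont_dual (G X) (G_c X) (G_c_topology X)"
proof -
 interpret net_space "G X" "{f. smooth_on X f}" by (rule net_space_G[OF X])
 have closed: "gadd (G X) U V:G_c X" "gscale (G X) z U:G_c X" if "U:G_c X" "V:G_c X" for U V z
 proof -
  obtain K where "compact K" "K <= X" "U:G_K X K" "V:G_K X K" by (rule G_c_common[OF \<open>U:G_c X\<close> \<open>V:G_c X\<close>])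
  then show "gadd (G X) U V:G_c X" "gscale (G X) z U:G_c X"
   using G_K_closed[OF X, of K U] G_c_iff[OF X] by blast+
 qed
 have gd: "gdiff (G X) U V = gadd (G X) U (gscale (G X) (- 1) V)" if "U:elems (G X)" "V:elems (G X)" for U V
  by (rule gdiff_alt[OF that])
 have add: "T (gadd (G X) U V) = T U + T V" if "U:G_c X" "V:G_c X" for U V
 proof -
  obtain K where K: "compact K" "K <= X" "U:G_K X K" "V:G_K X K" by (rule G_c_common[OF \<open>U:G_c X\<close> \<open>V:G_c X\<close>])
  obtain L K' j N where "net_functional L (sup_seminorm K' j) N" "ALL U:G_K X K. T U = induced L U" using T[OF K(1,2)] by blast
  then show ?thesis using induced_add G_K_elem K(3,4) G_K_closed(1)[OF X K(1,3,4)] by metis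
 qed
 have scale: "T (gscale (G X) z U) = z * T U" if "U:G_c X" for U z
 proof -
  from that obtain K where K: "compact K" "K <= X" "U:G_K X K" using G_c_iff[OF X] by blast
  obtain L K' j N where "net_functional L (sup_seminorm K' j) N" "ALL U:G_K X K. T U = induced L U" using T[OF K(1,2)] by blast
  then show ?thesis using induced_scale G_K_elem K(3) G_K_closed(2)[OF X K(1,3)] by metis
 qed
 have diff_c: "gdiff (G X) U V:G_c X" if "U:G_c X" "V:G_c X" for U V
  using closed gd[OF G_c_elem G_c_elem] that by metis
 have diff: "T (gdiff (G X) U V) = T U - T V" if "U:G_c X" "V:G_c X" for U V
  using add[OF that(1) closed(2)[OF that(2,2)], of "- 1"] scale[OF that(2), of "- 1"] gd[OF G_c_elem[OF that(1)] G_c_elem[OF that(2)]] by simp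
 define P where "P U = abs_e (T U)" for U
 have zero_c: "gzero (G X) : G_c X" unfolding gzero_def
  by (rule compact_support_G_c(2)[OF X compact_empty]) (use N_M_zero[OF X] N_M_subset_E_M[OF X] in auto)
 have Tz: "T (gzero (G X)) = 0"
 proof -
  have "gadd (G X) (gzero (G X)) (gzero (G X)) = gzero (G X)"
   unfolding gadd_def gzero_def
  proof (rule cls_eqI)
   have m: "(%e x. 0) : moderate_nets (G X)" using N_M_zero[OF X] N_M_subset_E_M[OF X] by auto
   from negl_add[OF rep_cls[OF m] rep_cls[OF m]]
   show "(%e x. rep (cls (G X) (%e x. 0)) e x + rep (cls (G X) (%e x. 0)) e x - 0) : negligible_nets (G X)" by simp
  qed
  with add[OF zero_c zero_c] show ?thesis by simp
 qed
 have P: "ultra_pseudo_seminorm (G X) (G_c X) P"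
  unfolding ultra_pseudo_seminorm_def
 proof (intro conjI ballI allI impI)
  show "0 <= P U" for U by (simp add: P_def abs_e_nonneg)
  show "P (gzero (G X)) = 0" by (simp add: P_def Tz abs_e_zero)
  show "P (gscale (G X) z U) <= abs_e z * P U" if "U:G_c X" for U z
   unfolding P_def scale[OF that] by (rule abs_e_mult)
  show "P (gscale (G X) (abs_gnum (%e. c * of_real (e powr a))) U) = abs_e (abs_gnum (%e. c * of_real (e powr a))) * P U"
   if "U:G_c X" "c ~= 0" for U c a
   unfolding P_def scale[OF that(1)] abs_e_eps_power_mult[OF that(2)] abs_e_eps_power[OF that(2)] ..
  show "P (gadd (G X) U V) <= max (P U) (P V)" if "U:G_c X" "V:G_c X" for U V
   unfolding P_def add[OF that] by (rule abs_e_add)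
 qed
 have K_c: "G_K X K <= G_c X" if "compact K" "K <= X" for K using that G_c_iff[OF X] by blast
 have diff_K: "gdiff (G X) U V:G_K X K" if "compact K" "U:G_K X K" "V:G_K X K" for U V K
  using G_K_closed(1)[OF X that(1,2) G_K_closed(2)[OF X that(1,3)]] gd[OF G_K_elem[OF that(2)] G_K_elem[OF that(3)]] by simp
 have incl: "continuous_map (G_K_topology X K) (seminorm_topology (G X) (G_c X) {P}) (%U. U)" if K: "compact K" "K <= X" for K
  unfolding seminorm_topology_def[of _ "G_c X"]
 proof (rule continuous_on_generated_topo)
  obtain L K' j N where L: "compact K'" "K' <= X" "K <= interior K'" "net_functional L (sup_seminorm K' j) N" "ALL U:G_K X K. T U = induced L U" using T[OF K] by blast
  have ts: "topspace (G_K_topology X K) = G_K X K" unfolding G_K_topology_def by (rule seminorm_topology_topspace)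
  have op: "openin (G_K_topology X K) {V:G_K X K. P_Kj K' j (gdiff (G X) V U) < r}" if "U:G_K X K" "0 < r" for U r
   unfolding G_K_topology_def by (rule seminorm_topology_ball) (use that L K in auto)
  show "(%U. U) ` topspace (G_K_topology X K) <= \<Union> (insert (G_c X) {{V:G_c X. P' (gdiff (G X) V U) < r} |P' U r. P' : {P} & U:G_c X & 0 < r})"
   unfolding ts using K_c[OF K] by auto
  fix Q assume Q: "Q:insert (G_c X) {{V:G_c X. P' (gdiff (G X) V U) < r} |P' U r. P' : {P} & U:G_c X & 0 < r}"
  show "openin (G_K_topology X K) ((%U. U) -` Q \<inter> topspace (G_K_topology X K))"
  proof (cases "Q = G_c X")
   case True
   then have "(%U. U) -` Q \<inter> topspace (G_K_topology X K) = topspace (G_K_topology X K)" using K_c[OF K] ts by auto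
   then show ?thesis by simp
  next
   case False
   then obtain U r where U: "U:G_c X" "0 < r" "Q = {V:G_c X. P (gdiff (G X) V U) < r}" using Q by blast
   \<comment> \<open>The centre \<open>U\<close> may lie outside of \<open>G_K X K\<close>, so
     openness is checked around each point \<open>V0\<close> of the trace.\<close>
   show ?thesis
   proof (subst openin_subopen, rule ballI)
    fix V0 assume "V0 : (%U. U) -` Q \<inter> topspace (G_K_topology X K)"
    then have V0: "V0:G_K X K" "V0:G_c X" "P (gdiff (G X) V0 U) < r" using ts U(3) by auto
    \<comment> \<open>On this ball \<open>T\<close> moves by less than \<open>r\<close>, since
      \<open>exp N\<close> is its Lipschitz constant; the ultrametric inequality then keeps
      \<open>T V\<close> within distance \<open>r\<close> of \<open>T U\<close>.\<close>
    let ?O = "{V:G_K X K. P_Kj K' j (gdiff (G X) V V0) < r / exp N}"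
    have "P_Kj K' j (gdiff (G X) V0 V0) = 0"
     unfolding P_Kj_def using sharp_value_negl[OF admissible_sup_seminorm[OF X L(1,2)] gdiff_self_negl[OF G_K_elem[OF V0(1)]]] .
    then have "V0 : ?O" using V0(1) U(2) by simp
    moreover have "?O <= (%U. U) -` Q \<inter> topspace (G_K_topology X K)"
    proof
     fix V assume V: "V : ?O"
     then have VK: "V:G_K X K" "V:G_c X" using K_c[OF K] by auto
     have "abs_e (T V - T V0) = abs_e (induced L (gdiff (G X) V V0))"
      using diff[OF VK(2) V0(2)] L(5) diff_K[OF K(1) VK(1) V0(1)] by simp
     also have "... <= exp N * P_Kj K' j (gdiff (G X) V V0)"
      unfolding P_Kj_def by (rule induced_bound[OF L(4) G_K_elem[OF diff_K[OF K(1) VK(1) V0(1)]]])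
     also have "... < r" using V by (simp add: pos_less_divide_eq mult.commute)
     finally have 1: "abs_e (T V - T V0) < r" .
     have "abs_e (T V - T U) <= max (abs_e (T V - T V0)) (abs_e (T V0 - T U))"
      using abs_e_add[of "T V - T V0" "T V0 - T U"] by simp
     also have "... < r" using 1 V0(3) diff[OF V0(2) U(1)] by (simp add: P_def)
     finally show "V : (%U. U) -` Q \<inter> topspace (G_K_topology X K)"
      using VK U diff[OF VK(2) U(1)] ts by (simp add: P_def)
    qed
    ultimately show "EX O'. openin (G_K_topology X K) O' & V0:O' & O' <= (%U. U) -` Q \<inter> topspace (G_K_topology X K)"
     using op[OF V0(1), of "r / exp N"] U(2) by (intro exI[of _ ?O]) simp
   qed
  qed
 qed
 have "continuous_map (G_c_topology X) gnum_topology T"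
  unfolding G_c_topology_def
 proof (rule cont_map_gnumI[where P = P and c = 1])
  show "P:\<Union> {\<P>. (ALL P:\<P>. ultra_pseudo_seminorm (G X) (G_c X) P) &
    (ALL K. compact K & K <= X --> continuous_map (G_K_topology X K) (seminorm_topology (G X) (G_c X) \<P>) (%U. U))}"
   using P incl by (intro UnionI[of "{P}"]) auto
  show "P (gdiff (G X) U U) <= 0" if "U:G_c X" for U using diff[OF that that] by (simp add: P_def abs_e_zero)
 qed (use diff diff_c in \<open>auto simp: P_def\<close>)
 then show ?thesis unfolding cont_dual_def using add scale by simp
qed

text \<open>For classes supported in \<open>K\<close>, one compact neighbourhood of \<open>K\<close>
  serves as domain of integration, and on it the pairing is bounded by one seminorm.\<close>

lemma pairing_cont_dual:
 assumes X: "open X" and I: "I:elems (G X)"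
 shows "(%V. gintegral X (gmult (G X) I V)) : cont_dual (G X) (G_c X) (G_c_topology X)"
proof (rule G_c_cont_dual[OF X])
 interpret net_space "G X" "{f. smooth_on X f}" by (rule net_space_G[OF X])
 have rI: "rep I:E_M X" "rep I:I" using rep_moderate[OF I] rep_in[OF I] by auto
 fix K assume K: "compact K" "K <= X"
 obtain \<delta> where \<delta>: "0 < \<delta>" "compact (\<Union>x\<in>K. cball x \<delta>)" "(\<Union>x\<in>K. cball x \<delta>) <= X" using K(1) X K(2) by (rule compact_thicken)
 let ?K = "\<Union>x\<in>K. cball x \<delta>"
 have int: "K <= interior ?K"
 proof -
  have "(\<Union>x\<in>K. ball x \<delta>) <= interior ?K" by (rule interior_maximal) (auto simp: less_imp_le)
  then show ?thesis using \<delta>(1) by force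
 qed
 obtain N where N: "net_functional (%e f. LINT y:?K|lborel. rep I e y * f y) (sup_seminorm ?K 0) N"
  using pairing_functional[OF X rI(1) \<delta>(2,3)] by blast
 have "gintegral X (gmult (G X) I U) = induced (%e f. LINT y:?K|lborel. rep I e y * f y) U" if "U:G_K X K" for U
  unfolding induced_def
  by (rule gintegral_gmult[OF X I rI(2) G_K_elem[OF that] rep_in[OF G_K_elem[OF that]] \<delta>(2,3)]) (use that int in \<open>auto simp: G_K_def\<close>)
 then show "EX L K' j N. compact K' & K' <= X & K <= interior K' & net_functional L (sup_seminorm K' j) N &
   (ALL U:G_K X K. gintegral X (gmult (G X) I U) = induced L U)"
  using \<delta>(2,3) int N by (intro exI conjI) auto
qed

section \<open>Distributions and their embedding\<close>

lemma linear_onD: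
 assumes "linear_on X w" "f:X"
 shows "g:X ==> w (%x. f x + g x) = w f + w g" "w (%x. c * f x) = c * w f"
 using assms by (simp_all add: linear_on_def)

lemma linear_on_diff:
 assumes "linear_on X w" "f:X" "g:X" "(%x. - 1 * g x) : X"
 shows "w (%x. f x - g x) = w f - w g"
 using linear_onD(1)[OF assms(1,2,4)] linear_onD(2)[OF assms(1,3), of "- 1"] by simp

lemma dist_linear_on: "w:distributions X ==> linear_on (test X) w"
 by (simp add: distributions_def)

lemma test_combine:
 fixes f g :: "'n::finite fn"
 assumes "f:test X" "g:test X"
 shows "(%x. a * f x + b * g x) : test X"
proof -
 obtain K where K: "compact K" "K <= X" "!!x. x ~: K ==> f x = 0" using testE[OF assms(1)] by metis
 obtain L where L: "compact L" "L <= X" "!!x. x ~: L ==> g x = 0" using testE[OF assms(2)] by metis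
 have "smooth_on UNIV (%x. a * f x + b * g x)"
  by (intro smooth_on_add[OF open_UNIV] smooth_on_cmult[OF open_UNIV] test_smooth[OF assms(1)] test_smooth[OF assms(2)])
 then show ?thesis unfolding test_functions_def
  using K L by (intro CollectI conjI exI[of _ "K \<union> L"]) auto
qed

lemma test_diff: "f:test X ==> g:test X ==> (%x. f x - g x) : test X"
 using test_combine[of f X g 1 "-1"] by simp

lemma test_cmult: "f:test X ==> (%x. c * f x) : test X"
 using test_combine[of f X f c 0] by simp

lemma dist_diff: "w:distributions X ==> f:test X ==> g:test X ==> w (%x. f x - g x) = w f - w g"
 using test_cmult[of g X "- 1"] by (intro linear_on_diff[OF dist_linear_on]) auto

lemma dist_bound:
 assumes w: "w:distributions X" and K: "compact K" "K <= X"
 shows "EX C j. 0 < C & (ALL f:test X. (ALL x. x ~: K --> f x = 0) -->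
  (ALL B. 0 <= B --> (ALL is x. length is <= j --> x:K --> cmod (ideriv is f x) <= B) --> cmod (w f) <= C * B))"
proof -
 have "EX (C::real) j. ALL f:test X. (ALL x. x ~: K --> f x = 0) --> ennreal (cmod (w f)) <= ennreal C * sup_seminorm K j f"
  using w K by (simp add: distributions_def)
 then obtain C :: real and j where C: "ALL f:test X. (ALL x. x ~: K --> f x = 0) --> ennreal (cmod (w f)) <= ennreal C * sup_seminorm K j f"
  by (elim exE)
 show ?thesis
 proof (intro exI[of _ "\<bar>C\<bar> + 1"] exI[of _ j] conjI ballI allI impI)
  fix f and B :: real
  assume f: "f:test X" "ALL x. x ~: K --> f x = 0" and B: "0 <= B" "ALL is x. length is <= j --> x:K --> cmod (ideriv is f x) <= B"
  have s: "sup_seminorm K j f <= ennreal B"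
   using sup_seminorm_le_iff[OF open_UNIV test_smooth[OF f(1)] subset_UNIV B(1)] B(2) by blast
  have "ennreal (cmod (w f)) <= ennreal C * sup_seminorm K j f" using bspec[OF C f(1)] f(2) by simp
  also have "... <= ennreal (\<bar>C\<bar> + 1) * ennreal B" by (intro mult_mono ennreal_leI s) auto
  also have "... = ennreal ((\<bar>C\<bar> + 1) * B)" using B(1) by (simp add: ennreal_mult)
  finally show "cmod (w f) <= (\<bar>C\<bar> + 1) * B" using B(1) by (subst (asm) ennreal_le_iff) auto
 qed simp
qed

text \<open>The product with \<psi> is a test function supported in the fixed set \<open>K\<close>.
  The Leibniz bound absorbs the derivatives of \<psi> into the constant, so that \<psi> w acts on
  all smooth functions on \<open>X\<close>.\<close>

lemma cutoff_bound:
 assumes X: "open X" and w: "w:distributions X" and \<psi>: "\<psi>:test X"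
  and K: "compact K" "K <= X" "ALL x. x ~: K --> \<psi> x = 0"
 shows "EX C j. 0 < C & (ALL f. smooth_on X f -->
  (ALL B. 0 <= B --> (ALL is x. length is <= j --> x:K --> cmod (ideriv is f x) <= B) --> cmod (w (%x. \<psi> x * f x)) <= C * B))"
proof -
 obtain C j where C: "0 < C" "ALL f:test X. (ALL x. x ~: K --> f x = 0) -->
  (ALL B. 0 <= B --> (ALL is x. length is <= j --> x:K --> cmod (ideriv is f x) <= B) --> cmod (w f) <= C * B)"
  using dist_bound[OF w K(1,2)] by (elim exE conjE)
 have \<psi>s: "smooth_on X \<psi>" by (rule test_smooth_on[OF \<psi>])
 obtain A where A: "A >= 0" "!!is x. length is <= j ==> x:K ==> cmod (ideriv is \<psi> x) <= A"
  using ideriv_bounded_compact[OF \<psi>s K(1,2), of j] by blast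
 show ?thesis
 proof (intro exI[of _ "C * (2 ^ j * (A + 1))"] exI[of _ j] conjI allI impI)
  show "0 < C * (2 ^ j * (A + 1))" using C(1) A(1) by simp
  fix f and B :: real
  assume f: "smooth_on X f" and B: "0 <= B" "ALL is x. length is <= j --> x:K --> cmod (ideriv is f x) <= B"
  have "cmod (ideriv is (%x. \<psi> x * f x) x) <= 2 ^ j * ((A + 1) * B)" if "length is <= j" "x:K" for "is" x
  proof -
   have "cmod (ideriv is (%x. \<psi> x * f x) x) <= 2 ^ length is * (A * B)"
    by (rule ideriv_mult_bound[OF X \<psi>s f]) (use that K(2) A B in auto)
   also have "... <= 2 ^ j * ((A + 1) * B)" using A(1) B(1) that by (intro mult_mono power_increasing) auto
   finally show ?thesis .
  qed
  moreover have "(%x. \<psi> x * f x) : test X" by (rule test_mult[OF X \<psi> f])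
  moreover have "0 <= 2 ^ j * ((A + 1) * B)" using A(1) B(1) by simp
  ultimately have "cmod (w (%x. \<psi> x * f x)) <= C * (2 ^ j * ((A + 1) * B))"
   using C(2) K(3) by auto
  then show "cmod (w (%x. \<psi> x * f x)) <= C * (2 ^ j * (A + 1)) * B" by (simp add: mult_ac)
 qed
qed

lemma cutoff_linear:
 assumes X: "open X" and w: "w:distributions X" and \<psi>: "\<psi>:test X"
 shows "linear_on {f. smooth_on X f} (%f. w (%x. \<psi> x * f x))"
proof -
 note l = dist_linear_on[OF w]
 show ?thesis unfolding linear_on_def
 proof (intro conjI ballI allI)
  fix f g assume fg: "f : {f. smooth_on X f}" "g : {f. smooth_on X f}"
  then have "(%x. \<psi> x * f x) : test X" "(%x. \<psi> x * g x) : test X" using test_mult[OF X \<psi>] by auto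
  then have "w (%x. \<psi> x * f x + \<psi> x * g x) = w (%x. \<psi> x * f x) + w (%x. \<psi> x * g x)" by (rule linear_onD[OF l])
  then show "w (%x. \<psi> x * (f x + g x)) = w (%x. \<psi> x * f x) + w (%x. \<psi> x * g x)" by (simp add: distrib_left)
 next
  fix c f assume "f : {f. smooth_on X f}"
  then have "(%x. \<psi> x * f x) : test X" using test_mult[OF X \<psi>] by auto
  then have "w (%x. c * (\<psi> x * f x)) = c * w (%x. \<psi> x * f x)" by (rule linear_onD[OF l])
  then show "w (%x. \<psi> x * (c * f x)) = c * w (%x. \<psi> x * f x)" by (simp add: mult_ac)
 qed
qed

lemma cutoff_functional:
 assumes X: "open X" and w: "w:distributions X" and \<psi>: "\<psi>:test X"
  and K: "compact K" "K <= X" "ALL x. x ~: K --> \<psi> x = 0"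
 shows "EX j. net_space.net_functional (G X) {f. smooth_on X f} (%e f. w (%x. \<psi> x * f x)) (sup_seminorm K j) 0"
proof -
 interpret net_space "G X" "{f. smooth_on X f}" by (rule net_space_G[OF X])
 obtain C j where C: "0 < C" "ALL f. smooth_on X f -->
  (ALL B. 0 <= B --> (ALL is x. length is <= j --> x:K --> cmod (ideriv is f x) <= B) --> cmod (w (%x. \<psi> x * f x)) <= C * B)"
  using cutoff_bound[OF X w \<psi> K] by (elim exE conjE)
 have b: "ennreal (cmod (w (%x. \<psi> x * f x))) <= ennreal C * sup_seminorm K j f" if f: "smooth_on X f" for f
 proof (rule seminorm_boundI[OF C(1)])
  fix B :: real assume B: "0 <= B" "sup_seminorm K j f <= ennreal B"
  then show "cmod (w (%x. \<psi> x * f x)) <= C * B"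
   using C(2) f sup_seminorm_le_iff[OF X f K(2) B(1), of j] by auto
 qed
 have "EV e. ALL f:{f. smooth_on X f}. ennreal (cmod (w (%x. \<psi> x * f x))) <= ennreal (C * e powr (- 0)) * sup_seminorm K j f"
  by (rule eventually_mono[OF EV_unit]) (use b in simp)
 then have "net_functional (%e f. w (%x. \<psi> x * f x)) (sup_seminorm K j) 0"
  unfolding net_functional_def using admissible_sup_seminorm[OF X K(1,2)] cutoff_linear[OF X w \<psi>] by blast
 then show ?thesis by blast
qed

text \<open>A bound by finitely many derivatives on a compact set is also a bound by a Schwartz
  seminorm. This makes the theory of tempered distributions available on every open set.\<close>

lemma cutoff_tempered:
 fixes X :: "(real^'n::finite) set"
 assumes X: "open X" and w: "w:distributions X" and \<psi>: "\<psi>:test X"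
 shows "cutoff_dist \<psi> w:tempered"
 unfolding tempered_iff
proof
 have s: "f : {f. smooth_on X f}" if "f:schwartz" for f
  using smooth_on_subset[OF schwartz_smooth[OF that]] by simp
 show "linear_on schwartz (cutoff_dist \<psi> w)"
  using cutoff_linear[OF X w \<psi>] s unfolding linear_on_def cutoff_dist_def by blast
 obtain K where K: "compact K" "K <= X" "ALL x. x ~: K --> \<psi> x = 0" using testE[OF \<psi>] by metis
 obtain C j where C: "0 < C" "ALL f. smooth_on X f -->
  (ALL B. 0 <= B --> (ALL is x. length is <= j --> x:K --> cmod (ideriv is f x) <= B) --> cmod (w (%x. \<psi> x * f x)) <= C * B)"
  using cutoff_bound[OF X w \<psi> K] by (elim exE conjE)
 have "tbound (cutoff_dist \<psi> w) C j"
  unfolding tbound_def cutoff_dist_def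
 proof (intro conjI ballI allI impI)
  fix f :: "'n fn" and B :: real assume f: "f:schwartz" "sbound j f B"
  show "cmod (w (%y. \<psi> y * f y)) <= C * B"
   using C(2) s[OF f(1)] sbound_nonneg[OF f(2)] sbound_le[OF f(2)] by auto
 qed (use C(1) in simp)
 then show "EX C j. tbound (cutoff_dist \<psi> w) C j" by blast
qed

lemma cutoff_dist_eq:
 assumes "!!x. f x ~= 0 ==> \<psi> x = 1" shows "cutoff_dist \<psi> w f = w f"
proof -
 have "(%y. \<psi> y * f y) = f" using assms by (intro ext) (metis mult_1 mult_zero_right)
 then show ?thesis by (simp add: cutoff_dist_def)
qed

subsection \<open>Regularised nets\<close>

abbreviation conv_net :: "('n::finite fn) => (('n fn) => complex) => 'n net" where
 "conv_net \<phi> w \<equiv> %e. dist_conv w (meps \<phi> e)"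

lemma inverse_power_powr: "0 < e ==> inverse e ^ m = e powr (- real m)"
 by (simp add: powr_minus powr_realpow power_inverse)

lemma conv_net_bound:
 fixes \<phi> :: "'n::finite fn"
 assumes w: "w:tempered" and \<phi>: "\<phi>:schwartz"
 shows "EX C M j. 0 <= C & (ALL e x. 0 < e --> e <= 1 --> cmod (ideriv is (conv_net \<phi> w e) x) <= C * e powr (- real M) * (1 + norm x) ^ j)"
proof -
 obtain C j where C: "tbound w C j" using tempered_tbound[OF w] by blast
 obtain B where B: "sbound (j + length is) \<phi> B" using schwartz_sbound[OF \<phi>] by blast
 \<comment> \<open>\<open>CARD('n)\<close> powers of \<open>1 / e\<close> stem from the
   normalisation of the mollifier, and one more from each of at most \<open>j + length is\<close>
   derivatives.\<close>
 let ?M = "CARD('n) + (j + length is)"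
 show ?thesis
 proof (rule exI[of _ "C * B"], rule exI[of _ ?M], rule exI[of _ j], intro conjI allI impI)
  show "0 <= C * B" using C sbound_nonneg[OF B] by (simp add: tbound_def)
  fix e :: real and x :: "real^'n" assume e: "0 < e" "e <= 1"
  have "sbound j (ideriv is (meps \<phi> e)) (inverse e ^ ?M * B)"
   by (rule sbound_ideriv[OF sbound_meps[OF \<phi> B e]])
  from dist_conv_bound[OF C schwartz_ideriv[OF meps_schwartz[OF \<phi> e]] this, of x]
  show "cmod (ideriv is (conv_net \<phi> w e) x) <= C * B * e powr (- real ?M) * (1 + norm x) ^ j"
   unfolding ideriv_dist_conv[OF w meps_schwartz[OF \<phi> e]] inverse_power_powr[OF e(1)] by (simp add: mult_ac)
 qed
qed

lemma conv_net_smooth: "w:tempered ==> \<phi>:schwartz ==> 0 < e ==> e <= 1 ==> smooth_on S (conv_net \<phi> w e)"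
 using smooth_on_subset[OF dist_conv_smooth[OF _ meps_schwartz]] by blast

lemma conv_net_E_M:
 assumes w: "w:tempered" and \<phi>: "\<phi>:schwartz" and V: "open V"
 shows "conv_net \<phi> w:E_M V"
 unfolding E_M_iff[OF V]
proof (intro conjI allI impI)
 show "conv_net \<phi> w:smooth_nets V"    by (simp add: smooth_nets_def conv_net_smooth[OF w \<phi>])
 fix K "is" assume K: "compact K & K <= V"
 obtain R where R: "!!x. x:K ==> norm x <= R" using compact_imp_bounded[of K] K by (auto simp: bounded_iff)
 obtain C M j where C: "0 <= C" "!!e x. 0 < e ==> e <= 1 ==> cmod (ideriv is (conv_net \<phi> w e) x) <= C * e powr (- real M) * (1 + norm x) ^ j"
  using conv_net_bound[OF w \<phi>, of "is"] by blast
 have "uO K (%e. ideriv is (conv_net \<phi> w e)) (- real M)"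
 proof (rule uOI[of _ _ "C * (1 + R) ^ j"])
  fix e x assume e: "0 < e" "e < (1::real)" "x:K"
  have "cmod (ideriv is (conv_net \<phi> w e) x) <= C * e powr (- real M) * (1 + norm x) ^ j" by (rule C(2)) (use e in auto)
  also have "... <= C * e powr (- real M) * (1 + R) ^ j" using C(1) R[OF e(3)] by (intro mult_left_mono power_mono) auto
  finally show "cmod (ideriv is (conv_net \<phi> w e) x) <= C * (1 + R) ^ j * e powr (- real M)" by (simp add: mult_ac)
 qed
 then show "umod K (%e. ideriv is (conv_net \<phi> w e))" by (rule umodI)
qed

text \<open>At distance \<delta> from the origin the argument of \<phi> has norm at least
  \<open>\<delta> / e\<close>. Decay of order \<open>p\<close> then gains \<open>e powr p\<close>
  against the powers lost by normalisation and derivatives.\<close>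

lemma mollifier_tail:
 fixes \<phi> :: "'n::finite fn"
 assumes \<phi>: "\<phi>:schwartz" and B: "sbound p \<phi> B" and l: "length js <= p" and e: "0 < e" "e <= 1" and z: "0 < \<delta>" "\<delta> <= norm z"
 shows "cmod (ideriv js (meps \<phi> e) z) <= (B / \<delta> ^ p) * e powr (real p - real (CARD('n) + length js))"
proof -
 have sc: "smooth_on UNIV (%y. \<phi> (inverse e *\<^sub>R y))"
  using schwartz_smooth[OF schwartz_scale[OF \<phi>]] e by (simp add: one_le_inverse)
 have eq: "ideriv js (meps \<phi> e) z = of_real (inverse e ^ CARD('n)) * (of_real (inverse e ^ length js) * ideriv js \<phi> (inverse e *\<^sub>R z))"
  unfolding meps_alt ideriv_cmult[OF open_UNIV sc UNIV_I] using ideriv_affine_UNIV[OF schwartz_smooth[OF \<phi>], of js 0 "inverse e" z] by simp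
 have "(\<delta> / e) ^ p * cmod (ideriv js \<phi> (inverse e *\<^sub>R z)) <= (1 + norm (inverse e *\<^sub>R z)) ^ p * cmod (ideriv js \<phi> (inverse e *\<^sub>R z))"
 proof (intro mult_right_mono power_mono)
  have "\<delta> / e <= norm z / e" using z e by (intro divide_right_mono) auto
  moreover have "norm (inverse e *\<^sub>R z) = norm z / e" using e by (simp add: divide_inverse mult.commute)
  ultimately show "\<delta> / e <= 1 + norm (inverse e *\<^sub>R z)" by linarith
 qed (use z e in auto)
 also have "... <= B" by (rule sboundD[OF B l])
 finally have "cmod (ideriv js \<phi> (inverse e *\<^sub>R z)) <= B / (\<delta> / e) ^ p"
  using z e by (subst pos_le_divide_eq) (auto simp: mult.commute)
 also have "... = (B / \<delta> ^ p) * e powr real p" using e by (simp add: power_divide powr_realpow)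
 finally have *: "cmod (ideriv js \<phi> (inverse e *\<^sub>R z)) <= (B / \<delta> ^ p) * e powr real p" .
 have "cmod (ideriv js (meps \<phi> e) z) = inverse e ^ CARD('n) * (inverse e ^ length js * cmod (ideriv js \<phi> (inverse e *\<^sub>R z)))"
  unfolding eq using e by (simp add: norm_mult norm_power norm_inverse)
 also have "... <= inverse e ^ CARD('n) * (inverse e ^ length js * ((B / \<delta> ^ p) * e powr real p))"
  using e by (intro mult_left_mono *) simp_all
 also have "... = (B / \<delta> ^ p) * (e powr real p * (e powr (- real (CARD('n))) * e powr (- real (length js))))"
  unfolding inverse_power_powr[OF e(1)] by (simp only: mult_ac)
 also have "e powr real p * (e powr (- real (CARD('n))) * e powr (- real (length js))) = e powr (real p - real (CARD('n) + length js))"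
  unfolding powr_add[symmetric] by (rule arg_cong[of _ _ "%a. e powr a"]) simp
 finally show ?thesis .
qed

text \<open>Away from the support, the regularised net is negligible because \<open>\<phi>\<^sub>e\<close> concentrates at the origin.\<close>

lemma conv_net_off_support:
 fixes \<phi> :: "'n::finite fn"
 assumes X: "open X" and w: "w:distributions X" and \<theta>: "\<theta>:test X" and \<phi>: "\<phi>:schwartz"
  and K: "compact K" and W: "open W" "K <= W" "!!x. x:W ==> \<theta> x = 0"
 shows "unegl K (%e. ideriv is (conv_net \<phi> (cutoff_dist \<theta> w) e))"
proof (rule uneglI)
 fix q :: nat
 obtain L where L: "compact L" "L <= X" "!!x. x ~: L ==> \<theta> x = 0" using testE[OF \<theta>] by metis
 obtain C j where C: "0 < C" "ALL f:test X. (ALL x. x ~: L --> f x = 0) -->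
  (ALL B. 0 <= B --> (ALL is x. length is <= j --> x:L --> cmod (ideriv is f x) <= B) --> cmod (w f) <= C * B)"
  using dist_bound[OF w L(1,2)] by (elim exE conjE)
 obtain A where A: "A >= 0" "!!is x. length is <= j ==> x:L ==> cmod (ideriv is \<theta> x) <= A"
  using ideriv_bounded_compact[OF test_smooth_on[OF \<theta>] L(1,2), of j] by blast
 obtain \<delta> where \<delta>: "0 < \<delta>" "compact (\<Union>x\<in>K. cball x \<delta>)" "(\<Union>x\<in>K. cball x \<delta>) <= W" using K W(1,2) by (rule compact_thicken)
 \<comment> \<open>Decay of this order leaves \<open>e powr q\<close> after the normalisation and at
   most \<open>j + length is\<close> derivatives.\<close>
 define p where "p = q + CARD('n) + (j + length is)"
 obtain B where B: "sbound p \<phi> B" using schwartz_sbound[OF \<phi>] by blast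
 have B0: "B >= 0" by (rule sbound_nonneg[OF B])
 have wt: "cutoff_dist \<theta> w:tempered" by (rule cutoff_tempered[OF X w \<theta>])
 show "uO K (%e. ideriv is (conv_net \<phi> (cutoff_dist \<theta> w) e)) (real q)"
 proof (rule uOI[of _ _ "C * (2 ^ j * (A * (B / \<delta> ^ p)))"])
  fix e x assume e: "0 < e" "e < (1::real)" and x: "x:K"
  let ?k = "ideriv is (meps \<phi> e)"
  let ?f = "%y. ?k (x - y)"
  let ?D = "(B / \<delta> ^ p) * e powr real q"
  have ks: "?k:schwartz" using \<phi> e by (intro schwartz_ideriv meps_schwartz) auto
  have fs: "smooth_on UNIV ?f" by (rule schwartz_smooth[OF schwartz_reflect[OF ks]])
  have D0: "0 <= A * ?D" using A(1) B0 \<delta>(1) by simp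
  have "cmod (ideriv js (%y. \<theta> y * ?f y) y) <= 2 ^ j * (A * ?D)" if js: "length js <= j" and y: "y:L" for js y
  proof (cases "y:W")
   case True
   have "ideriv js (%y. \<theta> y * ?f y) y = ideriv js (%_. 0) y" by (rule ideriv_cong[OF W(1) _ True]) (simp add: W(3))
   then have "cmod (ideriv js (%y. \<theta> y * ?f y) y) = 0" by (simp add: ideriv_const)
   moreover have "0 <= 2 ^ j * (A * ?D)" by (rule mult_nonneg_nonneg[OF _ D0]) simp
   ultimately show ?thesis by linarith
  next
   case False
   \<comment> \<open>The closed \<delta>-neighbourhood of \<open>K\<close> lies in \<open>W\<close>,
     so outside of \<open>W\<close> the argument of the mollifier stays away from 0.\<close>
   then have "\<not> dist x y <= \<delta>" using \<delta>(3) x by fastforce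
   then have d: "\<delta> <= norm (x - y)" by (simp add: dist_norm)
   have "cmod (ideriv js (%y. \<theta> y * ?f y) y) <= 2 ^ length js * (A * ?D)"
   proof (rule ideriv_mult_bound[OF open_UNIV test_smooth[OF \<theta>] fs UNIV_I])
    fix ls :: "'n list" assume ls: "length ls <= length js"
    show "cmod (ideriv ls \<theta> y) <= A" using A(2) ls js y by simp
    have "cmod (ideriv ls ?f y) = cmod (ideriv (ls @ is) (meps \<phi> e) (x - y))"
     using ideriv_affine_UNIV[OF schwartz_smooth[OF ks], of ls x "-1" y] by (simp add: norm_mult norm_power ideriv_append)
    also have "... <= (B / \<delta> ^ p) * e powr (real p - real (CARD('n) + length (ls @ is)))"
     by (rule mollifier_tail[OF \<phi> B _ e(1) _ \<delta>(1) d]) (use ls js e p_def in auto)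
    also have "... <= ?D" using ls js e B0 \<delta>(1) by (intro mult_left_mono powr_mono') (auto simp: p_def)
    finally show "cmod (ideriv ls ?f y) <= ?D" .
   qed
   also have "... <= 2 ^ j * (A * ?D)" using js D0 by (intro mult_right_mono power_increasing) auto
   finally show ?thesis .
  qed
  moreover have "(%y. \<theta> y * ?f y) : test X" by (rule test_mult[OF X \<theta> smooth_on_subset[OF fs subset_UNIV]])
  moreover have "0 <= 2 ^ j * (A * ?D)" by (rule mult_nonneg_nonneg[OF _ D0]) simp
  ultimately have "cmod (w (%y. \<theta> y * ?f y)) <= C * (2 ^ j * (A * ?D))"
   using bspec[OF C(2), of "%y. \<theta> y * ?f y"] L(3) by (metis (no_types, lifting) mult_zero_left)
  then show "cmod (ideriv is (conv_net \<phi> (cutoff_dist \<theta> w) e) x) <= C * (2 ^ j * (A * (B / \<delta> ^ p))) * e powr real q"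
   using ideriv_dist_conv[OF wt meps_schwartz[OF \<phi>], of e "is"] e by (simp add: dist_conv_def cutoff_dist_def mult_ac)
 qed
qed

text \<open>The difference of the two cutoffs is a test function vanishing on \<open>W\<close>, to
  which \<open>conv_net_off_support\<close> applies. This is the reason why the embedding does not
  depend on the cutoff.\<close>

lemma conv_net_cutoff_diff:
 fixes \<phi> :: "'n::finite fn"
 assumes X: "open X" and w: "w:distributions X" and \<psi>: "\<psi>:test X" "\<psi>' : test X" and \<phi>: "\<phi>:schwartz"
  and W: "open W" "!!x. x:W ==> \<psi> x = \<psi>' x"
 shows "(%e x. conv_net \<phi> (cutoff_dist \<psi> w) e x - conv_net \<phi> (cutoff_dist \<psi>' w) e x) : N_M W"
proof (rule N_M_zeroth_order[OF W(1)])
 show "(%e x. conv_net \<phi> (cutoff_dist \<psi> w) e x - conv_net \<phi> (cutoff_dist \<psi>' w) e x) : E_M W"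
  by (intro E_M_diff[OF W(1)] conv_net_E_M[OF _ \<phi> W(1)] cutoff_tempered[OF X w] \<psi>)
 fix K assume K: "compact K" "K <= W"
 have "unegl K (%e. ideriv [] (conv_net \<phi> (cutoff_dist (%x. \<psi> x - \<psi>' x) w) e))"
  by (rule conv_net_off_support[OF X w test_diff[OF \<psi>] \<phi> K(1) W(1) K(2)]) (simp add: W(2))
 then show "unegl K (%e x. conv_net \<phi> (cutoff_dist \<psi> w) e x - conv_net \<phi> (cutoff_dist \<psi>' w) e x)"
 proof (rule unegl_cong)
  fix e :: real and x assume e: "0 < e" "e < 1"
  have s: "smooth_on X (%y. meps \<phi> e (x - y))"
   using smooth_on_subset[OF schwartz_smooth[OF schwartz_reflect[OF meps_schwartz[OF \<phi> e(1)]]]] e by simp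
  show "ideriv [] (conv_net \<phi> (cutoff_dist (%x. \<psi> x - \<psi>' x) w) e) x = conv_net \<phi> (cutoff_dist \<psi> w) e x - conv_net \<phi> (cutoff_dist \<psi>' w) e x"
   using dist_diff[OF w test_mult[OF X \<psi>(1) s] test_mult[OF X \<psi>(2) s]]
   by (simp add: dist_conv_def cutoff_dist_def left_diff_distrib)
 qed
qed

subsection \<open>Glueing nets\<close>

text \<open>For each \<open>e\<close> one takes the largest admissible member of the sequence.\<close>

lemma glue_nets:
 fixes u :: "nat => 'n::finite net"
 assumes X: "open X" and L: "!!m. compact (L m)" "!!m. L m <= X" "!!K. compact K ==> K <= X ==> EX k. K <= interior (L k)"
  and u: "!!m. u m:E_M X"
  and agree: "!!k m is. k <= m ==> unegl (L k) (%e x. ideriv is (u m e) x - ideriv is (u k e) x)"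
 shows "EX v:E_M X. ALL k. (%e x. v e x - u k e x) : N_M (interior (L k))"
proof -
 \<comment> \<open>Member \<open>m\<close> is good at \<open>e\<close> if it agrees with all earlier
   members on their sets, for derivatives up to order \<open>m\<close> and within
   \<open>e powr m\<close>. Each \<open>m\<close> is good for all small \<open>e\<close>.\<close>
 define P where "P m e \<longleftrightarrow> (ALL k<=m. ALL is. length is <= m --> (ALL x:L k. cmod (ideriv is (u m e) x - ideriv is (u k e) x) <= e powr real m))" for m e
 have "ALL m. EX d>0. ALL e. 0 < e & e < d --> P m e"
 proof
  fix m
  have one: "EV e. ALL x:L k. cmod (ideriv is (u m e) x - ideriv is (u k e) x) <= e powr real m" if "k <= m" for k "is"
  proof -
   have "uO (L k) (%e x. ideriv is (u m e) x - ideriv is (u k e) x) (real m + 1)" by (rule unegl_uO[OF agree[OF that]])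
   then obtain C where C: "0 <= C" "EV e. 0 < e & e < 1 & (ALL x:L k. cmod (ideriv is (u m e) x - ideriv is (u k e) x) <= C * e powr (real m + 1))" by (rule uOE)
   have "EV e. e : {0<..<1 / (C + 1)}" using C(1) by (intro eventually_at_right_real) simp
   with C(2) show ?thesis
   proof eventually_elim
    case (elim e)
    have "C * e <= 1" using elim C(1) by (simp add: field_simps)
    then have "(C * e) * e powr real m <= 1 * e powr real m" by (rule mult_right_mono) simp
    then have "C * e powr (real m + 1) <= e powr real m" using elim by (simp add: powr_add mult_ac)
    then show ?case using elim by (meson order_trans)
   qed
  qed
  have fin: "finite ({..m} \<times> {is :: 'n list. length is <= m})" using finite_lists_length_le[of "UNIV :: 'n set" m] by simp
  have "EV e. ALL p:{..m} \<times> {is :: 'n list. length is <= m}. ALL x:L (fst p). cmod (ideriv (snd p) (u m e) x - ideriv (snd p) (u (fst p) e) x) <= e powr real m"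
   unfolding eventually_ball_finite_distrib[OF fin] using one by auto
  then have "EV e. P m e"
   by (rule eventually_mono) (auto simp: P_def)
  then show "EX d>0. ALL e. 0 < e & e < d --> P m e" by (auto simp: eventually_at_right_field)
 qed
 then obtain d where d: "!!m. 0 < d m" "!!m e. 0 < e ==> e < d m ==> P m e" using choice[of "%m d. d > 0 & (ALL e. 0 < e & e < d --> P m e)"] by blast
 \<comment> \<open>The condition \<open>m <= 1 / e\<close> keeps the set finite and the index 0
   keeps it nonempty, so the maximum exists; it tends to infinity as \<open>e\<close> tends to
   0.\<close>
 define S where "S e = {m. real m <= 1 / e & (m = 0 \<or> e < d m)}" for e
 define M where "M e = Max (S e)" for e
 have Sfin: "finite (S e)" for e
 proof (rule finite_subset)
  show "S e <= {..nat \<lfloor>1 / e\<rfloor>}" by (auto simp: S_def le_nat_floor)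
 qed simp
 have M_in: "M e:S e" if "0 < e" for e
  unfolding M_def by (rule Max_in[OF Sfin]) (use that in \<open>auto simp: S_def intro!: exI[of _ 0]\<close>)
 have M_ge: "k <= M e" if "0 < e" "e < d k" "e * real k <= 1" for k e
  unfolding M_def by (rule Max_ge[OF Sfin]) (use that in \<open>auto simp: S_def field_simps\<close>)
 have M_large: "EV e. 0 < e & e < 1 & k <= M e" for k
 proof -
  have "EV e. e : {0<..<d k}" using d(1) by (rule eventually_at_right_real)
  moreover have "EV e. e : {0<..<1 / (real k + 1)}" by (intro eventually_at_right_real) simp
  ultimately show ?thesis using EV_unit
  proof eventually_elim
   case (elim e)
   have "e * (real k + 1) < 1" using elim by (simp add: pos_less_divide_eq)
   then have "e * real k <= 1" using elim by (simp add: distrib_left)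
   then show ?case using M_ge[of e k] elim by simp
  qed
 qed
 define v where "v e = u (M e) e" for e
 have us: "smooth_on X (u m e)" if "0 < e" "e <= 1" for m e using smooth_netsD[OF E_M_smooth[OF X u] that] .
 have vs: "v:smooth_nets X" using us by (auto simp: smooth_nets_def v_def)
 have close: "unegl (L k) (%e x. ideriv is (v e) x - ideriv is (u k e) x)" for k "is"
 proof (rule uneglI, rule uO_eventuallyI[of _ _ 1])
  fix q :: nat
  show "EV e. ALL x:L k. cmod (ideriv is (v e) x - ideriv is (u k e) x) <= 1 * e powr real q"
   using M_large[of "Suc (k + length is + q)"]
  proof eventually_elim
   case (elim e)
   then have "P (M e) e" using d(2) M_in[of e] by (auto simp: S_def)
   then have "ALL x:L k. cmod (ideriv is (v e) x - ideriv is (u k e) x) <= e powr real (M e)" using elim by (simp add: P_def v_def)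
   moreover have "e powr real (M e) <= e powr real q" using elim by (intro powr_mono') auto
   ultimately show ?case by (auto intro: order_trans)
  qed
 qed
 have vE: "v:E_M X"
  unfolding E_M_iff[OF X]
 proof (intro conjI vs allI impI)
  fix K "is" assume K: "compact K & K <= X"
  then obtain k where k: "K <= interior (L k)" using L(3) by blast
  have kL: "K <= L k" using k interior_subset by blast
  have "umod K (%e x. (ideriv is (v e) x - ideriv is (u k e) x) + ideriv is (u k e) x)"
   by (rule umod_add[OF unegl_imp_umod[OF unegl_subset[OF close kL]]]) (use K E_M_umod[OF X u] in blast)
  then show "umod K (%e. ideriv is (v e))" by simp
 qed
 moreover have "(%e x. v e x - u k e x) : N_M (interior (L k))" for k
 proof (rule N_M_zeroth_order[OF open_interior])
  have sub: "interior (L k) <= X" using L(2)[of k] interior_subset[of "L k"] by blast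
  show "(%e x. v e x - u k e x) : E_M (interior (L k))"
   by (rule net_restrict(1)[OF X open_interior sub E_M_diff[OF X vE u]])
  fix K assume "compact K" "K <= interior (L k)"
  then have "K <= L k" using interior_subset by blast
  then show "unegl K (%e x. v e x - u k e x)" using unegl_subset[OF close[of k "[]"]] by simp
 qed
 ultimately show ?thesis by blast
qed

subsection \<open>The embedding\<close>

text \<open>The property inside the definite description of \<open>iota\<close>, named for the
  proofs of existence and uniqueness.\<close>

definition iota_spec :: "('n::finite fn) => (real^'n) set => (('n fn) => complex) => 'n net set => bool" where
 "iota_spec \<phi> X w U \<longleftrightarrow> U:elems (G X) &
   (ALL X\<^sub>1 \<psi>. open X\<^sub>1 & compact (closure X\<^sub>1) & closure X\<^sub>1 <= X &
    \<psi>:test X & (EX W. open W & closure X\<^sub>1 <= W & (ALL x:W. \<psi> x = 1)) -->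
    grestrict X\<^sub>1 U = cls (G X\<^sub>1) (conv_net \<phi> (cutoff_dist \<psi> w)))"

lemma grestrict_eqD:
 assumes X: "open X" and V: "open V" "V <= X" and U: "U:elems (G X)" "a:U" and eq: "grestrict V U = cls (G V) b"
 shows "(%e x. a e x - b e x) : N_M V"
proof -
 interpret X: net_space "G X" "{f. smooth_on X f}" by (rule net_space_G[OF X])
 interpret V: net_space "G V" "{f. smooth_on V f}" by (rule net_space_G[OF V(1)])
 have r: "rep U:E_M V" using X.rep_moderate[OF U(1)] net_restrict(1)[OF X V] by simp
 have 1: "(%e x. a e x - rep U e x) : N_M V"
  using X.mem_negl[OF U X.rep_in[OF U(1)]] net_restrict(2)[OF X V] by simp
 have 2: "(%e x. rep U e x - b e x) : N_M V"
  using V.cls_eqD[of "rep U" b] r eq unfolding grestrict_def by simp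
 show ?thesis using V.negl_sub_trans[of a "rep U" b] 1 2 by simp
qed

lemma grestrict_eqI:
 assumes X: "open X" and V: "open V" "V <= X" and U: "U:elems (G X)" "a:U" and d: "(%e x. a e x - b e x) : N_M V"
 shows "grestrict V U = cls (G V) b"
proof -
 interpret X: net_space "G X" "{f. smooth_on X f}" by (rule net_space_G[OF X])
 interpret V: net_space "G V" "{f. smooth_on V f}" by (rule net_space_G[OF V(1)])
 have 1: "(%e x. rep U e x - a e x) : N_M V"
  using X.mem_negl[OF U(1) X.rep_in[OF U(1)] U(2)] net_restrict(2)[OF X V] by simp
 show ?thesis unfolding grestrict_def
  by (rule V.cls_eqI) (use V.negl_sub_trans[of "rep U" a b] 1 d in simp)
qed

text \<open>Balls with closure in \<open>X\<close> are admissible in the defining property, and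
  negligibility is local.\<close>

lemma iota_spec_unique:
 assumes X: "open X" and U: "iota_spec \<phi> X w U" "iota_spec \<phi> X w U'"
 shows "U = U'"
proof -
 interpret net_space "G X" "{f. smooth_on X f}" by (rule net_space_G[OF X])
 have el: "U:elems (G X)" "U' : elems (G X)" using U by (auto simp: iota_spec_def)
 note r = rep_in[OF el(1)] rep_in[OF el(2)]
 have "(%e x. rep U e x - rep U' e x) : N_M X"
 proof (rule N_M_local[OF X])
  show "(%e x. rep U e x - rep U' e x) : E_M X" using rep_moderate[OF el(1)] rep_moderate[OF el(2)] by (intro E_M_diff[OF X]) auto
  fix x assume "x:X"
  then obtain e where e: "0 < e" "cball x e <= X" using X open_contains_cball by blast
  obtain \<psi> W where \<psi>: "\<psi>:test X" "open W" "cball x e <= W" "!!x. x:W ==> \<psi> x = 1"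
   by (rule cutoff_exists[OF X compact_cball e(2)]) blast
  have cl: "closure (ball x e) = cball x e" using e(1) by simp
  have sub: "ball x e <= X" using e(2) ball_subset_cball by blast
  have c: "open (ball x e) & compact (closure (ball x e)) & closure (ball x e) <= X &
    \<psi>:test X & (EX W. open W & closure (ball x e) <= W & (ALL x:W. \<psi> x = 1))"
   unfolding cl using e \<psi> by (intro conjI exI[of _ W]) auto
  have "(%e x. rep Z e x - conv_net \<phi> (cutoff_dist \<psi> w) e x) : N_M (ball x e)" if "iota_spec \<phi> X w Z" "Z:elems (G X)" for Z
   using that c unfolding iota_spec_def by (intro grestrict_eqD[OF X open_ball sub that(2) rep_in[OF that(2)]]) blast
  from N_M_diff[OF open_ball this[OF U(1) el(1)] this[OF U(2) el(2)]]
  have "(%e x. rep U e x - rep U' e x) : N_M (ball x e)" by simp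
  then show "EX W. open W & x:W & W <= X & (%e x. rep U e x - rep U' e x) : N_M W"
   using e(1) sub by (intro exI[of _ "ball x e"]) simp
 qed
 then have "cls (G X) (rep U) = cls (G X) (rep U')" by (intro cls_eqI) simp
 then show ?thesis using cls_rep el by simp
qed

text \<open>Cutoffs that are 1 near the members of an exhausting sequence give nets which agree on
  these members up to negligible nets; \<open>glue_nets\<close> joins them into one net.\<close>

lemma iota_spec_exists:
 fixes \<phi> :: "'n::finite fn"
 assumes X: "open X" and \<phi>: "\<phi>:schwartz" and w: "w:distributions X"
 shows "EX U. iota_spec \<phi> X w U"
proof -
 interpret net_space "G X" "{f. smooth_on X f}" by (rule net_space_G[OF X])
 obtain L where L: "!!m. compact (L m)" "!!m. L m <= X" "!!m. L m <= interior (L (Suc m))" "\<Union>(range L) = X"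
  "!!K. compact K ==> K <= X ==> EX N. ALL n>=N. K <= L n"
  using open_Union_compact_subsets[OF X] by metis
 have L3: "EX k. K <= interior (L k)" if "compact K" "K <= X" for K
  using L(5)[OF that] L(3) by blast
 have Lmono: "L k <= L m" if "k <= m" for k m
  using that by (rule lift_Suc_mono_le[rotated]) (use L(3) interior_subset in blast)
 have "ALL m. EX \<psi>. \<psi>:test X & (EX W. open W & L m <= W & (ALL x:W. \<psi> x = 1))"
 proof
  fix m
  obtain \<psi> W where "\<psi>:test X" "open W" "L m <= W" "!!x. x:W ==> \<psi> x = 1"
   by (rule cutoff_exists[OF X L(1,2)[of m]]) blast
  then show "EX \<psi>. \<psi>:test X & (EX W. open W & L m <= W & (ALL x:W. \<psi> x = 1))" by blast
 qed
 then obtain \<psi> where "ALL m. \<psi> m:test X & (EX W. open W & L m <= W & (ALL x:W. \<psi> m x = 1))" by (rule choice[THEN exE])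
 then have \<psi>: "!!m. \<psi> m:test X" "!!m. EX W. open W & L m <= W & (ALL x:W. \<psi> m x = 1)" by auto
 define u where "u m = conv_net \<phi> (cutoff_dist (\<psi> m) w)" for m
 have wt: "cutoff_dist (\<psi> m) w:tempered" for m by (rule cutoff_tempered[OF X w \<psi>(1)])
 have uE: "u m:E_M V" if "open V" for m V unfolding u_def by (rule conv_net_E_M[OF wt \<phi> that])
 have ag: "unegl (L k) (%e x. ideriv is (u m e) x - ideriv is (u k e) x)" if "k <= m" for k m "is"
 proof -
  obtain W1 W2 where W: "open W1" "L k <= W1" "ALL x:W1. \<psi> k x = 1" "open W2" "L m <= W2" "ALL x:W2. \<psi> m x = 1" using \<psi>(2) by meson
  have op: "open (W1 \<inter> W2)" using W by auto
  have "(%e x. u m e x - u k e x) : N_M (W1 \<inter> W2)"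
   unfolding u_def by (rule conv_net_cutoff_diff[OF X w \<psi>(1) \<psi>(1) \<phi> op]) (use W in auto)
  then have "unegl (L k) (%e. ideriv is (%x. u m e x - u k e x))"
   by (rule N_M_unegl[OF op _ L(1)]) (use W Lmono[OF that] in auto)
  then show ?thesis
  proof (rule unegl_cong)
   fix e :: real and x assume e: "0 < e" "e < 1"
   show "ideriv is (%x. u m e x - u k e x) x = ideriv is (u m e) x - ideriv is (u k e) x"
    unfolding u_def by (rule ideriv_diff[OF open_UNIV _ _ UNIV_I]) (intro conv_net_smooth wt \<phi>; use e in simp)+
  qed
 qed
 obtain v where v: "v:E_M X" "!!k. (%e x. v e x - u k e x) : N_M (interior (L k))"
  using glue_nets[OF X L(1,2) L3 uE[OF X] ag] by blast
 have el: "cls (G X) v:elems (G X)" "v:cls (G X) v" using v(1) cls_elem cls_self by auto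
 have "iota_spec \<phi> X w (cls (G X) v)"
  unfolding iota_spec_def
 proof (intro conjI el(1) allI impI, elim conjE exE)
  fix X\<^sub>1 \<psi>' W
  assume 1: "open X\<^sub>1" "compact (closure X\<^sub>1)" "closure X\<^sub>1 <= X" "\<psi>' : test X" "open W" "closure X\<^sub>1 <= W" "ALL x:W. \<psi>' x = 1"
  obtain k where k: "closure X\<^sub>1 <= interior (L k)" using L3[OF 1(2,3)] by blast
  obtain Wk where Wk: "open Wk" "L k <= Wk" "ALL x:Wk. \<psi> k x = 1" using \<psi>(2) by blast
  have c: "X\<^sub>1 <= closure X\<^sub>1" by (rule closure_subset)
  have s1: "X\<^sub>1 <= X" and s2: "X\<^sub>1 <= interior (L k)" using c 1(3) k by auto
  have a: "(%e x. v e x - u k e x) : N_M X\<^sub>1" by (rule net_restrict(2)[OF open_interior 1(1) s2 v(2)])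
  have b: "(%e x. u k e x - conv_net \<phi> (cutoff_dist \<psi>' w) e x) : N_M X\<^sub>1"
   unfolding u_def
  proof (rule conv_net_cutoff_diff[OF X w \<psi>(1) 1(4) \<phi> 1(1)])
   fix x assume "x:X\<^sub>1"
   then have "x:W" "x:Wk" using c 1(6) s2 interior_subset[of "L k"] Wk(2) by auto
   then show "\<psi> k x = \<psi>' x" using 1(7) Wk(3) by simp
  qed
  have "(%e x. v e x - conv_net \<phi> (cutoff_dist \<psi>' w) e x) : N_M X\<^sub>1" using N_M_add[OF 1(1) a b] by simp
  then show "grestrict X\<^sub>1 (cls (G X) v) = cls (G X\<^sub>1) (conv_net \<phi> (cutoff_dist \<psi>' w))"
   by (rule grestrict_eqI[OF X 1(1) s1 el])
 qed
 then show ?thesis by blast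
qed

lemma iota_iota_spec:
 assumes X: "open X" and \<phi>: "\<phi>:schwartz" and w: "w:distributions X"
 shows "iota_spec \<phi> X w (iota \<phi> X w)"
proof -
 obtain U where U: "iota_spec \<phi> X w U" using iota_spec_exists[OF assms] by blast
 have "iota \<phi> X w = (THE U. iota_spec \<phi> X w U)" unfolding iota_def iota_spec_def ..
 moreover have "iota_spec \<phi> X w (THE U. iota_spec \<phi> X w U)"
  using U iota_spec_unique[OF X _ U] by (rule theI)
 ultimately show ?thesis by simp
qed

lemma iota_elem: "open X ==> \<phi>:schwartz ==> w:distributions X ==> iota \<phi> X w:elems (G X)"
 using iota_iota_spec unfolding iota_spec_def by blast

text \<open>Passes from relatively compact sets, near whose closure \<psi> is 1, to any open set on
  which \<psi> is 1, by covering it with small balls.\<close>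

lemma iota_net:
 assumes X: "open X" and \<phi>: "\<phi>:schwartz" and w: "w:distributions X" and a: "a:iota \<phi> X w"
  and \<psi>: "\<psi>:test X" and W: "open W" "W <= X" "!!x. x:W ==> \<psi> x = 1"
 shows "(%e x. a e x - conv_net \<phi> (cutoff_dist \<psi> w) e x) : N_M W"
proof -
 interpret net_space "G X" "{f. smooth_on X f}" by (rule net_space_G[OF X])
 note el = iota_elem[OF X \<phi> w]
 have aE: "a:E_M X" using mem_elem(1)[OF el a] by simp
 show ?thesis
 proof (rule N_M_local[OF W(1)])
  show "(%e x. a e x - conv_net \<phi> (cutoff_dist \<psi> w) e x) : E_M W"
   by (intro E_M_diff[OF W(1)] net_restrict(1)[OF X W(1,2) aE] conv_net_E_M[OF _ \<phi> W(1)] cutoff_tempered[OF X w \<psi>])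
  fix x assume "x:W"
  then obtain e where e: "0 < e" "cball x e <= W" using W(1) open_contains_cball by blast
  have cl: "closure (ball x e) = cball x e" using e(1) by simp
  have sub: "ball x e <= X" "ball x e <= W" using e(2) ball_subset_cball W(2) by blast+
  have "open (ball x e) & compact (closure (ball x e)) & closure (ball x e) <= X &
    \<psi>:test X & (EX W. open W & closure (ball x e) <= W & (ALL x:W. \<psi> x = 1))"
   unfolding cl using e \<psi> W by (intro conjI exI[of _ W]) auto
  then have "grestrict (ball x e) (iota \<phi> X w) = cls (G (ball x e)) (conv_net \<phi> (cutoff_dist \<psi> w))"
   using iota_iota_spec[OF X \<phi> w] unfolding iota_spec_def by blast
  then have "(%e x. a e x - conv_net \<phi> (cutoff_dist \<psi> w) e x) : N_M (ball x e)"
   by (rule grestrict_eqD[OF X open_ball sub(1) el a])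
  then show "EX V. open V & x:V & V <= W & (%e x. a e x - conv_net \<phi> (cutoff_dist \<psi> w) e x) : N_M V"
   using e(1) sub(2) by (intro exI[of _ "ball x e"]) simp
 qed
qed

section \<open>Comparing the two functionals\<close>

lemma moll_schwartz: "mollifier \<phi> ==> \<phi>:schwartz"
 by (simp add: mollifier_def)

text \<open>By transposition the difference is \<open>w\<close> applied to the mollification error
  of \<open>f e\<close>. Since the growth exponent \<open>N\<close> of \<open>f\<close> is the same
  for all seminorms, the order \<open>r\<close> can be chosen after \<open>N\<close>, although it
  raises the seminorm to \<open>j + r\<close>. This is the point where regularity enters.\<close>

lemma mollify_pairing_negligible:
 fixes \<phi> :: "'n::finite fn"
 assumes w: "w:tempered" and \<phi>: "mollifier \<phi>" and f: "f:E_S_inf"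
 shows "negligible_num (%e. (LINT y|lborel. conv_net \<phi> w e y * f e y) - w (f e))"
 unfolding negl_num_iff
proof (rule uneglI)
 fix q :: nat
 have fn: "f:nets_in schwartz" using f by (simp add: E_S_inf_def)
 obtain N :: nat where N: "ALL j. bigO_eps (%e. schwartz_seminorm j (f e)) (- real N)" using f by (auto simp: E_S_inf_def)
 obtain C j where C: "tbound w C j" using tempered_tbound[OF w] by blast
 \<comment> \<open>\<open>e ^ r\<close> has to outweigh \<open>e powr (- N)\<close> and leave
   \<open>e powr q\<close>; the summand 1 makes \<open>r\<close> positive.\<close>
 define r where "r = q + N + 1"
 obtain D where D: "0 <= D" "EV e. 0 < e & e < 1 & sbound (j + r) (f e) (D * e powr (- real N))" (is "EV e. ?P e")
  using N schwartz_bigO_iff[OF fn, of "j + r" "- real N"] by blast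
 let ?M = "C * (moll_const \<phi> r j * D)"
 show "uO (UNIV :: unit set) (%e _. (LINT y|lborel. conv_net \<phi> w e y * f e y) - w (f e)) (real q)"
 proof (rule uO_eventuallyI[of _ _ ?M], rule eventually_mono[OF D(2)], intro ballI)
  fix e :: real assume e: "?P e"
  let ?g = "correlate (f e) (meps \<phi> e)"
  have fs: "f e:schwartz" using fn e by (simp add: nets_in_def)
  have ms: "meps \<phi> e:schwartz" using moll_schwartz[OF \<phi>] e by (intro meps_schwartz) auto
  have sb: "sbound j (%x. ?g x - f e x) (moll_const \<phi> r j * e ^ r * (D * e powr (- real N)))"
   by (rule sbound_mollify[OF \<phi> fs]) (use e in \<open>auto simp: r_def\<close>)
  have cs: "?g:schwartz" by (rule correlate_schwartz[OF fs schwartz_rapid[OF ms]])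
  have eq: "(LINT y|lborel. conv_net \<phi> w e y * f e y) - w (f e) = w (%x. ?g x - f e x)"
   using dist_conv_pairing[OF w ms fs] tempered_diff[OF w cs fs] by simp
  have "cmod (w (%x. ?g x - f e x)) <= C * (moll_const \<phi> r j * e ^ r * (D * e powr (- real N)))"
   by (rule tboundD[OF C schwartz_diff[OF cs fs] sb])
  also have "... = ?M * (e powr real r * e powr (- real N))" using e by (simp add: powr_realpow)
  also have "... <= ?M * e powr real q" unfolding powr_add[symmetric]
   using e C D(1) moll_const_nonneg[of \<phi> r j] by (intro mult_left_mono powr_mono' mult_nonneg_nonneg) (auto simp: r_def tbound_def)
  finally show "cmod ((LINT y|lborel. conv_net \<phi> w e y * f e y) - w (f e)) <= ?M * e powr real q" unfolding eq .
 qed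
qed

lemma cutoff_net_schwartz:
 assumes "open X" "u:smooth_nets X" "\<psi>:test X"
 shows "(%e x. \<psi> x * u e x) : nets_in schwartz"
 using test_schwartz[OF test_mult[OF assms(1,3) smooth_netsD[OF assms(2)]]] by (simp add: nets_in_def)

lemma cutoff_net_bigO:
 fixes u :: "'n::finite net"
 assumes X: "open X" and us: "u:smooth_nets X" and \<psi>: "\<psi>:test X"
  and K: "compact K" "K <= X" "!!x. x ~: K ==> \<psi> x = 0"
  and N: "!!is. length is <= j ==> uO K (%e. ideriv is (u e)) (- real N)"
 shows "bigO_eps (%e. schwartz_seminorm j (%x. \<psi> x * u e x)) (- real N)"
proof -
 note nets = cutoff_net_schwartz[OF X us \<psi>]
 obtain R0 where R0: "!!x. x:K ==> norm x <= R0" using compact_imp_bounded[OF K(1)] by (auto simp: bounded_iff)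
 define R where "R = max R0 0"
 have R: "!!x. x:K ==> norm x <= R" "0 <= R" using R0 by (force simp: R_def)+
 have sn: "(%e. \<psi>) : smooth_nets X" using test_smooth_on[OF \<psi>] by (simp add: smooth_nets_def)
 have p: "uO K (%e. ideriv js \<psi>) 0" for js
 proof -
  obtain B where "!!is x. length is <= length js ==> x:K ==> cmod (ideriv is \<psi> x) <= B"
   using ideriv_bounded_compact[OF test_smooth_on[OF \<psi>] K(1,2), of "length js"] by blast
  then show ?thesis by (intro uO_const_net) auto
 qed
 have m: "uO K (%e. ideriv is (%x. \<psi> x * u e x)) (- real N)" if "length is <= j" for "is"
  using uO_ideriv_mult[OF X sn us K(2) p N, of "is"] that by simp
 obtain C where C: "0 <= C" "EV e. 0 < e & e < 1 & (ALL is. length is <= j --> (ALL x:K. cmod (ideriv is (%x. \<psi> x * u e x) x) <= C * e powr (- real N)))" (is "EV e. ?P e")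
  by (rule uO_all_lists[OF m]) auto
 have "EV e. 0 < e & e < 1 & sbound j (%x. \<psi> x * u e x) ((1 + R) ^ j * C * e powr (- real N))"
  using C(2)
 proof (rule eventually_mono)
  fix e :: real assume e: "?P e"
  have "sbound j (%x. \<psi> x * u e x) ((1 + R) ^ j * (C * e powr (- real N)))"
   by (rule sbound_compact_support[OF compact_imp_closed[OF K(1)] _ R(1,2)]) (use e K(3) C(1) in auto)
  then show "0 < e & e < 1 & sbound j (%x. \<psi> x * u e x) ((1 + R) ^ j * C * e powr (- real N))" using e by (simp add: mult.assoc)
 qed
 then show ?thesis unfolding schwartz_bigO_iff[OF nets] using C(1) R(2) by (intro exI[of _ "(1 + R) ^ j * C"]) simp
qed

lemma cutoff_net_E_S_inf:
 assumes X: "open X" and u: "u:E_M_inf X" and \<psi>: "\<psi>:test X"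
 shows "(%e x. \<psi> x * u e x) : E_S_inf"
proof -
 obtain K where K: "compact K" "K <= X" "!!x. x ~: K ==> \<psi> x = 0" by (rule testE[OF \<psi>]) blast
 have us: "u:smooth_nets X" using u E_M_inf_iff[OF X] by blast
 obtain N :: nat where N: "!!is. uO K (%e. ideriv is (u e)) (- real N)" using u K(1,2) E_M_inf_iff[OF X] by blast
 have "bigO_eps (%e. schwartz_seminorm j (%x. \<psi> x * u e x)) (- real N)" for j
  by (rule cutoff_net_bigO[OF X us \<psi> K N])
 then show ?thesis using cutoff_net_schwartz[OF X us \<psi>] by (auto simp: E_S_inf_def)
qed

text \<open>Around the supports of \<open>u\<close> the representative \<open>a\<close> may be
  replaced by the explicit net \<open>b\<close>. As \<open>u\<close> vanishes off \<open>K\<close>,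
  the integral over a compact set becomes one over the whole space.\<close>

lemma gintegral_gmult_supported:
 fixes a b u :: "'n::finite net"
 assumes X: "open X" and I: "I:elems (G X)" "a:I" and W: "open W" "W <= X" and d: "(%e x. a e x - b e x) : N_M W"
  and u: "u:E_M X" and K: "compact K" "K <= W" and z: "!!e x. 0 < e ==> e <= 1 ==> x ~: K ==> u e x = 0"
 shows "gintegral X (gmult (G X) I (cls (G X) u)) = abs_gnum (%e. LINT y|lborel. b e y * u e y)" (is ?A)
  and "moderate_num (%e. LINT y|lborel. b e y * u e y)" (is ?B)
proof -
 interpret net_space "G X" "{f. smooth_on X f}" by (rule net_space_G[OF X])
 have KX: "K <= X" using K W by blast
 obtain \<delta> where \<delta>: "0 < \<delta>" "compact (\<Union>x\<in>K. cball x \<delta>)" "(\<Union>x\<in>K. cball x \<delta>) <= W" using K(1) W(1) K(2) by (rule compact_thicken)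
 let ?K = "\<Union>x\<in>K. cball x \<delta>"
 have "(\<Union>x\<in>K. ball x \<delta>) <= interior ?K" by (intro interior_maximal) (auto intro: less_imp_le)
 then have int: "K <= interior ?K" using \<delta>(1) by force
 have U: "cls (G X) u:elems (G X)" "u:cls (G X) u" using u cls_elem cls_self by auto
 have s: "gsupp X (cls (G X) u) <= interior ?K" using compact_support_G_c(3)[OF X K(1) KX u z] int by blast
 have 1: "gintegral X (gmult (G X) I (cls (G X) u)) = abs_gnum (%e. LINT y:?K|lborel. a e y * u e y)"
  by (rule gintegral_gmult[OF X I U \<delta>(2)]) (use s \<delta>(3) W in auto)
 have uW: "u:E_M W" by (rule net_restrict(1)[OF X W u])
 have aW: "a:E_M W" by (rule net_restrict(1)[OF X W]) (use mem_elem(1)[OF I] in simp)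
 have "(%e x. a e x - (a e x - b e x)) : E_M W" by (rule E_M_diff[OF W(1) aW]) (use d N_M_subset_E_M[OF W(1)] in blast)
 then have bW: "b:E_M W" by simp
 have abu: "(%e x. a e x * u e x) : E_M W" "(%e x. b e x * u e x) : E_M W" by (intro E_M_mult[OF W(1)] aW bW uW)+
 have ng: "unegl ?K (%e x. (a e x - b e x) * u e x)"
  using N_M_unegl[OF W(1) N_M_mult[OF W(1) d uW] \<delta>(2,3), of "[]"] by simp
 have b_eq: "(LINT y:?K|lborel. b e y * u e y) = (LINT y|lborel. b e y * u e y)" if "0 < e" "e < 1" for e
 proof -
  have "indicator ?K y *\<^sub>R (b e y * u e y) = b e y * u e y" for y
   using z[OF that(1), of y] that int interior_subset[of ?K] by (cases "y:K") (auto simp: indicator_def)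
  then show ?thesis by (simp add: set_lebesgue_integral_def)
 qed
 have mb: "moderate_num (%e. LINT y:?K|lborel. b e y * u e y)" by (rule moderate_set_integral[OF W(1) abu(2) \<delta>(2,3)])
 have "negligible_num (%e. LINT y:?K|lborel. (a e y - b e y) * u e y)"
  by (rule negligible_set_integral[OF \<delta>(2) subset_refl \<delta>(2) ng])
 then have "negligible_num (%e. (LINT y:?K|lborel. a e y * u e y) - (LINT y:?K|lborel. b e y * u e y))"
 proof (rule negl_num_cong)
  fix e :: real assume e: "0 < e" "e < 1"
  note i = smooth_nets_set_integrable[OF E_M_smooth[OF W(1) abu(1)] \<delta>(2,3) e] smooth_nets_set_integrable[OF E_M_smooth[OF W(1) abu(2)] \<delta>(2,3) e]
  show "(LINT y:?K|lborel. (a e y - b e y) * u e y) = (LINT y:?K|lborel. a e y * u e y) - (LINT y:?K|lborel. b e y * u e y)"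
   using set_integral_diff(2)[OF i] by (simp add: left_diff_distrib)
 qed
 then have "abs_gnum (%e. LINT y:?K|lborel. a e y * u e y) = abs_gnum (%e. LINT y:?K|lborel. b e y * u e y)"
  by (rule abs_gnum_eqI'[OF moderate_set_integral[OF W(1) abu(1) \<delta>(2,3)]])
 also have "... = abs_gnum (%e. LINT y|lborel. b e y * u e y)" by (rule abs_gnum_cong[OF mb b_eq])
 finally show ?A using 1 by simp
 show ?B by (rule mod_num_cong[OF mb b_eq])
qed

subsection \<open>Distributions\<close>

text \<open>\<open>u\<close> and the representative chosen by \<open>crep\<close> are both supported
  in compact sets. With a cutoff that is 1 near both, \<open>w\<close> becomes a functional bounded
  by one seminorm, which does not distinguish representatives.\<close>

lemma iota_d_eq:
 fixes u :: "'n::finite net"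
 assumes X: "open X" and w: "w:distributions X" and u: "u:E_M X"
  and K: "compact K" "K <= X" and z: "!!e x. 0 < e ==> e <= 1 ==> x ~: K ==> u e x = 0"
 shows "iota_d X w (cls (G X) u) = abs_gnum (%e. w (u e))" "moderate_num (%e. w (u e))"
proof -
 interpret net_space "G X" "{f. smooth_on X f}" by (rule net_space_G[OF X])
 let ?U = "cls (G X) u"
 have U: "?U:G_c X" by (rule compact_support_G_c(2)[OF X K u z])
 define v where "v = crep X ?U"
 have v: "v : ?U" using crep_props(1)[OF X U] by (simp add: v_def)
 obtain K' where K': "compact K'" "K' <= X" "ALL e:{0<..1}. ALL x. x ~: K' --> v e x = 0" using crep_props(2)[OF X U] unfolding v_def by blast
 have KK: "compact (K \<union> K')" "K \<union> K' <= X" using K K' by auto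
 obtain \<psi> W where \<psi>: "\<psi>:test X" "open W" "K \<union> K' <= W" "!!x. x:W ==> \<psi> x = 1" by (rule cutoff_exists[OF X KK]) blast
 obtain L where L: "compact L" "L <= X" "!!x. x ~: L ==> \<psi> x = 0" by (rule testE[OF \<psi>(1)]) blast
 obtain j where j: "net_functional (%e f. w (%x. \<psi> x * f x)) (sup_seminorm L j) 0"
  using cutoff_functional[OF X w \<psi>(1) L(1,2)] L(3) by blast
 have cu: "w (%x. \<psi> x * f e x) = w (f e)" if "!!x. x ~: K \<union> K' ==> f e x = 0" for f and e :: real
 proof -
  have "(%x. \<psi> x * f e x) = f e"
  proof
   fix x show "\<psi> x * f e x = f e x" using that[of x] \<psi>(3,4) by (cases "x:K \<union> K'") auto
  qed
  then show ?thesis by simp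
 qed
 have cu1: "w (%x. \<psi> x * u e x) = w (u e)" "w (%x. \<psi> x * v e x) = w (v e)" if "0 < e" "e < 1" for e
  using that z K'(3) by (intro cu; auto)+
 have m: "moderate_num (%e. w (%x. \<psi> x * u e x))" "moderate_num (%e. w (%x. \<psi> x * v e x))"
  using functional_moderate[OF j, of u] functional_moderate[OF j, of v] u mem_elem(1)[OF G_c_elem[OF U] v] by simp_all
 show "moderate_num (%e. w (u e))" by (rule mod_num_cong[OF m(1) cu1(1)])
 have "abs_gnum (%e. w (v e)) = abs_gnum (%e. w (%x. \<psi> x * v e x))" by (rule abs_gnum_cong[OF m(2) cu1(2), symmetric])
 also have "... = abs_gnum (%e. w (%x. \<psi> x * u e x))"
  using functional_cong[OF j, of v u] v u by (simp add: cls_def)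
 also have "... = abs_gnum (%e. w (u e))" by (rule abs_gnum_cong[OF m(1) cu1(1)])
 finally show "iota_d X w ?U = abs_gnum (%e. w (u e))" by (simp add: iota_d_def v_def)
qed

lemma iota_d_cont_dual:
 assumes X: "open X" and w: "w:distributions X"
 shows "iota_d X w:cont_dual (G X) (G_c X) (G_c_topology X)"
proof (rule G_c_cont_dual[OF X])
 interpret net_space "G X" "{f. smooth_on X f}" by (rule net_space_G[OF X])
 fix K assume K: "compact K" "K <= X"
 obtain \<psi> W where \<psi>: "\<psi>:test X" "open W" "K <= W" "!!x. x:W ==> \<psi> x = 1" by (rule cutoff_exists[OF X K]) blast
 obtain L where L: "compact L" "L <= X" "!!x. x ~: L ==> \<psi> x = 0" by (rule testE[OF \<psi>(1)]) blast
 obtain j where j: "net_functional (%e f. w (%x. \<psi> x * f x)) (sup_seminorm L j) 0"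
  using cutoff_functional[OF X w \<psi>(1) L(1,2)] L(3) by blast
 \<comment> \<open>Points where \<psi> is 1 lie in every set outside of which \<psi>
   vanishes.\<close>
 have "W <= L" using \<psi>(4) L(3) by force
 then have int: "K <= interior L" using interior_maximal[OF _ \<psi>(2)] \<psi>(3) by blast
 have "iota_d X w U = induced (%e f. w (%x. \<psi> x * f x)) U" if "U:G_K X K" for U
 proof -
  have Ue: "U:elems (G X)" and sU: "gsupp X U <= W" using that \<psi>(3) by (auto simp: G_K_def)
  have m: "(%e x. \<psi> x * rep U e x) : U" by (rule cutoff_net_mem[OF X Ue rep_in[OF Ue] \<psi>(1,2) sU \<psi>(4)])
  have "iota_d X w (cls (G X) (%e x. \<psi> x * rep U e x)) = abs_gnum (%e. w (%x. \<psi> x * rep U e x))"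
   by (rule iota_d_eq(1)[OF X w _ L(1,2)]) (use mem_elem(1)[OF Ue m] L(3) in auto)
  then show ?thesis unfolding mem_elem(2)[OF Ue m] induced_def .
 qed
 then show "EX L' K' j N. compact K' & K' <= X & K <= interior K' & net_functional L' (sup_seminorm K' j) N & (ALL U:G_K X K. iota_d X w U = induced L' U)"
  using L(1,2) int j by (intro exI conjI) auto
qed

lemma iota_prime_cont_dual:
 "open X ==> mollifier \<phi> ==> w:distributions X ==> iota_prime \<phi> X w:cont_dual (G X) (G_c X) (G_c_topology X)"
 unfolding iota_prime_def by (rule pairing_cont_dual[OF _ iota_elem[OF _ moll_schwartz]])

lemma iota_prime_eq:
 fixes u :: "'n::finite net"
 assumes X: "open X" and \<phi>: "mollifier \<phi>" and w: "w:distributions X" and \<psi>: "\<psi>:test X"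
  and W: "open W" "W <= X" "!!x. x:W ==> \<psi> x = 1"
  and u: "u:E_M X" and K: "compact K" "K <= W" and z: "!!e x. 0 < e ==> e <= 1 ==> x ~: K ==> u e x = 0"
 shows "iota_prime \<phi> X w (cls (G X) u) = abs_gnum (%e. LINT y|lborel. conv_net \<phi> (cutoff_dist \<psi> w) e y * u e y)"
  "moderate_num (%e. LINT y|lborel. conv_net \<phi> (cutoff_dist \<psi> w) e y * u e y)"
proof -
 interpret net_space "G X" "{f. smooth_on X f}" by (rule net_space_G[OF X])
 note \<phi>s = moll_schwartz[OF \<phi>]
 note el = iota_elem[OF X \<phi>s w]
 have d: "(%e x. rep (iota \<phi> X w) e x - conv_net \<phi> (cutoff_dist \<psi> w) e x) : N_M W"
  by (rule iota_net[OF X \<phi>s w rep_in[OF el] \<psi> W])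
 show "iota_prime \<phi> X w (cls (G X) u) = abs_gnum (%e. LINT y|lborel. conv_net \<phi> (cutoff_dist \<psi> w) e y * u e y)"
  "moderate_num (%e. LINT y|lborel. conv_net \<phi> (cutoff_dist \<psi> w) e y * u e y)"
  unfolding iota_prime_def by (rule gintegral_gmult_supported[OF X el rep_in[OF el] W(1,2) d u K z]; assumption)+
qed

lemma rep_regular:
 assumes X: "open X" and U: "U:G_inf X"
 shows "U:elems (G X)" "u:U ==> u:E_M_inf X"
proof -
 interpret net_space "G X" "{f. smooth_on X f}" by (rule net_space_G[OF X])
 obtain v where v: "v:E_M_inf X" "U = cls (G X) v" using U by (auto simp: G_inf_def)
 show el: "U:elems (G X)" using v E_M_inf_subset_E_M[OF X] cls_elem[of v] by auto
 show "u:E_M_inf X" if "u:U"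
  by (rule E_M_inf_perturb[OF X v(1)]) (use that v(2) in \<open>auto simp: cls_def\<close>)
qed

lemma iota_d_eq_iota_prime:
 assumes X: "open X" and \<phi>: "mollifier \<phi>" and w: "w:distributions X" and U: "U:G_c_inf X"
 shows "iota_d X w U = iota_prime \<phi> X w U"
proof -
 interpret net_space "G X" "{f. smooth_on X f}" by (rule net_space_G[OF X])
 have Ui: "U:G_inf X" using U by (simp add: G_c_inf_def)
 note el = rep_regular(1)[OF X Ui]
 have Uc: "U:G_c X" using U el by (simp add: G_c_inf_def G_c_def)
 define u where "u = crep X U"
 have uU: "u:U" using crep_props(1)[OF X Uc] by (simp add: u_def)
 note ui = rep_regular(2)[OF X Ui uU]
 obtain K where K: "compact K" "K <= X" "ALL e:{0<..1}. ALL x. x ~: K --> u e x = 0" using crep_props(2)[OF X Uc] unfolding u_def by blast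
 have z: "u e x = 0" if "0 < e" "e <= 1" "x ~: K" for e x using K(3) that by auto
 obtain \<psi> W where \<psi>: "\<psi>:test X" "open W" "K <= W" "!!x. x:W ==> \<psi> x = 1" by (rule cutoff_exists[OF X K(1,2)]) blast
 have W: "open (W \<inter> X)" "W \<inter> X <= X" "K <= W \<inter> X" using \<psi> X K by auto
 let ?w = "cutoff_dist \<psi> w"
 note uE = subsetD[OF E_M_inf_subset_E_M[OF X] ui]
 have "negligible_num (%e. (LINT y|lborel. conv_net \<phi> ?w e y * (\<psi> y * u e y)) - ?w (%y. \<psi> y * u e y))"
  by (rule mollify_pairing_negligible[OF cutoff_tempered[OF X w \<psi>(1)] \<phi> cutoff_net_E_S_inf[OF X ui \<psi>(1)]])
 then have n: "negligible_num (%e. (LINT y|lborel. conv_net \<phi> ?w e y * u e y) - w (u e))"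
 proof (rule negl_num_cong)
  fix e :: real assume e: "0 < e" "e < 1"
  have s: "\<psi> y * u e y = u e y" for y using z[of e y] e \<psi>(3,4) by (cases "y:K") auto
  show "(LINT y|lborel. conv_net \<phi> ?w e y * (\<psi> y * u e y)) - ?w (%y. \<psi> y * u e y) = (LINT y|lborel. conv_net \<phi> ?w e y * u e y) - w (u e)"
   by (simp add: cutoff_dist_def s)
 qed
 have "iota_prime \<phi> X w (cls (G X) u) = abs_gnum (%e. LINT y|lborel. conv_net \<phi> ?w e y * u e y)"
  by (rule iota_prime_eq(1)[OF X \<phi> w \<psi>(1) W(1,2) \<psi>(4) uE K(1) W(3) z]) auto
 also have "... = abs_gnum (%e. w (u e))"
  by (rule abs_gnum_eqI'[OF iota_prime_eq(2)[OF X \<phi> w \<psi>(1) W(1,2) \<psi>(4) uE K(1) W(3) z] n]) auto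
 also have "... = iota_d X w (cls (G X) u)" by (rule iota_d_eq(1)[OF X w uE K(1,2) z, symmetric])
 finally show ?thesis using mem_elem(2)[OF el uU] by simp
qed

subsection \<open>Compactly supported distributions\<close>

context net_space
begin

lemma cont_dual_cong:
 assumes T: "T:cont_dual A (elems A) (seminorm_topology A (elems A) \<P>)" and eq: "!!U. U:elems A ==> T U = T' U"
 shows "T' : cont_dual A (elems A) (seminorm_topology A (elems A) \<P>)"
proof -
 have "continuous_map (seminorm_topology A (elems A) \<P>) gnum_topology T'"
  by (rule continuous_map_eq[of _ _ T]) (use T eq in \<open>auto simp: cont_dual_def seminorm_topology_topspace\<close>)
 then show ?thesis using T eq gadd_elem gscale_elem unfolding cont_dual_def by simp
qed

end

lemma cdistE:
 assumes X: "open X" and w: "w:compact_distributions X"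
 obtains K C j where "compact K" "K <= X" "0 < C" "!!f. smooth_on X f ==> ennreal (cmod (w f)) <= ennreal C * sup_seminorm K j f"
proof -
 have "EX K (C::real) j. compact K & K <= X & (ALL f. smooth_on X f --> ennreal (cmod (w f)) <= ennreal C * sup_seminorm K j f)"
  using w by (simp add: compact_distributions_def)
 then obtain K and C :: real and j where K: "compact K" "K <= X" and b: "ALL f. smooth_on X f --> ennreal (cmod (w f)) <= ennreal C * sup_seminorm K j f"
  by (elim exE conjE)
 have "ennreal (cmod (w f)) <= ennreal (\<bar>C\<bar> + 1) * sup_seminorm K j f" if "smooth_on X f" for f
 proof -
  have "ennreal (cmod (w f)) <= ennreal C * sup_seminorm K j f" using b that by simp
  also have "... <= ennreal (\<bar>C\<bar> + 1) * sup_seminorm K j f" by (intro mult_right_mono ennreal_leI) auto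
  finally show ?thesis .
 qed
 then show thesis using K by (intro that[of K "\<bar>C\<bar> + 1" j]) auto
qed

lemma cdist_linear: "w:compact_distributions X ==> linear_on {f. smooth_on X f} w"
 by (simp add: compact_distributions_def)

lemma cdist_subset:
 assumes X: "open X" and w: "w:compact_distributions X"
 shows "w:distributions X"
proof -
 obtain K0 C j where K0: "compact K0" "K0 <= X" "0 < C" and b: "!!f. smooth_on X f ==> ennreal (cmod (w f)) <= ennreal C * sup_seminorm K0 j f"
  by (rule cdistE[OF X w]) blast
 have lin: "linear_on (test X) w"
  using cdist_linear[OF w] test_smooth_on[of _ X X] by (simp add: linear_on_def)
 have "ennreal (cmod (w f)) <= ennreal C * sup_seminorm K j f"
  if K: "compact K" and f: "f:test X" "ALL x. x ~: K --> f x = 0" for K f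
 proof -
  \<comment> \<open>Derivatives of \<open>f\<close> vanish off \<open>K\<close>, so the seminorm
    over the compact set belonging to \<open>w\<close> is at most the one over
    \<open>K\<close>.\<close>
  have "ennreal (cmod (multi_deriv \<alpha> f x)) <= sup_seminorm K j f" if "mi_order \<alpha> <= j" for \<alpha> x
  proof (cases "x:K")
   case True
   then show ?thesis unfolding sup_seminorm_def using that by (intro SUP_upper2[of \<alpha>] SUP_upper2[of x]) auto
  next
   case False
   then show ?thesis using ideriv_outside[OF compact_imp_closed[OF K], of f x] f(2) by (simp add: multi_deriv_ideriv)
  qed
  then have "sup_seminorm K0 j f <= sup_seminorm K j f" unfolding sup_seminorm_def[of K0] by (intro SUP_least) simp
  then have "ennreal C * sup_seminorm K0 j f <= ennreal C * sup_seminorm K j f" by (rule mult_left_mono) simp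
  with b[OF test_smooth_on[OF f(1)]] show ?thesis by (rule order_trans)
 qed
 then show ?thesis unfolding distributions_def using lin by blast
qed

text \<open>The difference of \<open>f\<close> and its product with \<psi> vanishes near the compact
  set whose seminorm bounds \<open>w\<close>, together with all its derivatives.\<close>

lemma cdist_cutoff:
 assumes X: "open X" and w: "w:compact_distributions X"
 obtains \<psi> where "\<psi>:test X" "!!f. smooth_on X f ==> w f = w (%x. \<psi> x * f x)"
proof -
 obtain K C j where K: "compact K" "K <= X" "0 < C" and b: "!!f. smooth_on X f ==> ennreal (cmod (w f)) <= ennreal C * sup_seminorm K j f"
  by (rule cdistE[OF X w]) blast
 obtain \<psi> W where \<psi>: "\<psi>:test X" "open W" "K <= W" "!!x. x:W ==> \<psi> x = 1" by (rule cutoff_exists[OF X K(1,2)]) blast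
 have "w f = w (%x. \<psi> x * f x)" if f: "smooth_on X f" for f
 proof -
  have p: "smooth_on X (%x. \<psi> x * f x)" by (rule smooth_on_mult[OF X test_smooth_on[OF \<psi>(1)] f])
  have s: "smooth_on X (%x. f x - \<psi> x * f x)" by (rule smooth_on_diff[OF X f p])
  have "cmod (ideriv is (%x. f x - \<psi> x * f x) x) <= 0" if "x:K" for "is" x
   using ideriv_cong[OF \<psi>(2), of "%x. f x - \<psi> x * f x" "%_. 0" x "is"] \<psi>(3,4) that by (auto simp: ideriv_const)
  then have "sup_seminorm K j (%x. f x - \<psi> x * f x) <= ennreal 0"
   by (subst sup_seminorm_le_iff[OF X s K(2)]) auto
  then have "w (%x. f x - \<psi> x * f x) = 0" using b[OF s] by simp
  moreover have "w (%x. f x - \<psi> x * f x) = w f - w (%x. \<psi> x * f x)"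
   by (rule linear_on_diff[OF cdist_linear[OF w]]) (use f p smooth_on_cmult[OF X p, of "-1"] in auto)
  ultimately show ?thesis by simp
 qed
 with \<psi>(1) show thesis by (rule that)
qed

lemma iota_d_c_cont_dual:
 assumes X: "open X" and w: "w:compact_distributions X"
 shows "iota_d_c w:cont_dual (G X) (elems (G X)) (G_topology X)"
proof -
 interpret net_space "G X" "{f. smooth_on X f}" by (rule net_space_G[OF X])
 obtain K C j where K: "compact K" "K <= X" "0 < C" and b: "!!f. smooth_on X f ==> ennreal (cmod (w f)) <= ennreal C * sup_seminorm K j f"
  by (rule cdistE[OF X w]) blast
 have "EV e. ALL f:{f. smooth_on X f}. ennreal (cmod (w f)) <= ennreal (C * e powr (- 0)) * sup_seminorm K j f"
  by (rule eventually_mono[OF EV_unit]) (use b in simp)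
 then have "net_functional (%e. w) (sup_seminorm K j) 0"
  unfolding net_functional_def using admissible_sup_seminorm[OF X K(1,2)] cdist_linear[OF w] by blast
 moreover have "iota_d_c w = induced (%e. w)" unfolding iota_d_c_def induced_def ..
 moreover have "(%U. sharp_value (%e. sup_seminorm K j (rep U e))) : {P_Kj K j | K j. compact K & K <= X}"
  unfolding P_Kj_def[abs_def] using K by blast
 ultimately show ?thesis unfolding G_topology_def using induced_cont_dual by simp
qed

lemma conv_net_cutoff_negl:
 fixes \<phi> :: "'n::finite fn"
 assumes X: "open X" and w: "w:distributions X" and \<theta>: "\<theta>:test X" and \<phi>: "\<phi>:schwartz"
  and W: "open W" "!!x. x:W ==> \<theta> x = 0"
 shows "conv_net \<phi> (cutoff_dist \<theta> w) : N_M W"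
 unfolding N_M_iff[OF W(1)] using conv_net_off_support[OF X w \<theta> \<phi> _ W(1) _ W(2)] E_M_smooth[OF W(1) conv_net_E_M[OF cutoff_tempered[OF X w \<theta>] \<phi> W(1)]] by blast

context
 fixes X L :: "(real^'n::finite) set" and \<phi> \<psi> :: "'n fn" and w
 assumes X: "open X" and \<phi>: "mollifier \<phi>" and w: "w:compact_distributions X" and \<psi>: "\<psi>:test X"
  and cut: "!!f. smooth_on X f ==> w f = w (%x. \<psi> x * f x)"
  and L: "compact L" "L <= X" "!!x. x ~: L ==> \<psi> x = 0"
begin

interpretation net_space "G X" "{f. smooth_on X f}" by (rule net_space_G[OF X])

text \<open>The translated mollifiers are smooth on \<open>X\<close>, so \<psi> may be inserted into
  \<open>w\<close> without changing the net; the set \<open>L\<close> off which \<psi> vanishes then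
  confines the support of the embedding.\<close>

lemma iota_c_facts:
 "iota_c \<phi> X w:elems (G X)" "conv_net \<phi> (cutoff_dist \<psi> w) : iota_c \<phi> X w" "gsupp X (iota_c \<phi> X w) <= L"
 "conv_net \<phi> (cutoff_dist \<psi> w) : N_M (X - L)"
proof -
 note wd = cdist_subset[OF X w]
 let ?a = "conv_net \<phi> (cutoff_dist \<psi> w)"
 have aE: "?a:E_M X" by (rule conv_net_E_M[OF cutoff_tempered[OF X wd \<psi>] moll_schwartz[OF \<phi>] X])
 have "conv_net \<phi> w e x - ?a e x = 0" if "0 < e" "e <= 1" for e x
  using cut[OF smooth_on_subset[OF schwartz_smooth[OF schwartz_reflect[OF meps_schwartz[OF moll_schwartz[OF \<phi>] that]]] subset_UNIV]]
  by (simp add: dist_conv_def cutoff_dist_def)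
 then have "(%e x. conv_net \<phi> w e x - ?a e x) : N_M (X - {})" by (intro vanishing_net_N_M[OF X]) auto
 then have eq: "iota_c \<phi> X w = cls (G X) ?a" unfolding iota_c_def by (intro cls_eqI) simp
 show 1: "iota_c \<phi> X w:elems (G X)" "?a:iota_c \<phi> X w" unfolding eq using aE cls_elem cls_self by auto
 show n: "?a:N_M (X - L)"
  by (rule conv_net_cutoff_negl[OF X wd \<psi> moll_schwartz[OF \<phi>] open_Diff[OF X compact_imp_closed[OF L(1)]]]) (use L(3) in auto)
 then show "gsupp X (iota_c \<phi> X w) <= L" using gsupp_subset_iff[OF X compact_imp_closed[OF L(1)] 1] by simp
qed

lemma iota_prime_c_cont_dual: "iota_prime_c \<phi> X w:cont_dual (G X) (elems (G X)) (G_topology X)"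
proof -
 obtain \<delta> where \<delta>: "0 < \<delta>" "compact (\<Union>x\<in>L. cball x \<delta>)" "(\<Union>x\<in>L. cball x \<delta>) <= X" using L(1) X L(2) by (rule compact_thicken)
 let ?K = "\<Union>x\<in>L. cball x \<delta>"
 have "(\<Union>x\<in>L. ball x \<delta>) <= interior ?K" by (intro interior_maximal) (auto intro: less_imp_le)
 then have int: "gsupp X (iota_c \<phi> X w) <= interior ?K" using \<delta>(1) iota_c_facts(3) by force
 note el = iota_c_facts(1)
 obtain N where N: "net_functional (%e f. LINT y:?K|lborel. rep (iota_c \<phi> X w) e y * f y) (sup_seminorm ?K 0) N"
  using pairing_functional[OF X _ \<delta>(2,3)] rep_moderate[OF el] by (auto simp only: moderate_G)
 have P: "(%U. sharp_value (%e. sup_seminorm ?K 0 (rep U e))) : {P_Kj K j | K j. compact K & K <= X}"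
  unfolding P_Kj_def[abs_def] using \<delta>(2,3) by blast
 show ?thesis unfolding G_topology_def
 proof (rule cont_dual_cong[OF induced_cont_dual[OF N P]])
  fix U assume U: "U:elems (G X)"
  show "induced (%e f. LINT y:?K|lborel. rep (iota_c \<phi> X w) e y * f y) U = iota_prime_c \<phi> X w U"
   unfolding iota_prime_c_def induced_def
   by (rule gintegral_gmult[OF X el rep_in[OF el] U rep_in[OF U] \<delta>(2,3), symmetric]) (use int in blast)
 qed
qed

text \<open>A general \<open>U\<close> has no compact support. It is multiplied by a cutoff \<rho>
  that is 1 near \<open>L\<close>: this leaves the values of \<open>w\<close> unchanged, and alters
  the product with the embedding by a negligible net, as the embedding is negligible off
  \<open>L\<close>.\<close>

lemma iota_d_c_eq_iota_prime_c:
 assumes U: "U:G_inf X"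
 shows "iota_d_c w U = iota_prime_c \<phi> X w U"
proof -
 note wd = cdist_subset[OF X w]
 let ?w = "cutoff_dist \<psi> w" let ?a = "conv_net \<phi> ?w"
 note el = rep_regular(1)[OF X U] and uU = rep_in[OF rep_regular(1)[OF X U]]
 note ui = rep_regular(2)[OF X U uU]
 note uE = subsetD[OF E_M_inf_subset_E_M[OF X] ui]
 obtain \<rho> W where \<rho>: "\<rho>:test X" "open W" "L <= W" "!!x. x:W ==> \<rho> x = 1" by (rule cutoff_exists[OF X L(1,2)]) blast
 obtain M where M: "compact M" "M <= X" "!!x. x ~: M ==> \<rho> x = 0" by (rule testE[OF \<rho>(1)]) blast
 let ?u = "%e x. \<rho> x * rep U e x"
 have uE': "?u:E_M X" by (rule cutoff_net_E_M[OF X \<rho>(1) uE])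
 have U': "cls (G X) ?u:elems (G X)" "?u:cls (G X) ?u" using uE' cls_elem cls_self by auto
 note aE = mem_elem(1)[OF iota_c_facts(1,2), unfolded moderate_G]
 have m: "(%e x. ?a e x * rep U e x) : gmult (G X) (iota_c \<phi> X w) U" "(%e x. ?a e x * ?u e x) : gmult (G X) (iota_c \<phi> X w) (cls (G X) ?u)"
  by (intro gmult_mem(2)[OF X iota_c_facts(1,2)] el uU U')+
 have e: "gmult (G X) (iota_c \<phi> X w) U:elems (G X)" "gmult (G X) (iota_c \<phi> X w) (cls (G X) ?u) : elems (G X)"
  by (rule gmult_mem(1)[OF X iota_c_facts(1,2) el uU] gmult_mem(1)[OF X iota_c_facts(1,2) U'])+
 let ?d = "%e x. ?a e x * rep U e x - ?a e x * ?u e x"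
 have dE: "?d:E_M X" by (intro E_M_diff[OF X] E_M_mult[OF X] aE uE uE')
 have op: "open (X \<inter> W)" "open (X - L)" using X \<rho>(2) compact_imp_closed[OF L(1)] by auto
 have "?d:N_M X"
 proof (rule N_M_local[OF X dE])
  fix x assume x: "x:X"
  show "EX W. open W & x:W & W <= X & ?d:N_M W"
  proof (cases "x:W")
   case True
   have "?d:N_M (X \<inter> W)"
   proof (rule N_M_zeroth_order[OF op(1) net_restrict(1)[OF X op(1) Int_lower1 dE]])
    fix K assume K: "compact K" "K <= X \<inter> W"
    show "unegl K ?d" by (rule unegl_cong[OF unegl_zero]) (use K \<rho>(4) in auto)
   qed
   then show ?thesis using True x op(1) by (intro exI[of _ "X \<inter> W"]) auto
  next
   case False
   have "(%e x. ?a e x * (rep U e x - ?u e x)) : N_M (X - L)"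
    by (rule N_M_mult[OF op(2) iota_c_facts(4)]) (intro net_restrict(1)[OF X op(2)] E_M_diff[OF X uE uE'] Diff_subset)
   then have "?d:N_M (X - L)" by (simp add: right_diff_distrib)
   then show ?thesis using False x op(2) \<rho>(3) by (intro exI[of _ "X - L"]) auto
  qed
 qed
 then have ge: "gmult (G X) (iota_c \<phi> X w) U = gmult (G X) (iota_c \<phi> X w) (cls (G X) ?u)"
  using mem_elem(2)[OF e(1) m(1)] mem_elem(2)[OF e(2) m(2)] cls_eqI[of "%e x. ?a e x * rep U e x" "%e x. ?a e x * ?u e x"] by simp
 have z0: "(%e x. ?a e x - ?a e x) : N_M X" using N_M_zero[OF X] by simp
 have z: "?u e x = 0" if "x ~: M" for e x using M(3)[OF that] by simp
 note gi = gintegral_gmult_supported[OF X iota_c_facts(1,2) X subset_refl z0 uE' M(1,2) z]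
 have n: "negligible_num (%e. (LINT y|lborel. ?a e y * ?u e y) - ?w (?u e))"
  by (rule mollify_pairing_negligible[OF cutoff_tempered[OF X wd \<psi>] \<phi> cutoff_net_E_S_inf[OF X ui \<rho>(1)]])
 have "iota_prime_c \<phi> X w U = abs_gnum (%e. LINT y|lborel. ?a e y * ?u e y)"
  unfolding iota_prime_c_def ge by (rule gi(1))
 also have "... = abs_gnum (%e. ?w (?u e))" by (rule abs_gnum_eqI'[OF gi(2) n])
 also have "... = abs_gnum (%e. w (rep U e))"
 proof (rule abs_gnum_cong[OF mod_num_perturb[OF gi(2)]])
  show "negligible_num (%e. ?w (?u e) - (LINT y|lborel. ?a e y * ?u e y))" using negligible_num_uminus[OF n] by simp
  fix e :: real assume e: "0 < e" "e < 1"
  have "(%x. \<psi> x * (\<rho> x * rep U e x)) = (%x. \<psi> x * rep U e x)"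
  proof
   fix x show "\<psi> x * (\<rho> x * rep U e x) = \<psi> x * rep U e x" using L(3)[of x] \<rho>(3,4) by (cases "x:L") auto
  qed
  then show "?w (?u e) = w (rep U e)"
   using cut[OF smooth_netsD[OF E_M_smooth[OF X uE]], of e] e by (simp add: cutoff_dist_def)
 qed
 finally show ?thesis by (simp add: iota_d_c_def)
qed

end

subsection \<open>Tempered distributions\<close>

lemma integral_weight_bound:
 fixes h :: "'n::finite fn"
 assumes h: "!!y. cmod (h y) * (1 + norm y) ^ (2 * CARD('n)) <= B"
 shows "cmod (LINT y|lborel. h y) <= (LINT x|lborel. 1 / (1 + norm (x :: real^'n)) ^ (2 * CARD('n))) * B"
proof -
 have "0 <= cmod (h 0) * (1 + norm (0 :: real^'n)) ^ (2 * CARD('n))" by simp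
 then have B: "0 <= B" using h[of 0] by linarith
 have I: "0 <= (LINT x|lborel. 1 / (1 + norm (x :: real^'n)) ^ (2 * CARD('n)))" by (intro integral_nonneg_AE) simp
 show ?thesis
 proof (cases "integrable lborel h")
  case True
  have "cmod (LINT y|lborel. h y) <= (LINT x|lborel. B * (1 / (1 + norm (x :: real^'n)) ^ (2 * CARD('n))))"
   by (rule Bochner_Integration.integral_norm_bound_integral[OF True integrable_mult_right[OF integrable_weight]])
    (simp add: pos_le_divide_eq[OF weight_pos] h)
  also have "... = B * (LINT x|lborel. 1 / (1 + norm (x :: real^'n)) ^ (2 * CARD('n)))"
   by (rule integral_mult_right_zero)
  finally show ?thesis by (simp only: mult_ac)
 next
  case False
  then show ?thesis using I B by (simp add: not_integrable_integral_eq)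
 qed
qed

lemma pairing_bound:
 fixes f b :: "'n::finite fn"
 assumes f: "f:schwartz" "sbound (N + 2 * CARD('n)) f B" and b: "!!x. cmod (b x) <= D * (1 + norm x) ^ N" and D: "0 <= D"
 shows "cmod (LINT y|lborel. b y * f y) <= (LINT x|lborel. 1 / (1 + norm (x :: real^'n)) ^ (2 * CARD('n))) * (D * B)"
proof (rule integral_weight_bound)
 fix y :: "real^'n"
 have "cmod (b y) * cmod (f y) * (1 + norm y) ^ (2 * CARD('n)) <= D * (1 + norm y) ^ N * cmod (f y) * (1 + norm y) ^ (2 * CARD('n))"
  using b[of y] by (intro mult_right_mono) auto
 also have "... = D * ((1 + norm y) ^ (N + 2 * CARD('n)) * cmod (ideriv [] f y))" by (simp add: power_add mult_ac)
 also have "... <= D * B" by (intro mult_left_mono[OF sboundD[OF f(2)] D]) simp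
 finally show "cmod (b y * f y) * (1 + norm y) ^ (2 * CARD('n)) <= D * B" by (simp add: norm_mult)
qed

lemma growth_seminorm_le_iff:
 assumes "0 <= B"
 shows "growth_seminorm N \<alpha> f <= ennreal B \<longleftrightarrow> (ALL x. cmod (ideriv (mi_list \<alpha>) f x) <= B * (1 + norm x) ^ N)"
 unfolding growth_seminorm_def SUP_ennreal_le_iff[OF assms] multi_deriv_ideriv by (simp add: pos_divide_le_eq weight_pos)

lemma growth_order_zero:
 assumes "bigO_eps (%e. growth_seminorm N (%_. 0) (u e)) b"
 shows "EX C>=0. EV e. ALL x. cmod (u e x) <= C * e powr b * (1 + norm x) ^ N"
proof -
 obtain C where C: "EV e. growth_seminorm N (%_. 0) (u e) <= ennreal (C * e powr b)" using assms by (auto simp: bigO_eps_def)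
 have m: "mi_list (%_. 0) = []" by (rule length_0_conv[THEN iffD1]) (simp add: length_mi_list mi_order_def)
 have "EV e. ALL x. cmod (u e x) <= \<bar>C\<bar> * e powr b * (1 + norm x) ^ N"
  using C
 proof (rule eventually_mono)
  fix e assume "growth_seminorm N (%_. 0) (u e) <= ennreal (C * e powr b)"
  also have "... <= ennreal (\<bar>C\<bar> * e powr b)" by (intro ennreal_leI mult_right_mono) auto
  finally show "ALL x. cmod (u e x) <= \<bar>C\<bar> * e powr b * (1 + norm x) ^ N" by (subst (asm) growth_seminorm_le_iff) (simp_all add: m)
 qed
 then show ?thesis by (intro exI[of _ "\<bar>C\<bar>"]) simp
qed

lemma conv_net_E_tau:
 fixes \<phi> :: "'n::finite fn"
 assumes w: "w:tempered" and \<phi>: "\<phi>:schwartz"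
 shows "conv_net \<phi> w:E_tau"
proof -
 have key: "EX N::nat. EX C>=0. ALL e. 0 < e --> e <= 1 --> growth_seminorm N \<alpha> (conv_net \<phi> w e) <= ennreal (C * e powr (- real N))" for \<alpha>
 proof -
  obtain C M j where C: "0 <= C" "!!e x. 0 < e ==> e <= 1 ==> cmod (ideriv (mi_list \<alpha>) (conv_net \<phi> w e) x) <= C * e powr (- real M) * (1 + norm x) ^ j"
   using conv_net_bound[OF w \<phi>, of "mi_list \<alpha>"] by blast
  \<comment> \<open>\<open>E_tau\<close> demands the same exponent for the growth in
    \<open>x\<close> and in \<open>e\<close>, so the larger of the two is taken.\<close>
  have "growth_seminorm (max M j) \<alpha> (conv_net \<phi> w e) <= ennreal (C * e powr (- real (max M j)))" if e: "0 < e" "e <= 1" for e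
  proof (subst growth_seminorm_le_iff)
   show "ALL x. cmod (ideriv (mi_list \<alpha>) (conv_net \<phi> w e) x) <= C * e powr (- real (max M j)) * (1 + norm x) ^ max M j"
   proof
    fix x :: "real^'n"
    have "C * e powr (- real M) * (1 + norm x) ^ j <= C * e powr (- real (max M j)) * (1 + norm x) ^ max M j"
     using C(1) e by (intro mult_mono power_increasing powr_mono' mult_nonneg_nonneg) auto
    then show "cmod (ideriv (mi_list \<alpha>) (conv_net \<phi> w e) x) <= C * e powr (- real (max M j)) * (1 + norm x) ^ max M j"
     using C(2)[OF e, of x] by linarith
   qed
  qed (use C(1) in simp)
  then show ?thesis using C(1) by blast
 qed
 have "conv_net \<phi> w e:slowly_increasing" if e: "e : {0<..1}" for e
  unfolding slowly_increasing_def
 proof (intro CollectI conjI allI)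
  show "smooth_on UNIV (conv_net \<phi> w e)" using conv_net_smooth[OF w \<phi>] e by simp
  fix \<alpha> :: "'n => nat"
  obtain N C where "growth_seminorm N \<alpha> (conv_net \<phi> w e) <= ennreal (C * e powr (- real N))" using key[of \<alpha>] e by auto
  also have "... < \<infinity>" by simp
  finally show "EX N. growth_seminorm N \<alpha> (conv_net \<phi> w e) < \<infinity>" by blast
 qed
 moreover have "EX N::nat. bigO_eps (%e. growth_seminorm N \<alpha> (conv_net \<phi> w e)) (- real N)" for \<alpha>
 proof -
  obtain N C where k: "!!e. 0 < e ==> e <= 1 ==> growth_seminorm N \<alpha> (conv_net \<phi> w e) <= ennreal (C * e powr (- real N))" using key[of \<alpha>] by blast
  have "EV e. growth_seminorm N \<alpha> (conv_net \<phi> w e) <= ennreal (C * e powr (- real N))"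
   by (rule eventually_mono[OF EV_unit]) (use k in simp)
  then show ?thesis unfolding bigO_eps_def by blast
 qed
 ultimately show ?thesis unfolding E_tau_def nets_in_def by simp
qed

lemma N_tau_zero: "(%e x. 0) : N_tau"
proof -
 have g: "growth_seminorm N \<alpha> (%_. 0) <= ennreal 0" for N \<alpha>
  by (subst growth_seminorm_le_iff) (auto simp: ideriv_const)
 then have g0: "growth_seminorm N \<alpha> (%_. 0) = 0" for N \<alpha> by simp
 show ?thesis
  unfolding N_tau_def nets_in_def slowly_increasing_def bigO_eps_def by (simp add: g0 smooth_on_const)
qed

context
 fixes \<phi> :: "'n::finite fn" and w :: "('n fn) => complex"
 assumes \<phi>: "mollifier \<phi>" and w: "w:tempered"
begin

interpretation net_space "G_S :: 'n net_quotient" schwartz by (rule net_space_G_S)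

lemma iota_tau_rep: "rep (iota_tau \<phi> w) : E_tau" "(%e x. rep (iota_tau \<phi> w) e x - conv_net \<phi> w e x) : N_tau"
proof -
 have "conv_net \<phi> w:iota_tau \<phi> w"
  using conv_net_E_tau[OF w moll_schwartz[OF \<phi>]] N_tau_zero by (simp add: iota_tau_def cls_def G_tau_def)
 then have "rep (iota_tau \<phi> w) : iota_tau \<phi> w" unfolding rep_def by (rule someI[of "%u. u:iota_tau \<phi> w"])
 then show "rep (iota_tau \<phi> w) : E_tau" "(%e x. rep (iota_tau \<phi> w) e x - conv_net \<phi> w e x) : N_tau"
  by (simp_all add: iota_tau_def cls_def G_tau_def)
qed

lemma iota_tau_integrable:
 assumes e: "0 < e" "e <= 1" and f: "f:schwartz"
 shows "integrable lborel (%y. rep (iota_tau \<phi> w) e y * f y)"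
proof -
 have s: "rep (iota_tau \<phi> w) e:slowly_increasing" using iota_tau_rep(1) e by (simp add: E_tau_def nets_in_def)
 have m: "mi_list (%_. 0 :: nat) = ([] :: 'n list)" by (rule length_0_conv[THEN iffD1]) (simp add: length_mi_list mi_order_def)
 obtain N where "growth_seminorm N (%_. 0) (rep (iota_tau \<phi> w) e) < \<infinity>" using s unfolding slowly_increasing_def by blast
 then obtain B where B: "0 <= B" "growth_seminorm N (%_. 0) (rep (iota_tau \<phi> w) e) = ennreal B" by (rule ennreal_finiteE)
 have b: "!!x. cmod (rep (iota_tau \<phi> w) e x) <= B * (1 + norm x) ^ N"
  using growth_seminorm_le_iff[OF B(1), of N "%_. 0" "rep (iota_tau \<phi> w) e"] B(2) m by simp
 have "smooth_on UNIV (rep (iota_tau \<phi> w) e)" using s by (simp add: slowly_increasing_def)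
 then show ?thesis by (rule rapid_mult_integrable[OF schwartz_rapid[OF f] smooth_measurable b])
qed

lemma iota_prime_S_functional:
 "EX j N. net_functional (%e f. LINT y|lborel. rep (iota_tau \<phi> w) e y * f y) (schwartz_seminorm j) N"
proof -
 let ?a = "rep (iota_tau \<phi> w)"
 obtain N :: nat where N: "bigO_eps (%e. growth_seminorm N (%_. 0) (?a e)) (- real N)" using iota_tau_rep(1) unfolding E_tau_def by blast
 obtain C where C: "0 <= C" "EV e. ALL x. cmod (?a e x) <= C * e powr (- real N) * (1 + norm x) ^ N" (is "EV e. ?P e")
  using growth_order_zero[OF N] by blast
 let ?I = "LINT x|lborel. 1 / (1 + norm (x :: real^'n)) ^ (2 * CARD('n))"
 have I: "0 <= ?I" by (intro integral_nonneg_AE) simp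
 have "EV e. ALL f:schwartz. ennreal (cmod (LINT y|lborel. ?a e y * f y)) <= ennreal ((?I * C + 1) * e powr (- real N)) * schwartz_seminorm (N + 2 * CARD('n)) f"
  using C(2) EV_unit
 proof (eventually_elim, intro ballI)
  fix e :: real and f :: "'n fn"
  assume a: "?P e" and e: "0 < e & e < 1" and f: "f:schwartz"
  show "ennreal (cmod (LINT y|lborel. ?a e y * f y)) <= ennreal ((?I * C + 1) * e powr (- real N)) * schwartz_seminorm (N + 2 * CARD('n)) f"
  proof (rule seminorm_boundI)
   show "0 < (?I * C + 1) * e powr (- real N)" using e I C(1) by (intro mult_pos_pos add_nonneg_pos) auto
   fix B :: real assume B: "0 <= B" "schwartz_seminorm (N + 2 * CARD('n)) f <= ennreal B"
   have "cmod (LINT y|lborel. ?a e y * f y) <= ?I * (C * e powr (- real N) * B)"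
    by (rule pairing_bound[OF f]) (use a B C(1) sbound_iff[OF schwartz_smooth[OF f] B(1)] in auto)
   also have "... <= (?I * C + 1) * e powr (- real N) * B" using B(1) by (simp add: algebra_simps)
   finally show "cmod (LINT y|lborel. ?a e y * f y) <= (?I * C + 1) * e powr (- real N) * B" .
  qed
 qed
 moreover have "linear_on schwartz (%f. LINT y|lborel. ?a e y * f y)" if "0 < e" "e < 1" for e
  unfolding linear_on_def
 proof (intro conjI ballI allI)
  fix f g :: "'n fn" assume "f:schwartz" "g:schwartz"
  then show "(LINT y|lborel. ?a e y * (f y + g y)) = (LINT y|lborel. ?a e y * f y) + (LINT y|lborel. ?a e y * g y)"
   using Bochner_Integration.integral_add[OF iota_tau_integrable iota_tau_integrable] that by (simp add: distrib_left)
 next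
  fix c and f :: "'n fn"
  have "(LINT y|lborel. ?a e y * (c * f y)) = (LINT y|lborel. c * (?a e y * f y))" by (simp add: mult_ac)
  then show "(LINT y|lborel. ?a e y * (c * f y)) = c * (LINT y|lborel. ?a e y * f y)" by simp
 qed
 ultimately show ?thesis unfolding net_functional_def
  using admissible_schwartz_seminorm[of "N + 2 * CARD('n)"] by blast
qed

lemma iota_prime_S_cont_dual: "iota_prime_S \<phi> w:cont_dual G_S (elems G_S) G_S_topology"
proof -
 obtain j N where L: "net_functional (%e f. LINT y|lborel. rep (iota_tau \<phi> w) e y * f y) (schwartz_seminorm j) N"
  using iota_prime_S_functional by blast
 have "iota_prime_S \<phi> w = induced (%e f. LINT y|lborel. rep (iota_tau \<phi> w) e y * f y)" unfolding iota_prime_S_def induced_def ..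
 then show ?thesis unfolding G_S_topology_def using induced_cont_dual[OF L, of "{%U. sharp_value (%e. schwartz_seminorm j (rep U e)) |j. True}"] by auto
qed

lemma iota_d_S_functional: "EX j. net_functional (%e. w) (schwartz_seminorm j) 0"
proof -
 obtain C j where C: "tbound w C j" using tempered_tbound[OF w] by blast
 have b: "ennreal (cmod (w f)) <= ennreal (C + 1) * schwartz_seminorm j f" if f: "f:schwartz" for f
 proof (rule seminorm_boundI)
  show "0 < C + 1" using C by (simp add: tbound_def)
  fix B :: real assume B: "0 <= B" "schwartz_seminorm j f <= ennreal B"
  then have "cmod (w f) <= C * B" using tboundD[OF C f] sbound_iff[OF schwartz_smooth[OF f] B(1)] by simp
  then show "cmod (w f) <= (C + 1) * B" using B(1) by (simp add: distrib_right)
 qed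
 have "EV e. ALL f:schwartz. ennreal (cmod (w f)) <= ennreal ((C + 1) * e powr (- 0)) * schwartz_seminorm j f"
  by (rule eventually_mono[OF EV_unit]) (use b in simp)
 then have "net_functional (%e. w) (schwartz_seminorm j) 0"
  unfolding net_functional_def using admissible_schwartz_seminorm[of j] w tempered_iff by blast
 then show ?thesis by blast
qed

lemma iota_d_S_cont_dual: "iota_d_S w:cont_dual G_S (elems G_S) G_S_topology"
proof -
 obtain j where L: "net_functional (%e. w) (schwartz_seminorm j) 0" using iota_d_S_functional by blast
 have "iota_d_S w = induced (%e. w)" unfolding iota_d_S_def induced_def ..
 then show ?thesis unfolding G_S_topology_def using induced_cont_dual[OF L, of "{%U. sharp_value (%e. schwartz_seminorm j (rep U e)) |j. True}"] by auto
qed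

lemma iota_d_S_eq_iota_prime_S:
 assumes U: "U:G_S_inf"
 shows "iota_d_S w U = iota_prime_S \<phi> w U"
proof -
 let ?a = "rep (iota_tau \<phi> w)" let ?c = "conv_net \<phi> w"
 obtain u where u: "u:E_S_inf" "U = cls G_S u" using U by (auto simp: G_S_inf_def)
 have uE: "u:moderate_nets G_S" using u(1) unfolding E_S_inf_def G_S_def E_S_def by auto
 have el: "U:elems G_S" "u:U" unfolding u(2) using cls_elem[OF uE] cls_self[OF uE] by auto
 obtain jd where Ld: "net_functional (%e. w) (schwartz_seminorm jd) 0" using iota_d_S_functional by blast
 obtain j N where Lp: "net_functional (%e f. LINT y|lborel. ?a e y * f y) (schwartz_seminorm j) N"
  using iota_prime_S_functional by blast
 have d: "iota_d_S w U = abs_gnum (%e. w (u e))" using induced_mem[OF Ld el] by (simp add: iota_d_S_def induced_def)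
 have p: "iota_prime_S \<phi> w U = abs_gnum (%e. LINT y|lborel. ?a e y * u e y)"
  using induced_mem[OF Lp el] by (simp add: iota_prime_S_def induced_def)
 have un: "u:nets_in schwartz" using u(1) by (simp add: E_S_inf_def)
 obtain N' :: nat where N': "ALL q::nat. bigO_eps (%e. growth_seminorm N' (%_. 0) (%x. ?a e x - ?c e x)) (real q)"
  using iota_tau_rep(2) unfolding N_tau_def by blast
 obtain M :: nat where M: "bigO_eps (%e. schwartz_seminorm (N' + 2 * CARD('n)) (u e)) (- real M)" using u(1) unfolding E_S_inf_def by blast
 obtain D where D: "0 <= D" "EV e. 0 < e & e < 1 & sbound (N' + 2 * CARD('n)) (u e) (D * e powr (- real M))"
  using M unfolding schwartz_bigO_iff[OF un] by blast
 let ?I = "LINT x|lborel. 1 / (1 + norm (x :: real^'n)) ^ (2 * CARD('n))"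
 \<comment> \<open>The chosen representative differs from the explicit net by an element of
   \<open>N_tau\<close>, whose fixed polynomial growth \<open>N'\<close> is absorbed by the decay of
   \<open>u\<close>.\<close>
 have "negligible_num (%e. LINT y|lborel. (?a e y - ?c e y) * u e y)"
  unfolding negl_num_iff
 proof (rule uneglI)
  fix q :: nat
  obtain C where C: "0 <= C" "EV e. ALL x. cmod (?a e x - ?c e x) <= C * e powr real (q + M) * (1 + norm x) ^ N'" (is "EV e. ?P e")
   using growth_order_zero[OF N'[rule_format]] by blast
  show "uO (UNIV :: unit set) (%e _. LINT y|lborel. (?a e y - ?c e y) * u e y) (real q)"
  proof (rule uO_eventuallyI[of _ _ "?I * C * D"])
   show "EV e. ALL x:(UNIV :: unit set). cmod (LINT y|lborel. (?a e y - ?c e y) * u e y) <= ?I * C * D * e powr real q"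
    using C(2) D(2)
   proof (eventually_elim, intro ballI)
    fix e :: real
    assume c: "?P e"
     and e: "0 < e & e < 1 & sbound (N' + 2 * CARD('n)) (u e) (D * e powr (- real M))"
    have "cmod (LINT y|lborel. (?a e y - ?c e y) * u e y) <= ?I * (C * e powr real (q + M) * (D * e powr (- real M)))"
     by (rule pairing_bound) (use un e c C(1) in \<open>auto simp: nets_in_def\<close>)
    also have "... = ?I * C * D * (e powr real (q + M) * e powr (- real M))" by (simp only: mult_ac)
    also have "e powr real (q + M) * e powr (- real M) = e powr real q" unfolding powr_add[symmetric] by simp
    finally show "cmod (LINT y|lborel. (?a e y - ?c e y) * u e y) <= ?I * C * D * e powr real q" .
   qed
  qed
 qed
 from negligible_num_add[OF this mollify_pairing_negligible[OF w \<phi> u(1)]]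
 have "negligible_num (%e. (LINT y|lborel. ?a e y * u e y) - w (u e))"
 proof (rule negl_num_cong)
  fix e :: real assume e: "0 < e" "e < 1"
  have us: "u e:schwartz" using un e by (simp add: nets_in_def)
  have "(LINT y|lborel. (?a e y - ?c e y) * u e y) = (LINT y|lborel. ?a e y * u e y) - (LINT y|lborel. ?c e y * u e y)"
   using Bochner_Integration.integral_diff[OF iota_tau_integrable dist_conv_integrable[OF w meps_schwartz[OF moll_schwartz[OF \<phi>]] schwartz_rapid[OF us]], of e "u e" e] us e
   by (simp add: left_diff_distrib)
  then show "(LINT y|lborel. (?a e y - ?c e y) * u e y) + ((LINT y|lborel. ?c e y * u e y) - w (u e)) = (LINT y|lborel. ?a e y * u e y) - w (u e)" by simp
 qed
 then show ?thesis unfolding d p using abs_gnum_eqI'[OF functional_moderate[OF Lp uE]] by simp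
qed

end

section \<open>Supports\<close>

subsection \<open>Compactly supported nets\<close>

text \<open>Representatives of elements of \<open>G_c V\<close>, extended by zero. On this level the
  inclusion into a larger open set is the identity, see
  \<open>functional_restrict_cnet\<close>.\<close>

definition cnets :: "(real^'n::finite) set => 'n net set" where
 "cnets V = {u:E_M V. EX K. compact K & K <= V & (ALL e:{0<..1}. ALL x. x ~: K --> u e x = 0)}"

lemma cnetsI:
 "u:E_M V ==> compact K ==> K <= V ==> (!!e x. 0 < e ==> e <= 1 ==> x ~: K ==> u e x = 0) ==> u:cnets V"
 unfolding cnets_def by auto

lemma cnetsE:
 assumes "u:cnets V"
 obtains K where "u:E_M V" "compact K" "K <= V" "!!e x. 0 < e ==> e <= 1 ==> x ~: K ==> u e x = 0"
proof -
 obtain K where K: "u:E_M V" "compact K" "K <= V" "ALL e:{0<..1}. ALL x. x ~: K --> u e x = 0" using assms unfolding cnets_def by blast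
 then show thesis by (intro that[of K]) auto
qed

lemma cnets_test:
 assumes V: "open V" and u: "u:cnets V" and e: "0 < e" "e <= 1"
 shows "u e:test V"
proof -
 obtain K where K: "u:E_M V" "compact K" "K <= V" "!!e x. 0 < e ==> e <= 1 ==> x ~: K ==> u e x = 0" by (rule cnetsE[OF u]) blast
 have "smooth_on UNIV (u e)"
  by (rule smooth_extend_zero[OF V smooth_netsD[OF E_M_smooth[OF V K(1)] e] compact_imp_closed[OF K(2)] K(3) K(4)[OF e]])
 then show ?thesis unfolding test_functions_def using K(2,3) K(4)[OF e] by blast
qed

lemma cnets_mono:
 assumes V: "open V" "V <= X" and X: "open X" and u: "u:cnets V"
 shows "u:cnets X"
proof -
 obtain K where K: "u:E_M V" "compact K" "K <= V" "!!e x. 0 < e ==> e <= 1 ==> x ~: K ==> u e x = 0" by (rule cnetsE[OF u]) blast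
 have "u:E_M X" unfolding E_M_iff[OF X]
 proof (intro conjI allI impI)
  show "u:smooth_nets X" using test_smooth_on[OF cnets_test[OF V(1) u]] by (simp add: smooth_nets_def)
  fix L "is"
  obtain N :: nat where "uO K (%e. ideriv is (u e)) (- real N)" using E_M_umod[OF V(1) K(1-3), of "is"] by (auto simp: umod_def)
  then obtain C where C: "0 <= C" "EV e. 0 < e & e < 1 & (ALL x:K. cmod (ideriv is (u e) x) <= C * e powr (- real N))" (is "EV e. ?P e") by (rule uOE)
  have "uO L (%e. ideriv is (u e)) (- real N)"
  proof (rule uO_eventuallyI, rule eventually_mono[OF C(2)], intro ballI)
   fix e x assume e: "?P e"
   have "ideriv is (u e) x = 0" if "x ~: K"
    by (rule ideriv_outside[OF compact_imp_closed[OF K(2)] _ that]) (use K(4) e in auto)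
   then show "cmod (ideriv is (u e) x) <= C * e powr (- real N)" using e C(1) by (cases "x:K") auto
  qed
  then show "umod L (%e. ideriv is (u e))" by (rule umodI)
 qed
 then show ?thesis by (rule cnetsI[OF _ K(2)]) (use K V in auto)
qed

lemma cnets_G_c:
 assumes V: "open V" and u: "u:cnets V"
 shows "cls (G V) u:G_c V"
proof -
 obtain K where K: "u:E_M V" "compact K" "K <= V" "!!e x. 0 < e ==> e <= 1 ==> x ~: K ==> u e x = 0" by (rule cnetsE[OF u]) blast
 show ?thesis by (rule compact_support_G_c(2)[OF V K(2,3,1,4)])
qed

lemma crep_cnet:
 assumes V: "open V" and U: "U:G_c V"
 shows "crep V U:cnets V" "cls (G V) (crep V U) = U"
proof -
 interpret net_space "G V" "{f. smooth_on V f}" by (rule net_space_G[OF V])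
 show "crep V U:cnets V" unfolding cnets_def
  using mem_elem(1)[OF G_c_elem[OF U] crep_props(1)[OF V U]] crep_props(2)[OF V U] by simp
 show "cls (G V) (crep V U) = U" by (rule mem_elem(2)[OF G_c_elem[OF U] crep_props(1)[OF V U]])
qed

text \<open>The larger set is covered by \<open>V\<close> and the complement of the two
  supports.\<close>

lemma cnets_negl:
 assumes V: "open V" "V <= X" and X: "open X" and u: "u:cnets V" "v:cnets V" and d: "(%e x. u e x - v e x) : N_M V"
 shows "(%e x. u e x - v e x) : N_M X"
proof -
 obtain K where K: "u:E_M V" "compact K" "K <= V" "!!e x. 0 < e ==> e <= 1 ==> x ~: K ==> u e x = 0" by (rule cnetsE[OF u(1)]) blast
 obtain L where L: "v:E_M V" "compact L" "L <= V" "!!e x. 0 < e ==> e <= 1 ==> x ~: L ==> v e x = 0" by (rule cnetsE[OF u(2)]) blast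
 have cl: "closed (K \<union> L)" using K(2) L(2) by (intro closed_Un compact_imp_closed)
 show ?thesis
 proof (rule N_M_local[OF X])
  show "(%e x. u e x - v e x) : E_M X"
   using cnets_mono[OF V X u(1)] cnets_mono[OF V X u(2)] by (intro E_M_diff[OF X]) (auto simp: cnets_def)
  fix x assume x: "x:X"
  show "EX W. open W & x:W & W <= X & (%e x. u e x - v e x) : N_M W"
  proof (cases "x:V")
   case False
   have "(%e x. u e x - v e x) : N_M (X - (K \<union> L))" by (rule vanishing_net_N_M[OF X cl]) (use K(4) L(4) in auto)
   then show ?thesis using x False K(3) L(3) open_Diff[OF X cl] by (intro exI[of _ "X - (K \<union> L)"]) auto
  qed (use V d in blast)
 qed
qed

lemma functional_restrict_cnet:
 assumes V: "open V" "V <= X" and X: "open X" and u: "u:cnets V"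
 shows "functional_restrict X V T (cls (G V) u) = T (cls (G X) u)"
proof -
 interpret V: net_space "G V" "{f. smooth_on V f}" by (rule net_space_G[OF V(1)])
 interpret X: net_space "G X" "{f. smooth_on X f}" by (rule net_space_G[OF X])
 let ?v = "crep V (cls (G V) u)"
 note c = cnets_G_c[OF V(1) u]
 have "?v:E_M V" using crep_cnet(1)[OF V(1) c] by (simp add: cnets_def)
 then have "(%e x. ?v e x - u e x) : N_M V" using V.cls_eqD[of ?v u] crep_cnet(2)[OF V(1) c] by simp
 then have "(%e x. ?v e x - u e x) : N_M X" by (rule cnets_negl[OF V X crep_cnet(1)[OF V(1) c] u])
 then show ?thesis unfolding functional_restrict_def gextend_def using X.cls_eqI[of ?v u] by simp
qed

lemma ball_G_c_iff:
 assumes V: "open V"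
 shows "(ALL U:G_c V. Q U) \<longleftrightarrow> (ALL u:cnets V. Q (cls (G V) u))"
 using cnets_G_c[OF V] crep_cnet[OF V] by metis

lemma gintegral_cnet:
 assumes V: "open V" "V <= X" and X: "open X" and I: "I:elems (G X)" "a:I" and u: "u:cnets V"
 shows "gintegral X (gmult (G X) I (cls (G X) u)) = abs_gnum (%e. LINT y|lborel. a e y * u e y)"
  "moderate_num (%e. LINT y|lborel. a e y * u e y)"
proof -
 obtain K where K: "u:E_M X" "compact K" "K <= X" "!!e x. 0 < e ==> e <= 1 ==> x ~: K ==> u e x = 0"
  by (rule cnetsE[OF cnets_mono[OF V X u]]) blast
 have z: "(%e x. a e x - a e x) : N_M X" using N_M_zero[OF X] by simp
 show "gintegral X (gmult (G X) I (cls (G X) u)) = abs_gnum (%e. LINT y|lborel. a e y * u e y)"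
  "moderate_num (%e. LINT y|lborel. a e y * u e y)"
  by (rule gintegral_gmult_supported[OF X I X subset_refl z K]; assumption)+
qed

lemma pairing_negligible:
 assumes V: "open V" and ab: "a:E_M V" "(%e x. a e x - b e x) : N_M V" and u: "u:cnets V"
 shows "negligible_num (%e. (LINT y|lborel. a e y * u e y) - (LINT y|lborel. b e y * u e y))"
proof -
 interpret net_space "G V" "{f. smooth_on V f}" by (rule net_space_G[OF V])
 have "(%e x. a e x - (a e x - b e x)) : E_M V" by (rule E_M_diff[OF V ab(1)]) (use ab(2) N_M_subset_E_M[OF V] in blast)
 then have b: "b:E_M V" by simp
 have e: "cls (G V) a:elems (G V)" "a:cls (G V) a" "cls (G V) b:elems (G V)" "b:cls (G V) b" "cls (G V) a = cls (G V) b"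
  using cls_elem[of a] cls_self[of a] cls_elem[of b] cls_self[of b] cls_eqI[of a b] ab b by simp_all
 show ?thesis
  by (rule abs_gnum_eqD[OF gintegral_cnet(2)[OF V subset_refl V e(1,2) u] gintegral_cnet(2)[OF V subset_refl V e(3,4) u]])
   (use gintegral_cnet(1)[OF V subset_refl V e(1,2) u] gintegral_cnet(1)[OF V subset_refl V e(3,4) u] e(5) in simp)
qed

subsection \<open>Testing nets against concentrated mollifiers\<close>

text \<open>The scale \<open>c\<close> of the mollifier is kept independent of the index
  \<open>e\<close>: later it is a power of \<open>e\<close>, \<open>e\<close> itself, or one half or
  twice the index.\<close>

lemma mollify_regular:
 fixes \<phi> :: "'n::finite fn"
 assumes \<phi>: "mollifier \<phi>" and f: "f:nets_in schwartz" and N: "bigO_eps (%e. schwartz_seminorm r (f e)) (- real N)" and r: "0 < r"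
 shows "EX C>=0. EV e. 0 < e & e < 1 & (ALL c x. 0 < c --> c <= 1 -->
  cmod ((LINT y|lborel. f e y * meps \<phi> c (x - y)) - f e x) <= C * c ^ r * e powr (- real N))"
proof -
 obtain D where D: "0 <= D" "EV e. 0 < e & e < 1 & sbound r (f e) (D * e powr (- real N))"
  using N unfolding schwartz_bigO_iff[OF f] by blast
 show ?thesis
 proof (intro exI[of _ "moll_const \<phi> r 0 * D"] conjI)
  show "0 <= moll_const \<phi> r 0 * D" using D(1) moll_const_nonneg[of \<phi> r 0] by simp
  show "EV e. 0 < e & e < 1 & (ALL c x. 0 < c --> c <= 1 -->
   cmod ((LINT y|lborel. f e y * meps \<phi> c (x - y)) - f e x) <= moll_const \<phi> r 0 * D * c ^ r * e powr (- real N))"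
  proof (rule eventually_mono[OF D(2)], intro conjI allI impI)
   fix e c :: real and x assume e: "0 < e & e < 1 & sbound r (f e) (D * e powr (- real N))" and c: "0 < c" "c <= 1"
   have fs: "f e:schwartz" using f e by (simp add: nets_in_def)
   \<comment> \<open>Reflection turns the convolution into a correlation, the form in which
     \<open>mollify_approx\<close> is stated.\<close>
   let ?g = "%y. f e (0 + (- 1) *\<^sub>R y)"
   have gs: "?g:schwartz" by (rule schwartz_isometry[OF fs]) simp
   have gb: "sbound r ?g (D * e powr (- real N))"
    using sbound_isometry[OF schwartz_smooth[OF fs], of r "D * e powr (- real N)" "-1" 0] e by simp
   have ms: "meps \<phi> c:schwartz" by (rule meps_schwartz[OF moll_schwartz[OF \<phi>] c])
   have "(LINT y|lborel. f e y * meps \<phi> c (x - y)) = (LINT y|lborel. f e (x - y) * meps \<phi> c (x - (x - y)))"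
    by (intro integral_lborel_reflect borel_measurable_times smooth_measurable schwartz_smooth fs schwartz_reflect ms)
   also have "... = correlate ?g (meps \<phi> c) (- x)" by (simp add: correlate_def)
   finally have eq: "(LINT y|lborel. f e y * meps \<phi> c (x - y)) - f e x = correlate ?g (meps \<phi> c) (- x) - ?g (- x)" by simp
   have "(1 + norm (- x)) ^ 0 * cmod (correlate ?g (meps \<phi> c) (- x) - ?g (- x)) <= moll_const \<phi> r 0 * c ^ r * (D * e powr (- real N))"
   proof (rule mollify_approx[OF \<phi> gs c r])
    show "(1 + norm y) ^ 0 * cmod (ideriv is ?g y) <= D * e powr (- real N)" if "length is = r" for "is" y
     using sbound_le[OF gb, of "is" y] that by simp
   qed
   then show "cmod ((LINT y|lborel. f e y * meps \<phi> c (x - y)) - f e x) <= moll_const \<phi> r 0 * D * c ^ r * e powr (- real N)"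
    unfolding eq by (simp add: mult_ac)
  qed auto
 qed
qed

text \<open>The centres \<open>x e\<close> may vary arbitrarily with \<open>e\<close>, since the
  bounds for the mollifier are uniform in its argument.\<close>

lemma mollifier_net_compact:
 fixes \<phi> :: "'n::finite fn" and V :: "(real^'n) set"
 assumes V: "open V" and \<psi>: "\<psi>:test V" and \<phi>: "\<phi>:schwartz"
 shows "(%e y. \<psi> y * meps \<phi> (e ^ m) (x e - y)) : cnets V"
proof -
 obtain L where L: "compact L" "L <= V" "!!x. x ~: L ==> \<psi> x = 0" by (rule testE[OF \<psi>]) blast
 have c: "0 < e ^ m" "e ^ m <= 1" if "0 < e" "e <= 1" for e :: real using that by (auto simp: power_le_one)
 have ms: "meps \<phi> (e ^ m) : schwartz" if "0 < e" "e <= 1" for e by (rule meps_schwartz[OF \<phi> c[OF that]])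
 have "(%e y. meps \<phi> (e ^ m) (x e - y)) : E_M V"
  unfolding E_M_iff[OF V]
 proof (intro conjI allI impI)
  show "(%e y. meps \<phi> (e ^ m) (x e - y)) : smooth_nets V"
   using smooth_on_subset[OF schwartz_smooth[OF schwartz_reflect[OF ms]] subset_UNIV] by (simp add: smooth_nets_def)
  fix K :: "(real^'n) set" and "is" :: "'n list"
  obtain B where B: "sbound (length is) \<phi> B" using schwartz_sbound[OF \<phi>] by blast
  have "uO K (%e. ideriv is (%y. meps \<phi> (e ^ m) (x e - y))) (- real (m * (CARD('n) + length is)))"
  proof (rule uOI[of _ _ B])
   fix e :: real and y assume e: "0 < e" "e < 1"
   have "cmod (ideriv is (%y. meps \<phi> (e ^ m) (x e - y)) y) = cmod (ideriv is (meps \<phi> (e ^ m)) (x e - y))"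
    using ideriv_affine_UNIV[OF schwartz_smooth[OF ms], of e "is" "x e" "-1" y] e by (simp add: norm_mult norm_power)
   also have "... <= inverse (e ^ m) ^ (CARD('n) + length is) * B"
    using sbound_le[OF sbound_meps[OF \<phi> B c]] e by simp
   also have "inverse (e ^ m) ^ (CARD('n) + length is) = e powr (- real (m * (CARD('n) + length is)))"
    using inverse_power_powr[OF e(1), of "m * (CARD('n) + length is)"] by (simp add: power_mult power_inverse)
   finally show "cmod (ideriv is (%y. meps \<phi> (e ^ m) (x e - y)) y) <= B * e powr (- real (m * (CARD('n) + length is)))"
    by (simp only: mult.commute)
  qed
  then show "umod K (%e. ideriv is (%y. meps \<phi> (e ^ m) (x e - y)))" by (rule umodI)
 qed
 then have "(%e y. \<psi> y * meps \<phi> (e ^ m) (x e - y)) : E_M V" by (rule cutoff_net_E_M[OF V \<psi>])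
 then show ?thesis by (rule cnetsI[OF _ L(1,2)]) (simp add: L(3))
qed

text \<open>Evaluating along maximum points reduces uniform estimates to selections of points.\<close>

lemma unegl_selection:
 fixes W :: "'n::finite net"
 assumes W: "W:smooth_nets V" and K: "compact K" "K <= V"
  and n: "!!x. (!!e. x e:K) ==> negligible_num (%e. W e (x e))"
 shows "unegl K W"
proof (cases "K = {}")
 case True
 then show ?thesis by (intro uneglI uOI[of _ _ 0]) simp
next
 case False
 have "ALL e. EX x. x:K & (0 < e & e < 1 --> (ALL y:K. cmod (W e y) <= cmod (W e x)))"
 proof
  fix e
  show "EX x. x:K & (0 < e & e < 1 --> (ALL y:K. cmod (W e y) <= cmod (W e x)))"
  proof (cases "0 < e & e < 1")
   case True
   then have "continuous_on K (%x. cmod (W e x))"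
    using smooth_netsD[OF W, of e] smooth_on_cont K(2) by (intro continuous_on_norm) (auto intro: continuous_on_subset)
   from continuous_attains_sup[OF K(1) False this] show ?thesis by blast
  next
   case False
   then show ?thesis using \<open>K ~= {}\<close> by blast
  qed
 qed
 then obtain x where x: "ALL e. x e:K & (0 < e & e < 1 --> (ALL y:K. cmod (W e y) <= cmod (W e (x e))))" by (rule choice[THEN exE])
 have u: "unegl (UNIV :: unit set) (%e _. W e (x e))" using n[of x] x unfolding negl_num_iff by simp
 show ?thesis
  by (rule uneglI, rule uO_dominated[OF unegl_uO[OF u], of 1]) (use x in auto)
qed

text \<open>Pairing with a mollifier of sufficiently fine scale reproduces the value of
  \<open>W\<close> at a selected point, up to any power of \<open>e\<close>.\<close>

lemma pairing_determines:
 fixes \<phi> :: "'n::finite fn" and V :: "(real^'n) set"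
 assumes \<phi>: "mollifier \<phi>" and V: "open V" and W: "W:E_M V"
  and n: "!!u. u:cnets V ==> negligible_num (%e. LINT y|lborel. W e y * u e y)"
 shows "W:N_M V"
proof (rule N_M_zeroth_order[OF V W])
 fix K assume K: "compact K" "K <= V"
 note Ws = E_M_smooth[OF V W]
 obtain \<psi> Z where \<psi>: "\<psi>:test V" "open Z" "K <= Z" "!!x. x:Z ==> \<psi> x = 1" by (rule cutoff_exists[OF V K]) blast
 obtain L where L: "compact L" "L <= V" "!!x. x ~: L ==> \<psi> x = 0" by (rule testE[OF \<psi>(1)]) blast
 obtain N :: nat where N: "ALL is. length is <= 1 --> uO L (%e. ideriv is (W e)) (- real N)"
  using umod_all_lists[of 1 L "%is e. ideriv is (W e)"] E_M_umod[OF V W L(1,2)] by blast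
 have b: "bigO_eps (%e. schwartz_seminorm 1 (%x. \<psi> x * W e x)) (- real N)"
  by (rule cutoff_net_bigO[OF V Ws \<psi>(1) L]) (use N in auto)
 obtain C where C: "0 <= C" "EV e. 0 < e & e < 1 & (ALL c x. 0 < c --> c <= 1 -->
  cmod ((LINT y|lborel. \<psi> y * W e y * meps \<phi> c (x - y)) - \<psi> x * W e x) <= C * c ^ 1 * e powr (- real N))"
  using mollify_regular[OF \<phi> cutoff_net_schwartz[OF V Ws \<psi>(1)] b] by auto
 show "unegl K W"
 proof (rule unegl_selection[OF Ws K])
  fix x :: "real => real^'n" assume x: "!!e. x e:K"
  show "negligible_num (%e. W e (x e))" unfolding negl_num_iff
  proof (rule uneglI)
   fix q :: nat
   \<comment> \<open>At order one the error at scale \<open>c\<close> is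
     \<open>c * e powr (- N)\<close>; the scale \<open>e ^ (q + N)\<close> makes it
     \<open>e powr q\<close>.\<close>
   let ?I = "%e. LINT y|lborel. W e y * (\<psi> y * meps \<phi> (e ^ (q + N)) (x e - y))"
   have 1: "uO (UNIV :: unit set) (%e _. ?I e) (real q)"
    using n[OF mollifier_net_compact[OF V \<psi>(1) moll_schwartz[OF \<phi>], of "q + N" x]] unegl_uO unfolding negl_num_iff by blast
   have 2: "uO (UNIV :: unit set) (%e _. ?I e - W e (x e)) (real q)"
   proof (rule uO_eventuallyI[of _ _ C], rule eventually_mono[OF C(2)], intro ballI)
    fix e assume e: "0 < e & e < 1 & (ALL c x. 0 < c --> c <= 1 -->
     cmod ((LINT y|lborel. \<psi> y * W e y * meps \<phi> c (x - y)) - \<psi> x * W e x) <= C * c ^ 1 * e powr (- real N))"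
    have "0 < e ^ (q + N)" "e ^ (q + N) <= 1" using e by (auto simp: power_le_one)
    then have "cmod ((LINT y|lborel. \<psi> y * W e y * meps \<phi> (e ^ (q + N)) (x e - y)) - \<psi> (x e) * W e (x e)) <= C * (e ^ (q + N)) ^ 1 * e powr (- real N)"
     using e by blast
    also have "... = C * (e powr real (q + N) * e powr (- real N))" using e powr_realpow[of e "q + N"] by simp
    also have "e powr real (q + N) * e powr (- real N) = e powr real q" unfolding powr_add[symmetric] by simp
    finally show "cmod (?I e - W e (x e)) <= C * e powr real q"
     using \<psi>(4) \<psi>(3) x[of e] by (auto simp: mult_ac)
   qed
   show "uO (UNIV :: unit set) (%e _. W e (x e)) (real q)" using uO_diff[OF 1 2] by simp
  qed
 qed
qed

text \<open>On the test nets \<open>w\<close> gives exactly the regularised net at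
  \<open>x e\<close>, which ties the scale of the mollifier to \<open>e\<close>. At this scale the
  pairing with \<open>b\<close> reproduces \<open>b\<close> because \<open>b\<close> is regular, so
  that the order of approximation can exceed its growth exponent.\<close>

lemma dual_determines_iota:
 fixes \<phi> :: "'n::finite fn"
 assumes \<phi>: "mollifier \<phi>" and V: "open V" "V <= X" and X: "open X" and w: "w:distributions X" and b: "b:E_M_inf V"
  and n: "!!u. u:cnets V ==> negligible_num (%e. w (u e) - (LINT y|lborel. b e y * u e y))"
  and \<psi>: "\<psi>:test V" and Z: "open Z" "Z <= V" "!!x. x:Z ==> \<psi> x = 1"
 shows "(%e x. conv_net \<phi> (cutoff_dist \<psi> w) e x - b e x) : N_M Z" (is "?W:_")
proof (rule N_M_zeroth_order[OF Z(1)])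
 have bE: "b:E_M V" using b E_M_inf_subset_E_M[OF V(1)] by blast
 have wt: "cutoff_dist \<psi> w:tempered" by (rule cutoff_tempered[OF X w test_mono[OF \<psi> V(2)]])
 show WE: "?W:E_M Z"
  by (intro E_M_diff[OF Z(1)] conv_net_E_M[OF wt moll_schwartz[OF \<phi>] Z(1)] net_restrict(1)[OF V(1) Z(1,2) bE])
 have bS: "(%e x. \<psi> x * b e x) : E_S_inf" by (rule cutoff_net_E_S_inf[OF V(1) b \<psi>])
 have bn: "(%e x. \<psi> x * b e x) : nets_in schwartz" using bS by (simp add: E_S_inf_def)
 obtain N :: nat where N: "ALL j. bigO_eps (%e. schwartz_seminorm j (%x. \<psi> x * b e x)) (- real N)" using bS unfolding E_S_inf_def by blast
 fix K assume K: "compact K" "K <= Z"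
 show "unegl K ?W"
 proof (rule unegl_selection[OF E_M_smooth[OF Z(1) WE] K])
  fix x :: "real => real^'n" assume x: "!!e. x e:K"
  show "negligible_num (%e. ?W e (x e))" unfolding negl_num_iff
  proof (rule uneglI)
   fix q :: nat
   let ?u = "%e y. \<psi> y * meps \<phi> e (x e - y)"
   let ?I = "%e. LINT y|lborel. b e y * ?u e y"
   have "negligible_num (%e. w (?u e) - ?I e)"
    using n[OF mollifier_net_compact[OF V(1) \<psi> moll_schwartz[OF \<phi>], of 1 x]] by simp
   then have 1: "uO (UNIV :: unit set) (%e _. w (?u e) - ?I e) (real q)" using unegl_uO unfolding negl_num_iff by blast
   define r where "r = q + N + 1"
   obtain C where C: "0 <= C" "EV e. 0 < e & e < 1 & (ALL c x. 0 < c --> c <= 1 -->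
    cmod ((LINT y|lborel. \<psi> y * b e y * meps \<phi> c (x - y)) - \<psi> x * b e x) <= C * c ^ r * e powr (- real N))"
    using mollify_regular[OF \<phi> bn N[rule_format, of r]] by (auto simp: r_def)
   have 2: "uO (UNIV :: unit set) (%e _. ?I e - b e (x e)) (real q)"
   proof (rule uO_eventuallyI[of _ _ C], rule eventually_mono[OF C(2)], intro ballI)
    fix e assume e: "0 < e & e < 1 & (ALL c x. 0 < c --> c <= 1 -->
     cmod ((LINT y|lborel. \<psi> y * b e y * meps \<phi> c (x - y)) - \<psi> x * b e x) <= C * c ^ r * e powr (- real N))"
    then have "cmod ((LINT y|lborel. \<psi> y * b e y * meps \<phi> e (x e - y)) - \<psi> (x e) * b e (x e)) <= C * e ^ r * e powr (- real N)"
     by auto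
    also have "... = C * (e powr real r * e powr (- real N))" using e by (simp add: powr_realpow)
    also have "... <= C * e powr real q" unfolding powr_add[symmetric] using e C(1) by (intro mult_left_mono powr_mono') (auto simp: r_def)
    finally show "cmod (?I e - b e (x e)) <= C * e powr real q"
     using Z(3) K(2) x[of e] by (auto simp: mult_ac)
   qed
   show "uO (UNIV :: unit set) (%e _. ?W e (x e)) (real q)"
    using uO_add[OF 1 2] by (simp add: dist_conv_def cutoff_dist_def)
  qed
 qed
qed

subsection \<open>Regular nets come from smooth functions\<close>

text \<open>Where \<rho> differs from 1, the kernel is evaluated at distance more than \<delta> from
  the origin. As \<open>c\<close> is at most \<open>2 * e\<close>, its decay outweighs the growth of
  the net both in \<open>1 / e\<close> and at infinity.\<close>

lemma conv_tail:
 fixes \<phi> :: "'n::finite fn"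
 assumes w: "w:tempered" and \<phi>: "\<phi>:schwartz" and K: "compact K" and \<rho>: "\<rho>:test X"
  and \<delta>: "0 < \<delta>" "!!x y. x:K ==> dist x y <= \<delta> ==> \<rho> y = 1"
 shows "EX C>=0. ALL e c x. 0 < e --> e <= 1 --> 0 < c --> c <= 1 --> c <= 2 * e --> x:K -->
  cmod (LINT y|lborel. (1 - \<rho> y) * conv_net \<phi> w e y * meps \<phi> c (x - y)) <= C * e powr real q"
proof -
 let ?I = "LINT x|lborel. 1 / (1 + norm (x :: real^'n)) ^ (2 * CARD('n))"
 have I: "0 <= ?I" by (intro integral_nonneg_AE) simp
 obtain C1 M j where C1: "0 <= C1" "!!e x. 0 < e ==> e <= 1 ==> cmod (conv_net \<phi> w e x) <= C1 * e powr (- real M) * (1 + norm x) ^ j"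
  using conv_net_bound[OF w \<phi>, of "[]", unfolded ideriv_Nil] by blast
 obtain B0 where B0: "sbound 0 \<rho> B0" using schwartz_sbound[OF test_schwartz[OF \<rho>]] by blast
 have R: "cmod (1 - \<rho> y) <= 1 + B0" for y
  using norm_triangle_ineq4[of 1 "\<rho> y"] sbound_le[OF B0, of "[]" y] by simp
 have B00: "0 <= B0" by (rule sbound_nonneg[OF B0])
 obtain R0 where "!!x. x:K ==> norm x <= R0" using compact_imp_bounded[OF K] by (auto simp: bounded_iff)
 then have RK: "!!x. x:K ==> norm x <= \<bar>R0\<bar>" by force
 define s where "s = j + 2 * CARD('n)"
 \<comment> \<open>Of this decay, \<open>s\<close> pays for the growth in \<open>y\<close> and for
   integrability, \<open>CARD('n)\<close> for the normalisation and \<open>M\<close> for the growth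
   in \<open>e\<close>; \<open>q\<close> remains.\<close>
 define p where "p = s + q + CARD('n) + M"
 obtain B where B: "sbound p \<phi> B" using schwartz_sbound[OF \<phi>] by blast
 have Bn: "0 <= B" by (rule sbound_nonneg[OF B])
 \<comment> \<open>Arises from \<open>1 + z <= ((1 + \<delta>) / \<delta>) * z\<close> for
   \<open>z >= \<delta>\<close>, and from the weight of the points of \<open>K\<close> when the
   weight is moved from \<open>y\<close> to \<open>x - y\<close>.\<close>
 define Q where "Q = (1 + \<bar>R0\<bar>) ^ s * ((1 + \<delta>) / \<delta>) ^ p"
 have Q: "0 <= Q" using \<delta>(1) by (simp add: Q_def)
 define D where "D = (1 + B0) * C1 * B * Q * 2 ^ (s + q + M)"
 have D: "0 <= D" using B00 C1(1) Bn Q by (simp add: D_def)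
 show ?thesis
 proof (intro exI[of _ "?I * D"] conjI allI impI)
  show "0 <= ?I * D" using I D by simp
  fix e c :: real and x :: "real^'n" assume e: "0 < e" "e <= 1" and c: "0 < c" "c <= 1" "c <= 2 * e" and x: "x:K"
  have "cmod (LINT y|lborel. (1 - \<rho> y) * conv_net \<phi> w e y * meps \<phi> c (x - y)) <= ?I * (D * e powr real q)"
  proof (rule integral_weight_bound)
   fix y
   show "cmod ((1 - \<rho> y) * conv_net \<phi> w e y * meps \<phi> c (x - y)) * (1 + norm y) ^ (2 * CARD('n)) <= D * e powr real q"
   proof (cases "dist x y <= \<delta>")
    case True
    then show ?thesis using \<delta>(2)[OF x True] D by simp
   next
    case False
    let ?z = "norm (x - y)"
    have z: "\<delta> <= ?z" "0 < ?z" using False \<delta>(1) by (auto simp: dist_norm)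
    let ?c = "c powr real (s + q + M)"
    \<comment> \<open>The tail estimate is used with the actual distance instead of \<delta>, which
      keeps the decay in \<open>y\<close>.\<close>
    have m: "cmod (meps \<phi> c (x - y)) <= B / ?z ^ p * ?c"
     using mollifier_tail[OF \<phi> B, of "[]" c ?z "x - y"] c z by (simp add: p_def add.assoc)
    have "(1 + norm y) ^ s <= (1 + norm x) ^ s * (1 + ?z) ^ s"
     using one_plus_norm_mult[of y s "x - y"] by simp
    also have "... <= (1 + \<bar>R0\<bar>) ^ s * (((1 + \<delta>) / \<delta>) * ?z) ^ p"
    proof (intro mult_mono power_mono)
     have "1 + ?z <= ((1 + \<delta>) / \<delta>) * ?z" using z \<delta>(1) by (simp add: field_simps)
     then have "(1 + ?z) ^ p <= (((1 + \<delta>) / \<delta>) * ?z) ^ p" by (intro power_mono) auto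
     moreover have "(1 + ?z) ^ s <= (1 + ?z) ^ p" by (intro power_increasing) (auto simp: p_def)
     ultimately show "(1 + ?z) ^ s <= (((1 + \<delta>) / \<delta>) * ?z) ^ p" by linarith
    qed (use RK[OF x] \<delta>(1) in auto)
    also have "... = Q * ?z ^ p" by (simp add: Q_def power_mult_distrib power_divide)
    finally have y: "(1 + norm y) ^ s / ?z ^ p <= Q" using z by (simp add: pos_divide_le_eq)
    have "?c <= (2 * e) powr real (s + q + M)" using c by (intro powr_mono2) auto
    also have "... = 2 ^ (s + q + M) * e powr real (s + q + M)" using e powr_realpow[of 2 "s + q + M"] by (simp only: powr_mult)
    also have "... <= 2 ^ (s + q + M) * e powr real (q + M)" using e by (intro mult_left_mono powr_mono') auto
    finally have cb: "?c <= 2 ^ (s + q + M) * e powr real (q + M)" .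
    have "cmod ((1 - \<rho> y) * conv_net \<phi> w e y * meps \<phi> c (x - y)) * (1 + norm y) ^ (2 * CARD('n))
     = cmod (1 - \<rho> y) * cmod (conv_net \<phi> w e y) * cmod (meps \<phi> c (x - y)) * (1 + norm y) ^ (2 * CARD('n))" by (simp add: norm_mult)
    also have "... <= (1 + B0) * (C1 * e powr (- real M) * (1 + norm y) ^ j) * (B / ?z ^ p * ?c) * (1 + norm y) ^ (2 * CARD('n))"
     using R[of y] C1(2)[OF e, of y] m B00 C1(1) by (intro mult_right_mono mult_mono mult_nonneg_nonneg) auto
    also have "... = ((1 + B0) * C1 * B) * e powr (- real M) * ((1 + norm y) ^ s / ?z ^ p) * ?c" by (simp add: s_def power_add mult_ac)
    also have "... <= ((1 + B0) * C1 * B) * e powr (- real M) * Q * (2 ^ (s + q + M) * e powr real (q + M))"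
     using y cb B00 C1(1) Bn Q by (intro mult_mono mult_left_mono mult_nonneg_nonneg) auto
    also have "... = D * (e powr (- real M) * e powr real (q + M))" by (simp only: D_def mult_ac)
    also have "e powr (- real M) * e powr real (q + M) = e powr real q" unfolding powr_add[symmetric] by simp
    finally show ?thesis .
   qed
  qed
  then show "cmod (LINT y|lborel. (1 - \<rho> y) * conv_net \<phi> w e y * meps \<phi> c (x - y)) <= ?I * D * e powr real q" by (simp only: mult.assoc)
 qed
qed

text \<open>The part near \<open>K\<close> is a regular net of Schwartz functions, where
  mollification is accurate to any order; the rest is \<open>conv_tail\<close>. The range
  \<open>c <= 2 * e\<close> includes scale \<open>e / 2\<close> at index \<open>e\<close> and scale
  \<open>e\<close> at index \<open>e / 2\<close>.\<close>

lemma conv_mollify: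
 fixes \<phi> :: "'n::finite fn" and V :: "(real^'n) set"
 assumes \<phi>: "mollifier \<phi>" and w: "w:tempered" and V: "open V" and reg: "conv_net \<phi> w:E_M_inf V" and K: "compact K" "K <= V"
 shows "EX C>=0. EV e. 0 < e & e < 1 & (ALL c x. 0 < c --> c <= 1 --> c <= 2 * e --> x:K -->
  cmod ((LINT y|lborel. conv_net \<phi> w e y * meps \<phi> c (x - y)) - conv_net \<phi> w e x) <= C * e powr real q)"
proof -
 note \<phi>s = moll_schwartz[OF \<phi>]
 obtain \<delta> where \<delta>: "0 < \<delta>" "compact (\<Union>x\<in>K. cball x \<delta>)" "(\<Union>x\<in>K. cball x \<delta>) <= V" using K(1) V K(2) by (rule compact_thicken)
 obtain \<rho> Z where \<rho>: "\<rho>:test V" "open Z" "(\<Union>x\<in>K. cball x \<delta>) <= Z" "!!x. x:Z ==> \<rho> x = 1"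
  by (rule cutoff_exists[OF V \<delta>(2,3)]) blast
 have \<rho>1: "\<rho> y = 1" if "x:K" "dist x y <= \<delta>" for x y by (rule \<rho>(4), rule subsetD[OF \<rho>(3)]) (use that in auto)
 have uS: "(%e x. \<rho> x * conv_net \<phi> w e x) : E_S_inf" by (rule cutoff_net_E_S_inf[OF V reg \<rho>(1)])
 then have un: "(%e x. \<rho> x * conv_net \<phi> w e x) : nets_in schwartz" by (simp add: E_S_inf_def)
 obtain N :: nat where N: "ALL j. bigO_eps (%e. schwartz_seminorm j (%x. \<rho> x * conv_net \<phi> w e x)) (- real N)" using uS unfolding E_S_inf_def by blast
 define r where "r = q + N + 1"
 have r0: "0 < r" by (simp add: r_def)
 obtain C1 where C1: "0 <= C1" "EV e. 0 < e & e < 1 & (ALL c x. 0 < c --> c <= 1 -->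
  cmod ((LINT y|lborel. \<rho> y * conv_net \<phi> w e y * meps \<phi> c (x - y)) - \<rho> x * conv_net \<phi> w e x) <= C1 * c ^ r * e powr (- real N))"
  using mollify_regular[OF \<phi> un N[rule_format] r0] by (elim exE conjE)
 have "EX C>=0. ALL e c x. 0 < e --> e <= 1 --> 0 < c --> c <= 1 --> c <= 2 * e --> x:K -->
  cmod (LINT y|lborel. (1 - \<rho> y) * conv_net \<phi> w e y * meps \<phi> c (x - y)) <= C * e powr real q"
  by (rule conv_tail[OF w \<phi>s K(1) \<rho>(1) \<delta>(1) \<rho>1])
 then obtain C2 where C2: "0 <= C2" "ALL e c x. 0 < e --> e <= 1 --> 0 < c --> c <= 1 --> c <= 2 * e --> x:K -->
  cmod (LINT y|lborel. (1 - \<rho> y) * conv_net \<phi> w e y * meps \<phi> c (x - y)) <= C2 * e powr real q"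
  by (elim exE conjE)
 show ?thesis
 proof (intro exI[of _ "C1 * 2 ^ r + C2"] conjI)
  show "0 <= C1 * 2 ^ r + C2" using C1(1) C2(1) by simp
  show "EV e. 0 < e & e < 1 & (ALL c x. 0 < c --> c <= 1 --> c <= 2 * e --> x:K -->
   cmod ((LINT y|lborel. conv_net \<phi> w e y * meps \<phi> c (x - y)) - conv_net \<phi> w e x) <= (C1 * 2 ^ r + C2) * e powr real q)"
  proof (rule eventually_mono[OF C1(2)], intro conjI allI impI)
   fix e c :: real and x assume e: "0 < e & e < 1 & (ALL c x. 0 < c --> c <= 1 -->
    cmod ((LINT y|lborel. \<rho> y * conv_net \<phi> w e y * meps \<phi> c (x - y)) - \<rho> x * conv_net \<phi> w e x) <= C1 * c ^ r * e powr (- real N))"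
    and c: "0 < c" "c <= 1" "c <= 2 * e" and x: "x:K"
   let ?f = "%y. conv_net \<phi> w e y * meps \<phi> c (x - y)"
   let ?g = "%y. \<rho> y * conv_net \<phi> w e y * meps \<phi> c (x - y)"
   have e': "0 < e" "e <= 1" using e by auto
   have rp: "rapid (%y. meps \<phi> c (x - y))" by (intro schwartz_rapid schwartz_reflect meps_schwartz \<phi>s c)
   have i1: "integrable lborel ?f" by (rule dist_conv_integrable[OF w meps_schwartz[OF \<phi>s e'] rp])
   have gs: "(%y. \<rho> y * conv_net \<phi> w e y) : schwartz" using un e' by (simp add: nets_in_def)
   obtain B where B: "sbound 0 (%y. \<rho> y * conv_net \<phi> w e y) B" using schwartz_sbound[OF gs] by blast
   have i2: "integrable lborel ?g"
    by (rule rapid_mult_integrable[OF rp smooth_measurable[OF schwartz_smooth[OF gs]], of B 0]) (use sbound_le[OF B, of "[]"] in simp)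
   have "(LINT y|lborel. ?f y) - (LINT y|lborel. ?g y) = (LINT y|lborel. (1 - \<rho> y) * conv_net \<phi> w e y * meps \<phi> c (x - y))"
    unfolding Bochner_Integration.integral_diff[OF i1 i2, symmetric] by (simp add: algebra_simps)
   then have 2: "cmod ((LINT y|lborel. ?f y) - (LINT y|lborel. ?g y)) <= C2 * e powr real q" using C2(2)[rule_format, OF e' c x] by simp
   have "cmod ((LINT y|lborel. ?g y) - conv_net \<phi> w e x) <= C1 * c ^ r * e powr (- real N)"
    using e[THEN conjunct2, THEN conjunct2, rule_format, OF c(1,2), of x] \<rho>1[OF x, of x] \<delta>(1) by simp
   also have "... <= C1 * (2 * e) ^ r * e powr (- real N)" using C1(1) c by (intro mult_right_mono mult_left_mono power_mono) auto
   also have "... = C1 * 2 ^ r * (e powr real r * e powr (- real N))" using e' by (simp add: powr_realpow power_mult_distrib)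
   also have "... <= C1 * 2 ^ r * e powr real q" unfolding powr_add[symmetric] using e' C1(1) by (intro mult_left_mono powr_mono') (auto simp: r_def)
   finally have 1: "cmod ((LINT y|lborel. ?g y) - conv_net \<phi> w e x) <= C1 * 2 ^ r * e powr real q" .
   show "cmod ((LINT y|lborel. ?f y) - conv_net \<phi> w e x) <= (C1 * 2 ^ r + C2) * e powr real q"
    using norm_triangle_ineq[of "(LINT y|lborel. ?f y) - (LINT y|lborel. ?g y)" "(LINT y|lborel. ?g y) - conv_net \<phi> w e x"] 1 2
    by (simp add: distrib_right)
  qed auto
 qed
qed

lemma eventually_half: "EV e. P e ==> EV e. P (e / 2)"
 unfolding eventually_at_right_field by (elim exE conjE, rule_tac x = "b" in exI) auto

lemma uO_half:
 assumes "uO K F b" shows "uO K (%e. F (e / 2)) b"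
proof -
 obtain C where C: "EV e. 0 < e & e < 1 & (ALL x:K. cmod (F e x) <= C * e powr b)" by (rule uOE[OF assms]) blast
 show ?thesis
  by (rule uO_eventuallyI[of _ _ "C * (1 / 2) powr b"], rule eventually_mono[OF eventually_half[OF C]])
   (auto simp: powr_divide powr_mult)
qed

text \<open>
 Both sides of \<open>u\<^sub>e * \<phi>\<^sub>\<eta> = u\<^sub>\<eta> * \<phi>\<^sub>e\<close> with \<open>\<eta> = e / 2\<close> differ negligibly from \<open>u\<^sub>e\<close> and \<open>u\<^sub>\<eta>\<close>, since all
 derivatives of \<open>u\<close> grow at the same rate.
\<close>

lemma regular_half:
 fixes \<phi> :: "'n::finite fn" and V :: "(real^'n) set"
 assumes \<phi>: "mollifier \<phi>" and w: "w:tempered" and V: "open V" and reg: "conv_net \<phi> w:E_M_inf V"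
 shows "(%e x. conv_net \<phi> w e x - conv_net \<phi> w (e / 2) x) : N_M V"
proof (rule N_M_zeroth_order[OF V])
 let ?u = "conv_net \<phi> w"
 note \<phi>s = moll_schwartz[OF \<phi>]
 have uE: "?u:E_M V" by (rule conv_net_E_M[OF w \<phi>s V])
 have "(%e. ?u (e / 2)) : E_M V" unfolding E_M_iff[OF V]
 proof (intro conjI allI impI)
  show "(%e. ?u (e / 2)) : smooth_nets V" using conv_net_smooth[OF w \<phi>s] by (simp add: smooth_nets_def)
  fix K "is" assume "compact K & K <= V"
  then obtain N :: nat where "uO K (%e. ideriv is (?u e)) (- real N)" using E_M_umod[OF V uE] unfolding umod_def by blast
  from umodI[OF uO_half[OF this]] show "umod K (%e. ideriv is (?u (e / 2)))" .
 qed
 then show "(%e x. ?u e x - ?u (e / 2) x) : E_M V" by (rule E_M_diff[OF V uE])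
 fix K assume K: "compact K" "K <= V"
 show "unegl K (%e x. ?u e x - ?u (e / 2) x)"
 proof (rule uneglI)
  fix q :: nat
  obtain C where C: "0 <= C" "EV e. 0 < e & e < 1 & (ALL c x. 0 < c --> c <= 1 --> c <= 2 * e --> x:K -->
   cmod ((LINT y|lborel. ?u e y * meps \<phi> c (x - y)) - ?u e x) <= C * e powr real q)" (is "eventually ?P _")
   using conv_mollify[OF \<phi> w V reg K, of q] by blast
  show "uO K (%e x. ?u e x - ?u (e / 2) x) (real q)"
  proof (rule uO_eventuallyI[of _ _ "C + C"], rule eventually_mono[OF eventually_conj[OF C(2) eventually_half[OF C(2)]]], intro ballI)
   fix e x assume e: "?P e & ?P (e / 2)" and x: "x:K"
   note P = conjunct1[OF e] conjunct2[OF e]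
   have e0: "0 < e" "e < 1" using P(1) by (simp_all only:)
   let ?J = "LINT y|lborel. ?u e y * meps \<phi> (e / 2) (x - y)"
   have "?J = (LINT y|lborel. ?u (e / 2) y * meps \<phi> e (x - y))"
    by (rule dist_conv_symmetric[OF w]) (use e0 in \<open>auto intro!: meps_schwartz \<phi>s\<close>)
   then have 2: "cmod (?J - ?u (e / 2) x) <= C * (e / 2) powr real q"
    using P(2)[THEN conjunct2, THEN conjunct2, rule_format, of e x] e0 x by simp
   have 1: "cmod (?J - ?u e x) <= C * e powr real q"
    using P(1)[THEN conjunct2, THEN conjunct2, rule_format, of "e / 2" x] e0 x by simp
   have "(e / 2) powr real q <= e powr real q" using e0 by (intro powr_mono2) auto
   then have "C * (e / 2) powr real q <= C * e powr real q" using C(1) by (rule mult_left_mono)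
   then have "cmod ((?J - ?u (e / 2) x) - (?J - ?u e x)) <= (C + C) * e powr real q"
    using norm_triangle_ineq4[of "?J - ?u (e / 2) x" "?J - ?u e x"] 1 2 by (simp add: distrib_right)
   then show "cmod (?u e x - ?u (e / 2) x) <= (C + C) * e powr real q" by simp
  qed
 qed
qed

text \<open>Along a coordinate line, uniform convergence of the derivatives makes
  \<open>H (i # is)\<close> the derivative of \<open>H is\<close>. All \<open>H is\<close> are
  continuous as uniform limits, so differentiability follows by induction on the order.\<close>

lemma smooth_limit:
 fixes F :: "nat => 'n::finite fn"
 assumes S: "open S" and F: "!!m. smooth_on S (F m)" and lim: "!!is. uniform_limit S (%m. ideriv is (F m)) (H is) sequentially"
 shows "smooth_on S (H [])"
proof -
 have pt: "(%m. ideriv is (F m) x) \<longlonglongrightarrow> H is x" if "x:S" for "is" x using tendsto_uniform_limitI[OF lim that] .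
 have part: "has_partial i (H is) (H (i # is) x) x" if x: "x:S" for i "is" x
 proof -
  obtain r where r: "0 < r" "ball x r <= S" using S x open_contains_ball by blast
  let ?l = "%t::real. x + t *\<^sub>R axis i 1"
  have l: "?l t:S" if "t : {-r<..<r}" for t
   using that by (intro subsetD[OF r(2)]) (auto simp: dist_norm norm_axis_1)
  have "EX g. ALL t:{-r<..<r}. (%m. ideriv is (F m) (?l t)) \<longlonglongrightarrow> g t & (g has_derivative (%s. s *\<^sub>R H (i # is) (?l t))) (at t within {-r<..<r})"
  proof (rule has_derivative_sequence)
   show "((%t. ideriv is (F m) (?l t)) has_derivative (%s. s *\<^sub>R ideriv (i # is) (F m) (?l t))) (at t within {-r<..<r})" if "t : {-r<..<r}" for m t
    using ideriv_has_partial[OF F l[OF that], of i "is" m] unfolding has_partial_shift[symmetric] has_vector_derivative_def by (rule has_derivative_at_withinI)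
   show "\<forall>\<^sub>F m in sequentially. ALL t:{-r<..<r}. ALL s. norm (s *\<^sub>R ideriv (i # is) (F m) (?l t) - s *\<^sub>R H (i # is) (?l t)) <= e * norm s" if "e > 0" for e
    using uniform_limitD[OF lim[of "i # is"] that]
   proof (rule eventually_mono, intro ballI allI)
    fix m t and s :: real assume a: "ALL x:S. dist (ideriv (i # is) (F m) x) (H (i # is) x) < e" and t: "t : {-r<..<r}"
    have "norm (ideriv (i # is) (F m) (?l t) - H (i # is) (?l t)) <= e" using a l[OF t] by (auto simp: dist_norm intro: less_imp_le)
    then show "norm (s *\<^sub>R ideriv (i # is) (F m) (?l t) - s *\<^sub>R H (i # is) (?l t)) <= e * norm s"
     unfolding scaleR_diff_right[symmetric] norm_scaleR by (simp add: mult.commute[of e] mult_left_mono)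
   qed
   show "(%m. ideriv is (F m) (?l 0)) \<longlonglongrightarrow> H is x" using pt[OF x] by simp
  qed (use r(1) in auto)
  then obtain g where g: "!!t. t : {-r<..<r} ==> (%m. ideriv is (F m) (?l t)) \<longlonglongrightarrow> g t"
   "!!t. t : {-r<..<r} ==> (g has_derivative (%s. s *\<^sub>R H (i # is) (?l t))) (at t within {-r<..<r})" by blast
  have 0: "0 : {-r<..<r}" using r(1) by simp
  have "(g has_derivative (%s. s *\<^sub>R H (i # is) x)) (at 0)"
   using g(2)[OF 0] 0 by (simp add: at_within_open[OF 0])
  then have "((%t. H is (?l t)) has_derivative (%s. s *\<^sub>R H (i # is) x)) (at 0)"
   by (rule has_derivative_transform_within_open[OF _ open_greaterThanLessThan 0]) (use LIMSEQ_unique[OF g(1) pt[OF l]] in auto)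
  then show ?thesis by (simp add: has_partial_def has_vector_derivative_def)
 qed
 have cont: "continuous_on S (H is)" for "is"
  by (rule uniform_limit_theorem[OF _ lim]) (use smooth_on_cont[OF smooth_on_ideriv[OF F]] in auto)
 have "Ck_on k S (H is)" for k "is"
 proof (induction k arbitrary: "is")
  case 0
  show ?case using cont by simp
 next
  case (Suc k)
  show ?case by (rule Ck_on_SucI[OF S cont part Suc])
 qed
 then show ?thesis by (simp add: smooth_on_def)
qed

lemma half_power_at_right: "filterlim (%m. (1 / 2 :: real) ^ m) (at_right 0) sequentially"
 by (intro tendsto_imp_filterlim_at_right LIMSEQ_power_zero) auto

lemma regular_imp_smooth:
 fixes \<phi> :: "'n::finite fn" and S V :: "(real^'n) set"
 assumes \<phi>: "mollifier \<phi>" and w: "w:tempered" and V: "open V" and reg: "conv_net \<phi> w:E_M_inf V"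
  and S: "open S" "compact (closure S)" "closure S <= V"
 shows "EX g. smooth_on S g & (ALL f:test S. w f = (LINT y:S|lborel. g y * f y))"
proof -
 note \<phi>s = moll_schwartz[OF \<phi>]
 define F where "F m = conv_net \<phi> w ((1 / 2) ^ m)" for m
 have e01: "0 < (1 / 2 :: real) ^ m" "(1 / 2 :: real) ^ m <= 1" for m by (auto simp: power_le_one)
 have Fs: "smooth_on T (F m)" for T m unfolding F_def by (rule conv_net_smooth[OF w \<phi>s e01])
 define h where "h is m x = ideriv is (F (Suc m)) x - ideriv is (F m) x" for "is" m x
 \<comment> \<open>The limit as a telescoping series: an increment of order 1 in \<open>e\<close> is
   at most a constant times \<open>(1 / 2) ^ m\<close> at \<open>e = (1 / 2) ^ m\<close>, which the
   Weierstrass test sums.\<close>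
 define H where "H is x = (\<Sum>m. h is m x) + ideriv is (F 0) x" for "is" x
 have lim: "uniform_limit S (%m. ideriv is (F m)) (H is) sequentially" for "is"
 proof -
  have "unegl (closure S) (%e. ideriv is (%x. conv_net \<phi> w e x - conv_net \<phi> w (e / 2) x))"
   by (rule N_M_unegl[OF V regular_half[OF \<phi> w V reg] S(2,3)])
  then obtain C where C: "EV e. 0 < e & e < 1 &
   (ALL x:closure S. cmod (ideriv is (%x. conv_net \<phi> w e x - conv_net \<phi> w (e / 2) x) x) <= C * e powr 1)" by (rule uOE[OF unegl_uO[where b = 1]]) blast
  have "\<forall>\<^sub>F m in sequentially. ALL x:S. norm (h is m x) <= C * (1 / 2) ^ m"
   using filterlim_iff[THEN iffD1, OF half_power_at_right, rule_format, OF C]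
  proof (rule eventually_mono, intro ballI)
   fix m x assume a: "0 < (1 / 2 :: real) ^ m & (1 / 2 :: real) ^ m < 1 &
    (ALL x:closure S. cmod (ideriv is (%x. conv_net \<phi> w ((1 / 2) ^ m) x - conv_net \<phi> w ((1 / 2) ^ m / 2) x) x) <= C * ((1 / 2) ^ m) powr 1)" and x: "x:S"
   have "(%x. conv_net \<phi> w ((1 / 2) ^ m) x - conv_net \<phi> w ((1 / 2) ^ m / 2) x) = (%x. F m x - F (Suc m) x)" by (simp add: F_def)
   moreover have "ideriv is (%x. F m x - F (Suc m) x) x = - h is m x"
    using ideriv_diff[OF open_UNIV Fs Fs UNIV_I] by (simp add: h_def)
   ultimately show "norm (h is m x) <= C * (1 / 2) ^ m"
    using bspec[OF a[THEN conjunct2, THEN conjunct2] subsetD[OF closure_subset x]] e01[of m] by simp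
  qed
  then have "uniform_limit S (%n x. \<Sum>m<n. h is m x) (%x. \<Sum>m. h is m x) sequentially"
   by (rule Weierstrass_m_test_ev) (intro summable_mult summable_geometric, simp)
  from uniform_limit_add[OF this uniform_limit_const]
  have "uniform_limit S (%n x. (\<Sum>m<n. h is m x) + ideriv is (F 0) x) (%x. (\<Sum>m. h is m x) + ideriv is (F 0) x) sequentially" .
  moreover have "(%n x. (\<Sum>m<n. h is m x) + ideriv is (F 0) x) = (%n. ideriv is (F n))"
  proof (intro ext)
   fix n x show "(\<Sum>m<n. h is m x) + ideriv is (F 0) x = ideriv is (F n) x"
    using sum_lessThan_telescope[of "%m. ideriv is (F m) x" n] by (simp add: h_def)
  qed
  ultimately show ?thesis by (simp add: H_def[abs_def])
 qed
 have g: "smooth_on S (H [])" by (rule smooth_limit[OF S(1) Fs lim])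
 have lim0: "uniform_limit S F (H []) sequentially" using lim[of "[]"] by simp
 have "w f = (LINT y:S|lborel. H [] y * f y)" if f: "f:test S" for f
 proof -
  obtain L where L: "compact L" "L <= S" "!!x. x ~: L ==> f x = 0" by (rule testE[OF f]) blast
  \<comment> \<open>The constant net \<open>f\<close> is regular, so its pairing with the
    regularised \<open>w\<close> differs from \<open>w f\<close> by a negligible number.\<close>
  have "(%e x. f x * 1) : E_S_inf"
   by (rule cutoff_net_E_S_inf[OF S(1) const_net_E_M_inf[OF S(1) smooth_on_const[OF S(1)]] f])
  then have "negligible_num (%e. (LINT y|lborel. conv_net \<phi> w e y * f y) - w f)"
   using mollify_pairing_negligible[OF w \<phi>, of "%e. f"] by simp
  then have "uO (UNIV :: unit set) (%e _. (LINT y|lborel. conv_net \<phi> w e y * f y) - w f) 1" using unegl_uO unfolding negl_num_iff by blast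
  then obtain C where C: "EV e. 0 < e & e < 1 & (ALL x:(UNIV :: unit set). cmod ((LINT y|lborel. conv_net \<phi> w e y * f y) - w f) <= C * e powr 1)" by (rule uOE) blast
  have lim1: "(%m. LINT y|lborel. F m y * f y) \<longlonglongrightarrow> w f"
  proof (rule Lim_transform_bound[THEN LIM_zero_cancel])
   show "\<forall>\<^sub>F m in sequentially. norm ((LINT y|lborel. F m y * f y) - w f) <= norm (C * (1 / 2) ^ m)"
    by (rule eventually_mono[OF filterlim_iff[THEN iffD1, OF half_power_at_right, rule_format, OF C]]) (force simp: F_def)
   show "(%m. C * (1 / 2) ^ m) \<longlonglongrightarrow> 0" by (intro tendsto_mult_right_zero LIMSEQ_power_zero) simp
  qed
  have toL: "(LINT y:T|lborel. k y * f y) = (LINT y:L|lborel. k y * f y)" if "L <= T" for T and k :: "'n fn"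
   unfolding set_lebesgue_integral_def using that L(3) by (intro Bochner_Integration.integral_cong) (auto simp: indicator_def)
  have toL': "(LINT y|lborel. k y * f y) = (LINT y:L|lborel. k y * f y)" for k :: "'n fn"
   using toL[of UNIV k] by (simp add: set_lebesgue_integral_def)
  have fc: "continuous_on L f" by (rule smooth_on_cont[OF test_smooth_on[OF f]])
  have Hc: "continuous_on L (H [])" using smooth_on_cont[OF g] L(2) continuous_on_subset by blast
  obtain A where A: "!!y. y:L ==> cmod (f y) <= A" "0 <= A"
   using ideriv_bounded_compact[OF test_smooth_on[OF f] L(1,2), of 0] by fastforce
  have "(%m. LINT y:L|lborel. F m y * f y) \<longlonglongrightarrow> (LINT y:L|lborel. H [] y * f y)"
  proof (rule tendstoI)
   fix e :: real assume e: "0 < e"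
   define d where "d = e / (A * measure lborel L + 1)"
   have den: "0 < A * measure lborel L + 1" using A(2) by (intro add_nonneg_pos mult_nonneg_nonneg) auto
   then have d: "0 < d" using e by (simp add: d_def)
   show "\<forall>\<^sub>F m in sequentially. dist (LINT y:L|lborel. F m y * f y) (LINT y:L|lborel. H [] y * f y) < e"
    using uniform_limitD[OF lim0 d]
   proof (rule eventually_mono)
    fix m assume a: "ALL x:S. dist (F m x) (H [] x) < d"
    have c: "continuous_on L (F m)" by (rule smooth_on_cont[OF Fs])
    have "(LINT y:L|lborel. F m y * f y) - (LINT y:L|lborel. H [] y * f y) = (LINT y:L|lborel. F m y * f y - H [] y * f y)"
     by (intro set_integral_diff(2)[symmetric] set_integrable_cont L(1) continuous_on_mult c Hc fc)
    also have "cmod ... <= (d * A) * measure lborel L"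
    proof (rule set_integral_bound[OF L(1) subset_refl])
     fix y assume y: "y:L"
     have "cmod (F m y - H [] y) <= d" using a y L(2) by (auto simp: dist_norm intro: less_imp_le)
     then show "cmod (F m y * f y - H [] y * f y) <= d * A"
      unfolding left_diff_distrib[symmetric] norm_mult using A(1)[OF y] d by (intro mult_mono) auto
    qed (use d A(2) in simp)
    also have "... < d * (A * measure lborel L + 1)" using d by (simp add: algebra_simps)
    also have "... = e" using den by (simp add: d_def)
    finally show "dist (LINT y:L|lborel. F m y * f y) (LINT y:L|lborel. H [] y * f y) < e" by (simp add: dist_norm)
   qed
  qed
  then have "(%m. LINT y|lborel. F m y * f y) \<longlonglongrightarrow> (LINT y:L|lborel. H [] y * f y)" unfolding toL' .
  from LIMSEQ_unique[OF lim1 this] show ?thesis using toL[OF L(2)] by simp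
 qed
 then show ?thesis using g by blast
qed

subsection \<open>Comparison of supports\<close>

text \<open>The supports in question are complements in \<open>X\<close> of sets of this form. For
  an inclusion between two of them, the implication between the properties may shrink the
  neighbourhood.\<close>

definition near :: "'a::topological_space set => ('a set => bool) => 'a set" where
 "near X P = {x:X. EX V. open V & x:V & V <= X & P V}"

lemma near_mono:
 assumes "!!x V. open V ==> x:V ==> V <= X ==> P V ==> EX Z. open Z & x:Z & Z <= V & Q Z"
 shows "near X P <= near X Q"
proof
 fix x assume "x:near X P"
 then obtain V where V: "x:X" "open V" "x:V" "V <= X" "P V" unfolding near_def by blast
 then obtain Z where "open Z" "x:Z" "Z <= V" "Q Z" using assms by blast
 then show "x:near X Q" using V unfolding near_def by blast
qed

lemma supports_as_near:
 fixes X :: "(real^'n::finite) set"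
 shows "dist_supp X w = X - near X (%V. ALL f:test V. w f = 0)"
  "dist_sing_supp X w = X - near X (%V. EX g. smooth_on V g & (ALL f:test V. w f = (LINT y:V|lborel. g y * f y)))"
  "gsupp X U = X - near X (%V. grestrict V U = gzero (G V))"
  "gsing_supp X U = X - near X (%V. grestrict V U:G_inf V)"
  "functional_supp X T = X - near X (%V. ALL U:G_c V. functional_restrict X V T U = 0)"
  "functional_sing_supp X T = X - near X (%V. EX v:G_inf V. ALL U:G_c V. functional_restrict X V T U = gintegral V (gmult (G V) v U))"
 unfolding dist_supp_def dist_sing_supp_def gsupp_def gsing_supp_def functional_supp_def functional_sing_supp_def near_def by blast+

lemma near_cong: "(!!V. open V ==> V <= X ==> P V \<longleftrightarrow> Q V) ==> near X P = near X Q"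
 unfolding near_def by blast

lemma functional_zero_iff:
 assumes V: "open V" "V <= X" and X: "open X"
  and F: "!!u. u:cnets V ==> T (cls (G X) u) = abs_gnum (F u) & moderate_num (F u)"
 shows "(ALL U:G_c V. functional_restrict X V T U = 0) \<longleftrightarrow> (ALL u:cnets V. negligible_num (F u))"
 unfolding ball_G_c_iff[OF V(1)] using functional_restrict_cnet[OF V X, of _ T] F by (simp add: abs_gnum_eq_0_iff)

lemma functional_regular_iff:
 fixes F :: "'n::finite net => real => complex"
 assumes V: "open V" "V <= X" and X: "open X"
  and F: "!!u. u:cnets V ==> T (cls (G X) u) = abs_gnum (F u) & moderate_num (F u)"
 shows "(EX v:G_inf V. ALL U:G_c V. functional_restrict X V T U = gintegral V (gmult (G V) v U)) \<longleftrightarrow>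
  (EX b:E_M_inf V. ALL u:cnets V. negligible_num (%e. F u e - (LINT y|lborel. b e y * u e y)))"
proof -
 interpret net_space "G V" "{f. smooth_on V f}" by (rule net_space_G[OF V(1)])
 have "functional_restrict X V T (cls (G V) u) = gintegral V (gmult (G V) (cls (G V) b) (cls (G V) u)) \<longleftrightarrow>
   negligible_num (%e. F u e - (LINT y|lborel. b e y * u e y))" if b: "b:E_M_inf V" and u: "u:cnets V" for b u
 proof -
  have bE: "b:E_M V" using b E_M_inf_subset_E_M[OF V(1)] by blast
  have e: "cls (G V) b:elems (G V)" "b:cls (G V) b" using bE cls_elem[of b] cls_self[of b] by auto
  note gi = gintegral_cnet[OF V(1) subset_refl V(1) e u]
  show ?thesis unfolding functional_restrict_cnet[OF V X u] gi(1) conjunct1[OF F[OF u]]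
   by (intro iffI) (erule abs_gnum_eqD[OF conjunct2[OF F[OF u]] gi(2)], erule abs_gnum_eqI'[OF conjunct2[OF F[OF u]]])
 qed
 then show ?thesis unfolding G_inf_def ball_G_c_iff[OF V(1)] by simp
qed

section \<open>Local comparison of a distribution with its images\<close>

context
 fixes \<phi> :: "'n::finite fn" and X :: "(real^'n) set" and w :: "('n fn) => complex"
 assumes \<phi>: "mollifier \<phi>" and X: "open X" and w: "w:distributions X"
begin

interpretation net_space "G X" "{f. smooth_on X f}" by (rule net_space_G[OF X])

abbreviation (input) "J \<equiv> iota \<phi> X w"

lemma iota_rep: "J:elems (G X)" "rep J:J" "rep J:E_M X"
 using iota_elem[OF X moll_schwartz[OF \<phi>] w] rep_in rep_moderate by auto

lemma iota_d_net:
 assumes V: "open V" "V <= X" and u: "u:cnets V"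
 shows "iota_d X w (cls (G X) u) = abs_gnum (%e. w (u e)) & moderate_num (%e. w (u e))"
proof -
 obtain K where K: "u:E_M X" "compact K" "K <= X" "!!e x. 0 < e ==> e <= 1 ==> x ~: K ==> u e x = 0"
  by (rule cnetsE[OF cnets_mono[OF V X u]]) blast
 show ?thesis using iota_d_eq[OF X w K] by blast
qed

lemma iota_prime_net:
 assumes V: "open V" "V <= X" and u: "u:cnets V"
 shows "iota_prime \<phi> X w (cls (G X) u) = abs_gnum (%e. LINT y|lborel. rep J e y * u e y) &
  moderate_num (%e. LINT y|lborel. rep J e y * u e y)"
 using gintegral_cnet[OF V X iota_rep(1,2) u] by (simp add: iota_prime_def)

text \<open>Near \<open>x\<close> the embedding is represented by the regularisation of a cutoff of
  \<open>w\<close>, to which \<open>dual_determines_iota\<close> applies.\<close>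

lemma iota_local_net:
 assumes V: "open V" "V <= X" and x: "x:V" and b: "b:E_M_inf V"
  and n: "!!u. u:cnets V ==> negligible_num (%e. w (u e) - (LINT y|lborel. b e y * u e y))"
 shows "EX Z. open Z & x:Z & Z <= V & (%e x. rep J e x - b e x) : N_M Z"
proof -
 have c: "compact {x}" "{x} <= V" using x by auto
 obtain \<psi> W where \<psi>: "\<psi>:test V" "open W" "{x} <= W" "!!x. x:W ==> \<psi> x = 1" by (rule cutoff_exists[OF V(1) c]) blast
 have Z: "open (W \<inter> V)" "W \<inter> V <= V" "W \<inter> V <= X" "!!x. x:W \<inter> V ==> \<psi> x = 1" using \<psi> V by auto
 have 1: "(%e x. rep J e x - conv_net \<phi> (cutoff_dist \<psi> w) e x) : N_M (W \<inter> V)"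
  by (rule iota_net[OF X moll_schwartz[OF \<phi>] w iota_rep(2) test_mono[OF \<psi>(1) V(2)] Z(1,3,4)])
 have 2: "(%e x. conv_net \<phi> (cutoff_dist \<psi> w) e x - b e x) : N_M (W \<inter> V)"
  by (rule dual_determines_iota[OF \<phi> V X w b n \<psi>(1) Z(1,2,4)])
 from N_M_add[OF Z(1) 1 2] have "(%e x. rep J e x - b e x) : N_M (W \<inter> V)" by simp
 then show ?thesis using Z(1) x \<psi>(3) by (intro exI[of _ "W \<inter> V"]) auto
qed

lemma dist_regular_pairing:
 assumes V: "open V" and g: "ALL f:test V. w f = (LINT y:V|lborel. g y * f y)" and u: "u:cnets V"
 shows "negligible_num (%e. w (u e) - (LINT y|lborel. g y * u e y))"
proof (rule negl_num_cong[OF negligible_num_zero])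
 fix e :: real assume e: "0 < e" "e < 1"
 obtain K where K: "u:E_M V" "compact K" "K <= V" "!!e x. 0 < e ==> e <= 1 ==> x ~: K ==> u e x = 0" by (rule cnetsE[OF u]) blast
 have "u e:test V" using cnets_test[OF V u] e by simp
 then have "w (u e) = (LINT y:V|lborel. g y * u e y)" using g by blast
 also have "... = (LINT y|lborel. g y * u e y)" unfolding set_lebesgue_integral_def
  by (rule Bochner_Integration.integral_cong) (use K(3) K(4)[of e] e in \<open>auto simp: indicator_def\<close>)
 finally show "0 = w (u e) - (LINT y|lborel. g y * u e y)" by simp
qed

text \<open>A test function is a regular constant net, on which both functionals agree;
  \<open>w f\<close> is thus a negligible constant.\<close>

lemma dist_zero_of_iota_zero:
 assumes V: "open V" "V <= X" and a: "rep J:N_M V" and f: "f:test V"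
 shows "w f = 0"
proof -
 obtain K where K: "compact K" "K <= V" "!!x. x ~: K ==> f x = 0" by (rule testE[OF f]) blast
 let ?u = "%e::real. f"
 have u: "?u:cnets V"
  by (rule cnetsI[OF const_net_E_M[OF V(1) test_smooth_on[OF f]] K(1,2)]) (rule K(3))
 note c = cnets_G_c[OF X cnets_mono[OF V X u]]
 have "cls (G X) ?u:G_c_inf X"
  using c const_net_E_M_inf[OF X test_smooth_on[OF f]] by (auto simp: G_c_inf_def G_inf_def G_c_def)
 from iota_d_eq_iota_prime[OF X \<phi> w this]
 have eq: "abs_gnum (%e. w f) = abs_gnum (%e. LINT y|lborel. rep J e y * f y)"
  using iota_d_net[OF V u] iota_prime_net[OF V u] by simp
 have "negligible_num (%e. (LINT y|lborel. rep J e y * f y) - (LINT y|lborel. 0 * f y))"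
  by (rule pairing_negligible[OF V(1) net_restrict(1)[OF X V iota_rep(3)] _ u, of "%e x. 0"]) (use a in simp)
 then have "abs_gnum (%e. LINT y|lborel. rep J e y * f y) = 0"
  using iota_prime_net[OF V u] by (simp add: abs_gnum_eq_0_iff)
 then have "negligible_num (%e. w f)" using eq abs_gnum_eq_0_iff[OF moderate_num_const[of "w f"]] by simp
 \<comment> \<open>Were \<open>w f\<close> nonzero, multiplication with its inverse would make 1
   negligible.\<close>
 then have "negligible_num (%e. w f * inverse (w f))" by (rule negligible_num_mult[OF _ moderate_num_const])
 then show ?thesis using not_negligible_num_one by (cases "w f = 0") auto
qed

text \<open>The regularised cutoff of \<open>w\<close> inherits regularity from the embedding near
  \<open>x\<close>; \<open>regular_imp_smooth\<close> gives a density on a ball, where \<psi> is 1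
  and the cutoff coincides with \<open>w\<close>.\<close>

lemma dist_regular_of_iota_regular:
 assumes V: "open V" "V <= X" and x: "x:V" and a: "rep J:E_M_inf V"
 shows "EX Z. open Z & x:Z & Z <= V & (EX g. smooth_on Z g & (ALL f:test Z. w f = (LINT y:Z|lborel. g y * f y)))"
proof -
 note \<phi>s = moll_schwartz[OF \<phi>]
 have c: "compact {x}" "{x} <= V" using x by auto
 obtain \<psi> W where \<psi>: "\<psi>:test V" "open W" "{x} <= W" "!!x. x:W ==> \<psi> x = 1" by (rule cutoff_exists[OF V(1) c]) blast
 have Y: "open (W \<inter> V)" "W \<inter> V <= V" "W \<inter> V <= X" "!!x. x:W \<inter> V ==> \<psi> x = 1" "x:W \<inter> V" using \<psi> V x by auto
 note \<psi>X = test_mono[OF \<psi>(1) V(2)]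
 have "(%e x. rep J e x - conv_net \<phi> (cutoff_dist \<psi> w) e x) : N_M (W \<inter> V)"
  by (rule iota_net[OF X \<phi>s w iota_rep(2) \<psi>X Y(1,3,4)])
 from N_M_diff[OF Y(1) N_M_zero[OF Y(1)] this]
 have "(%e x. conv_net \<phi> (cutoff_dist \<psi> w) e x - rep J e x) : N_M (W \<inter> V)" by simp
 then have reg: "conv_net \<phi> (cutoff_dist \<psi> w) : E_M_inf (W \<inter> V)"
  by (rule E_M_inf_perturb[OF Y(1) net_restrict(3)[OF V(1) Y(1,2) a]])
 obtain e where e: "0 < e" "cball x e <= W \<inter> V" using Y(1,5) open_contains_cball by blast
 have cl: "closure (ball x e) = cball x e" using e(1) by simp
 have b: "ball x e <= W \<inter> V" using e(2) ball_subset_cball by blast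
 obtain g where g: "smooth_on (ball x e) g" "ALL f:test (ball x e). cutoff_dist \<psi> w f = (LINT y:ball x e|lborel. g y * f y)"
  using regular_imp_smooth[OF \<phi> cutoff_tempered[OF X w \<psi>X] Y(1) reg open_ball, of x e] cl e(2) compact_cball[of x e] by auto
 have "w f = (LINT y:ball x e|lborel. g y * f y)" if f: "f:test (ball x e)" for f
 proof -
  obtain K where K: "compact K" "K <= ball x e" "!!x. x ~: K ==> f x = 0" by (rule testE[OF f]) blast
  have "cutoff_dist \<psi> w f = w f" by (rule cutoff_dist_eq) (use K(2,3) b Y(4) in blast)
  then show ?thesis using g(2) f by metis
 qed
 then show ?thesis using g(1) e(1) b by (intro exI[of _ "ball x e"]) auto
qed

lemma iota_supports:
 shows "dist_supp X w = gsupp X J" "functional_supp X (iota_prime \<phi> X w) = gsupp X J"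
  "functional_supp X (iota_d X w) = gsupp X J"
proof -
 let ?A = "%V. ALL f:test V. w f = 0"
 let ?B = "%V. rep J:N_M V"
 let ?C = "%V. ALL u:cnets V. negligible_num (%e. LINT y|lborel. rep J e y * u e y)"
 let ?D = "%V. ALL u:cnets V. negligible_num (%e. w (u e))"
 have B: "near X (%V. grestrict V J = gzero (G V)) = near X ?B"
  by (rule near_cong) (rule grestrict_zero_iff[OF X _ _ iota_rep(1,2)])
 have C: "near X (%V. ALL U:G_c V. functional_restrict X V (iota_prime \<phi> X w) U = 0) = near X ?C"
  by (rule near_cong, rule functional_zero_iff[OF _ _ X, where F = "%u e. LINT y|lborel. rep J e y * u e y"])
   (assumption | rule iota_prime_net)+
 have D: "near X (%V. ALL U:G_c V. functional_restrict X V (iota_d X w) U = 0) = near X ?D"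
  by (rule near_cong, rule functional_zero_iff[OF _ _ X, where F = "%u e. w (u e)"]) (assumption | rule iota_d_net)+
 have AD: "near X ?A <= near X ?D"
 proof (rule near_mono)
  fix x V assume V: "open V" "x:V" "V <= X" "?A V"
  have "negligible_num (%e. w (u e))" if "u:cnets V" for u
   using dist_regular_pairing[OF V(1) _ that, of "%_. 0"] V(4) by (simp add: set_lebesgue_integral_def)
  then show "EX Z. open Z & x:Z & Z <= V & ?D Z" using V by blast
 qed
 have DB: "near X ?D <= near X ?B"
 proof (rule near_mono)
  fix x V assume V: "open V" "x:V" "V <= X" "?D V"
  show "EX Z. open Z & x:Z & Z <= V & ?B Z"
   \<comment> \<open>Vanishing of \<open>w\<close> on compactly supported nets is the case of the
     density \<open>b = 0\<close>.\<close>
   using iota_local_net[OF V(1,3,2) const_net_E_M_inf[OF V(1) smooth_on_const[OF V(1), of 0]]] V(4) by simp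
 qed
 have BA: "near X ?B <= near X ?A" by (rule near_mono) (use dist_zero_of_iota_zero in blast)
 have BC: "near X ?B = near X ?C"
 proof (rule near_cong)
  fix V assume V: "open V" "V <= X"
  note r = net_restrict(1)[OF X V iota_rep(3)]
  show "?B V \<longleftrightarrow> ?C V"
  proof
   assume b: "?B V"
   have "negligible_num (%e. (LINT y|lborel. rep J e y * u e y) - (LINT y|lborel. 0 * u e y))" if "u:cnets V" for u
    by (rule pairing_negligible[OF V(1) r _ that, of "%e x. 0"]) (use b in simp)
   then show "?C V" by simp
  qed (use pairing_determines[OF \<phi> V(1) r] in blast)
 qed
 show "dist_supp X w = gsupp X J" "functional_supp X (iota_prime \<phi> X w) = gsupp X J" "functional_supp X (iota_d X w) = gsupp X J"
  unfolding supports_as_near B C D using AD DB BA BC by blast+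
qed

lemma iota_sing_supports:
 shows "dist_sing_supp X w = gsing_supp X J" "functional_sing_supp X (iota_prime \<phi> X w) = gsing_supp X J"
  "functional_sing_supp X (iota_d X w) = gsing_supp X J"
proof -
 let ?A = "%V. EX g. smooth_on V g & (ALL f:test V. w f = (LINT y:V|lborel. g y * f y))"
 let ?B = "%V. rep J:E_M_inf V"
 let ?C = "%V. EX b:E_M_inf V. ALL u:cnets V. negligible_num (%e. (LINT y|lborel. rep J e y * u e y) - (LINT y|lborel. b e y * u e y))"
 let ?D = "%V. EX b:E_M_inf V. ALL u:cnets V. negligible_num (%e. w (u e) - (LINT y|lborel. b e y * u e y))"
 have B: "near X (%V. grestrict V J:G_inf V) = near X ?B"
 proof (rule near_cong)
  fix V assume V: "open V" "V <= X"
  interpret V: net_space "G V" "{f. smooth_on V f}" by (rule net_space_G[OF V(1)])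
  have s: "rep J:cls (G V) (rep J)" using V.cls_self[of "rep J"] net_restrict(1)[OF X V iota_rep(3)] by simp
  show "grestrict V J:G_inf V \<longleftrightarrow> ?B V"
   unfolding grestrict_def by (intro iffI rep_regular(2)[OF V(1) _ s]) (simp_all add: G_inf_def)
 qed
 have C: "near X (%V. EX v:G_inf V. ALL U:G_c V. functional_restrict X V (iota_prime \<phi> X w) U = gintegral V (gmult (G V) v U)) = near X ?C"
  by (rule near_cong, rule functional_regular_iff[OF _ _ X, where F = "%u e. LINT y|lborel. rep J e y * u e y"])
   (assumption | rule iota_prime_net)+
 have D: "near X (%V. EX v:G_inf V. ALL U:G_c V. functional_restrict X V (iota_d X w) U = gintegral V (gmult (G V) v U)) = near X ?D"
  by (rule near_cong, rule functional_regular_iff[OF _ _ X, where F = "%u e. w (u e)"]) (assumption | rule iota_d_net)+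
 have AD: "near X ?A <= near X ?D"
 proof (rule near_mono)
  fix x V assume V: "open V" "x:V" "V <= X" "?A V"
  then obtain g where g: "smooth_on V g" "ALL f:test V. w f = (LINT y:V|lborel. g y * f y)" by blast
  have "?D V" by (rule bexI[OF _ const_net_E_M_inf[OF V(1) g(1)]]) (use dist_regular_pairing[OF V(1) g(2)] in blast)
  then show "EX Z. open Z & x:Z & Z <= V & ?D Z" using V by blast
 qed
 have DB: "near X ?D <= near X ?B"
 proof (rule near_mono)
  fix x V assume V: "open V" "x:V" "V <= X" "?D V"
  then obtain b where b: "b:E_M_inf V" "ALL u:cnets V. negligible_num (%e. w (u e) - (LINT y|lborel. b e y * u e y))" by blast
  obtain Z where Z: "open Z" "x:Z" "Z <= V" "(%e x. rep J e x - b e x) : N_M Z"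
   using iota_local_net[OF V(1,3,2) b(1)] b(2) by blast
  then show "EX Z. open Z & x:Z & Z <= V & ?B Z"
   using E_M_inf_perturb[OF Z(1) net_restrict(3)[OF V(1) Z(1,3) b(1)] Z(4)] by blast
 qed
 have BA: "near X ?B <= near X ?A" by (rule near_mono) (rule dist_regular_of_iota_regular)
 have BC: "near X ?B = near X ?C"
 proof (rule near_cong)
  fix V assume V: "open V" "V <= X"
  note r = net_restrict(1)[OF X V iota_rep(3)]
  show "?B V \<longleftrightarrow> ?C V"
  proof
   assume "?B V"
   then show "?C V" by (rule bexI[rotated]) (simp add: negligible_num_zero)
  next
   assume "?C V"
   then obtain b where b: "b:E_M_inf V" "ALL u:cnets V. negligible_num (%e. (LINT y|lborel. rep J e y * u e y) - (LINT y|lborel. b e y * u e y))" by blast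
   have bE: "b:E_M V" using b(1) E_M_inf_subset_E_M[OF V(1)] by blast
   \<comment> \<open>Nets with the same pairings differ by a negligible net, so \<open>rep J\<close>
     inherits the regularity of \<open>b\<close>.\<close>
   have "(%e x. rep J e x - b e x) : N_M V"
   proof (rule pairing_determines[OF \<phi> V(1) E_M_diff[OF V(1) r bE]])
    fix u assume u: "u:cnets V"
    obtain K where K: "u:E_M V" "compact K" "K <= V" "!!e x. 0 < e ==> e <= 1 ==> x ~: K ==> u e x = 0" by (rule cnetsE[OF u]) blast
    from b(2) u have "negligible_num (%e. (LINT y|lborel. rep J e y * u e y) - (LINT y|lborel. b e y * u e y))" by blast
    then show "negligible_num (%e. LINT y|lborel. (rep J e y - b e y) * u e y)"
    proof (rule negl_num_cong)
     fix e :: real assume e: "0 < e" "e < 1"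
     have i: "integrable lborel (%y. k e y * u e y)" if k: "k:E_M V" for k
     proof -
      have "set_integrable lborel K (%y. k e y * u e y)"
       by (rule smooth_nets_set_integrable[OF E_M_smooth[OF V(1) E_M_mult[OF V(1) k K(1)]] K(2,3) e])
      moreover have "(%y. indicator K y *\<^sub>R (k e y * u e y)) = (%y. k e y * u e y)"
       using K(4)[of e] e by (auto simp: fun_eq_iff indicator_def)
      ultimately show ?thesis by (simp add: set_integrable_def)
     qed
     show "(LINT y|lborel. rep J e y * u e y) - (LINT y|lborel. b e y * u e y) = (LINT y|lborel. (rep J e y - b e y) * u e y)"
      using Bochner_Integration.integral_diff[OF i[OF r] i[OF bE]] by (simp add: left_diff_distrib)
    qed
   qed
   then show "?B V" by (rule E_M_inf_perturb[OF V(1) b(1)])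
  qed
 qed
 show "dist_sing_supp X w = gsing_supp X J" "functional_sing_supp X (iota_prime \<phi> X w) = gsing_supp X J"
  "functional_sing_supp X (iota_d X w) = gsing_supp X J"
  unfolding supports_as_near B C D using AD DB BA BC by blast+
qed

end

theorem proposition3p10:
  fixes \<Omega> :: "(real^'n::finite) set" and \<phi> :: "real^'n \<Rightarrow> complex"
  assumes "open \<Omega>" and "mollifier \<phi>"
  shows
    "(\<forall>w\<in>distributions \<Omega>.
        iota_d \<Omega> w \<in> cont_dual (G \<Omega>) (G_c \<Omega>) (G_c_topology \<Omega>) \<and>
        iota_prime \<phi> \<Omega> w \<in> cont_dual (G \<Omega>) (G_c \<Omega>) (G_c_topology \<Omega>) \<and>
        (\<forall>U\<in>G_c_inf \<Omega>. iota_d \<Omega> w U = iota_prime \<phi> \<Omega> w U)) \<and>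
     (\<forall>w\<in>compact_distributions \<Omega>.
        iota_d_c w \<in> cont_dual (G \<Omega>) (elems (G \<Omega>)) (G_topology \<Omega>) \<and>
        iota_prime_c \<phi> \<Omega> w \<in> cont_dual (G \<Omega>) (elems (G \<Omega>)) (G_topology \<Omega>) \<and>
        (\<forall>U\<in>G_inf \<Omega>. iota_d_c w U = iota_prime_c \<phi> \<Omega> w U)) \<and>
     (\<forall>w\<in>(tempered_distributions :: ((real^'n \<Rightarrow> complex) \<Rightarrow> complex) set).
        iota_d_S w \<in> cont_dual G_S (elems G_S) G_S_topology \<and>
        iota_prime_S \<phi> w \<in> cont_dual G_S (elems G_S) G_S_topology \<and>
        (\<forall>U\<in>G_S_inf. iota_d_S w U = iota_prime_S \<phi> w U)) \<and>
     (\<forall>w\<in>distributions \<Omega>.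
        dist_supp \<Omega> w = gsupp \<Omega> (iota \<phi> \<Omega> w) \<and>
        gsupp \<Omega> (iota \<phi> \<Omega> w) = functional_supp \<Omega> (iota_prime \<phi> \<Omega> w) \<and>
        functional_supp \<Omega> (iota_prime \<phi> \<Omega> w) = functional_supp \<Omega> (iota_d \<Omega> w) \<and>
        dist_sing_supp \<Omega> w = gsing_supp \<Omega> (iota \<phi> \<Omega> w) \<and>
        gsing_supp \<Omega> (iota \<phi> \<Omega> w) = functional_sing_supp \<Omega> (iota_prime \<phi> \<Omega> w) \<and>
        functional_sing_supp \<Omega> (iota_prime \<phi> \<Omega> w) = functional_sing_supp \<Omega> (iota_d \<Omega> w))"
proof (intro conjI ballI)
  fix w assume w: "w \<in> compact_distributions \<Omega>"
  show "iota_d_c w \<in> cont_dual (G \<Omega>) (elems (G \<Omega>)) (G_topology \<Omega>)" by (rule iota_d_c_cont_dual[OF assms(1) w])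
  obtain \<psi> where \<psi>: "\<psi> \<in> test_functions \<Omega>" "\<And>f. smooth_on \<Omega> f \<Longrightarrow> w f = w (\<lambda>x. \<psi> x * f x)"
    by (rule cdist_cutoff[OF assms(1) w]) blast
  obtain L where L: "compact L" "L \<subseteq> \<Omega>" "\<And>x. x \<notin> L \<Longrightarrow> \<psi> x = 0" by (rule testE[OF \<psi>(1)]) blast
  show "iota_prime_c \<phi> \<Omega> w \<in> cont_dual (G \<Omega>) (elems (G \<Omega>)) (G_topology \<Omega>)"
    by (rule iota_prime_c_cont_dual[OF assms w \<psi> L])
  show "iota_d_c w U = iota_prime_c \<phi> \<Omega> w U" if "U \<in> G_inf \<Omega>" for U
    by (rule iota_d_c_eq_iota_prime_c[OF assms w \<psi> L that])
qed (use assms in \<open>simp_all add: iota_d_cont_dual iota_prime_cont_dual iota_d_eq_iota_prime iota_d_S_cont_dual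
  iota_prime_S_cont_dual iota_d_S_eq_iota_prime_S iota_supports iota_sing_supports\<close>)


end
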